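(* Up to a nonzero constant factor, the Coble quartic can be written as the following polynomial (with 134 monomials in the $s_i$ and $x_\varepsilon$): $$ \begin{aligned} C(\tau,z)={}& s_{1}Q_{000}-2(s_{1}+2s_{6})Q_{001}-2(s_{1}+2s_{3})Q_{010}-2(s_{1}+2s_{9})Q_{011}\\ &-2(s_{1}+2s_{2})Q_{100}-2(s_{1}+2s_{7})Q_{101}-2(s_{1}+2s_{4})Q_{110}-2(s_{1}-2s_{10})Q_{111}\\ &+8(s_{1}+s_{2}+s_{3}+s_{4}+2s_{5})Q'_{001}+8(s_{1}+s_{2}+s_{6}+s_{7}+2s_{8})Q'_{010}\\ &+8(s_{1}+s_{2}+s_{9}-s_{10}+2s_{11})Q'_{011}+8(s_{1}+s_{3}+s_{6}+s_{9}+2s_{12})Q'_{100}\\ &+8(s_{1}+s_{3}+s_{7}-s_{10}+2s_{13})Q'_{101}+8(s_{1}+s_{4}+s_{6}-s_{10}+2s_{14})Q'_{110}\\ &+8(s_{1}+s_{4}+s_{7}+s_{9}+2s_{15})Q'_{111}, \end{aligned} $$ where $s_i=H(F_i)=\chi_{18}/\prod_{n\in F_i}\theta_n$ for the fifteen Fano configurations $F_1,\dots,F_{15}$ listed in the context.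
   Context: $\mathbb H_3$ is the Siegel upper half-space of complex symmetric $3\times3$ matrices $\tau$ with positive definite imaginary part; $\gamma=\begin{pmatrix}A&B\\ C&D\end{pmatrix}\in\mathrm{Sp}(6,\mathbb Z)$ acts by $\gamma\tau=(A\tau+B)(C\tau+D)^{-1}$; $\Gamma_3(2)$ is the kernel of $\mathrm{Sp}(6,\mathbb Z)\to\mathrm{Sp}(6,\mathbb F_2)$. For $m=\left[\begin{smallmatrix}m'\\ m''\end{smallmatrix}\right]$, $m',m''\in\mathbb F_2^3$ (entries taken in $\{0,1\}$), $z\in\mathbb C^3$, $$\theta_m(\tau,z)=\sum_{p\in\mathbb Z^3}\exp\pi i\Big[\big(p+\tfrac{m'}2\big)^t\big(\tau(p+\tfrac{m'}2)+2(z+\tfrac{m''}2)\big)\Big],$$ and $\theta_m=\theta_m(\tau,0)$. The characteristic $m$ is even if $m'\cdot m''$ is even (36 such); $\chi_{18}=\prod_{m\text{ even}}\theta_m(\tau,0)$. Second order theta functions: $x_\varepsilon=\Theta[\varepsilon](\tau,z)=\theta\left[\begin{smallmatrix}\varepsilon\\ 0\end{smallmatrix}\right](2\tau,2z)$, $\varepsilon\in\mathbb F_2^3$; these are the coordinates on the $\mathbb P^7$ target of the Kummer map $z\mapsto[\Theta[\varepsilon](\tau,z)]_\varepsilon$ of $X_\tau=\mathbb C^3/(\mathbb Z^3+\tau\mathbb Z^3)$. The formula is an identity of quartic polynomials in the coordinates $x_\varepsilon$ whose coefficients are functions of $\tau$. A Fano configuration is a Lagrangian subspace $F\subset\mathbb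 F_2^6$ (for the form $m'\cdot n''-m''\cdot n'$) all of whose 8 elements are even. For such $F$, $H(F)=\chi_{18}/\prod_{n\in F}\theta_n$, a modular form of weight 14 for $\Gamma_3(2)$. The span $W$ of all $H(F)$ is 15-dimensional. Each of the following $F_i$ is written as $U\times V=\{\left[\begin{smallmatrix}m'\\ m''\end{smallmatrix}\right]:m'\in U,\ m''\in V\}$: $F_1=\{000\}\times\mathbb F_2^3$; $F_2=\{000,100\}\times\{000,001,010,011\}$; $F_3=\{000,010\}\times\{000,001,100,101\}$; $F_4=\{000,110\}\times\{000,001,110,111\}$; $F_5=\{000,010,100,110\}\times\{000,001\}$; $F_6=\{000,001\}\times\{000,010,100,110\}$; $F_7=\{000,101\}\times\{000,010,101,111\}$; $F_8=\{000,001,100,101\}\times\{000,010\}$; $F_9=\{000,011\}\times\{000,011,100,111\}$; $F_{10}=\{000,111\}\times\{000,011,101,110\}$; $F_{11}=\{000,011,100,111\}\times\{000,011\}$; $F_{12}=\{000,001,010,011\}\times\{000,100\}$; $F_{13}=\{000,010,101,111\}\times\{000,101\}$; $F_{14}=\{000,001,110,111\}\times\{000,110\}$; $F_{15}=\{000,011,101,110\}\times\{000,111\}$. The forms $H(F_1),\dots,H(F_{15})$ are a basis of $W$. Quartics: $Q_{000}=\sum_\varepsilon x_\varepsilon^4$, and for $\alpha\in\mathbb F_2^3\setminus\{0\}$, $Q_\alpha=\tfrac12\sum_\varepsilon x_\varepsilon^2x_{\varepsilon+\alpha}^2$ and $Q'_\alpha=\tfrac14\sum_\varepsilon\prod_{\mu\in\alpha^\perp}x_{\varepsilon+\mu}$,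 with $\varepsilon$ running over $\mathbb F_2^3$ and $\alpha^\perp$ the two-dimensional subspace orthogonal to $\alpha$ for the standard scalar product. They are linearly independent and span a 15-dimensional space $W'$. The group $\mathrm{Sp}(6,\mathbb F_2)=\mathrm{Sp}(6,\mathbb Z)/\Gamma_3(2)$ acts on $W$ by $(\gamma h)(\tau)=\det(C\tau+D)^{-14}h(\gamma\tau)$, on $W'$ by $(\gamma q)(\tau,z)=\det(C\tau+D)^{-2}e^{-8\pi i z^t(C\tau+D)^{-1}Cz}q(\gamma\tau,(C\tau+D)^{-t}z)$ (where $(C\tau+D)^{-t}$ is the inverse transpose), and diagonally on $W\otimes W'$. The Coble quartic is the nonzero element of $W\otimes W'$, unique up to a constant factor, invariant under $\mathrm{Sp}(6,\mathbb F_2)$; viewed as a quartic polynomial in the $x_\varepsilon$ depending on $\tau$, its eight partial derivatives with respect to the $x_\varepsilon$ are the eight cubics defining the Kummer threefold $X_\tau/\pm1\subset\mathbb P^7$ when $X_\tau$ is the Jacobian of a non-hyperelliptic genus 3 curve. *)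

theory Defs
  imports
    "HOL-Analysis.Analysis"
    "HOL-Library.Z2"
    "HOL-Library.Poly_Mapping"
begin

section \<open>The Siegel upper half-space and the integral symplectic group\<close>

definition siegel :: "(complex^3^3) set" where
  "siegel = {\<tau>. transpose \<tau> = \<tau> \<and>
     (\<forall>v::real^3. v \<noteq> 0 \<longrightarrow> 0 < v \<bullet> (map_matrix Im \<tau> *v v))}"

text \<open>A matrix indexed by \<^typ>\<open>3 + 3\<close> is a 6-by-6 matrix in 3-by-3 blocks; \<^const>\<open>Inl\<close>
  indexes the first three rows (columns), \<^const>\<open>Inr\<close> the last three.\<close>

type_synonym mat6 = "int^(3 + 3)^(3 + 3)"

definition blockA :: "mat6 \<Rightarrow> complex^3^3" where
  "blockA g = (\<chi> i j. of_int (g $ Inl i $ Inl j))"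

definition blockB :: "mat6 \<Rightarrow> complex^3^3" where
  "blockB g = (\<chi> i j. of_int (g $ Inl i $ Inr j))"

definition blockC :: "mat6 \<Rightarrow> complex^3^3" where
  "blockC g = (\<chi> i j. of_int (g $ Inr i $ Inl j))"

definition blockD :: "mat6 \<Rightarrow> complex^3^3" where
  "blockD g = (\<chi> i j. of_int (g $ Inr i $ Inr j))"

definition symp_form :: mat6 where
  "symp_form = (\<chi> a b. case (a, b) of
      (Inl i, Inr j) \<Rightarrow> if i = j then 1 else 0
    | (Inr i, Inl j) \<Rightarrow> if i = j then - 1 else 0
    | _ \<Rightarrow> 0)"

definition Sp6Z :: "mat6 set" where
  "Sp6Z = {g. transpose g ** symp_form ** g = symp_form}"

definition automorphy :: "mat6 \<Rightarrow> complex^3^3 \<Rightarrow> complex^3^3" where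
  "automorphy g \<tau> = blockC g ** \<tau> + blockD g"

definition moebius :: "mat6 \<Rightarrow> complex^3^3 \<Rightarrow> complex^3^3" where
  "moebius g \<tau> = (blockA g ** \<tau> + blockB g) ** matrix_inv (automorphy g \<tau>)"

text \<open>The bilinear product without conjugation; the library's inner product on
  \<^typ>\<open>complex^3\<close> is a different (real-valued) one.\<close>

definition cdot :: "'a::comm_semiring_1^3 \<Rightarrow> 'a^3 \<Rightarrow> 'a" where
  "cdot u v = (\<Sum>i\<in>UNIV. u $ i * v $ i)"

section \<open>Characteristics and theta functions\<close>

lemma UNIV_bit: "(UNIV :: bit set) = {0, 1}"
  by (auto intro: bit.exhaust)

instance bit :: finite
  by standard (simp add: UNIV_bit)

type_synonym characteristic = "(bit^3) \<times> (bit^3)"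

definition bv :: "bit \<Rightarrow> bit \<Rightarrow> bit \<Rightarrow> bit^3" where
  "bv a b c = vector [a, b, c]"

definition lift :: "bit^3 \<Rightarrow> complex^3" where
  "lift e = (\<chi> i. if e $ i = 1 then 1 else 0)"

definition theta :: "characteristic \<Rightarrow> complex^3^3 \<Rightarrow> complex^3 \<Rightarrow> complex" where
  "theta m \<tau> z = (\<Sum>\<^sub>\<infinity>p\<in>(UNIV :: (int^3) set).
     let u = (\<chi> i. of_int (p $ i)) + (1/2) *\<^sub>R lift (fst m)
     in exp (of_real pi * \<i> * cdot u (\<tau> *v u + 2 *\<^sub>R (z + (1/2) *\<^sub>R lift (snd m)))))"

definition Theta2 :: "complex^3^3 \<Rightarrow> complex^3 \<Rightarrow> bit^3 \<Rightarrow> complex" where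
  "Theta2 \<tau> z e = theta (e, 0) (2 *\<^sub>R \<tau>) (2 *\<^sub>R z)"

definition even_chars :: "characteristic set" where
  "even_chars = {m. cdot (fst m) (snd m) = 0}"

definition chi18 :: "complex^3^3 \<Rightarrow> complex" where
  "chi18 \<tau> = (\<Prod>m\<in>even_chars. theta m \<tau> 0)"

section \<open>Fano configurations and the space of forms of weight 14\<close>

definition lagrangian :: "characteristic set \<Rightarrow> bool" where
  "lagrangian F \<longleftrightarrow> 0 \<in> F \<and> (\<forall>m\<in>F. \<forall>n\<in>F. m + n \<in> F) \<and> card F = 2 ^ 3 \<and>
     (\<forall>m\<in>F. \<forall>n\<in>F. cdot (fst m) (snd n) - cdot (snd m) (fst n) = 0)"

definition fano :: "characteristic set \<Rightarrow> bool" where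
  "fano F \<longleftrightarrow> lagrangian F \<and> F \<subseteq> even_chars"

text \<open>Functions on the Siegel space are represented by their extension by zero, so that equality
  of functions is equality on the Siegel space. The quotient of \<^const>\<open>chi18\<close> by the
  theta constants of a Fano configuration is a quotient of holomorphic functions; it is written
  with the factors cancelled because the pointwise quotient in HOL has the wrong value where a
  theta constant in the denominator vanishes.\<close>

definition fano_form :: "characteristic set \<Rightarrow> complex^3^3 \<Rightarrow> complex" where
  "fano_form F \<tau> = (if \<tau> \<in> siegel then \<Prod>m\<in>even_chars - F. theta m \<tau> 0 else 0)"

lemma fano_form_times_prod:
  assumes "fano F" "\<tau> \<in> siegel"
  shows "fano_form F \<tau> * (\<Prod>n\<in>F. theta n \<tau> 0) = chi18 \<tau>"
  using prod.subset_diff[of F even_chars "\<lambda>m. theta m \<tau> 0"] assms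
  by (simp add: fano_form_def chi18_def fano_def)

corollary fano_form_quotient:
  assumes "fano F" "\<tau> \<in> siegel" "\<And>n. n \<in> F \<Longrightarrow> theta n \<tau> 0 \<noteq> 0"
  shows "fano_form F \<tau> = chi18 \<tau> / (\<Prod>n\<in>F. theta n \<tau> 0)"
proof -
  have "finite F" using assms(1) by simp
  then have "(\<Prod>n\<in>F. theta n \<tau> 0) \<noteq> 0" using assms(3) by simp
  then show ?thesis using fano_form_times_prod[OF assms(1,2)] by (simp add: field_simps)
qed

definition cspan :: "('a \<Rightarrow> complex) set \<Rightarrow> ('a \<Rightarrow> complex) set" where
  "cspan B = {f. \<exists>T c. finite T \<and> T \<subseteq> B \<and> f = (\<lambda>x. \<Sum>b\<in>T. c b * b x)}"

definition W :: "(complex^3^3 \<Rightarrow> complex) set" where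
  "W = cspan {fano_form F | F. fano F}"

definition act_W :: "mat6 \<Rightarrow> (complex^3^3 \<Rightarrow> complex) \<Rightarrow> complex^3^3 \<Rightarrow> complex" where
  "act_W g h \<tau> = (if \<tau> \<in> siegel then h (moebius g \<tau>) / det (automorphy g \<tau>) ^ 14 else 0)"

section \<open>Quartics in the eight coordinates\<close>

text \<open>The polynomial expressions are defined over an arbitrary commutative ring \<^typ>\<open>'r\<close>
  with an embedding \<open>k\<close> of the complex constants. They are used with values in the complex numbers
  (as polynomial functions of the coordinates \<open>x\<close>) and with values in a formal polynomial ring
  (to speak about monomials).\<close>

definition quartic_Q :: "(complex \<Rightarrow> 'r::comm_ring_1) \<Rightarrow> bit^3 \<Rightarrow> (bit^3 \<Rightarrow> 'r) \<Rightarrow> 'r" where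
  "quartic_Q k a x =
     (if a = 0 then \<Sum>e\<in>UNIV. x e ^ 4
      else k (1/2) * (\<Sum>e\<in>UNIV. x e ^ 2 * x (e + a) ^ 2))"

definition quartic_Q' :: "(complex \<Rightarrow> 'r::comm_ring_1) \<Rightarrow> bit^3 \<Rightarrow> (bit^3 \<Rightarrow> 'r) \<Rightarrow> 'r" where
  "quartic_Q' k a x = k (1/4) * (\<Sum>e\<in>UNIV. \<Prod>m\<in>{m. cdot a m = 0}. x (e + m))"

definition W' :: "((bit^3 \<Rightarrow> complex) \<Rightarrow> complex) set" where
  "W' = cspan (range (quartic_Q id) \<union> {quartic_Q' id a | a. a \<noteq> 0})"

text \<open>The action on \<^const>\<open>W'\<close> is defined by regarding a quartic as the function of
  \<open>(\<tau>, z)\<close> obtained by substituting \<^const>\<open>Theta2\<close> for the coordinates. This is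
  injective on \<^const>\<open>W'\<close>, whence the definite description.\<close>

definition act_W' :: "mat6 \<Rightarrow> ((bit^3 \<Rightarrow> complex) \<Rightarrow> complex) \<Rightarrow> (bit^3 \<Rightarrow> complex) \<Rightarrow> complex" where
  "act_W' g q = (THE q'. q' \<in> W' \<and> (\<forall>\<tau>\<in>siegel. \<forall>z.
     q' (Theta2 \<tau> z) =
       exp (- 8 * of_real pi * \<i> *
            cdot z (matrix_inv (automorphy g \<tau>) *v (blockC g *v z)))
       / det (automorphy g \<tau>) ^ 2
       * q (Theta2 (moebius g \<tau>) (transpose (matrix_inv (automorphy g \<tau>)) *v z))))"

section \<open>The Coble quartic\<close>

text \<open>Elements of the tensor product of \<^const>\<open>W\<close> and \<^const>\<open>W'\<close> are quartic polynomials
  in the coordinates \<open>x\<close> whose coefficients are functions of \<open>\<tau>\<close>. The two arguments have to be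
  independent: after the substitution of \<^const>\<open>Theta2\<close> for \<open>x\<close> the Coble quartic vanishes
  identically.\<close>

type_synonym family = "complex^3^3 \<Rightarrow> (bit^3 \<Rightarrow> complex) \<Rightarrow> complex"
type_synonym tensor =
  "((complex^3^3 \<Rightarrow> complex) \<times> ((bit^3 \<Rightarrow> complex) \<Rightarrow> complex)) list"

definition tensor_sum :: "tensor \<Rightarrow> family" where
  "tensor_sum ps \<tau> x = (\<Sum>(h, q)\<leftarrow>ps. h \<tau> * q x)"

definition WW' :: "family set" where
  "WW' = {tensor_sum ps | ps. set ps \<subseteq> W \<times> W'}"

text \<open>Invariance under the diagonal action, which sends a sum of pure tensors \<open>h \<otimes> q\<close> to the sum
  of the \<open>gh \<otimes> gq\<close>. The group of the 6-by-6 symplectic matrices over the field with two elements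
  is a quotient of \<^const>\<open>Sp6Z\<close> and acts through representatives.\<close>

definition invariant :: "family \<Rightarrow> bool" where
  "invariant t \<longleftrightarrow> (\<forall>g\<in>Sp6Z. \<forall>ps. set ps \<subseteq> W \<times> W' \<and> tensor_sum ps = t \<longrightarrow>
     tensor_sum (map (\<lambda>(h, q). (act_W g h, act_W' g q)) ps) = t)"

definition coble_quartic :: "family \<Rightarrow> bool" where
  "coble_quartic t \<longleftrightarrow> t \<in> WW' \<and> t \<noteq> (\<lambda>\<tau> x. 0) \<and> invariant t"

section \<open>The explicit formula\<close>

definition fano_list :: "characteristic set list" where
  "fano_list = [
    {bv 0 0 0} \<times> UNIV,
    {bv 0 0 0, bv 1 0 0} \<times> {bv 0 0 0, bv 0 0 1, bv 0 1 0, bv 0 1 1},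
    {bv 0 0 0, bv 0 1 0} \<times> {bv 0 0 0, bv 0 0 1, bv 1 0 0, bv 1 0 1},
    {bv 0 0 0, bv 1 1 0} \<times> {bv 0 0 0, bv 0 0 1, bv 1 1 0, bv 1 1 1},
    {bv 0 0 0, bv 0 1 0, bv 1 0 0, bv 1 1 0} \<times> {bv 0 0 0, bv 0 0 1},
    {bv 0 0 0, bv 0 0 1} \<times> {bv 0 0 0, bv 0 1 0, bv 1 0 0, bv 1 1 0},
    {bv 0 0 0, bv 1 0 1} \<times> {bv 0 0 0, bv 0 1 0, bv 1 0 1, bv 1 1 1},
    {bv 0 0 0, bv 0 0 1, bv 1 0 0, bv 1 0 1} \<times> {bv 0 0 0, bv 0 1 0},
    {bv 0 0 0, bv 0 1 1} \<times> {bv 0 0 0, bv 0 1 1, bv 1 0 0, bv 1 1 1},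
    {bv 0 0 0, bv 1 1 1} \<times> {bv 0 0 0, bv 0 1 1, bv 1 0 1, bv 1 1 0},
    {bv 0 0 0, bv 0 1 1, bv 1 0 0, bv 1 1 1} \<times> {bv 0 0 0, bv 0 1 1},
    {bv 0 0 0, bv 0 0 1, bv 0 1 0, bv 0 1 1} \<times> {bv 0 0 0, bv 1 0 0},
    {bv 0 0 0, bv 0 1 0, bv 1 0 1, bv 1 1 1} \<times> {bv 0 0 0, bv 1 0 1},
    {bv 0 0 0, bv 0 0 1, bv 1 1 0, bv 1 1 1} \<times> {bv 0 0 0, bv 1 1 0},
    {bv 0 0 0, bv 0 1 1, bv 1 0 1, bv 1 1 0} \<times> {bv 0 0 0, bv 1 1 1}]"

definition coble_expr ::
  "(complex \<Rightarrow> 'r::comm_ring_1) \<Rightarrow> (nat \<Rightarrow> 'r) \<Rightarrow> (bit^3 \<Rightarrow> 'r) \<Rightarrow> 'r" where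
  "coble_expr k s x =
     (let Q = (\<lambda>a b c. quartic_Q k (bv a b c) x);
          Q' = (\<lambda>a b c. quartic_Q' k (bv a b c) x)
      in s 1 * Q 0 0 0
         - 2 * (s 1 + 2 * s 6) * Q 0 0 1
         - 2 * (s 1 + 2 * s 3) * Q 0 1 0
         - 2 * (s 1 + 2 * s 9) * Q 0 1 1
         - 2 * (s 1 + 2 * s 2) * Q 1 0 0
         - 2 * (s 1 + 2 * s 7) * Q 1 0 1
         - 2 * (s 1 + 2 * s 4) * Q 1 1 0
         - 2 * (s 1 - 2 * s 10) * Q 1 1 1
         + 8 * (s 1 + s 2 + s 3 + s 4 + 2 * s 5) * Q' 0 0 1
         + 8 * (s 1 + s 2 + s 6 + s 7 + 2 * s 8) * Q' 0 1 0
         + 8 * (s 1 + s 2 + s 9 - s 10 + 2 * s 11) * Q' 0 1 1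
         + 8 * (s 1 + s 3 + s 6 + s 9 + 2 * s 12) * Q' 1 0 0
         + 8 * (s 1 + s 3 + s 7 - s 10 + 2 * s 13) * Q' 1 0 1
         + 8 * (s 1 + s 4 + s 6 - s 10 + 2 * s 14) * Q' 1 1 0
         + 8 * (s 1 + s 4 + s 7 + s 9 + 2 * s 15) * Q' 1 1 1)"

definition coble_formula :: family where
  "coble_formula \<tau> x = coble_expr id (\<lambda>i. fano_form (fano_list ! (i - 1)) \<tau>) x"

text \<open>The same expression as a formal polynomial with complex coefficients in variables
  \<open>s\<^sub>i\<close> (tagged \<^const>\<open>Inl\<close>) and \<open>x\<^sub>\<epsilon>\<close> (tagged \<^const>\<open>Inr\<close>); its
  \<^const>\<open>Poly_Mapping.keys\<close> are the monomials that occur.\<close>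

definition coble_poly :: "((nat + bit^3) \<Rightarrow>\<^sub>0 nat) \<Rightarrow>\<^sub>0 complex" where
  "coble_poly = coble_expr
     (Poly_Mapping.single 0)
     (\<lambda>i. Poly_Mapping.single (Poly_Mapping.single (Inl i) 1) 1)
     (\<lambda>e. Poly_Mapping.single (Poly_Mapping.single (Inr e) 1) 1)"

end

theory Submission
  imports Defs "HOL-Complex_Analysis.Conformal_Mappings" "HOL-Real_Asymp.Real_Asymp"
begin

text \<open>The symplectic group is generated by the partial inversion, one translation and the generators of
  \<open>GL\<^sub>3(\<int>)\<close>. Each of them acts on theta constants by a monomial substitution and on second order theta
  functions by a linear substitution \<open>\<rho>\<close> of the eight coordinates, so that invariance of the formula \<open>C\<close>
  means \<open>C(\<gamma>\<tau>, \<rho>x) = det(C\<tau> + D)\<^sup>1\<^sup>4 C(\<tau>, x)\<close>. A quartic in \<open>W'\<close> is determined by its values at fifteen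
  stabilizer vectors, where \<open>C\<close> takes as values multiples of the forms \<open>H(F)\<close>; there the identity reduces
  to permutations of these forms and to linear three-term relations, all of which are images of one
  quartic Riemann relation.

  Conversely, if \<open>t\<close> is invariant, its value at the coordinate vector \<open>\<delta>\<^sub>0\<close> is a form in \<open>W\<close> that is
  invariant under translations, hence a multiple \<open>c s\<^sub>1\<close>. Then \<open>t - c C\<close> is invariant and vanishes at
  \<open>\<delta>\<^sub>0\<close>, hence on the orbit of \<open>\<delta>\<^sub>0\<close>, which contains the fifteen stabilizer vectors up to scalars.\<close>

lemma summable_on_int_exp_abs: "(\<lambda>n::int. exp (- real_of_int \<bar>n\<bar>)) summable_on UNIV"
proof -
  have nat: "(\<lambda>n::nat. exp (- real n)) summable_on UNIV"
  proof -
    have "summable (\<lambda>n::nat. exp (-1::real) ^ n)"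
      by (rule summable_geometric) simp
    then have "summable (\<lambda>n::nat. exp (- real n))"
      by (simp flip: exp_of_nat_mult)
    then show ?thesis
      by (intro summable_nonneg_imp_summable_on) auto
  qed
  have 1: "(\<lambda>n::int. exp (- real_of_int \<bar>n\<bar>)) summable_on range int"
    using nat by (subst summable_on_reindex) (auto simp: o_def)
  have 2: "(\<lambda>n::int. exp (- real_of_int \<bar>n\<bar>)) summable_on range (\<lambda>n. - int n)"
    using nat by (subst summable_on_reindex) (auto simp: o_def inj_on_def)
  have "range int \<union> range (\<lambda>n. - int n) = UNIV"
  proof (intro set_eqI iffI UNIV_I)
    fix n :: int
    show "n \<in> range int \<union> range (\<lambda>n. - int n)" by (cases n rule: int_cases2) auto
  qed
  with summable_on_union[OF 1 2] show ?thesis by simp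
qed

lemma gauss_le_exp_abs:
  fixes a b x :: real
  assumes "a > 0"
  shows "exp (- a * x\<^sup>2 + b * \<bar>x\<bar>) \<le> exp ((b + 1)\<^sup>2 / (4 * a)) * exp (- \<bar>x\<bar>)"
proof -
  have "0 \<le> (2 * a * \<bar>x\<bar> - (b + 1))\<^sup>2 / (4 * a)"
    using assms by simp
  also have "\<dots> = a * x\<^sup>2 - (b + 1) * \<bar>x\<bar> + (b + 1)\<^sup>2 / (4 * a)"
    using assms by (simp add: field_simps power2_eq_square)
  finally have "- a * x\<^sup>2 + b * \<bar>x\<bar> \<le> (b + 1)\<^sup>2 / (4 * a) - \<bar>x\<bar>"
    by (simp add: algebra_simps)
  then show ?thesis by (simp flip: exp_add)
qed

lemma summable_on_gauss:
  assumes "(a::real) > 0"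
  shows "(\<lambda>n::int. exp (- a * (of_int n)\<^sup>2 + b * \<bar>of_int n\<bar>)) summable_on UNIV"
proof (rule summable_on_comparison_test)
  show "(\<lambda>n::int. exp ((b + 1)\<^sup>2 / (4 * a)) * exp (- real_of_int \<bar>n\<bar>)) summable_on UNIV"
    by (intro summable_on_cmult_right summable_on_int_exp_abs)
qed (use gauss_le_exp_abs[OF assms] in auto)

definition gsum :: "complex \<Rightarrow> complex \<Rightarrow> complex" where
  "gsum \<alpha> \<beta> = (\<Sum>\<^sub>\<infinity>n::int. exp (\<alpha> * (of_int n)\<^sup>2 + \<beta> * of_int n))"

lemma norm_gterm_le:
  fixes n :: int
  assumes "Re \<alpha> \<le> - a" "norm \<beta> \<le> b"
  shows "norm (exp (\<alpha> * (of_int n)\<^sup>2 + \<beta> * of_int n)) \<le> exp (- a * (of_int n)\<^sup>2 + b * \<bar>of_int n\<bar>)"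
proof -
  have "Re (\<alpha> * (of_int n)\<^sup>2) \<le> - a * (of_int n)\<^sup>2"
  proof -
    have "Re (\<alpha> * (of_int n)\<^sup>2) = Re \<alpha> * (of_int n)\<^sup>2"
      by (simp add: power2_eq_square)
    then show ?thesis using mult_right_mono[OF assms(1), of "(of_int n)\<^sup>2"] by simp
  qed
  moreover have "Re (\<beta> * of_int n) \<le> b * \<bar>of_int n\<bar>"
  proof -
    have "Re (\<beta> * of_int n) \<le> norm (\<beta> * of_int n)" by (rule complex_Re_le_cmod)
    also have "\<dots> \<le> b * \<bar>of_int n\<bar>"
      by (simp add: norm_mult assms(2) mult_right_mono)
    finally show ?thesis .
  qed
  ultimately show ?thesis by simp
qed

lemma gsum_summable:
  assumes "Re \<alpha> < 0"
  shows "(\<lambda>n::int. exp (\<alpha> * (of_int n)\<^sup>2 + \<beta> * of_int n)) summable_on UNIV"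
proof (rule Infinite_Sum.abs_summable_summable, rule Infinite_Sum.abs_summable_on_comparison_test'[where g = "\<lambda>n::int.
    exp (- (- Re \<alpha>) * (of_int n)\<^sup>2 + norm \<beta> * \<bar>of_int n\<bar>)"])
  show "(\<lambda>n::int. exp (- (- Re \<alpha>) * (of_int n)\<^sup>2 + norm \<beta> * \<bar>of_int n\<bar>)) summable_on UNIV"
    using assms by (intro summable_on_gauss) simp
qed (rule norm_gterm_le, auto)

lemma gsum_uniform_limit:
  assumes "a > 0" "\<And>s. s \<in> K \<Longrightarrow> Re (\<alpha> s) \<le> - a" "\<And>s. s \<in> K \<Longrightarrow> norm (\<beta> s) \<le> b"
  shows "uniform_limit K (\<lambda>X s. \<Sum>n\<in>X. exp (\<alpha> s * (of_int n)\<^sup>2 + \<beta> s * of_int n))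
           (\<lambda>s. gsum (\<alpha> s) (\<beta> s)) (finite_subsets_at_top UNIV)"
  unfolding gsum_def
  by (rule Weierstrass_m_test_general[OF norm_gterm_le summable_on_gauss[of a b]])
     (use assms in auto)

lemma gsum_holomorphic [holomorphic_intros]:
  assumes "open S" "\<alpha> holomorphic_on S" "\<beta> holomorphic_on S" "\<And>s. s \<in> S \<Longrightarrow> Re (\<alpha> s) < 0"
  shows "(\<lambda>s. gsum (\<alpha> s) (\<beta> s)) holomorphic_on S"
proof (rule holomorphic_on_open[OF assms(1), THEN iffD2], rule ballI)
  fix z assume "z \<in> S"
  then obtain r where r: "r > 0" "cball z r \<subseteq> S"
    using assms(1) open_contains_cball by blast
  have cpt: "compact (cball z r)" by simp
  have c1: "continuous_on (cball z r) (\<lambda>s. Re (\<alpha> s))" and c2: "continuous_on (cball z r) (\<lambda>s. norm (\<beta> s))"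
    using assms(2,3) r(2)
    by (auto intro!: continuous_intros elim: continuous_on_subset dest!: holomorphic_on_imp_continuous_on)
  have ne: "cball z r \<noteq> {}" using r by auto
  obtain s0 where s0: "s0 \<in> cball z r" "\<And>s. s \<in> cball z r \<Longrightarrow> Re (\<alpha> s) \<le> Re (\<alpha> s0)"
    using continuous_attains_sup[OF cpt ne c1] by auto
  obtain s1 where s1: "s1 \<in> cball z r" "\<And>s. s \<in> cball z r \<Longrightarrow> norm (\<beta> s) \<le> norm (\<beta> s1)"
    using continuous_attains_sup[OF cpt ne c2] by auto
  have lim: "uniform_limit (cball z r) (\<lambda>X s. \<Sum>n\<in>X. exp (\<alpha> s * (of_int n)\<^sup>2 + \<beta> s * of_int n))
           (\<lambda>s. gsum (\<alpha> s) (\<beta> s)) (finite_subsets_at_top UNIV)"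
    by (rule gsum_uniform_limit[where a = "- Re (\<alpha> s0)" and b = "norm (\<beta> s1)"])
       (use s0 s1 r assms(4) in auto)
  have hol: "(\<lambda>s. \<Sum>n\<in>X. exp (\<alpha> s * (of_int n)\<^sup>2 + \<beta> s * of_int n)) holomorphic_on S" for X :: "int set"
    by (intro holomorphic_intros assms)
  have "(\<lambda>s. gsum (\<alpha> s) (\<beta> s)) holomorphic_on ball z r"
  proof (rule holomorphic_uniform_limit[OF _ lim])
    show "\<forall>\<^sub>F X in finite_subsets_at_top UNIV.
        continuous_on (cball z r) (\<lambda>s. \<Sum>n\<in>X. exp (\<alpha> s * (of_int n)\<^sup>2 + \<beta> s * of_int n)) \<and>
        (\<lambda>s. \<Sum>n\<in>X. exp (\<alpha> s * (of_int n)\<^sup>2 + \<beta> s * of_int n)) holomorphic_on ball z r"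
      using hol r(2) ball_subset_cball[of z r]
      by (intro always_eventually allI)
         (meson continuous_on_subset holomorphic_on_imp_continuous_on holomorphic_on_subset order_trans)
  qed auto
  then show "\<exists>f'. ((\<lambda>s. gsum (\<alpha> s) (\<beta> s)) has_field_derivative f') (at z)"
    using r(1) by (auto simp: holomorphic_on_open)
qed

lemma exp_2pi_of_int [simp]:
  "exp (2 * of_real pi * \<i> * of_int k) = 1" "exp (- (2 * of_real pi * \<i> * of_int k)) = 1"
  using exp_integer_2pi[of "of_int k"] exp_integer_2pi[of "- of_int k"]
  by (auto simp: ac_simps)

section \<open>Uniqueness of Fourier coefficients\<close>

definition null_coeffs :: "(real \<Rightarrow> complex) \<Rightarrow> bool" where
  "null_coeffs G \<longleftrightarrow> continuous_on UNIV G \<and>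
     (\<forall>k::int. integral {0..1} (\<lambda>x. G x * exp (2 * of_real pi * \<i> * of_int k * of_real x)) = 0)"

lemma null_coeffs_cont: "null_coeffs G \<Longrightarrow> continuous_on A G"
  by (auto simp: null_coeffs_def intro: continuous_on_subset)

lemma null_coeffs_add:
  assumes "null_coeffs G" "null_coeffs H"
  shows "null_coeffs (\<lambda>x. G x + H x)"
  unfolding null_coeffs_def
proof (intro conjI allI)
  show "continuous_on UNIV (\<lambda>x. G x + H x)"
    using assms by (intro continuous_intros null_coeffs_cont)
  fix k :: int
  have "integral {0..1} (\<lambda>x. (G x + H x) * exp (2 * of_real pi * \<i> * of_int k * of_real x)) =
    integral {0..1} (\<lambda>x. G x * exp (2 * of_real pi * \<i> * of_int k * of_real x)) +
    integral {0..1} (\<lambda>x. H x * exp (2 * of_real pi * \<i> * of_int k * of_real x))"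
    unfolding ring_distribs
    by (intro integral_add integrable_continuous_real continuous_intros null_coeffs_cont assms)
  then show "integral {0..1} (\<lambda>x. (G x + H x) * exp (2 * of_real pi * \<i> * of_int k * of_real x)) = 0"
    using assms by (simp add: null_coeffs_def)
qed

lemma null_coeffs_cmult: "null_coeffs G \<Longrightarrow> null_coeffs (\<lambda>x. c * G x)"
  by (auto simp: null_coeffs_def mult.assoc intro!: continuous_intros)

lemma null_coeffs_exp:
  assumes "null_coeffs G"
  shows "null_coeffs (\<lambda>x. exp (2 * of_real pi * \<i> * of_int j * of_real x) * G x)"
  unfolding null_coeffs_def
proof (intro conjI allI)
  show "continuous_on UNIV (\<lambda>x. exp (2 * of_real pi * \<i> * of_int j * of_real x) * G x)"
    by (intro continuous_intros null_coeffs_cont assms)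
  fix k :: int
  have "(\<lambda>x::real. exp (2 * of_real pi * \<i> * of_int j * of_real x) * G x * exp (2 * of_real pi * \<i> * of_int k * of_real x))
      = (\<lambda>x. G x * exp (2 * of_real pi * \<i> * of_int (j + k) * of_real x))"
    by (simp add: algebra_simps exp_add)
  then show "integral {0..1} (\<lambda>x. exp (2 * of_real pi * \<i> * of_int j * of_real x) * G x * exp (2 * of_real pi * \<i> *
      of_int k * of_real x)) = 0"
    using assms unfolding null_coeffs_def by metis
qed

lemma null_coeffs_polynomial:
  assumes "real_polynomial_function (p :: complex \<Rightarrow> real)" "null_coeffs G"
  shows "null_coeffs (\<lambda>x. of_real (p (exp (2 * of_real pi * \<i> * of_real x))) * G x)"
  using assms
proof (induction p arbitrary: G rule: real_polynomial_function.induct)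
  case (linear f)
  define a b where "a = f 1" and "b = f \<i>"
  have f: "f z = Re z * a + Im z * b" for z
  proof -
    interpret bounded_linear f by fact
    have "z = Re z *\<^sub>R 1 + Im z *\<^sub>R \<i>" by (simp add: complex_eq_iff)
    then have "f z = f (Re z *\<^sub>R 1 + Im z *\<^sub>R \<i>)" by (rule arg_cong)
    then show ?thesis by (simp only: add scaleR a_def b_def real_scaleR_def)
  qed
  have "(\<lambda>x. of_real (f (exp (2 * of_real pi * \<i> * of_real x))) * G x) =
     (\<lambda>x. ((of_real a - \<i> * of_real b) / 2) * (exp (2 * of_real pi * \<i> * of_int 1 * of_real x) * G x)
       + ((of_real a + \<i> * of_real b) / 2) * (exp (2 * of_real pi * \<i> * of_int (-1) * of_real x) * G x))"
    (is "?l = ?r")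
  proof
    fix x
    have e: "exp (2 * of_real pi * \<i> * of_real x) = cis (2 * pi * x)"
            "exp (- (2 * of_real pi * \<i> * of_real x)) = cis (- (2 * pi * x))"
      by (auto simp: cis_conv_exp mult_ac)
    show "?l x = ?r x"
      by (simp add: e f) (simp add: complex_eq_iff field_simps)
  qed
  then show ?case
    using linear(2) by (simp only: null_coeffs_add null_coeffs_cmult null_coeffs_exp)
next
  case (const c)
  then show ?case by (rule null_coeffs_cmult)
next
  case (add f g)
  have "null_coeffs (\<lambda>x. of_real (f (exp (2 * of_real pi * \<i> * of_real x))) * G x +
      of_real (g (exp (2 * of_real pi * \<i> * of_real x))) * G x)"
    by (intro null_coeffs_add add)
  then show ?case by (simp add: algebra_simps)
next
  case (mult f g)
  have "null_coeffs (\<lambda>x. of_real (f (exp (2 * of_real pi * \<i> * of_real x))) *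
      (of_real (g (exp (2 * of_real pi * \<i> * of_real x))) * G x))"
    by (intro mult)
  then show ?case by (simp add: mult_ac)
qed

lemma periodic_of_int:
  assumes per: "\<And>x::real. F (x + 1) = F x"
  shows "F (x + of_int n) = F x"
proof -
  have nat: "F (y + of_nat m) = F y" for y m
  proof (induction m)
    case (Suc m) then show ?case using per[of "y + of_nat m"] by (simp add: add_ac)
  qed simp
  show ?thesis
  proof (cases n rule: int_cases2)
    case (nonneg m) then show ?thesis using nat by simp
  next
    case (nonpos m) then show ?thesis using nat[of "x - of_nat m" m] by simp
  qed
qed

lemma fourier_unique:
  fixes F :: "real \<Rightarrow> complex"
  assumes F: "null_coeffs F" and per: "\<And>x. F (x + 1) = F x"
  shows "F x = 0"
proof -
  define f where "f z = F (Arg z / (2 * pi))" for z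
  have fexp: "f z = F x" if "z \<noteq> 0" "z = norm z * exp (2 * of_real pi * \<i> * of_real x)" for z x
  proof -
    have "z = norm z * exp (\<i> * Arg z)" using that(1) by (simp add: Arg_eq)
    then have "exp (\<i> * Arg z) = exp (2 * of_real pi * \<i> * of_real x)"
      using that by (metis mult_cancel_left norm_eq_zero of_real_eq_0_iff)
    then obtain n :: int where "\<i> * Arg z = 2 * of_real pi * \<i> * of_real x + (of_int (2 * n) * pi) * \<i>"
      unfolding exp_eq by blast
    then have "of_real (Arg z) = (of_real (2 * pi * x + 2 * n * pi) :: complex)"
      by (auto simp: complex_eq_iff)
    then have "Arg z / (2 * pi) = x + of_int n"
      by (simp only: of_real_eq_iff) (simp add: field_simps)
    then show ?thesis unfolding f_def using periodic_of_int[of F, OF per] by simp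
  qed
  have f1: "f (exp (2 * of_real pi * \<i> * of_real x)) = F x" for x
    by (rule fexp) auto
  have contF: "continuous_on A F" for A by (rule null_coeffs_cont[OF F])
  have "continuous_on (sphere 0 1) f"
    unfolding continuous_on_eq_continuous_within
  proof
    fix z :: complex assume "z \<in> sphere 0 1"
    then have z0: "z \<noteq> 0" by auto
    have isF: "isCont F y" for y using contF[of UNIV] continuous_on_eq_continuous_at by blast
    show "continuous (at z within sphere 0 1) f"
    proof (cases "z \<in> \<real>\<^sub>\<le>\<^sub>0")
      case False
      have "continuous (at z) (\<lambda>z. F (Arg z / (2 * pi)))"
        by (rule isCont_o2[OF _ isF]) (intro continuous_intros continuous_at_Arg False, simp)
      then show ?thesis unfolding f_def by (rule continuous_at_imp_continuous_at_within)
    next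
      case True
      then have nz: "- z \<notin> \<real>\<^sub>\<le>\<^sub>0" using z0
        by (auto simp: complex_nonpos_Reals_iff complex_eq_iff)
      have "continuous (at z) (\<lambda>z. F (Arg (- z) / (2 * pi) + 1 / 2))"
        by (rule isCont_o2[OF _ isF])
           (intro continuous_intros isCont_o2[OF _ continuous_at_Arg] nz, simp)
      moreover have "\<forall>\<^sub>F w in nhds z. F (Arg (- w) / (2 * pi) + 1 / 2) = f w"
      proof (rule eventually_mono)
        show "\<forall>\<^sub>F w in nhds z. w \<noteq> 0" using z0 t1_space_nhds by blast
        fix w :: complex assume w: "w \<noteq> 0"
        have "f w = F (Arg (- w) / (2 * pi) + 1 / 2)"
        proof (rule fexp[OF w])
          have "- w = norm (- w) * exp (\<i> * Arg (- w))" using w by (intro Arg_eq) simp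
          moreover have "exp (2 * of_real pi * \<i> * of_real (Arg (- w) / (2 * pi) + 1 / 2)) = - exp (\<i> * Arg (- w))"
            by (simp add: ring_distribs exp_add mult.commute)
          ultimately show "w = norm w * exp (2 * of_real pi * \<i> * of_real (Arg (- w) / (2 * pi) + 1 / 2))"
            by (simp add: minus_equation_iff[of w])
        qed
        then show "F (Arg (- w) / (2 * pi) + 1 / 2) = f w" by simp
      qed
      ultimately have "continuous (at z) f" by (subst (asm) isCont_cong)
      then show ?thesis by (rule continuous_at_imp_continuous_at_within)
    qed
  qed
  then have contf: "continuous_on (sphere 0 1) (\<lambda>z. cnj (f z))" by (intro continuous_intros)
  have sq: "integral {0..1} (\<lambda>x. F x * cnj (F x)) = 0"
  proof (rule ccontr)
    let ?I = "integral {0..1} (\<lambda>x. F x * cnj (F x))"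
    assume "?I \<noteq> 0"
    define M where "M = integral {0..1} (\<lambda>x. norm (F x))"
    have M: "M \<ge> 0" unfolding M_def
      by (intro integral_nonneg integrable_continuous_real continuous_intros contF) auto
    define e where "e = norm ?I / (2 * (M + 1))"
    have e: "e > 0" using \<open>?I \<noteq> 0\<close> M by (simp add: e_def)
    obtain g where g: "polynomial_function g" "\<And>z. z \<in> sphere 0 1 \<Longrightarrow> norm (cnj (f z) - g z) < e"
      using Stone_Weierstrass_polynomial_function[OF _ contf e] by auto
    have cg: "continuous_on A g" for A by (rule continuous_on_polymonial_function[OF g(1)])
    have re: "real_polynomial_function (\<lambda>z. Re (g z))" "real_polynomial_function (\<lambda>z. Im (g z))"
      using g(1) bounded_linear_Re bounded_linear_Im unfolding polynomial_function_def o_def by auto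
    let ?E = "\<lambda>x::real. exp (2 * of_real pi * \<i> * of_real x)"
    have ge: "g z = of_real (Re (g z)) + \<i> * of_real (Im (g z))" for z by (simp add: complex_eq)
    have "null_coeffs (\<lambda>x. of_real (Re (g (?E x))) * F x + \<i> * (of_real (Im (g (?E x))) * F x))"
      by (intro null_coeffs_add null_coeffs_cmult null_coeffs_polynomial re F)
    also have "(\<lambda>x. of_real (Re (g (?E x))) * F x + \<i> * (of_real (Im (g (?E x))) * F x)) = (\<lambda>x. F x * g (?E x))"
      by (intro ext, subst (3) ge) (simp add: algebra_simps)
    finally have 0: "integral {0..1} (\<lambda>x. F x * g (?E x)) = 0"
      unfolding null_coeffs_def by (auto dest: spec[of _ 0])
    have contE: "continuous_on {0..1} (\<lambda>x. g (?E x))"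
      by (rule continuous_on_compose2[OF cg[of UNIV]]) (auto intro!: continuous_intros)
    have "?I = ?I - integral {0..1} (\<lambda>x. F x * g (?E x))" using 0 by simp
    also have "\<dots> = integral {0..1} (\<lambda>x. F x * cnj (F x) - F x * g (?E x))"
      by (intro integral_diff[symmetric] integrable_continuous_real continuous_intros contF contE)
    also have "norm \<dots> \<le> integral {0..1} (\<lambda>x. e * norm (F x))"
    proof (rule integral_norm_bound_integral)
      fix x :: real assume "x \<in> {0..1}"
      have "norm (cnj (F x) - g (?E x)) < e" using g(2)[of "?E x"] f1[of x] by simp
      then have "norm (F x) * norm (cnj (F x) - g (?E x)) \<le> norm (F x) * e"
        by (intro mult_left_mono) auto
      then show "norm (F x * cnj (F x) - F x * g (?E x)) \<le> e * norm (F x)"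
        by (simp add: mult.commute flip: norm_mult right_diff_distrib)
    qed (intro integrable_continuous_real continuous_intros contF contE)+
    also have "\<dots> = e * M" by (simp add: M_def)
    also have "\<dots> < norm ?I"
    proof -
      have "e * M \<le> e * (M + 1)" using e by simp
      also have "\<dots> = norm ?I / 2"
      proof -
        have "M + 1 \<noteq> 0" using M by linarith
        then show ?thesis by (simp add: e_def field_simps)
      qed
      also have "\<dots> < norm ?I" using \<open>?I \<noteq> 0\<close> by simp
      finally show ?thesis .
    qed
    finally show False by simp
  qed
  have "integral {0..1} (\<lambda>x. (norm (F x))\<^sup>2) = 0"
  proof -
    have "of_real (integral {0..1} (\<lambda>x. (norm (F x))\<^sup>2)) = integral {0..1} (\<lambda>x. complex_of_real ((norm (F x))\<^sup>2))"
    proof -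
      have "(\<lambda>x. (norm (F x))\<^sup>2) integrable_on {0..1}"
        by (intro integrable_continuous_real continuous_intros contF)
      from integral_linear[OF this bounded_linear_of_real[where 'a = complex]] show ?thesis by (simp add: o_def)
    qed
    also have "\<dots> = 0"
      using sq by (simp only: complex_norm_square)
    finally show ?thesis by simp
  qed
  then have zero: "\<forall>x\<in>{0..1}. (norm (F x))\<^sup>2 = 0"
    by (subst (asm) integral_eq_0_iff) (auto intro!: continuous_intros contF)
  have "x - of_int \<lfloor>x\<rfloor> \<in> {0..1}" by (auto simp: field_simps) linarith+
  then have "F (x - of_int \<lfloor>x\<rfloor>) = 0" using zero by simp
  then show ?thesis using periodic_of_int[of F "x - of_int \<lfloor>x\<rfloor>" "\<lfloor>x\<rfloor>", OF per] by simp
qed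

section \<open>Inversion of one-dimensional theta series\<close>

lemma entire_periodic_integral_shift:
  fixes h :: "complex \<Rightarrow> complex"
  assumes hol: "h holomorphic_on UNIV" and per: "\<And>z. h (z + 1) = h z"
  shows "integral {0..1} (\<lambda>x::real. h (of_real x + s)) = integral {0..1} (\<lambda>x::real. h (of_real x))"
proof -
  obtain P where P: "\<And>z. (P has_field_derivative h z) (at z)"
    using holomorphic_convex_primitive'[of UNIV h] hol by auto
  have I: "integral {0..1} (\<lambda>x::real. h (of_real x + s)) = P (1 + s) - P s" for s
  proof -
    have D: "((\<lambda>x::real. P (of_real x + s)) has_vector_derivative h (of_real x + s)) (at x within {0..1})" for x :: real
    proof -
      have "((\<lambda>z. P (z + s)) has_field_derivative h (of_real x + s)) (at (of_real x))"
        using P[of "of_real x + s"] by (simp only: DERIV_shift)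
      then show ?thesis
        by (rule has_vector_derivative_real_field[of "\<lambda>z. P (z + s)" "h (of_real x + s)" x "{0..1}"])
    qed
    have "((\<lambda>x::real. h (of_real x + s)) has_integral (P (of_real 1 + s) - P (of_real 0 + s))) {0..1}"
      by (rule fundamental_theorem_of_calculus[where f = "\<lambda>x. P (of_real x + s)", OF zero_le_one D])
    then show ?thesis by (simp add: integral_unique)
  qed
  have "((\<lambda>s. P (1 + s) - P s) has_field_derivative 0) (at s)" for s
  proof -
    have "((\<lambda>s. P (1 + s) - P s) has_field_derivative (h (1 + s) * 1 - h s)) (at s)"
      by (rule DERIV_diff[OF DERIV_chain2[of P, OF P] P]) (auto intro!: derivative_eq_intros)
    then show ?thesis using per[of s] by (simp add: add.commute)
  qed
  then obtain c where c: "\<And>s. P (1 + s) - P s = c"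
    using has_field_derivative_zero_constant[of UNIV "\<lambda>s. P (1 + s) - P s"] by auto
  then show ?thesis using I[of s] I[of 0] c[of s] c[of 0] by simp
qed

lemma integral_exp_2pi_int:
  "integral {0..1} (\<lambda>x::real. exp (2 * of_real pi * \<i> * of_int k * of_real x)) = (if k = 0 then 1 else 0)"
proof (cases "k = 0")
  case False
  let ?c = "2 * of_real pi * \<i> * of_int k"
  have c: "?c \<noteq> 0" using False by simp
  have "((\<lambda>x::real. exp (?c * of_real x)) has_integral (exp (?c * of_real 1) / ?c - exp (?c * of_real 0) / ?c)) {0..1}"
  proof (rule fundamental_theorem_of_calculus[where f = "\<lambda>x. exp (?c * of_real x) / ?c"])
    fix x :: real
    have "((\<lambda>z. exp (?c * z) / ?c) has_field_derivative exp (?c * of_real x)) (at (of_real x))"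
      using c by (auto intro!: derivative_eq_intros)
    then show "((\<lambda>x::real. exp (?c * of_real x) / ?c) has_vector_derivative exp (?c * of_real x)) (at x within {0..1})"
      by (rule has_vector_derivative_real_field[of "\<lambda>z. exp (?c * z) / ?c" "exp (?c * of_real x)" x "{0..1}"])
  qed simp
  then have "integral {0..1} (\<lambda>x::real. exp (?c * of_real x)) = 0"
    by (simp add: integral_unique)
  then show ?thesis using False by simp
qed simp

lemma gsum_uminus: "gsum \<alpha> (- \<beta>) = gsum \<alpha> \<beta>"
  unfolding gsum_def
  by (rule infsum_reindex_bij_witness[where i = uminus and j = uminus]) auto

definition gauss_shift :: "complex \<Rightarrow> complex \<Rightarrow> complex" where
  "gauss_shift \<tau> z = (\<Sum>\<^sub>\<infinity>n::int. exp (- (of_real pi * \<i> / \<tau>) * (of_int n + z)\<^sup>2))"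

definition gauss_dual :: "complex \<Rightarrow> complex \<Rightarrow> complex" where
  "gauss_dual \<tau> z = (\<Sum>\<^sub>\<infinity>n::int. exp (of_real pi * \<i> * \<tau> * (of_int n)\<^sup>2 + 2 * of_real pi * \<i> * z * of_int n))"

lemma Re_dual_neg: "0 < Im \<tau> \<Longrightarrow> Re (of_real pi * \<i> * \<tau>) < 0"
  by simp

lemma Re_shift_neg: "0 < Im \<tau> \<Longrightarrow> Re (- (of_real pi * \<i> / \<tau>)) < 0"
proof -
  assume *: "0 < Im \<tau>"
  have "Re (- (of_real pi * \<i> / \<tau>)) = - (pi * Im \<tau> / ((Re \<tau>)\<^sup>2 + (Im \<tau>)\<^sup>2))"
    by (simp add: Re_divide power2_eq_square)
  moreover have "0 < (Re \<tau>)\<^sup>2 + (Im \<tau>)\<^sup>2" using * by (simp add: add_nonneg_pos)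
  ultimately show ?thesis using * by simp
qed

lemma gauss_dual_gsum: "gauss_dual \<tau> z = gsum (of_real pi * \<i> * \<tau>) (2 * of_real pi * \<i> * z)"
  by (simp add: gauss_dual_def gsum_def)

lemma gauss_shift_gsum:
  "gauss_shift \<tau> z = exp (- (of_real pi * \<i> / \<tau>) * z\<^sup>2) *
     gsum (- (of_real pi * \<i> / \<tau>)) (- (of_real pi * \<i> / \<tau>) * (2 * z))"
proof -
  have "exp (- (of_real pi * \<i> / \<tau>) * (of_int n + z)\<^sup>2) = exp (- (of_real pi * \<i> / \<tau>) * z\<^sup>2) *
     exp (- (of_real pi * \<i> / \<tau>) * (of_int n)\<^sup>2 + - (of_real pi * \<i> / \<tau>) * (2 * z) * of_int n)" for n
    by (simp only: exp_add[symmetric]) (simp add: power2_eq_square algebra_simps)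
  then show ?thesis
    by (simp only: gauss_shift_def gsum_def infsum_cmult_right')
qed

lemma gauss_shift_holomorphic: "0 < Im \<tau> \<Longrightarrow> gauss_shift \<tau> holomorphic_on UNIV"
  unfolding gauss_shift_gsum[abs_def] by (intro holomorphic_intros Re_shift_neg) auto

lemma gauss_dual_holomorphic: "0 < Im \<tau> \<Longrightarrow> gauss_dual \<tau> holomorphic_on UNIV"
  unfolding gauss_dual_gsum[abs_def] by (intro holomorphic_intros Re_dual_neg) auto

lemma gauss_shift_1: "gauss_shift \<tau> (z + 1) = gauss_shift \<tau> z"
  unfolding gauss_shift_def
  by (rule infsum_reindex_bij_witness[where i = "\<lambda>n. n - 1" and j = "\<lambda>n. n + 1"]) (auto simp: add_ac)

lemma gauss_dual_1: "gauss_dual \<tau> (z + 1) = gauss_dual \<tau> z"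
proof -
  have "exp (of_real pi * \<i> * \<tau> * (of_int n)\<^sup>2 + 2 * of_real pi * \<i> * (z + 1) * of_int n) =
    exp (of_real pi * \<i> * \<tau> * (of_int n)\<^sup>2 + 2 * of_real pi * \<i> * z * of_int n) *
    exp (2 * of_real pi * \<i> * of_int n)" for n
    by (simp only: exp_add[symmetric]) (simp add: algebra_simps)
  then show ?thesis by (simp add: gauss_dual_def)
qed

lemma gauss_shift_tau:
  assumes "\<tau> \<noteq> 0"
  shows "gauss_shift \<tau> (z + \<tau>) = exp (- (of_real pi * \<i> * \<tau>) - 2 * of_real pi * \<i> * z) * gauss_shift \<tau> z"
proof -
  have "exp (- (of_real pi * \<i> / \<tau>) * (of_int n + (z + \<tau>))\<^sup>2) =
     exp (- (of_real pi * \<i> * \<tau>) - 2 * of_real pi * \<i> * z) * exp (- (of_real pi * \<i> / \<tau>) * (of_int n + z)\<^sup>2)" for n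
  proof -
    have "- (of_real pi * \<i> / \<tau>) * (of_int n + (z + \<tau>))\<^sup>2 =
      - (of_real pi * \<i> * \<tau>) - 2 * of_real pi * \<i> * z + - (of_real pi * \<i> / \<tau>) * (of_int n + z)\<^sup>2
        + - (2 * of_real pi * \<i> * of_int n)"
      using assms by (simp add: field_simps power2_eq_square)
    then show ?thesis by (simp only: exp_add exp_2pi_of_int mult_1_right)
  qed
  then show ?thesis by (simp only: gauss_shift_def infsum_cmult_right')
qed

definition gauss_c0 :: "complex \<Rightarrow> complex" where
  "gauss_c0 \<tau> = integral {0..1} (\<lambda>x::real. gauss_shift \<tau> (of_real x))"

lemma gauss_shift_coeff_shift:
  assumes "0 < Im \<tau>"
  shows "integral {0..1} (\<lambda>x::real. gauss_shift \<tau> (of_real x + s) * exp (- (2 * of_real pi * \<i> * of_int k * of_real x)))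
    = exp (2 * of_real pi * \<i> * of_int k * s) *
      integral {0..1} (\<lambda>x::real. gauss_shift \<tau> (of_real x) * exp (- (2 * of_real pi * \<i> * of_int k * of_real x)))"
proof -
  let ?h = "\<lambda>z. gauss_shift \<tau> z * exp (- (2 * of_real pi * \<i> * of_int k * z))"
  have "exp (- (2 * of_real pi * \<i> * of_int k * (z + 1))) = exp (- (2 * of_real pi * \<i> * of_int k * z)) * exp (- (2 *
      of_real pi * \<i> * of_int k))" for z
    by (simp only: exp_add[symmetric]) (simp add: algebra_simps)
  then have "?h (z + 1) = ?h z" for z
    by (simp add: gauss_shift_1)
  then have "integral {0..1} (\<lambda>x::real. ?h (of_real x)) = integral {0..1} (\<lambda>x::real. ?h (of_real x + s))"
    by (intro entire_periodic_integral_shift[symmetric] holomorphic_intros gauss_shift_holomorphic assms)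
  also have "(\<lambda>x::real. ?h (of_real x + s)) = (\<lambda>x::real. exp (- (2 * of_real pi * \<i> * of_int k * s)) *
     (gauss_shift \<tau> (of_real x + s) * exp (- (2 * of_real pi * \<i> * of_int k * of_real x))))"
  proof
    fix x :: real
    have "exp (- (2 * of_real pi * \<i> * of_int k * (of_real x + s))) =
       exp (- (2 * of_real pi * \<i> * of_int k * s)) * exp (- (2 * of_real pi * \<i> * of_int k * of_real x))"
      by (simp only: exp_add[symmetric]) (simp add: algebra_simps)
    then show "?h (of_real x + s) = exp (- (2 * of_real pi * \<i> * of_int k * s)) *
     (gauss_shift \<tau> (of_real x + s) * exp (- (2 * of_real pi * \<i> * of_int k * of_real x)))"
      by (simp only: mult_ac)
  qed
  finally have "integral {0..1} (\<lambda>x::real. ?h (of_real x)) = exp (- (2 * of_real pi * \<i> * of_int k * s)) *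
     integral {0..1} (\<lambda>x::real. gauss_shift \<tau> (of_real x + s) * exp (- (2 * of_real pi * \<i> * of_int k * of_real x)))"
    by (simp only: integral_mult_right)
  then show ?thesis by (simp only: mult.assoc[symmetric] exp_add[symmetric]) simp
qed

lemma gauss_shift_coeff:
  assumes "0 < Im \<tau>"
  shows "integral {0..1} (\<lambda>x::real. gauss_shift \<tau> (of_real x) * exp (- (2 * of_real pi * \<i> * of_int k * of_real x)))
    = gauss_c0 \<tau> * exp (of_real pi * \<i> * \<tau> * (of_int k)\<^sup>2)" (is "?c k = _")
proof -
  have t0: "\<tau> \<noteq> 0" using assms by auto
  have rec: "?c (k + 1) = exp (of_real pi * \<i> * \<tau> * (2 * of_int k + 1)) * ?c k" for k
  proof -
    have "exp (2 * of_real pi * \<i> * of_int k * \<tau>) * ?c k =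
      integral {0..1} (\<lambda>x::real. gauss_shift \<tau> (of_real x + \<tau>) * exp (- (2 * of_real pi * \<i> * of_int k * of_real x)))"
      using gauss_shift_coeff_shift[OF assms, of \<tau> k] by simp
    also have "(\<lambda>x::real. gauss_shift \<tau> (of_real x + \<tau>) * exp (- (2 * of_real pi * \<i> * of_int k * of_real x))) =
      (\<lambda>x::real. exp (- (of_real pi * \<i> * \<tau>)) *
         (gauss_shift \<tau> (of_real x) * exp (- (2 * of_real pi * \<i> * of_int (k + 1) * of_real x))))"
    proof
      fix x :: real
      have "exp (- (of_real pi * \<i> * \<tau>) - 2 * of_real pi * \<i> * of_real x) * exp (- (2 * of_real pi * \<i> * of_int k * of_real x)) =
        exp (- (of_real pi * \<i> * \<tau>)) * exp (- (2 * of_real pi * \<i> * of_int (k + 1) * of_real x))"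
        by (simp only: exp_add[symmetric]) (simp add: algebra_simps)
      then show "gauss_shift \<tau> (of_real x + \<tau>) * exp (- (2 * of_real pi * \<i> * of_int k * of_real x)) =
        exp (- (of_real pi * \<i> * \<tau>)) *
         (gauss_shift \<tau> (of_real x) * exp (- (2 * of_real pi * \<i> * of_int (k + 1) * of_real x)))"
        by (simp only: gauss_shift_tau[OF t0] mult_ac)
    qed
    finally have *: "exp (2 * of_real pi * \<i> * of_int k * \<tau>) * ?c k = exp (- (of_real pi * \<i> * \<tau>)) * ?c (k + 1)"
      by (simp only: integral_mult_right)
    have "?c (k + 1) = exp (of_real pi * \<i> * \<tau>) * (exp (- (of_real pi * \<i> * \<tau>)) * ?c (k + 1))"
      by (simp only: mult.assoc[symmetric] exp_add[symmetric]) simp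
    also have "\<dots> = exp (of_real pi * \<i> * \<tau> * (2 * of_int k + 1)) * ?c k"
      unfolding *[symmetric] by (simp only: mult.assoc[symmetric] exp_add[symmetric]) (simp add: algebra_simps)
    finally show ?thesis .
  qed
  have e: "exp (of_real pi * \<i> * \<tau> * (of_int (k + 1))\<^sup>2) = exp (of_real pi * \<i> * \<tau> * (2 * of_int k + 1)) * exp (of_real
      pi * \<i> * \<tau> * (of_int k)\<^sup>2)" for k
    by (simp only: exp_add[symmetric]) (simp add: algebra_simps power2_eq_square)
  show ?thesis
  proof (induction k rule: int_induct[where k = 0])
    case base then show ?case by (simp add: gauss_c0_def)
  next
    case (step1 i) then show ?case by (simp only: rec e) simp
  next
    case (step2 i)
    have "?c i = exp (of_real pi * \<i> * \<tau> * (2 * of_int (i - 1) + 1)) * ?c (i - 1)"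
      using rec[of "i - 1"] by simp
    moreover have "exp (of_real pi * \<i> * \<tau> * (of_int i)\<^sup>2) = exp (of_real pi * \<i> * \<tau> * (2 * of_int (i - 1) + 1)) * exp
        (of_real pi * \<i> * \<tau> * (of_int (i - 1))\<^sup>2)"
      using e[of "i - 1"] by simp
    ultimately have "exp (of_real pi * \<i> * \<tau> * (2 * of_int (i - 1) + 1)) * ?c (i - 1) =
      exp (of_real pi * \<i> * \<tau> * (2 * of_int (i - 1) + 1)) * (gauss_c0 \<tau> * exp (of_real pi * \<i> * \<tau> * (of_int (i - 1))\<^sup>2))"
      using step2(2) by (simp add: mult_ac)
    then show ?case by (rule mult_left_cancel[OF exp_not_eq_zero, THEN iffD1])
  qed
qed

lemma gauss_dual_coeff:
  assumes "0 < Im \<tau>"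
  shows "integral {0..1} (\<lambda>x::real. gauss_dual \<tau> (of_real x + s) * exp (- (2 * of_real pi * \<i> * of_int k * of_real x)))
    = exp (of_real pi * \<i> * \<tau> * (of_int k)\<^sup>2 + 2 * of_real pi * \<i> * s * of_int k)"
proof -
  let ?\<alpha> = "of_real pi * \<i> * \<tau>"
  let ?t = "\<lambda>n x. exp (?\<alpha> * (of_int n)\<^sup>2 + 2 * of_real pi * \<i> * (of_real x + s) * of_int n) * exp (- (2 * of_real pi * \<i>
      * of_int k * of_real x))"
  have "uniform_limit {0..1::real} (\<lambda>X x. \<Sum>n\<in>X. exp (?\<alpha> * (of_int n)\<^sup>2 + 2 * of_real pi * \<i> * (of_real x + s) * of_int n))
           (\<lambda>x. gauss_dual \<tau> (of_real x + s)) (finite_subsets_at_top UNIV)"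
    unfolding gauss_dual_gsum
  proof (rule gsum_uniform_limit[where a = "- Re ?\<alpha>" and b = "2 * pi * (1 + norm s)"])
    fix x :: real assume "x \<in> {0..1}"
    then have "norm (of_real x + s) \<le> 1 + norm s"
      by (intro norm_triangle_le) auto
    then show "norm (2 * of_real pi * \<i> * (of_real x + s)) \<le> 2 * pi * (1 + norm s)"
      by (simp add: norm_mult)
  qed (use Re_dual_neg[OF assms] in auto)
  then have "uniform_limit {0..1::real} (\<lambda>X x. (\<Sum>n\<in>X. exp (?\<alpha> * (of_int n)\<^sup>2 + 2 * of_real pi * \<i> * (of_real x + s) * of_int n)) *
      exp (- (2 * of_real pi * \<i> * of_int k * of_real x)))
           (\<lambda>x. gauss_dual \<tau> (of_real x + s) * exp (- (2 * of_real pi * \<i> * of_int k * of_real x))) (finite_subsets_at_top UNIV)"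
  proof (rule uniform_lim_mult[OF _ uniform_limit_const])
    have "continuous_on {0..1::real} (\<lambda>x. gauss_dual \<tau> (of_real x + s))"
      by (rule continuous_on_compose2[OF holomorphic_on_imp_continuous_on[OF gauss_dual_holomorphic[OF assms]]])
         (auto intro!: continuous_intros)
    then show "bounded ((\<lambda>x. gauss_dual \<tau> (of_real x + s)) ` {0..1})"
      by (intro compact_imp_bounded compact_continuous_image) auto
    show "bounded ((\<lambda>x::real. exp (- (2 * of_real pi * \<i> * of_int k * of_real x))) ` {0..1})"
      by (intro compact_imp_bounded compact_continuous_image continuous_intros) auto
  qed
  then have lim: "uniform_limit {0..1} (\<lambda>X x. \<Sum>n\<in>X. ?t n x)
           (\<lambda>x. gauss_dual \<tau> (of_real x + s) * exp (- (2 * of_real pi * \<i> * of_int k * of_real x))) (finite_subsets_at_top UNIV)"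
    by (simp add: sum_distrib_right)
  have int: "integral {0..1} (?t n) = (if n = k then exp (?\<alpha> * (of_int k)\<^sup>2 + 2 * of_real pi * \<i> * s * of_int k) else 0)" for n
  proof -
    have "?t n = (\<lambda>x. exp (?\<alpha> * (of_int n)\<^sup>2 + 2 * of_real pi * \<i> * s * of_int n) * exp (2 * of_real pi * \<i> * of_int (n
        - k) * of_real x))"
      by (rule ext) (simp only: exp_add[symmetric], simp add: algebra_simps)
    then show ?thesis using integral_exp_2pi_int[of "n - k"] by (simp only: integral_mult_right) simp
  qed
  obtain I J where IJ: "\<And>X. ((\<lambda>x. \<Sum>n\<in>X. ?t n x) has_integral I X) {0..1}"
     "((\<lambda>x::real. gauss_dual \<tau> (of_real x + s) * exp (- (2 * of_real pi * \<i> * of_int k * of_real x))) has_integral J) {0..1}"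
     "(I \<longlongrightarrow> J) (finite_subsets_at_top UNIV)"
    by (rule uniform_limit_integral[OF lim]) (intro continuous_intros finite_subsets_at_top_neq_bot | blast)+
  have I: "I X = (if k \<in> X then exp (?\<alpha> * (of_int k)\<^sup>2 + 2 * of_real pi * \<i> * s * of_int k) else 0)" if "finite X" for X
  proof -
    have "I X = integral {0..1} (\<lambda>x. \<Sum>n\<in>X. ?t n x)" using IJ(1)[of X] by (simp add: integral_unique)
    also have "\<dots> = (\<Sum>n\<in>X. integral {0..1} (?t n))"
      using that by (intro integral_sum integrable_continuous_real continuous_intros)
    finally show ?thesis using that by (simp add: int)
  qed
  have "\<forall>\<^sub>F X in finite_subsets_at_top UNIV. I X = exp (?\<alpha> * (of_int k)\<^sup>2 + 2 * of_real pi * \<i> * s * of_int k)"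
    unfolding eventually_finite_subsets_at_top by (rule exI[of _ "{k}"]) (auto simp: I)
  then have "(I \<longlongrightarrow> exp (?\<alpha> * (of_int k)\<^sup>2 + 2 * of_real pi * \<i> * s * of_int k)) (finite_subsets_at_top UNIV)"
    by (rule tendsto_eventually)
  then have "J = exp (?\<alpha> * (of_int k)\<^sup>2 + 2 * of_real pi * \<i> * s * of_int k)"
    using IJ(3) tendsto_unique[OF finite_subsets_at_top_neq_bot] by blast
  then show ?thesis using integral_unique[OF IJ(2)] by simp
qed

lemma gauss_shift_eq:
  assumes "0 < Im \<tau>"
  shows "gauss_shift \<tau> z = gauss_c0 \<tau> * gauss_dual \<tau> z"
proof -
  let ?D = "\<lambda>x::real. gauss_shift \<tau> (of_real x + z) - gauss_c0 \<tau> * gauss_dual \<tau> (of_real x + z)"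
  note hol = gauss_shift_holomorphic[OF assms] gauss_dual_holomorphic[OF assms]
  have c1: "continuous_on A (\<lambda>x::real. gauss_shift \<tau> (of_real x + z))" for A
    by (rule continuous_on_compose2[OF holomorphic_on_imp_continuous_on[OF hol(1)]]) (auto intro!: continuous_intros)
  have c2: "continuous_on A (\<lambda>x::real. gauss_dual \<tau> (of_real x + z))" for A
    by (rule continuous_on_compose2[OF holomorphic_on_imp_continuous_on[OF hol(2)]]) (auto intro!: continuous_intros)
  have "null_coeffs ?D"
    unfolding null_coeffs_def
  proof (intro conjI allI)
    show "continuous_on UNIV ?D" by (intro continuous_intros c1 c2)
    fix k :: int
    let ?e = "\<lambda>x::real. exp (- (2 * of_real pi * \<i> * of_int (- k) * of_real x))"
    have "integral {0..1} (\<lambda>x. ?D x * ?e x) =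
      integral {0..1} (\<lambda>x. gauss_shift \<tau> (of_real x + z) * ?e x - gauss_c0 \<tau> * (gauss_dual \<tau> (of_real x + z) * ?e x))"
      by (simp only: left_diff_distrib mult.assoc)
    also have "\<dots> = integral {0..1} (\<lambda>x. gauss_shift \<tau> (of_real x + z) * ?e x) -
        integral {0..1} (\<lambda>x. gauss_c0 \<tau> * (gauss_dual \<tau> (of_real x + z) * ?e x))"
      by (intro integral_diff integrable_continuous_real continuous_intros c1 c2)
    also have "\<dots> = 0"
      by (simp only: integral_mult_right gauss_dual_coeff[OF assms] gauss_shift_coeff_shift[OF assms]
          gauss_shift_coeff[OF assms] exp_add)
         (simp add: mult_ac)
    finally show "integral {0..1} (\<lambda>x. ?D x * exp (2 * of_real pi * \<i> * of_int k * of_real x)) = 0" by simp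
  qed
  moreover have "?D (x + 1) = ?D x" for x
    using gauss_shift_1[of \<tau> "of_real x + z"] gauss_dual_1[of \<tau> "of_real x + z"] by (simp add: add_ac)
  ultimately have "?D 0 = 0" by (rule fourier_unique)
  then show ?thesis by simp
qed

lemma infsum_int_residues:
  fixes f :: "int \<Rightarrow> complex" and N :: nat
  assumes N: "N > 0" and f: "f summable_on UNIV"
  shows "(\<Sum>\<^sub>\<infinity>n. f n) = (\<Sum>j<N. \<Sum>\<^sub>\<infinity>m. f (int N * m + int j))"
proof -
  let ?g = "\<lambda>(j, m). int N * m + int j"
  have bij: "bij_betw ?g ({..<N} \<times> UNIV) UNIV"
  proof (rule bij_betwI[where g = "\<lambda>n. (nat (n mod int N), n div int N)"])
    show "(case (nat (y mod int N), y div int N) of (j, m) \<Rightarrow> int N * m + int j) = y" for y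
      using N by (simp add: add.commute)
  qed (use N in \<open>auto simp: nat_less_iff\<close>)
  have s: "(\<lambda>x. f (?g x)) summable_on {..<N} \<times> UNIV"
    using f by (subst summable_on_reindex_bij_betw[OF bij])
  have "(\<Sum>\<^sub>\<infinity>n. f n) = (\<Sum>\<^sub>\<infinity>x\<in>{..<N} \<times> UNIV. f (?g x))"
    by (rule infsum_reindex_bij_betw[OF bij, symmetric])
  also have "\<dots> = (\<Sum>\<^sub>\<infinity>j\<in>{..<N}. \<Sum>\<^sub>\<infinity>m. f (?g (j, m)))"
    using infsum_Sigma_banach[OF s] by simp
  finally show ?thesis by simp
qed

lemma gauss_shift_summable:
  assumes "0 < Im \<tau>"
  shows "(\<lambda>n::int. exp (- (of_real pi * \<i> / \<tau>) * (of_int n + z)\<^sup>2)) summable_on UNIV"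
proof -
  have "exp (- (of_real pi * \<i> / \<tau>) * (of_int n + z)\<^sup>2) = exp (- (of_real pi * \<i> / \<tau>) * z\<^sup>2) *
     exp (- (of_real pi * \<i> / \<tau>) * (of_int n)\<^sup>2 + - (of_real pi * \<i> / \<tau>) * (2 * z) * of_int n)" for n
    by (simp only: exp_add[symmetric]) (simp add: power2_eq_square algebra_simps)
  then show ?thesis
    by (simp only:) (intro summable_on_cmult_right gsum_summable Re_shift_neg assms)
qed

lemma sum_roots_of_unity:
  fixes k :: int
  assumes "N > 0"
  shows "(\<Sum>j<N. exp (2 * of_real pi * \<i> * of_int k * of_nat j / of_nat N)) =
    (if int N dvd k then of_nat N else 0 :: complex)"
proof -
  let ?w = "exp (2 * of_real pi * \<i> * of_int k / of_nat N) :: complex"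
  have p: "exp (2 * of_real pi * \<i> * of_int k * of_nat j / of_nat N) = ?w ^ j" for j
    by (simp add: exp_of_nat_mult[symmetric] mult_ac)
  have wN: "?w ^ N = 1"
    using assms by (simp add: exp_of_nat_mult[symmetric])
  have w1: "?w = 1 \<longleftrightarrow> int N dvd k"
  proof
    assume "int N dvd k"
    then obtain l where "k = int N * l" by blast
    then have "2 * of_real pi * \<i> * of_int k / of_nat N = (2 * of_real pi * \<i> * of_int l :: complex)"
      using assms by simp
    then show "?w = 1" by (simp only: exp_2pi_of_int)
  next
    assume "?w = 1"
    then obtain l :: int where "Im (2 * of_real pi * \<i> * of_int k / of_nat N) = of_int (2 * l) * pi"
      unfolding exp_eq_1 by blast
    then have "real_of_int k = of_int l * of_nat N"
      using assms by (simp add: field_simps)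
    then have "k = l * int N"
      by (metis of_int_eq_iff of_int_mult of_int_of_nat_eq)
    then show "int N dvd k" by simp
  qed
  show ?thesis
  proof (cases "int N dvd k")
    case True then show ?thesis using w1 by (simp add: p)
  next
    case False
    then have "(\<Sum>j<N. ?w ^ j) = 0" using w1 wN by (subst geometric_sum) auto
    then show ?thesis using False by (simp add: p)
  qed
qed

lemma gauss_dual_summable:
  "0 < Im \<tau> \<Longrightarrow> (\<lambda>n::int. exp (of_real pi * \<i> * \<tau> * (of_int n)\<^sup>2 + 2 * of_real pi * \<i> * z * of_int n)) summable_on UNIV"
  using gsum_summable[OF Re_dual_neg] .

text \<open>Splitting the sum into residue classes modulo \<open>N\<close> and filtering with roots of unity on the
  dual side shows that the constant is homogeneous under scaling by squares.\<close>

lemma gauss_c0_scale: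
  assumes \<tau>: "0 < Im \<tau>" and N: "N > 0"
  shows "gauss_c0 ((of_nat N)\<^sup>2 * \<tau>) * gauss_dual ((of_nat N)\<^sup>2 * \<tau>) z =
    of_nat N * gauss_c0 \<tau> * gauss_dual ((of_nat N)\<^sup>2 * \<tau>) z"
proof -
  let ?\<tau>' = "(of_nat N)\<^sup>2 * \<tau>" and ?N = "of_nat N :: complex"
  have \<tau>': "0 < Im ?\<tau>'"
    using \<tau> N by (simp flip: of_nat_power)
  have t0: "\<tau> \<noteq> 0" using \<tau> by auto
  have "gauss_shift ?\<tau>' z = (\<Sum>j<N. \<Sum>\<^sub>\<infinity>m. exp (- (of_real pi * \<i> / ?\<tau>') * (of_int (int N * m + int j) + z)\<^sup>2))"
    unfolding gauss_shift_def by (rule infsum_int_residues[OF N gauss_shift_summable[OF \<tau>']])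
  also have "\<dots> = (\<Sum>j<N. gauss_shift \<tau> ((z + of_nat j) / ?N))"
  proof (intro sum.cong refl)
    fix j
    have "- (of_real pi * \<i> / ?\<tau>') * (of_int (int N * m + int j) + z)\<^sup>2 =
      - (of_real pi * \<i> / \<tau>) * (of_int m + (z + of_nat j) / ?N)\<^sup>2" for m
      using N t0 by (simp add: field_simps power2_eq_square)
    then show "(\<Sum>\<^sub>\<infinity>m. exp (- (of_real pi * \<i> / ?\<tau>') * (of_int (int N * m + int j) + z)\<^sup>2)) = gauss_shift \<tau> ((z + of_nat j) / ?N)"
      by (simp only: gauss_shift_def)
  qed
  also have "\<dots> = gauss_c0 \<tau> * (\<Sum>j<N. gauss_dual \<tau> ((z + of_nat j) / ?N))"
    by (simp only: gauss_shift_eq[OF \<tau>] sum_distrib_left)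
  also have "(\<Sum>j<N. gauss_dual \<tau> ((z + of_nat j) / ?N)) = ?N * gauss_dual ?\<tau>' z"
  proof -
    let ?t = "\<lambda>n j. exp (of_real pi * \<i> * \<tau> * (of_int n)\<^sup>2 + 2 * of_real pi * \<i> * ((z + of_nat j) / ?N) * of_int n)"
    let ?u = "\<lambda>n. exp (of_real pi * \<i> * \<tau> * (of_int n)\<^sup>2 + 2 * of_real pi * \<i> * (z / ?N) * of_int n)"
    have "((\<lambda>n. \<Sum>j<M. ?t n j) has_sum (\<Sum>j<M. gauss_dual \<tau> ((z + of_nat j) / ?N))) UNIV" for M
    proof (induction M)
      case (Suc M)
      have "((\<lambda>n. ?t n M) has_sum gauss_dual \<tau> ((z + of_nat M) / ?N)) UNIV"
        unfolding gauss_dual_def by (intro has_sum_infsum gauss_dual_summable \<tau>)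
      from has_sum_add[OF Suc this] show ?case by simp
    qed simp
    from infsumI[OF this[of N]]
    have "(\<Sum>j<N. gauss_dual \<tau> ((z + of_nat j) / ?N)) = (\<Sum>\<^sub>\<infinity>n. \<Sum>j<N. ?t n j)"
      by (rule sym)
    also have "\<dots> = (\<Sum>\<^sub>\<infinity>n. ?u n * (if int N dvd n then ?N else 0))"
    proof (intro infsum_cong)
      fix n
      have "?t n j = ?u n * exp (2 * of_real pi * \<i> * of_int n * of_nat j / ?N)" for j
        by (simp only: exp_add[symmetric]) (simp add: add_divide_distrib algebra_simps)
      then show "(\<Sum>j<N. ?t n j) = ?u n * (if int N dvd n then ?N else 0)"
        by (simp only: sum_distrib_left[symmetric] sum_roots_of_unity[OF N])
    qed
    also have "\<dots> = (\<Sum>\<^sub>\<infinity>n\<in>range (\<lambda>l. int N * l). ?u n * ?N)"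
      by (rule infsum_cong_neutral) (auto simp: dvd_def)
    also have "\<dots> = (\<Sum>\<^sub>\<infinity>l. ?u (int N * l) * ?N)"
      using N by (subst infsum_reindex) (auto simp: inj_on_def o_def)
    also have "\<dots> = (\<Sum>\<^sub>\<infinity>l. exp (of_real pi * \<i> * ?\<tau>' * (of_int l)\<^sup>2 + 2 * of_real pi * \<i> * z * of_int l) * ?N)"
      using N by (simp add: power_mult_distrib mult_ac)
    also have "\<dots> = ?N * gauss_dual ?\<tau>' z"
      by (simp only: gauss_dual_def infsum_cmult_left' mult.commute[of "?N"])
    finally show ?thesis .
  qed
  finally have "gauss_shift ?\<tau>' z = gauss_c0 \<tau> * (?N * gauss_dual ?\<tau>' z)" .
  then show ?thesis unfolding gauss_shift_eq[OF \<tau>', of z] by (simp only: mult_ac)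
qed

lemma gauss_dual_imaginary_pos:
  assumes "t > 0"
  shows "\<exists>r>0. gauss_dual (\<i> * of_real t) 0 = of_real r"
proof -
  let ?f = "\<lambda>n::int. exp (- (pi * t) * (of_int n)\<^sup>2 + 0 * \<bar>of_int n\<bar>)"
  have s: "?f summable_on UNIV" using assms by (intro summable_on_gauss) simp
  have "gauss_dual (\<i> * of_real t) 0 = (\<Sum>\<^sub>\<infinity>n. of_real (?f n))"
    unfolding gauss_dual_def
    by (intro infsum_cong) (simp add: exp_of_real[symmetric] mult_ac)
  also have "\<dots> = of_real (\<Sum>\<^sub>\<infinity>n. ?f n)"
    by (intro infsumI has_sum_of_real has_sum_infsum s)
  finally have "gauss_dual (\<i> * of_real t) 0 = of_real (\<Sum>\<^sub>\<infinity>n. ?f n)" .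
  moreover have "sum ?f {0} \<le> (\<Sum>\<^sub>\<infinity>n. ?f n)"
    using s by (intro finite_sum_le_infsum) auto
  ultimately show ?thesis by (intro exI[of _ "\<Sum>\<^sub>\<infinity>n. ?f n"]) simp
qed

lemma gauss_c0_eq_quotient:
  "t > 0 \<Longrightarrow> gauss_c0 (\<i> * of_real t) = gauss_shift (\<i> * of_real t) 0 / gauss_dual (\<i> * of_real t) 0"
  using gauss_shift_eq[of "\<i> * of_real t" 0] gauss_dual_imaginary_pos[of t] by auto

lemma gauss_holomorphic_in_tau:
  "(\<lambda>\<tau>. gauss_shift \<tau> z) holomorphic_on {\<tau>. 0 < Im \<tau>}"
  "(\<lambda>\<tau>. gauss_dual \<tau> z) holomorphic_on {\<tau>. 0 < Im \<tau>}"
proof -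
  have op: "open {\<tau>. 0 < Im \<tau>}" by (rule open_halfspace_Im_gt)
  show "(\<lambda>\<tau>. gauss_shift \<tau> z) holomorphic_on {\<tau>. 0 < Im \<tau>}"
    unfolding gauss_shift_gsum by (intro holomorphic_intros op Re_shift_neg) auto
  show "(\<lambda>\<tau>. gauss_dual \<tau> z) holomorphic_on {\<tau>. 0 < Im \<tau>}"
    unfolding gauss_dual_gsum by (intro holomorphic_intros op Re_dual_neg) auto
qed

lemma gauss_c0_imaginary:
  assumes "t > 0"
  shows "gauss_c0 (\<i> * of_real t) = of_real (sqrt t)"
proof -
  define \<phi> where "\<phi> r = gauss_c0 (\<i> * of_real (r\<^sup>2)) / of_real r" for r :: real
  have scale: "\<phi> (of_nat N * r) = \<phi> r" if "N > 0" "r > 0" for N r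
  proof -
    have e: "(of_nat N)\<^sup>2 * (\<i> * of_real (r\<^sup>2)) = \<i> * of_real ((of_nat N * r)\<^sup>2)"
      by (simp add: power_mult_distrib)
    have "gauss_dual (\<i> * of_real ((of_nat N * r)\<^sup>2)) 0 \<noteq> 0"
      using gauss_dual_imaginary_pos[of "(of_nat N * r)\<^sup>2"] that by auto
    then have "gauss_c0 (\<i> * of_real ((of_nat N * r)\<^sup>2)) = of_nat N * gauss_c0 (\<i> * of_real (r\<^sup>2))"
      using gauss_c0_scale[of "\<i> * of_real (r\<^sup>2)" N 0] that unfolding e by simp
    then show ?thesis using that by (simp add: \<phi>_def)
  qed
  have rat: "\<phi> (of_nat a / of_nat b) = \<phi> 1" if "a > 0" "b > 0" for a b
    using scale[of b "of_nat a / of_nat b"] scale[of a 1] that by simp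
  have cont: "continuous_on {0<..} \<phi>"
  proof -
    have "continuous_on {0<..} (\<lambda>r. gauss_shift (\<i> * of_real (r\<^sup>2)) 0 / gauss_dual (\<i> * of_real (r\<^sup>2)) 0 / of_real r)"
    proof (intro continuous_intros)
      show "continuous_on {0<..} (\<lambda>r. gauss_shift (\<i> * of_real (r\<^sup>2)) 0)"
        by (rule continuous_on_compose2[OF holomorphic_on_imp_continuous_on[OF gauss_holomorphic_in_tau(1)]])
           (auto intro!: continuous_intros)
      show "continuous_on {0<..} (\<lambda>r. gauss_dual (\<i> * of_real (r\<^sup>2)) 0)"
        by (rule continuous_on_compose2[OF holomorphic_on_imp_continuous_on[OF gauss_holomorphic_in_tau(2)]])
           (auto intro!: continuous_intros)
      show "\<forall>r\<in>{0<..}. gauss_dual (\<i> * of_real (r\<^sup>2)) 0 \<noteq> 0"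
        using gauss_dual_imaginary_pos by (metis greaterThan_iff less_irrefl of_real_eq_0_iff zero_less_power)
    qed auto
    then show ?thesis
      by (rule continuous_on_eq) (simp add: \<phi>_def gauss_c0_eq_quotient del: of_real_power)
  qed
  have const: "\<phi> r = \<phi> 1" if "r > 0" for r
  proof (rule ccontr)
    assume ne: "\<phi> r \<noteq> \<phi> 1"
    define U where "U = {s\<in>{0<..}. \<phi> s \<noteq> \<phi> 1}"
    have "open U"
    proof -
      have "U = {0<..} \<inter> \<phi> -` (- {\<phi> 1})" by (auto simp: U_def)
      then show ?thesis using continuous_open_preimage[OF cont, of "- {\<phi> 1}"] by auto
    qed
    moreover have "r \<in> U" using ne that by (simp add: U_def)
    ultimately obtain e where e: "e > 0" "ball r e \<subseteq> U" using open_contains_ball by blast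
    obtain q where q: "q \<in> \<rat>" "r < q" "q < r + e" using Rats_dense_in_real[of r "r + e"] e(1) by auto
    have "q \<in> U" using e q by (auto simp: dist_real_def)
    moreover have "\<phi> q = \<phi> 1"
    proof -
      have "q > 0" using q that by simp
      obtain a b :: nat where "b \<noteq> 0" "\<bar>q\<bar> = of_nat a / of_nat b"
        using Rats_abs_nat_div_natE[OF q(1)] by metis
      then show ?thesis using rat[of a b] \<open>q > 0\<close> by (cases "a = 0") auto
    qed
    ultimately show False by (simp add: U_def)
  qed
  have "\<phi> 1 = 1"
  proof -
    have "gauss_shift \<i> 0 = gauss_dual \<i> 0"
      by (simp add: gauss_shift_def gauss_dual_def mult_ac)
    then show ?thesis using gauss_c0_eq_quotient[of 1] gauss_dual_imaginary_pos[of 1] by (auto simp: \<phi>_def)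
  qed
  then have "\<phi> (sqrt t) = 1" using const[of "sqrt t"] assms by simp
  then show ?thesis using assms by (simp add: \<phi>_def divide_eq_1_iff)
qed

lemma gauss_c0_square:
  assumes "0 < Im \<tau>"
  shows "(gauss_c0 \<tau>)\<^sup>2 = - \<i> * \<tau>"
proof -
  let ?H = "{\<tau>. 0 < Im \<tau>}"
  have on_axis: "(gauss_shift (\<i> * of_real t) z)\<^sup>2 + \<i> * (\<i> * of_real t) * (gauss_dual (\<i> * of_real t) z)\<^sup>2 = 0"
    if "t > 0" for t z
  proof -
    have "(of_real (sqrt t))\<^sup>2 = (of_real t :: complex)" using that by (simp flip: of_real_power)
    then show ?thesis
      using that gauss_shift_eq[of "\<i> * of_real t" z] by (simp add: gauss_c0_imaginary power_mult_distrib)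
  qed
  have all: "(gauss_shift \<tau> z)\<^sup>2 + \<i> * \<tau> * (gauss_dual \<tau> z)\<^sup>2 = 0" for z
  proof (rule analytic_continuation[where S = ?H and U = "(\<lambda>t. \<i> * of_real t) ` {0<..}" and \<xi> = \<i>
        and f = "\<lambda>\<tau>. (gauss_shift \<tau> z)\<^sup>2 + \<i> * \<tau> * (gauss_dual \<tau> z)\<^sup>2"])
    show "(\<lambda>\<tau>. (gauss_shift \<tau> z)\<^sup>2 + \<i> * \<tau> * (gauss_dual \<tau> z)\<^sup>2) holomorphic_on ?H"
      by (intro holomorphic_intros gauss_holomorphic_in_tau)
    show "open ?H" by (rule open_halfspace_Im_gt)
    show "connected ?H" by (intro convex_connected convex_halfspace_Im_gt)
    show "\<i> islimpt (\<lambda>t. \<i> * of_real t) ` {0<..}"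
      unfolding islimpt_approachable
    proof (intro allI impI)
      fix e :: real assume "e > 0"
      moreover have "dist (\<i> * of_real (1 + e / 2)) \<i> = \<bar>e / 2\<bar>"
      proof -
        have "\<i> * of_real (1 + e / 2) - \<i> = \<i> * of_real (e / 2)"
          by (simp add: algebra_simps)
        then show ?thesis by (simp only: dist_norm norm_mult norm_of_real norm_ii mult_1)
      qed
      ultimately show "\<exists>x'\<in>(\<lambda>t. \<i> * of_real t) ` {0<..}. x' \<noteq> \<i> \<and> dist x' \<i> < e"
        by (intro bexI[of _ "\<i> * of_real (1 + e / 2)"])
           (auto simp: complex_eq_iff simp del: of_real_add)
    qed
  qed (use assms on_axis in auto)
  have "\<exists>z. gauss_dual \<tau> z \<noteq> 0"
  proof (rule ccontr)
    assume "\<nexists>z. gauss_dual \<tau> z \<noteq> 0"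
    then show False using gauss_dual_coeff[OF assms, of 0 0] by simp
  qed
  then obtain z where z: "gauss_dual \<tau> z \<noteq> 0" by blast
  have "((gauss_c0 \<tau>)\<^sup>2 + \<i> * \<tau>) * (gauss_dual \<tau> z)\<^sup>2 = 0"
    using all[of z] gauss_shift_eq[OF assms, of z] by (simp add: power_mult_distrib algebra_simps)
  then show ?thesis using z by (simp add: add_eq_0_iff2)
qed

theorem theta_inversion:
  assumes "0 < Im \<tau>"
  shows "(\<Sum>\<^sub>\<infinity>n::int. exp (of_real pi * \<i> * (- 1 / \<tau> * (of_int n + a)\<^sup>2 + 2 * (of_int n + a) * w))) =
    gauss_c0 \<tau> * (\<Sum>\<^sub>\<infinity>k::int. exp (of_real pi * \<i> * (\<tau> * (of_int k + w)\<^sup>2 - 2 * of_int k * a)))"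
proof -
  have t0: "\<tau> \<noteq> 0" using assms by auto
  have 1: "exp (of_real pi * \<i> * (- 1 / \<tau> * (of_int n + a)\<^sup>2 + 2 * (of_int n + a) * w)) =
    exp (of_real pi * \<i> * \<tau> * w\<^sup>2) * exp (- (of_real pi * \<i> / \<tau>) * (of_int n + (a - \<tau> * w))\<^sup>2)" for n
    using t0 by (simp only: exp_add[symmetric]) (simp add: field_simps power2_eq_square)
  have 2: "exp (of_real pi * \<i> * (\<tau> * (of_int k + w)\<^sup>2 - 2 * of_int k * a)) =
    exp (of_real pi * \<i> * \<tau> * w\<^sup>2) * exp (of_real pi * \<i> * \<tau> * (of_int k)\<^sup>2 + 2 * of_real pi * \<i> * (- (a - \<tau> * w)) *
        of_int k)" for k
    by (simp only: exp_add[symmetric]) (simp add: algebra_simps power2_eq_square)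
  have "gauss_dual \<tau> (- (a - \<tau> * w)) = gauss_dual \<tau> (a - \<tau> * w)"
    using gsum_uminus[of "of_real pi * \<i> * \<tau>" "2 * of_real pi * \<i> * (a - \<tau> * w)"]
    by (simp only: gauss_dual_gsum mult_minus_right)
  then show ?thesis
    unfolding 1 2 infsum_cmult_right'
    using gauss_shift_eq[OF assms, of "a - \<tau> * w"]
    by (simp add: gauss_shift_def gauss_dual_def)
qed

section \<open>Three-dimensional theta series\<close>

text \<open>Symmetric matrices are given by the entries \<open>a, b, c, d, e, f\<close> of the upper
  triangle, row by row.\<close>

definition qf :: "'a::comm_ring_1 \<Rightarrow> 'a \<Rightarrow> 'a \<Rightarrow> 'a \<Rightarrow> 'a \<Rightarrow> 'a \<Rightarrow> 'a \<Rightarrow> 'a \<Rightarrow> 'a \<Rightarrow> 'a" where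
  "qf a b c d e f x y z = a * x\<^sup>2 + d * y\<^sup>2 + f * z\<^sup>2 + 2 * (b * x * y + c * x * z + e * y * z)"

lemma Im_qf: "Im (qf a b c d e f (of_real x) (of_real y) (of_real z)) = qf (Im a) (Im b) (Im c) (Im d) (Im e) (Im f) x y z"
  by (simp add: qf_def power2_eq_square)

definition posdef :: "real \<Rightarrow> real \<Rightarrow> real \<Rightarrow> real \<Rightarrow> real \<Rightarrow> real \<Rightarrow> bool" where
  "posdef a b c d e f \<longleftrightarrow> (\<forall>x y z. (x, y, z) \<noteq> (0, 0, 0) \<longrightarrow> 0 < qf a b c d e f x y z)"

definition siegel6 :: "complex \<Rightarrow> complex \<Rightarrow> complex \<Rightarrow> complex \<Rightarrow> complex \<Rightarrow> complex \<Rightarrow> bool" where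
  "siegel6 a b c d e f \<longleftrightarrow> posdef (Im a) (Im b) (Im c) (Im d) (Im e) (Im f)"

lemma posdef_bound:
  assumes "posdef a b c d e f"
  obtains \<delta> where "\<delta> > 0" "\<And>x y z. \<delta> * (x\<^sup>2 + y\<^sup>2 + z\<^sup>2) \<le> qf a b c d e f x y z"
proof -
  let ?q = "\<lambda>(x, y, z). qf a b c d e f x y z"
  let ?S = "sphere (0, 0, 0) (1::real) :: (real \<times> real \<times> real) set"
  have S: "(x, y, z) \<in> ?S \<longleftrightarrow> x\<^sup>2 + y\<^sup>2 + z\<^sup>2 = 1" for x y z :: real
    by (simp add: dist_norm norm_Pair real_sqrt_eq_1_iff add.assoc)
  have ne: "?S \<noteq> {}" using S[of 1 0 0] by fastforce
  have cont: "continuous_on ?S ?q"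
    unfolding qf_def case_prod_unfold by (intro continuous_intros)
  obtain m where m: "m \<in> ?S" "\<And>v. v \<in> ?S \<Longrightarrow> ?q m \<le> ?q v"
    using continuous_attains_inf[OF compact_sphere ne cont] by blast
  define \<delta> where "\<delta> = ?q m"
  have "\<delta> > 0"
  proof (cases m)
    case (fields x y z)
    then have "(x, y, z) \<noteq> (0, 0, 0)" using m(1) S[of x y z] by auto
    then show ?thesis using assms unfolding \<delta>_def fields posdef_def by auto
  qed
  moreover have "\<delta> * (x\<^sup>2 + y\<^sup>2 + z\<^sup>2) \<le> qf a b c d e f x y z" for x y z
  proof (cases "x\<^sup>2 + y\<^sup>2 + z\<^sup>2 = 0")
    case True
    then have "x = 0" "y = 0" "z = 0"
      by (auto simp: add_nonneg_eq_0_iff)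
    then show ?thesis by (simp add: qf_def)
  next
    case False
    define r where "r = sqrt (x\<^sup>2 + y\<^sup>2 + z\<^sup>2)"
    have r: "r > 0" "r\<^sup>2 = x\<^sup>2 + y\<^sup>2 + z\<^sup>2"
      using False by (auto simp: r_def add_nonneg_nonneg less_le)
    have "(x / r)\<^sup>2 + (y / r)\<^sup>2 + (z / r)\<^sup>2 = 1"
      using False r(2) by (simp add: power_divide flip: add_divide_distrib)
    then have "\<delta> \<le> ?q (x / r, y / r, z / r)"
      unfolding \<delta>_def by (intro m(2)) (simp only: S)
    also have "\<dots> = qf a b c d e f x y z / r\<^sup>2"
      using r(1) by (simp add: qf_def field_simps power2_eq_square)
    finally have "\<delta> * r\<^sup>2 \<le> qf a b c d e f x y z"
      using r(1) by (simp add: pos_le_divide_eq)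
    then show ?thesis by (simp only: r(2))
  qed
  ultimately show ?thesis by (rule that)
qed

definition expabs :: "int \<Rightarrow> real" where "expabs n = exp (- real_of_int \<bar>n\<bar>)"

lemma expabs_summable: "expabs summable_on UNIV"
  unfolding expabs_def[abs_def] by (rule summable_on_int_exp_abs)

lemma summable_on_product_nonneg:
  fixes f :: "'a \<Rightarrow> real" and g :: "'b \<Rightarrow> real"
  assumes "f summable_on A" "g summable_on B" "\<And>x. f x \<ge> 0" "\<And>y. g y \<ge> 0"
  shows "(\<lambda>(x, y). f x * g y) summable_on A \<times> B"
proof (rule summable_on_SigmaI)
  show "((\<lambda>y. case (x, y) of (x, y) \<Rightarrow> f x * g y) has_sum (f x * infsum g B)) B" for x
    using assms(2) by (simp add: has_sum_cmult_right)
  show "(\<lambda>x. f x * infsum g B) summable_on A"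
    using assms(1) by (intro summable_on_cmult_left)
qed (use assms in auto)

lemma expabs3_summable: "(\<lambda>(k, l, m). expabs k * (expabs l * expabs m)) summable_on (UNIV :: (int \<times> int \<times> int) set)"
proof -
  have "(\<lambda>(k, p). expabs k * (case p of (l, m) \<Rightarrow> expabs l * expabs m)) summable_on (UNIV \<times> (UNIV \<times> UNIV))"
    by (intro summable_on_product_nonneg expabs_summable) (auto simp: expabs_def split: prod.splits)
  then show ?thesis by (simp add: case_prod_unfold)
qed

lemma lattice_term_bound:
  assumes "siegel6 a b c d e f"
  obtains K where "K > 0" "\<And>k l m :: int. norm (exp (of_real pi * \<i> * qf a b c d e f (of_int k) (of_int l) (of_int m) +
     \<beta>1 * of_int k + \<beta>2 * of_int l + \<beta>3 * of_int m)) \<le> K * (expabs k * (expabs l * expabs m))"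
proof -
  obtain \<delta> where \<delta>: "\<delta> > 0" "\<And>x y z. \<delta> * (x\<^sup>2 + y\<^sup>2 + z\<^sup>2) \<le> qf (Im a) (Im b) (Im c) (Im d) (Im e) (Im f) x y z"
    using assms posdef_bound unfolding siegel6_def by metis
  define C where "C \<beta> = exp ((norm \<beta> + 1)\<^sup>2 / (4 * (pi * \<delta>)))" for \<beta> :: complex
  have one: "exp (- (pi * \<delta>) * (of_int n)\<^sup>2 + norm \<beta> * \<bar>of_int n\<bar>) \<le> C \<beta> * expabs n" for n :: int and \<beta> :: complex
    using gauss_le_exp_abs[of "pi * \<delta>" "of_int n" "norm \<beta>"] \<delta>(1) by (simp add: C_def expabs_def)
  have lin: "Re (\<beta> * of_int n) \<le> norm \<beta> * \<bar>of_int n\<bar>" for n :: int and \<beta> :: complex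
    by (metis complex_Re_le_cmod norm_mult norm_of_int)
  show ?thesis
  proof (rule that[of "C \<beta>1 * C \<beta>2 * C \<beta>3"])
    fix k l m :: int
    have im: "Re (of_real pi * \<i> * qf a b c d e f (of_int k) (of_int l) (of_int m)) =
      - (pi * qf (Im a) (Im b) (Im c) (Im d) (Im e) (Im f) (of_int k) (of_int l) (of_int m))"
      by (simp add: qf_def power2_eq_square)
    have "pi * (\<delta> * ((of_int k)\<^sup>2 + (of_int l)\<^sup>2 + (of_int m)\<^sup>2)) \<le> pi * qf (Im a) (Im b) (Im c) (Im d) (Im e) (Im f)
        (of_int k) (of_int l) (of_int m)"
      by (intro mult_left_mono \<delta>(2)) simp
    then have "Re (of_real pi * \<i> * qf a b c d e f (of_int k) (of_int l) (of_int m) + \<beta>1 * of_int k + \<beta>2 * of_int l + \<beta>3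
        * of_int m)
       \<le> (- (pi * \<delta>) * (of_int k)\<^sup>2 + norm \<beta>1 * \<bar>of_int k\<bar>) + (- (pi * \<delta>) * (of_int l)\<^sup>2 + norm \<beta>2 * \<bar>of_int l\<bar>)
          + (- (pi * \<delta>) * (of_int m)\<^sup>2 + norm \<beta>3 * \<bar>of_int m\<bar>)"
      using lin[of \<beta>1 k] lin[of \<beta>2 l] lin[of \<beta>3 m] unfolding plus_complex.sel im by (simp add: algebra_simps)
    then have "norm (exp (of_real pi * \<i> * qf a b c d e f (of_int k) (of_int l) (of_int m) + \<beta>1 * of_int k + \<beta>2 * of_int
        l + \<beta>3 * of_int m))
      \<le> exp (- (pi * \<delta>) * (of_int k)\<^sup>2 + norm \<beta>1 * \<bar>of_int k\<bar>) * exp (- (pi * \<delta>) * (of_int l)\<^sup>2 + norm \<beta>2 * \<bar>of_int l\<bar>)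
          * exp (- (pi * \<delta>) * (of_int m)\<^sup>2 + norm \<beta>3 * \<bar>of_int m\<bar>)"
      unfolding norm_exp_eq_Re by (simp only: exp_add[symmetric] exp_le_cancel_iff)
    also have "\<dots> \<le> (C \<beta>1 * expabs k) * (C \<beta>2 * expabs l) * (C \<beta>3 * expabs m)"
      by (intro mult_mono one) (auto simp: C_def expabs_def)
    finally show "norm (exp (of_real pi * \<i> * qf a b c d e f (of_int k) (of_int l) (of_int m) +
     \<beta>1 * of_int k + \<beta>2 * of_int l + \<beta>3 * of_int m)) \<le> C \<beta>1 * C \<beta>2 * C \<beta>3 * (expabs k * (expabs l * expabs m))"
      by (simp only: mult_ac)
  qed (simp add: C_def)
qed

definition th3_term :: "complex \<Rightarrow> complex \<Rightarrow> complex \<Rightarrow> complex \<Rightarrow> complex \<Rightarrow> complex \<Rightarrow>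
    complex \<Rightarrow> complex \<Rightarrow> complex \<Rightarrow> complex \<Rightarrow> complex \<Rightarrow> complex \<Rightarrow> int \<times> int \<times> int \<Rightarrow> complex" where
  "th3_term a b c d e f s1 s2 s3 w1 w2 w3 = (\<lambda>(k, l, m).
     exp (of_real pi * \<i> * (qf a b c d e f (of_int k + s1) (of_int l + s2) (of_int m + s3) +
       2 * ((of_int k + s1) * w1 + (of_int l + s2) * w2 + (of_int m + s3) * w3))))"

definition th3 :: "complex \<Rightarrow> complex \<Rightarrow> complex \<Rightarrow> complex \<Rightarrow> complex \<Rightarrow> complex \<Rightarrow>
    complex \<Rightarrow> complex \<Rightarrow> complex \<Rightarrow> complex \<Rightarrow> complex \<Rightarrow> complex \<Rightarrow> complex" where
  "th3 a b c d e f s1 s2 s3 w1 w2 w3 = (\<Sum>\<^sub>\<infinity>p. th3_term a b c d e f s1 s2 s3 w1 w2 w3 p)"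

lemma th3_term_bound:
  assumes "siegel6 a b c d e f"
  obtains K where "K > 0"
    "\<And>k l m. norm (th3_term a b c d e f s1 s2 s3 w1 w2 w3 (k, l, m)) \<le> K * (expabs k * (expabs l * expabs m))"
proof -
  define \<beta>1 \<beta>2 \<beta>3 \<gamma> where
    "\<beta>1 = 2 * of_real pi * \<i> * (a * s1 + b * s2 + c * s3 + w1)" and
    "\<beta>2 = 2 * of_real pi * \<i> * (b * s1 + d * s2 + e * s3 + w2)" and
    "\<beta>3 = 2 * of_real pi * \<i> * (c * s1 + e * s2 + f * s3 + w3)" and
    "\<gamma> = of_real pi * \<i> * (qf a b c d e f s1 s2 s3 + 2 * (s1 * w1 + s2 * w2 + s3 * w3))"
  have eq: "th3_term a b c d e f s1 s2 s3 w1 w2 w3 (k, l, m) = exp \<gamma> *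
     exp (of_real pi * \<i> * qf a b c d e f (of_int k) (of_int l) (of_int m) + \<beta>1 * of_int k + \<beta>2 * of_int l + \<beta>3 * of_int
         m)" for k l m
    unfolding th3_term_def prod.case exp_add[symmetric] \<beta>1_def \<beta>2_def \<beta>3_def \<gamma>_def
    by (rule arg_cong[where f = exp]) (simp add: qf_def power2_eq_square algebra_simps)
  obtain K where K: "K > 0" "\<And>k l m :: int. norm (exp (of_real pi * \<i> * qf a b c d e f (of_int k) (of_int l) (of_int m) +
     \<beta>1 * of_int k + \<beta>2 * of_int l + \<beta>3 * of_int m)) \<le> K * (expabs k * (expabs l * expabs m))"
    using lattice_term_bound[OF assms] by metis
  show ?thesis
  proof (rule that[of "norm (exp \<gamma>) * K"])
    show "norm (th3_term a b c d e f s1 s2 s3 w1 w2 w3 (k, l, m)) \<le> norm (exp \<gamma>) * K * (expabs k * (expabs l * expabs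
        m))" for k l m
      unfolding eq norm_mult mult.assoc[of "norm (exp \<gamma>)"] by (intro mult_left_mono K) simp
  qed (use K in simp)
qed

lemma th3_abs_summable:
  assumes "siegel6 a b c d e f"
  shows "(\<lambda>p. norm (th3_term a b c d e f s1 s2 s3 w1 w2 w3 p)) summable_on UNIV"
proof -
  obtain K where K: "K > 0" "\<And>k l m. norm (th3_term a b c d e f s1 s2 s3 w1 w2 w3 (k, l, m)) \<le> K * (expabs k * (expabs l
      * expabs m))"
    using th3_term_bound[OF assms] by metis
  show ?thesis
    by (rule Infinite_Sum.abs_summable_on_comparison_test'[where g = "\<lambda>p. K * (case p of (k, l, m) \<Rightarrow> expabs k * (expabs
        l * expabs m))"])
       (use K in \<open>auto intro!: summable_on_cmult_right expabs3_summable split: prod.splits\<close>)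
qed

lemma th3_summable:
  "siegel6 a b c d e f \<Longrightarrow> th3_term a b c d e f s1 s2 s3 w1 w2 w3 summable_on UNIV"
  by (rule Infinite_Sum.abs_summable_summable[OF th3_abs_summable])

lemma infsum_first_inner:
  fixes g :: "int \<times> int \<times> int \<Rightarrow> complex"
  assumes "g summable_on UNIV"
  shows "(\<Sum>\<^sub>\<infinity>p. g p) = (\<Sum>\<^sub>\<infinity>q. \<Sum>\<^sub>\<infinity>k. g (k, q))"
proof -
  have s: "(\<lambda>(k, q). g (k, q)) summable_on UNIV \<times> UNIV" using assms by simp
  have "(\<Sum>\<^sub>\<infinity>p. g p) = (\<Sum>\<^sub>\<infinity>k. \<Sum>\<^sub>\<infinity>q. g (k, q))"
    using infsum_Sigma_banach[of g UNIV "\<lambda>_. UNIV"] assms by simp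
  also have "\<dots> = (\<Sum>\<^sub>\<infinity>q. \<Sum>\<^sub>\<infinity>k. g (k, q))"
    by (rule infsum_swap_banach[OF s])
  finally show ?thesis .
qed

lemma siegel6_Im_pos: "siegel6 a b c d e f \<Longrightarrow> 0 < Im a"
  unfolding siegel6_def posdef_def by (drule spec[of _ 1], drule spec[of _ 0], drule spec[of _ 0]) (simp add: qf_def)

text \<open>With \<open>w = (C\<tau> + D)\<^sup>-\<^sup>1 x\<close> the value of the transformed imaginary part at \<open>x\<close> is
  the sum of the values of the original one at the real and at the imaginary part of \<open>w\<close>.\<close>

lemma siegel6_inversion:
  assumes S: "siegel6 a b c d e f"
  shows "siegel6 (- 1 / a) (b / a) (c / a) (d - b\<^sup>2 / a) (e - b * c / a) (f - c\<^sup>2 / a)"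
  unfolding siegel6_def posdef_def
proof (intro allI impI)
  fix x y z :: real assume nz: "(x, y, z) \<noteq> (0, 0, 0)"
  have a: "Im a > 0" by (rule siegel6_Im_pos[OF S])
  then have a0: "a \<noteq> 0" by auto
  let ?Q = "qf (Im a) (Im b) (Im c) (Im d) (Im e) (Im f)"
  have pos: "0 < ?Q u v w" if "(u, v, w) \<noteq> (0, 0, 0)" for u v w
    using S that by (auto simp: siegel6_def posdef_def)
  define s where "s = b * of_real y + c * of_real z"
  define w where "w = (of_real x - s) / a"
  have "qf (Im (- 1 / a)) (Im (b / a)) (Im (c / a)) (Im (d - b\<^sup>2 / a)) (Im (e - b * c / a)) (Im (f - c\<^sup>2 / a)) x y z =
    Im (qf (- 1 / a) (b / a) (c / a) (d - b\<^sup>2 / a) (e - b * c / a) (f - c\<^sup>2 / a) (of_real x) (of_real y) (of_real z))"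
    by (rule Im_qf[symmetric])
  also have "qf (- 1 / a) (b / a) (c / a) (d - b\<^sup>2 / a) (e - b * c / a) (f - c\<^sup>2 / a) (of_real x) (of_real y) (of_real z) =
     (d * (of_real y)\<^sup>2 + f * (of_real z)\<^sup>2 + 2 * e * of_real y * of_real z) - a * w\<^sup>2"
    using a0 by (simp add: qf_def s_def w_def field_simps power2_eq_square)
  also have "Im \<dots> = ?Q (Re w) y z + Im a * (Im w)\<^sup>2"
  proof -
    have "a * w = of_real x - s" using a0 by (simp add: w_def)
    then have "Im (a * w) = - Im s" by simp
    then have e: "Re a * Im w = - (Im a * Re w) - (Im b * y + Im c * z)"
      by (simp add: s_def)
    have "Im (a * w\<^sup>2) = Im a * ((Re w)\<^sup>2 - (Im w)\<^sup>2) + 2 * Re w * (Re a * Im w)"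
      by (simp add: power2_eq_square algebra_simps)
    then show ?thesis
      unfolding e by (simp add: qf_def power2_eq_square algebra_simps)
  qed
  also have "0 < \<dots>"
  proof (cases "(Re w, y, z) = (0, 0, 0)")
    case False
    then show ?thesis using pos[of "Re w" y z] a by (simp add: add_pos_nonneg)
  next
    case True
    then have "x \<noteq> 0" "s = 0" using nz by (auto simp: s_def)
    then have "w \<noteq> 0" using a0 by (simp add: w_def)
    then have "Im w \<noteq> 0" using True by (auto simp: complex_eq_iff)
    then show ?thesis using True a by (simp add: qf_def)
  qed
  finally show "0 < qf (Im (- 1 / a)) (Im (b / a)) (Im (c / a)) (Im (d - b\<^sup>2 / a)) (Im (e - b * c / a)) (Im (f - c\<^sup>2 /
      a)) x y z" .
qed

lemma th3_inversion:
  assumes S: "siegel6 a b c d e f"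
  shows "th3 (- 1 / a) (b / a) (c / a) (d - b\<^sup>2 / a) (e - b * c / a) (f - c\<^sup>2 / a) s1 s2 s3 w1 w2 w3 =
    gauss_c0 a * exp (2 * of_real pi * \<i> * s1 * w1) * th3 a b c d e f w1 s2 s3 (- s1) w2 w3"
proof -
  have a: "Im a > 0" by (rule siegel6_Im_pos[OF S])
  then have a0: "a \<noteq> 0" by auto
  note S' = siegel6_inversion[OF S]
  let ?f = "th3_term (- 1 / a) (b / a) (c / a) (d - b\<^sup>2 / a) (e - b * c / a) (f - c\<^sup>2 / a) s1 s2 s3 w1 w2 w3"
  let ?g = "th3_term a b c d e f w1 s2 s3 (- s1) w2 w3"
  have inner: "(\<Sum>\<^sub>\<infinity>k. ?f (k, q)) = gauss_c0 a * exp (2 * of_real pi * \<i> * s1 * w1) * (\<Sum>\<^sub>\<infinity>k. ?g (k, q))" for q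
  proof -
    obtain l m where q: "q = (l, m)" by (cases q)
    define u v where "u = of_int l + s2" and "v = of_int m + s3"
    define R where "R = exp (of_real pi * \<i> * ((d - b\<^sup>2 / a) * u\<^sup>2 + (f - c\<^sup>2 / a) * v\<^sup>2 + 2 * (e - b * c / a) * u * v +
        2 * (u * w2 + v * w3)))"
    define W where "W = (b * u + c * v) / a + w1"
    have f: "?f (k, q) = R * exp (of_real pi * \<i> * (- 1 / a * (of_int k + s1)\<^sup>2 + 2 * (of_int k + s1) * W))" for k
      unfolding th3_term_def q prod.case u_def[symmetric] v_def[symmetric] R_def exp_add[symmetric] W_def
      using a0 by (intro arg_cong[where f = exp]) (simp add: qf_def field_simps power2_eq_square)
    have g: "exp (2 * of_real pi * \<i> * s1 * w1) * ?g (k, q) = R * exp (of_real pi * \<i> * (a * (of_int k + W)\<^sup>2 - 2 *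
        of_int k * s1))" for k
      unfolding th3_term_def q prod.case u_def[symmetric] v_def[symmetric] R_def exp_add[symmetric] W_def
      using a0 by (intro arg_cong[where f = exp]) (simp add: qf_def field_simps power2_eq_square)
    have "(\<Sum>\<^sub>\<infinity>k. ?f (k, q)) = gauss_c0 a * (R * (\<Sum>\<^sub>\<infinity>k. exp (of_real pi * \<i> * (a * (of_int k + W)\<^sup>2 - 2 * of_int k * s1))))"
      unfolding f infsum_cmult_right' theta_inversion[OF a] by (rule mult.left_commute)
    also have "R * (\<Sum>\<^sub>\<infinity>k. exp (of_real pi * \<i> * (a * (of_int k + W)\<^sup>2 - 2 * of_int k * s1))) =
       exp (2 * of_real pi * \<i> * s1 * w1) * (\<Sum>\<^sub>\<infinity>k. ?g (k, q))"
      by (simp only: infsum_cmult_right'[symmetric] g)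
    finally show ?thesis by (simp only: mult.assoc)
  qed
  show ?thesis
    unfolding th3_def infsum_first_inner[OF th3_summable[OF S]] infsum_first_inner[OF th3_summable[OF S']] inner
    by (simp only: infsum_cmult_right')
qed

lemma th3_shift_w1:
  "th3 a b c d e f s1 s2 s3 (w1 + of_int n) w2 w3 = exp (2 * of_real pi * \<i> * of_int n * s1) * th3 a b c d e f s1 s2 s3 w1 w2 w3"
proof -
  have "th3_term a b c d e f s1 s2 s3 (w1 + of_int n) w2 w3 p = exp (2 * of_real pi * \<i> * of_int n * s1) * th3_term a b
      c d e f s1 s2 s3 w1 w2 w3 p" for p
  proof -
    obtain k l m where p: "p = (k, l, m)" by (cases p) auto
    have "of_real pi * \<i> * (qf a b c d e f (of_int k + s1) (of_int l + s2) (of_int m + s3) +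
       2 * ((of_int k + s1) * (w1 + of_int n) + (of_int l + s2) * w2 + (of_int m + s3) * w3)) =
       2 * of_real pi * \<i> * of_int n * s1 + of_real pi * \<i> * (qf a b c d e f (of_int k + s1) (of_int l + s2) (of_int m + s3) +
       2 * ((of_int k + s1) * w1 + (of_int l + s2) * w2 + (of_int m + s3) * w3)) + 2 * of_real pi * \<i> * of_int (k * n)"
      by (simp add: algebra_simps)
    then show ?thesis
      unfolding p th3_term_def prod.case by (simp only: exp_add exp_2pi_of_int mult_1_right)
  qed
  then show ?thesis by (simp only: th3_def infsum_cmult_right')
qed

lemma th3_shift_s1: "th3 a b c d e f (s1 + of_int n) s2 s3 w1 w2 w3 = th3 a b c d e f s1 s2 s3 w1 w2 w3"
  unfolding th3_def th3_term_def
  by (rule infsum_reindex_bij_witness[where i = "\<lambda>(k, l, m). (k - n, l, m)" and j = "\<lambda>(k, l, m). (k + n, l, m)"])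
     (auto simp: add_ac)

lemma th3_swap12: "th3 a b c d e f s1 s2 s3 w1 w2 w3 = th3 d b e a c f s2 s1 s3 w2 w1 w3"
  unfolding th3_def th3_term_def qf_def
  by (rule infsum_reindex_bij_witness[where i = "\<lambda>(k, l, m). (l, k, m)" and j = "\<lambda>(k, l, m). (l, k, m)"])
     (auto simp: algebra_simps)

lemma th3_swap23: "th3 a b c d e f s1 s2 s3 w1 w2 w3 = th3 a c b f e d s1 s3 s2 w1 w3 w2"
  unfolding th3_def th3_term_def qf_def
  by (rule infsum_reindex_bij_witness[where i = "\<lambda>(k, l, m). (k, m, l)" and j = "\<lambda>(k, l, m). (k, m, l)"])
     (auto simp: algebra_simps)

lemma th3_shear:
  "th3 (a + 2 * b + d) (b + d) (c + e) d e f s1 s2 s3 w1 w2 w3 =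
   th3 a b c d e f s1 (s1 + s2) s3 (w1 - w2) w2 w3"
  unfolding th3_def th3_term_def qf_def
  by (rule infsum_reindex_bij_witness[where i = "\<lambda>(k, l, m). (k, l - k, m)" and j = "\<lambda>(k, l, m). (k, l + k, m)"])
     (auto simp: power2_eq_square algebra_simps intro!: arg_cong[where f = exp])

section \<open>Coordinates\<close>

lemma vec3_eq_iff: "(x :: 'a^3) = y \<longleftrightarrow> x $ 1 = y $ 1 \<and> x $ 2 = y $ 2 \<and> x $ 3 = y $ 3"
  by (simp add: vec_eq_iff forall_3)

definition sm :: "complex \<Rightarrow> complex \<Rightarrow> complex \<Rightarrow> complex \<Rightarrow> complex \<Rightarrow> complex \<Rightarrow> complex^3^3" where
  "sm a b c d e f = vector [vector [a, b, c], vector [b, d, e], vector [c, e, f]]"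

lemma sm_nth [simp]:
  "sm a b c d e f $ 1 $ 1 = a" "sm a b c d e f $ 1 $ 2 = b" "sm a b c d e f $ 1 $ 3 = c"
  "sm a b c d e f $ 2 $ 1 = b" "sm a b c d e f $ 2 $ 2 = d" "sm a b c d e f $ 2 $ 3 = e"
  "sm a b c d e f $ 3 $ 1 = c" "sm a b c d e f $ 3 $ 2 = e" "sm a b c d e f $ 3 $ 3 = f"
  by (simp_all add: sm_def)

lemma transpose_sm [simp]: "transpose (sm a b c d e f) = sm a b c d e f"
  by (simp add: vec3_eq_iff transpose_def)

lemma sm_in_siegel [simp]: "sm a b c d e f \<in> siegel \<longleftrightarrow> siegel6 a b c d e f"
proof -
  have q: "v \<bullet> (map_matrix Im (sm a b c d e f) *v v) =
     qf (Im a) (Im b) (Im c) (Im d) (Im e) (Im f) (v $ 1) (v $ 2) (v $ 3)" for v :: "real^3"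
    by (simp add: inner_vec_def sum_3 matrix_vector_mult_def map_matrix_def qf_def power2_eq_square algebra_simps)
  show ?thesis
    unfolding siegel_def siegel6_def posdef_def mem_Collect_eq transpose_sm q
  proof (intro iffI conjI allI impI refl)
    fix x y z :: real
    assume *: "sm a b c d e f = sm a b c d e f \<and> (\<forall>v::real^3. v \<noteq> 0 \<longrightarrow> 0 < qf (Im a) (Im b) (Im c) (Im d) (Im e) (Im f)
        (v $ 1) (v $ 2) (v $ 3))"
      and nz: "(x, y, z) \<noteq> (0, 0, 0)"
    from conjunct2[OF *, rule_format, of "vector [x, y, z]"] nz
    show "0 < qf (Im a) (Im b) (Im c) (Im d) (Im e) (Im f) x y z"
      by (auto simp: vec3_eq_iff)
  next
    fix v :: "real^3"
    assume *: "\<forall>x y z. (x, y, z) \<noteq> (0, 0, 0) \<longrightarrow> 0 < qf (Im a) (Im b) (Im c) (Im d) (Im e) (Im f) x y z"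
      and "v \<noteq> 0"
    have "(v $ 1, v $ 2, v $ 3) \<noteq> (0, 0, 0)"
      using \<open>v \<noteq> 0\<close> unfolding vec3_eq_iff[of v 0] by simp
    with * show "0 < qf (Im a) (Im b) (Im c) (Im d) (Im e) (Im f) (v $ 1) (v $ 2) (v $ 3)" by blast
  qed
qed

lemma siegel_cases [consumes 1]:
  assumes "\<tau> \<in> siegel"
  obtains a b c d e f where "\<tau> = sm a b c d e f" "siegel6 a b c d e f"
proof -
  have t: "transpose \<tau> = \<tau>" using assms by (simp add: siegel_def)
  have "\<tau> $ i $ j = \<tau> $ j $ i" for i j
    by (subst t[symmetric]) (simp add: transpose_def)
  from this[of 2 1] this[of 3 1] this[of 3 2]
  have *: "\<tau> = sm (\<tau> $ 1 $ 1) (\<tau> $ 1 $ 2) (\<tau> $ 1 $ 3) (\<tau> $ 2 $ 2) (\<tau> $ 2 $ 3) (\<tau> $ 3 $ 3)"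
    by (simp add: vec3_eq_iff)
  have "sm (\<tau> $ 1 $ 1) (\<tau> $ 1 $ 2) (\<tau> $ 1 $ 3) (\<tau> $ 2 $ 2) (\<tau> $ 2 $ 3) (\<tau> $ 3 $ 3) \<in> siegel"
    using assms * by (rule back_subst)
  then have "siegel6 (\<tau> $ 1 $ 1) (\<tau> $ 1 $ 2) (\<tau> $ 1 $ 3) (\<tau> $ 2 $ 2) (\<tau> $ 2 $ 3) (\<tau> $ 3 $ 3)"
    by (simp only: sm_in_siegel)
  with * show ?thesis by (rule that)
qed

definition bitc :: "bit \<Rightarrow> complex" where "bitc b = (if b = 1 then 1 else 0)"

lemma bitc_simps [simp]: "bitc 0 = 0" "bitc 1 = 1"
  by (simp_all add: bitc_def)

lemma bv_nth [simp]: "bv a b c $ 1 = a" "bv a b c $ 2 = b" "bv a b c $ 3 = c"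
  by (simp_all add: bv_def)

lemma bv_eq_iff [simp]: "bv a b c = bv a' b' c' \<longleftrightarrow> a = a' \<and> b = b' \<and> c = c'"
  by (simp add: vec3_eq_iff)

lemma bv_cases: obtains a b c where "e = bv a b c"
  by (rule that[of "e $ 1" "e $ 2" "e $ 3"]) (simp add: vec3_eq_iff)

lemma bv_add [simp]: "bv a b c + bv a' b' c' = bv (a + a') (b + b') (c + c')"
  by (simp add: vec3_eq_iff)

lemma bv_zero: "0 = bv 0 0 0"
  by (simp add: vec3_eq_iff)

lemma bv_eq_zero_iff [simp]: "bv a b c = 0 \<longleftrightarrow> a = 0 \<and> b = 0 \<and> c = 0"
  by (simp add: vec3_eq_iff)

lemma cdot_bv [simp]: "cdot (bv a b c) (bv a' b' c') = a * a' + b * b' + c * c'"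
  by (simp add: cdot_def sum_3)

lemma bij_int3: "bij_betw (\<lambda>(k, l, m). vector [k, l, m] :: int^3) UNIV UNIV"
  by (rule bij_betwI[where g = "\<lambda>v. (v $ 1, v $ 2, v $ 3)"]) (auto simp: vec3_eq_iff)

lemma theta_th3:
  "theta (x, y) (sm a b c d e f) z = th3 a b c d e f (bitc (x $ 1) / 2) (bitc (x $ 2) / 2) (bitc (x $ 3) / 2)
     (z $ 1 + bitc (y $ 1) / 2) (z $ 2 + bitc (y $ 2) / 2) (z $ 3 + bitc (y $ 3) / 2)"
  unfolding theta_def th3_def infsum_reindex_bij_betw[OF bij_int3, symmetric]
proof (intro infsum_cong)
  fix p :: "int \<times> int \<times> int"
  obtain k l m where p: "p = (k, l, m)" by (cases p) auto
  show "(let u = (\<chi> i. of_int ((case p of (k, l, m) \<Rightarrow> vector [k, l, m]) $ i)) + (1/2) *\<^sub>R lift (fst (x, y))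
     in exp (of_real pi * \<i> * cdot u (sm a b c d e f *v u + 2 *\<^sub>R (z + (1/2) *\<^sub>R lift (snd (x, y)))))) =
     th3_term a b c d e f (bitc (x $ 1) / 2) (bitc (x $ 2) / 2) (bitc (x $ 3) / 2)
     (z $ 1 + bitc (y $ 1) / 2) (z $ 2 + bitc (y $ 2) / 2) (z $ 3 + bitc (y $ 3) / 2) p"
    unfolding p th3_term_def Let_def prod.case
    by (rule arg_cong[where f = exp])
       (simp add: cdot_def sum_3 matrix_vector_mult_def lift_def bitc_def[symmetric] scaleR_conv_of_real[where 'a = complex]
          qf_def power2_eq_square algebra_simps add_divide_distrib)
qed

definition cc :: "bit \<Rightarrow> bit \<Rightarrow> bit \<Rightarrow> bit \<Rightarrow> bit \<Rightarrow> bit \<Rightarrow> characteristic" where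
  "cc a1 a2 a3 d1 d2 d3 = (bv a1 a2 a3, bv d1 d2 d3)"

lemma cc_eq_iff [simp]: "cc a1 a2 a3 d1 d2 d3 = cc b1 b2 b3 c1 c2 c3 \<longleftrightarrow>
    a1 = b1 \<and> a2 = b2 \<and> a3 = b3 \<and> d1 = c1 \<and> d2 = c2 \<and> d3 = c3"
  by (auto simp: cc_def)

lemma cc_cases: obtains a1 a2 a3 d1 d2 d3 where "m = cc a1 a2 a3 d1 d2 d3"
  by (metis bv_cases cc_def surj_pair)

lemma theta_cc:
  "theta (cc a1 a2 a3 d1 d2 d3) (sm a b c d e f) 0 = th3 a b c d e f (bitc a1 / 2) (bitc a2 / 2) (bitc a3 / 2)
     (bitc d1 / 2) (bitc d2 / 2) (bitc d3 / 2)"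
  by (simp add: cc_def theta_th3)

lemma bit_cases01: obtains "(b::bit) = 0" | "b = 1"
  by (metis bit.exhaust)

section \<open>Transformation of the theta constants\<close>

lemma th3_shift_w2:
  "th3 a b c d e f s1 s2 s3 w1 (w2 + of_int n) w3 = exp (2 * of_real pi * \<i> * of_int n * s2) * th3 a b c d e f s1 s2 s3 w1 w2 w3"
  by (subst (1 2) th3_swap12) (rule th3_shift_w1)

lemma th3_shift_s2: "th3 a b c d e f s1 (s2 + of_int n) s3 w1 w2 w3 = th3 a b c d e f s1 s2 s3 w1 w2 w3"
  by (subst (1 2) th3_swap12) (rule th3_shift_s1)

lemma even_square_diff: "\<exists>j. (k::int)\<^sup>2 - k = 2 * j"
proof -
  have "even (k\<^sup>2 - k)" by simp
  then show ?thesis by (rule dvdE) (rule exI)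
qed

lemma th3_T11:
  assumes "s1 = of_int n / 2"
  shows "th3 (a + 1) b c d e f s1 s2 s3 w1 w2 w3 = exp (- (of_real pi * \<i> * s1 * (s1 + 1))) * th3 a b c d e f s1 s2 s3
      (w1 + s1 + 1 / 2) w2 w3"
proof -
  have "th3_term (a + 1) b c d e f s1 s2 s3 w1 w2 w3 p = exp (- (of_real pi * \<i> * s1 * (s1 + 1))) * th3_term a b c d e f
      s1 s2 s3 (w1 + s1 + 1 / 2) w2 w3 p" for p
  proof -
    obtain k l m where p: "p = (k, l, m)" by (cases p) auto
    obtain j where j: "k\<^sup>2 - k = 2 * j" using even_square_diff by blast
    have j': "(of_int k)\<^sup>2 - of_int k = (2 * of_int j :: complex)"
      using arg_cong[OF j, of "of_int :: int \<Rightarrow> complex"] by simp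
    have "of_real pi * \<i> * (qf (a + 1) b c d e f (of_int k + s1) (of_int l + s2) (of_int m + s3) +
       2 * ((of_int k + s1) * w1 + (of_int l + s2) * w2 + (of_int m + s3) * w3)) =
       - (of_real pi * \<i> * s1 * (s1 + 1)) + of_real pi * \<i> * (qf a b c d e f (of_int k + s1) (of_int l + s2) (of_int m + s3) +
       2 * ((of_int k + s1) * (w1 + s1 + 1 / 2) + (of_int l + s2) * w2 + (of_int m + s3) * w3)) + of_real pi * \<i> *
           ((of_int k)\<^sup>2 - of_int k)"
      by (simp add: qf_def power2_eq_square algebra_simps)
    also have "of_real pi * \<i> * ((of_int k)\<^sup>2 - of_int k) = 2 * of_real pi * \<i> * of_int j"
      unfolding j' by simp
    finally show ?thesis
      unfolding p th3_term_def prod.case by (simp only: exp_add exp_2pi_of_int mult_1_right)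
  qed
  then show ?thesis by (simp only: th3_def infsum_cmult_right')
qed

lemma th3_T12:
  assumes "2 * s1 = of_int n1" "2 * s2 = of_int n2"
  shows "th3 a (b + 1) c d e f s1 s2 s3 w1 w2 w3 = exp (- (2 * of_real pi * \<i> * s1 * s2)) * th3 a b c d e f s1 s2 s3 (w1
      + s2) (w2 + s1) w3"
proof -
  have "th3_term a (b + 1) c d e f s1 s2 s3 w1 w2 w3 p = exp (- (2 * of_real pi * \<i> * s1 * s2)) * th3_term a b c d e f
      s1 s2 s3 (w1 + s2) (w2 + s1) w3 p" for p
  proof -
    obtain k l m where p: "p = (k, l, m)" by (cases p) auto
    have "of_real pi * \<i> * (qf a (b + 1) c d e f (of_int k + s1) (of_int l + s2) (of_int m + s3) +
       2 * ((of_int k + s1) * w1 + (of_int l + s2) * w2 + (of_int m + s3) * w3)) =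
       - (2 * of_real pi * \<i> * s1 * s2) + of_real pi * \<i> * (qf a b c d e f (of_int k + s1) (of_int l + s2) (of_int m + s3) +
       2 * ((of_int k + s1) * (w1 + s2) + (of_int l + s2) * (w2 + s1) + (of_int m + s3) * w3)) + 2 * of_real pi * \<i> *
           of_int (k * l)"
      by (simp add: qf_def power2_eq_square algebra_simps)
    then show ?thesis
      unfolding p th3_term_def prod.case by (simp only: exp_add exp_2pi_of_int mult_1_right)
  qed
  then show ?thesis by (simp only: th3_def infsum_cmult_right')
qed

lemma exp_pi_i_values:
  "exp (of_real pi * \<i>) = -1" "exp (\<i> * of_real pi) = -1" "exp (of_real pi * \<i> / 2) = \<i>" "exp (\<i> * of_real pi / 2) = \<i>"
  "exp (- (of_real pi * \<i> / 2)) = - \<i>" "exp (- (\<i> * of_real pi / 2)) = - \<i>"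
proof -
  have 1: "exp (\<i> * of_real pi / 2) = \<i>"
    using cis_pi_half cis_conv_exp[of "pi / 2"] by simp
  show "exp (\<i> * of_real pi / 2) = \<i>" by (fact 1)
  show "exp (of_real pi * \<i> / 2) = \<i>" using 1 by (simp add: mult.commute)
  show "exp (- (\<i> * of_real pi / 2)) = - \<i>" using 1 by (simp add: exp_minus)
  show "exp (- (of_real pi * \<i> / 2)) = - \<i>" using 1 by (simp add: exp_minus mult.commute)
qed (simp_all add: mult.commute)

lemmas theta_shift_simps =
  th3_shift_w1[where ?w1.0 = 0 and n = 1, simplified] th3_shift_w2[where ?w2.0 = 0 and n = 1, simplified]
  th3_shift_s1[where ?s1.0 = 0 and n = 1, simplified] th3_shift_s2[where ?s2.0 = 0 and n = 1, simplified]

definition zeta8 :: complex where "zeta8 = exp (of_real pi * \<i> / 4)"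

lemma zeta8_power: "zeta8 ^ 4 = -1"
  by (simp add: zeta8_def flip: exp_of_nat_mult)

lemma theta_T11:
  "theta (cc a1 a2 a3 d1 d2 d3) (sm (a + 1) b c d e f) 0 =
     (if a1 = 1 then zeta8 else 1) * theta (cc a1 a2 a3 (d1 + a1 + 1) d2 d3) (sm a b c d e f) 0"
proof -
  have 0: "th3 (a + 1) b c d e f 0 s2 s3 w1 w2 w3 = th3 a b c d e f 0 s2 s3 (w1 + 1 / 2) w2 w3" for s2 s3 w1 w2 w3
    using th3_T11[of 0 0 a b c d e f s2 s3 w1 w2 w3] by simp
  have 1: "th3 (a + 1) b c d e f (1 / 2) s2 s3 w1 w2 w3 = zeta8 * th3 a b c d e f (1 / 2) s2 s3 w1 w2 w3" for s2 s3 w1 w2 w3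
  proof -
    have "exp (- (of_real pi * \<i> * (1 / 2) * (1 / 2 + 1))) * exp (2 * of_real pi * \<i> * of_int 1 * (1 / 2)) = zeta8"
      unfolding zeta8_def exp_add[symmetric] by (rule arg_cong[where f = exp]) simp
    moreover have "th3 (a + 1) b c d e f (1 / 2) s2 s3 w1 w2 w3 = exp (- (of_real pi * \<i> * (1 / 2) * (1 / 2 + 1))) *
       th3 a b c d e f (1 / 2) s2 s3 (w1 + of_int 1) w2 w3"
      using th3_T11[of "1 / 2" 1 a b c d e f s2 s3 w1 w2 w3] by (simp add: add.assoc)
    ultimately show ?thesis by (simp only: th3_shift_w1 mult.assoc[symmetric])
  qed
  show ?thesis
    by (cases a1 rule: bit_cases01; cases d1 rule: bit_cases01)
       (simp_all add: theta_cc 0 1 theta_shift_simps)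
qed

lemma theta_T12:
  "theta (cc a1 a2 a3 d1 d2 d3) (sm a (b + 1) c d e f) 0 =
     (if a1 = 1 \<and> a2 = 1 then (if d1 = d2 then - \<i> else \<i>) else 1) * theta (cc a1 a2 a3 (d1 + a2) (d2 + a1) d3) (sm a b
         c d e f) 0"
proof -
  have T: "th3 a (b + 1) c d e f (bitc a1 / 2) (bitc a2 / 2) s3 w1 w2 w3 =
    exp (- (2 * of_real pi * \<i> * (bitc a1 / 2) * (bitc a2 / 2))) * th3 a b c d e f (bitc a1 / 2) (bitc a2 / 2) s3 (w1 +
        bitc a2 / 2) (w2 + bitc a1 / 2) w3" for s3 w1 w2 w3
    by (rule th3_T12[of _ "if a1 = 1 then 1 else 0" _ "if a2 = 1 then 1 else 0"]) (simp_all add: bitc_def)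
  show ?thesis
    unfolding theta_cc T
    by (cases a1 rule: bit_cases01; cases d1 rule: bit_cases01; cases a2 rule: bit_cases01; cases d2 rule: bit_cases01)
       (simp_all add: theta_shift_simps exp_pi_i_values)
qed

lemma theta_shear:
  "theta (cc a1 a2 a3 d1 d2 d3) (sm (a + 2 * b + d) (b + d) (c + e) d e f) 0 =
     (if a1 = 1 \<and> d1 = 0 \<and> d2 = 1 then -1 else 1) * theta (cc a1 (a1 + a2) a3 (d1 + d2) d2 d3) (sm a b c d e f) 0"
proof -
  have m: "th3 a b c d e f s1 s2 s3 (- (1 / 2)) w2 w3 = exp (- (2 * of_real pi * \<i> * s1)) * th3 a b c d e f s1 s2 s3 (1
      / 2) w2 w3" for s1 s2 s3 w2 w3
    using th3_shift_w1[of a b c d e f s1 s2 s3 "1 / 2" "-1" w2 w3] by simp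
  show ?thesis
    unfolding theta_cc th3_shear
    by (cases a1 rule: bit_cases01; cases d1 rule: bit_cases01; cases a2 rule: bit_cases01; cases d2 rule: bit_cases01)
       (simp_all add: theta_shift_simps m exp_pi_i_values exp_minus)
qed

lemma theta_swap12:
  "theta (cc a1 a2 a3 d1 d2 d3) (sm d b e a c f) 0 = theta (cc a2 a1 a3 d2 d1 d3) (sm a b c d e f) 0"
  unfolding theta_cc by (rule th3_swap12)

lemma theta_swap23:
  "theta (cc a1 a2 a3 d1 d2 d3) (sm a c b f e d) 0 = theta (cc a1 a3 a2 d1 d3 d2) (sm a b c d e f) 0"
  unfolding theta_cc by (rule th3_swap23)

lemma theta_inv:
  assumes "siegel6 a b c d e f"
  shows "theta (cc a1 a2 a3 d1 d2 d3) (sm (- 1 / a) (b / a) (c / a) (d - b\<^sup>2 / a) (e - b * c / a) (f - c\<^sup>2 / a)) 0 =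
     gauss_c0 a * (if a1 = 1 \<and> d1 = 1 then - \<i> else 1) * theta (cc d1 a2 a3 a1 d2 d3) (sm a b c d e f) 0"
proof -
  have m: "th3 a b c d e f s1 s2 s3 (- (1 / 2)) w2 w3 = exp (- (2 * of_real pi * \<i> * s1)) * th3 a b c d e f s1 s2 s3 (1
      / 2) w2 w3" for s1 s2 s3 w2 w3
    using th3_shift_w1[of a b c d e f s1 s2 s3 "1 / 2" "-1" w2 w3] by simp
  show ?thesis
    unfolding theta_cc th3_inversion[OF assms]
    by (cases a1 rule: bit_cases01; cases d1 rule: bit_cases01)
       (simp_all add: m exp_pi_i_values exp_minus)
qed

section \<open>Transformation of the second order theta functions\<close>

lemma Theta2_th3:
  "Theta2 (sm a b c d e f) z (bv e1 e2 e3) = th3 (2 * a) (2 * b) (2 * c) (2 * d) (2 * e) (2 * f)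
     (bitc e1 / 2) (bitc e2 / 2) (bitc e3 / 2) (2 * z $ 1) (2 * z $ 2) (2 * z $ 3)"
proof -
  have "2 *\<^sub>R sm a b c d e f = sm (2 * a) (2 * b) (2 * c) (2 * d) (2 * e) (2 * f)"
    by (simp add: vec3_eq_iff scaleR_conv_of_real[where 'a = complex])
  then show ?thesis by (simp add: Theta2_def theta_th3 scaleR_conv_of_real[where 'a = complex])
qed

lemma Theta2_T11:
  "Theta2 (sm (a + 1) b c d e f) z (bv e1 e2 e3) = (if e1 = 1 then \<i> else 1) * Theta2 (sm a b c d e f) z (bv e1 e2 e3)"
proof -
  let ?s = "bitc e1 / 2"
  have T: "th3 (2 * (a + 1)) b c d e f ?s s2 s3 w1 w2 w3 = (if e1 = 1 then \<i> else 1) * th3 (2 * a) b c d e f ?s s2 s3 w1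
      w2 w3" for b c d e f s2 s3 w1 w2 w3
  proof -
    have 1: "th3 (2 * (a + 1)) b c d e f ?s s2 s3 w1 w2 w3 = exp (- (of_real pi * \<i> * ?s * (?s + 1))) * (exp (- (of_real
        pi * \<i> * ?s * (?s + 1)))
         * th3 (2 * a) b c d e f ?s s2 s3 (w1 + ?s + 1 / 2 + ?s + 1 / 2) w2 w3)"
    proof -
      have s: "?s = of_int (if e1 = 1 then 1 else 0) / 2" by (simp add: bitc_def)
      have e: "2 * (a + 1) = 2 * a + 1 + 1" by simp
      show ?thesis unfolding e th3_T11[OF s] ..
    qed
    have "w1 + ?s + 1 / 2 + ?s + 1 / 2 = w1 + of_int (if e1 = 1 then 2 else 1)"
      by (cases e1 rule: bit_cases01) simp_all
    then have 2: "th3 (2 * a) b c d e f ?s s2 s3 (w1 + ?s + 1 / 2 + ?s + 1 / 2) w2 w3 =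
      exp (2 * of_real pi * \<i> * of_int (if e1 = 1 then 2 else 1) * ?s) * th3 (2 * a) b c d e f ?s s2 s3 w1 w2 w3"
      by (simp only: th3_shift_w1)
    have 3: "exp (- (of_real pi * \<i> * ?s * (?s + 1))) * (exp (- (of_real pi * \<i> * ?s * (?s + 1))) * exp (2 * of_real pi
        * \<i> * of_int (if e1 = 1 then 2 else 1) * ?s)) = (if e1 = 1 then \<i> else 1)"
    proof (cases e1 rule: bit_cases01)
      case 2
      have "- (of_real pi * \<i> * (1 / 2) * (1 / 2 + 1)) + (- (of_real pi * \<i> * (1 / 2) * (1 / 2 + 1)) + 2 * of_real pi *
          \<i> * of_int 2 * (1 / 2)) = of_real pi * \<i> / 2"
        by (simp add: field_simps)
      then show ?thesis using 2 by (simp only: exp_add[symmetric] bitc_simps if_True simp_thms exp_pi_i_values)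
    qed simp
    show ?thesis unfolding 1 2 by (subst 3[symmetric]) (simp only: mult.assoc)
  qed
  show ?thesis unfolding Theta2_th3 T ..
qed

lemma Theta2_shear:
  "Theta2 (sm (a + 2 * b + d) (b + d) (c + e) d e f) (vector [z1 + z2, z2, z3]) (bv e1 e2 e3) =
     Theta2 (sm a b c d e f) (vector [z1, z2, z3]) (bv e1 (e1 + e2) e3)"
proof -
  have "th3 (2 * (a + 2 * b + d)) (2 * (b + d)) (2 * (c + e)) (2 * d) (2 * e) (2 * f) s1 s2 s3 (2 * (z1 + z2)) (2 * z2) (2 * z3) =
    th3 (2 * a) (2 * b) (2 * c) (2 * d) (2 * e) (2 * f) s1 (s1 + s2) s3 (2 * z1) (2 * z2) (2 * z3)" for s1 s2 s3
    using th3_shear[of "2 * a" "2 * b" "2 * d" "2 * c" "2 * e" "2 * f" s1 s2 s3 "2 * (z1 + z2)" "2 * z2" "2 * z3"]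
    by (simp add: algebra_simps)
  then show ?thesis
    unfolding Theta2_th3 
    by (cases e1 rule: bit_cases01; cases e2 rule: bit_cases01)
       (simp_all add: theta_shift_simps)
qed

lemma Theta2_swap12:
  "Theta2 (sm d b e a c f) (vector [z2, z1, z3]) (bv e1 e2 e3) = Theta2 (sm a b c d e f) (vector [z1, z2, z3]) (bv e2 e1 e3)"
  unfolding Theta2_th3 vector_3 by (rule th3_swap12)

lemma Theta2_swap23:
  "Theta2 (sm a c b f e d) (vector [z1, z3, z2]) (bv e1 e2 e3) = Theta2 (sm a b c d e f) (vector [z1, z2, z3]) (bv e1 e3 e2)"
  unfolding Theta2_th3 vector_3 by (rule th3_swap23)

lemma siegel6_scale_first:
  assumes "siegel6 a b c d e f"
  shows "siegel6 (a / 2) b c (2 * d) (2 * e) (2 * f)"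
  unfolding siegel6_def posdef_def
proof (intro allI impI)
  fix x y z :: real assume "(x, y, z) \<noteq> (0, 0, 0)"
  then have "0 < 2 * qf (Im a) (Im b) (Im c) (Im d) (Im e) (Im f) (x / 2) y z"
    using assms by (auto simp: siegel6_def posdef_def)
  then show "0 < qf (Im (a / 2)) (Im b) (Im c) (Im (2 * d)) (Im (2 * e)) (Im (2 * f)) x y z"
    by (simp add: qf_def power2_eq_square algebra_simps)
qed

lemma Theta2_inv:
  assumes S: "siegel6 a b c d e f"
  shows "Theta2 (sm (- 1 / a) (b / a) (c / a) (d - b\<^sup>2 / a) (e - b * c / a) (f - c\<^sup>2 / a))
      (vector [z1 / a, z2 - b * z1 / a, z3 - c * z1 / a]) (bv e1 e2 e3) =
    gauss_c0 (a / 2) * exp (2 * of_real pi * \<i> * (z1\<^sup>2 / a)) *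
      (Theta2 (sm a b c d e f) (vector [z1, z2, z3]) (bv 0 e2 e3) +
       (if e1 = 1 then -1 else 1) * Theta2 (sm a b c d e f) (vector [z1, z2, z3]) (bv 1 e2 e3))"
proof -
  have a: "a \<noteq> 0" using siegel6_Im_pos[OF S] by auto
  define s1 s2 s3 where "s1 = bitc e1 / 2" and "s2 = bitc e2 / 2" and "s3 = bitc e3 / 2"
  note S2 = siegel6_scale_first[OF S]
  have e0: "- 1 / (a / 2) = 2 * (- 1 / a)" "b / (a / 2) = 2 * (b / a)" "c / (a / 2) = 2 * (c / a)"
      "2 * d - b\<^sup>2 / (a / 2) = 2 * (d - b\<^sup>2 / a)" "2 * e - b * c / (a / 2) = 2 * (e - b * c / a)"
      "2 * f - c\<^sup>2 / (a / 2) = 2 * (f - c\<^sup>2 / a)"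
    using a by (simp_all add: field_simps)
  define g where "g = th3_term (a / 2) b c (2 * d) (2 * e) (2 * f) (2 * (z1 / a)) s2 s3 (- s1) (2 * (z2 - b * z1 / a))
      (2 * (z3 - c * z1 / a))"
  define h where "h \<sigma> = th3_term (2 * a) (2 * b) (2 * c) (2 * d) (2 * e) (2 * f) \<sigma> s2 s3 (2 * z1) (2 * z2) (2 * z3)" for \<sigma>
  have gs: "g summable_on UNIV" unfolding g_def by (rule th3_summable[OF S2])
  have S22: "siegel6 (2 * a) (2 * b) (2 * c) (2 * d) (2 * e) (2 * f)"
  proof -
    have "qf (Im (2 * a)) (Im (2 * b)) (Im (2 * c)) (Im (2 * d)) (Im (2 * e)) (Im (2 * f)) x y z =
       2 * qf (Im a) (Im b) (Im c) (Im d) (Im e) (Im f) x y z" for x y z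
      by (simp add: qf_def algebra_simps)
    then show ?thesis using S unfolding siegel6_def posdef_def by simp
  qed
  have hs: "h \<sigma> summable_on UNIV" for \<sigma> unfolding h_def by (rule th3_summable[OF S22])
  define E where "E = exp (2 * of_real pi * \<i> * (z1\<^sup>2 / a))"
  have pref: "exp (2 * of_real pi * \<i> * s1 * (2 * (z1 / a))) * g (2 * p + j, q) = E * exp (- (2 * of_real pi * \<i> *
      of_int j * s1)) * h (of_int j / 2) (p, q)" for p j q
  proof -
    obtain l m where q: "q = (l, m)" by (cases q)
    define u v where "u = of_int l + s2" and "v = of_int m + s3"
    define S where "S = 2 * s1"
    have s1: "s1 = S / 2" by (simp add: S_def)
    obtain n :: int where n: "S = of_int n"
      by (rule that[of "if e1 = 1 then 1 else 0"]) (simp add: S_def s1_def bitc_def)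
    have "2 * of_real pi * \<i> * s1 * (2 * (z1 / a)) + of_real pi * \<i> * (qf (a / 2) b c (2 * d) (2 * e) (2 * f) (of_int (2
        * p + j) + 2 * (z1 / a)) u v +
       2 * ((of_int (2 * p + j) + 2 * (z1 / a)) * (- s1) + u * (2 * (z2 - b * z1 / a)) + v * (2 * (z3 - c * z1 / a)))) =
       2 * of_real pi * \<i> * (z1\<^sup>2 / a) + - (2 * of_real pi * \<i> * of_int j * s1) +
       of_real pi * \<i> * (qf (2 * a) (2 * b) (2 * c) (2 * d) (2 * e) (2 * f) (of_int p + of_int j / 2) u v +
       2 * ((of_int p + of_int j / 2) * (2 * z1) + u * (2 * z2) + v * (2 * z3))) + - (2 * of_real pi * \<i> * (of_int p * S))"
      using a by (simp add: s1 qf_def field_simps power2_eq_square)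
    also have "of_int p * S = of_int (p * n)" by (simp add: n)
    finally show ?thesis
      unfolding q g_def h_def th3_term_def prod.case u_def[symmetric] v_def[symmetric] E_def
      by (simp only: exp_add[symmetric] of_int_mult[symmetric]) (simp only: exp_add exp_2pi_of_int mult_1_right)
  qed
  have eS: "exp (- (2 * of_real pi * \<i> * s1)) = (if e1 = 1 then -1 else 1)"
    by (cases e1 rule: bit_cases01) (simp_all add: s1_def exp_minus)
  have slice: "(\<lambda>k. g (k, q)) summable_on UNIV" for q
  proof -
    have "(\<lambda>(q, k). g (k, q)) summable_on UNIV \<times> UNIV"
    proof -
      have "bij_betw (\<lambda>(q, k). (k, q)) (UNIV :: ((int \<times> int) \<times> int) set) (UNIV :: (int \<times> int \<times> int) set)"
        by (rule bij_betwI[where g = "\<lambda>(k, q). (q, k)"]) auto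
      from summable_on_reindex_bij_betw[OF this, of g] gs show ?thesis by (simp add: case_prod_unfold)
    qed
    from summable_on_SigmaD1[OF this, of q] show ?thesis by simp
  qed
  have "th3 (2 * (- 1 / a)) (2 * (b / a)) (2 * (c / a)) (2 * (d - b\<^sup>2 / a)) (2 * (e - b * c / a)) (2 * (f - c\<^sup>2 / a)) s1 s2 s3
      (2 * (z1 / a)) (2 * (z2 - b * z1 / a)) (2 * (z3 - c * z1 / a)) =
     gauss_c0 (a / 2) * (exp (2 * of_real pi * \<i> * s1 * (2 * (z1 / a))) * (\<Sum>\<^sub>\<infinity>p. g p))"
    using th3_inversion[OF S2, of s1 s2 s3 "2 * (z1 / a)" "2 * (z2 - b * z1 / a)" "2 * (z3 - c * z1 / a)"]
    unfolding e0 by (simp only: th3_def[of "a / 2"] g_def mult.assoc)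
  also have "exp (2 * of_real pi * \<i> * s1 * (2 * (z1 / a))) * (\<Sum>\<^sub>\<infinity>p. g p) =
    (\<Sum>\<^sub>\<infinity>q. exp (2 * of_real pi * \<i> * s1 * (2 * (z1 / a))) * (\<Sum>\<^sub>\<infinity>k. g (k, q)))"
    by (simp only: infsum_first_inner[OF gs] infsum_cmult_right')
  also have "\<dots> = (\<Sum>\<^sub>\<infinity>q. E * (\<Sum>\<^sub>\<infinity>p. h 0 (p, q)) + E * (if e1 = 1 then -1 else 1) * (\<Sum>\<^sub>\<infinity>p. h (1 / 2) (p, q)))"
  proof (intro infsum_cong)
    fix q
    have "(\<Sum>\<^sub>\<infinity>k. g (k, q)) = (\<Sum>\<^sub>\<infinity>p. g (2 * p + 0, q)) + (\<Sum>\<^sub>\<infinity>p. g (2 * p + 1, q))"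
      using infsum_int_residues[of 2 "\<lambda>k. g (k, q)", OF _ slice] by (simp add: numeral_2_eq_2)
    then have "exp (2 * of_real pi * \<i> * s1 * (2 * (z1 / a))) * (\<Sum>\<^sub>\<infinity>k. g (k, q)) =
       (\<Sum>\<^sub>\<infinity>p. exp (2 * of_real pi * \<i> * s1 * (2 * (z1 / a))) * g (2 * p + 0, q)) +
       (\<Sum>\<^sub>\<infinity>p. exp (2 * of_real pi * \<i> * s1 * (2 * (z1 / a))) * g (2 * p + 1, q))"
      by (simp only: ring_distribs infsum_cmult_right')
    also have "\<dots> = E * (\<Sum>\<^sub>\<infinity>p. h 0 (p, q)) + E * (if e1 = 1 then -1 else 1) * (\<Sum>\<^sub>\<infinity>p. h (1 / 2) (p, q))"
      unfolding pref infsum_cmult_right' by (simp add: eS)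
    finally show "exp (2 * of_real pi * \<i> * s1 * (2 * (z1 / a))) * (\<Sum>\<^sub>\<infinity>k. g (k, q)) =
       E * (\<Sum>\<^sub>\<infinity>p. h 0 (p, q)) + E * (if e1 = 1 then -1 else 1) * (\<Sum>\<^sub>\<infinity>p. h (1 / 2) (p, q))" .
  qed
  also have "\<dots> = (\<Sum>\<^sub>\<infinity>q. E * (\<Sum>\<^sub>\<infinity>p. h 0 (p, q))) + (\<Sum>\<^sub>\<infinity>q. E * (if e1 = 1 then -1 else 1) * (\<Sum>\<^sub>\<infinity>p. h (1 / 2) (p, q)))"
  proof (rule infsum_add)
    have "(\<lambda>q. \<Sum>\<^sub>\<infinity>p. h \<sigma> (p, q)) summable_on UNIV" for \<sigma>
    proof -
      have bij: "bij_betw (\<lambda>(q, k). (k, q)) (UNIV :: ((int \<times> int) \<times> int) set) (UNIV :: (int \<times> int \<times> int) set)"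
        by (rule bij_betwI[where g = "\<lambda>(k, q). (q, k)"]) auto
      have "(\<lambda>x. h \<sigma> (case x of (q, k) \<Rightarrow> (k, q))) summable_on UNIV"
        using summable_on_reindex_bij_betw[OF bij, of "h \<sigma>"] hs[of \<sigma>] by simp
      then show ?thesis
        using summable_on_Sigma_banach[of "\<lambda>q k. h \<sigma> (k, q)" UNIV "\<lambda>_. UNIV"] by (simp add: case_prod_unfold)
    qed
    then show "(\<lambda>q. E * (\<Sum>\<^sub>\<infinity>p. h 0 (p, q))) summable_on UNIV"
      "(\<lambda>q. E * (if e1 = 1 then -1 else 1) * (\<Sum>\<^sub>\<infinity>p. h (1 / 2) (p, q))) summable_on UNIV"
      by (intro summable_on_cmult_right; simp)+
  qed
  also have "\<dots> = E * ((\<Sum>\<^sub>\<infinity>p. h 0 p) + (if e1 = 1 then -1 else 1) * (\<Sum>\<^sub>\<infinity>p. h (1 / 2) p))"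
    by (simp only: infsum_cmult_right' infsum_first_inner[OF hs] ring_distribs mult.assoc)
  finally show ?thesis
    unfolding Theta2_th3 vector_3 s1_def[symmetric] s2_def[symmetric] s3_def[symmetric]
    by (simp add: th3_def h_def E_def mult.assoc)
qed

section \<open>The quartic Riemann relation\<close>

lemma infsum_times:
  fixes f :: "'a \<Rightarrow> complex" and g :: "'b \<Rightarrow> complex"
  assumes "(\<lambda>x. norm (f x)) summable_on UNIV" "(\<lambda>y. norm (g y)) summable_on UNIV"
  shows "(\<lambda>(x, y). norm (f x * g y)) summable_on UNIV"
    and "infsum f UNIV * infsum g UNIV = (\<Sum>\<^sub>\<infinity>(x, y). f x * g y)"
proof -
  have "(\<lambda>(x, y). norm (f x) * norm (g y)) summable_on UNIV \<times> UNIV"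
    using assms by (intro summable_on_product_nonneg) auto
  then show 1: "(\<lambda>(x, y). norm (f x * g y)) summable_on UNIV"
    by (simp add: norm_mult)
  have s: "(\<lambda>(x, y). f x * g y) summable_on UNIV"
    by (rule Infinite_Sum.abs_summable_summable) (use 1 in \<open>simp add: case_prod_unfold\<close>)
  have "infsum f UNIV * infsum g UNIV = (\<Sum>\<^sub>\<infinity>x. \<Sum>\<^sub>\<infinity>y. f x * g y)"
    by (simp only: infsum_cmult_right' infsum_cmult_left')
  also have "\<dots> = (\<Sum>\<^sub>\<infinity>(x, y). f x * g y)"
    using infsum_Sigma_banach[of "\<lambda>(x, y). f x * g y" UNIV "\<lambda>_. UNIV"] s by simp
  finally show "infsum f UNIV * infsum g UNIV = (\<Sum>\<^sub>\<infinity>(x, y). f x * g y)" .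
qed

definition Ysum_term :: "complex \<Rightarrow> complex \<Rightarrow> complex \<Rightarrow> complex \<Rightarrow> complex \<Rightarrow> complex \<Rightarrow> int \<Rightarrow> int \<Rightarrow> int \<Rightarrow> int \<times> int \<times> int \<Rightarrow>
    complex" where
  "Ysum_term a b c d e f s1 s2 s3 = (\<lambda>(k, l, m). exp (of_real pi * \<i> *
     (2 * qf a b c d e f (of_int k + of_int s1 / 2) (of_int l + of_int s2 / 2) (of_int m + of_int s3 / 2) + of_int l)))"

definition Ysum :: "complex \<Rightarrow> complex \<Rightarrow> complex \<Rightarrow> complex \<Rightarrow> complex \<Rightarrow> complex \<Rightarrow> int \<Rightarrow> int \<Rightarrow> int \<Rightarrow> complex" where
  "Ysum a b c d e f s1 s2 s3 = (\<Sum>\<^sub>\<infinity>p. Ysum_term a b c d e f s1 s2 s3 p)"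

lemma siegel6_double: "siegel6 a b c d e f \<Longrightarrow> siegel6 (2 * a) (2 * b) (2 * c) (2 * d) (2 * e) (2 * f)"
proof -
  assume S: "siegel6 a b c d e f"
  have "qf (Im (2 * a)) (Im (2 * b)) (Im (2 * c)) (Im (2 * d)) (Im (2 * e)) (Im (2 * f)) x y z =
     2 * qf (Im a) (Im b) (Im c) (Im d) (Im e) (Im f) x y z" for x y z
    by (simp add: qf_def algebra_simps)
  then show ?thesis using S unfolding siegel6_def posdef_def by simp
qed

lemma Ysum_term_abs_summable:
  assumes "siegel6 a b c d e f"
  shows "(\<lambda>p. norm (Ysum_term a b c d e f s1 s2 s3 p)) summable_on UNIV"
proof -
  have "Ysum_term a b c d e f s1 s2 s3 p = exp (- (of_real pi * \<i> * of_int s2 / 2)) *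
    th3_term (2 * a) (2 * b) (2 * c) (2 * d) (2 * e) (2 * f) (of_int s1 / 2) (of_int s2 / 2) (of_int s3 / 2) 0 (1 / 2) 0 p" for p
  proof -
    obtain k l m where p: "p = (k, l, m)" by (rule prod_cases3)
    show ?thesis
      unfolding p th3_term_def Ysum_term_def prod.case exp_add[symmetric]
      by (rule arg_cong[where f = exp]) (simp add: qf_def power2_eq_square algebra_simps add_divide_distrib)
  qed
  then show ?thesis
    unfolding norm_mult
    by (simp only: norm_mult) (intro summable_on_cmult_right th3_abs_summable siegel6_double assms)
qed

lemma Ysum_shift2: "Ysum a b c d e f (s1 + 2) s2 s3 = Ysum a b c d e f s1 s2 s3"
  unfolding Ysum_def Ysum_term_def
  by (rule infsum_reindex_bij_witness[where i = "\<lambda>(k, l, m). (k - 1, l, m)" and j = "\<lambda>(k, l, m). (k + 1, l, m)"])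
     (auto simp: add_divide_distrib add_ac)

lemma Ysum_odd: "Ysum a b c d e f s1 1 s3 = 0"
proof -
  have "Ysum a b c d e f s1 1 s3 = - Ysum a b c d e f s1 1 s3"
    unfolding Ysum_def infsum_uminus[symmetric]
  proof (rule infsum_reindex_bij_witness[where i = "\<lambda>(k, l, m). (- k - s1, - l - 1, - m - s3)" and j = "\<lambda>(k, l, m). (- k
      - s1, - l - 1, - m - s3)"])
    fix p :: "int \<times> int \<times> int"
    obtain k l m where p: "p = (k, l, m)" by (rule prod_cases3)
    have q: "qf a b c d e f (- x) (- y) (- z) = qf a b c d e f x y z" for x y z
      by (simp add: qf_def)
    have e: "of_int (- k - s1) + of_int s1 / 2 = - (of_int k + of_int s1 / 2 :: complex)"
      "of_int (- l - 1) + of_int 1 / 2 = - (of_int l + of_int 1 / 2 :: complex)"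
      "of_int (- m - s3) + of_int s3 / 2 = - (of_int m + of_int s3 / 2 :: complex)"
      by (simp_all add: field_simps)
    have "of_real pi * \<i> * (2 * X + of_int l) = of_real pi * \<i> * (2 * X + of_int (- l - 1)) + 2 * of_real pi * \<i> *
        of_int l + of_real pi * \<i>" for X
      by (simp add: algebra_simps)
    then have "exp (of_real pi * \<i> * (2 * X + of_int l)) = - exp (of_real pi * \<i> * (2 * X + of_int (- l - 1)))" for X
      by (simp only: exp_add exp_2pi_of_int exp_pi_i_values) simp
    then show "- Ysum_term a b c d e f s1 1 s3 (case p of (k, l, m) \<Rightarrow> (- k - s1, - l - 1, - m - s3)) = Ysum_term a b c d
        e f s1 1 s3 p"
      unfolding p prod.case Ysum_term_def e q by simp
  qed auto
  then show ?thesis by simp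
qed

definition sumdiff :: "(int \<times> int \<times> int) \<times> (int \<times> int \<times> int) \<times> (int \<times> int \<times> int) \<Rightarrow> (int \<times> int \<times> int) \<times> (int \<times> int \<times> int)" where
  "sumdiff = (\<lambda>((x, y, z), (l1, l2, l3), (k1, k2, k3)). ((k1 + l1 + x, k2 + l2 + y, k3 + l3 + z), (l1 - k1, l2 - k2, l3 - k3)))"

lemma bij_sumdiff: "bij_betw sumdiff (({0, 1} \<times> {0, 1} \<times> {0, 1}) \<times> UNIV) UNIV"
proof (rule bij_betwI[where g = "\<lambda>((p1, p2, p3), (q1, q2, q3)).
    (((p1 - q1) mod 2, (p2 - q2) mod 2, (p3 - q3) mod 2),
     (q1 + (p1 - q1) div 2, q2 + (p2 - q2) div 2, q3 + (p3 - q3) div 2),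
     ((p1 - q1) div 2, (p2 - q2) div 2, (p3 - q3) div 2))"], goal_cases)
  case 1 then show ?case by simp
next
  case 2
  have m: "n mod 2 \<in> {0, 1}" for n :: int by (cases "even n") (simp_all add: odd_iff_mod_2_eq_one)
  show ?case
  proof (rule Pi_I, goal_cases)
    case (1 y)
    obtain p1 p2 p3 q1 q2 q3 where y: "y = ((p1, p2, p3), (q1, q2, q3))" by (metis surj_pair)
    show ?case
      unfolding y prod.case mem_Sigma_iff by (intro conjI m UNIV_I)
  qed
next
  case (3 x)
  have e: "(k + l + x - (l - k)) mod 2 = x \<and> (k + l + x - (l - k)) div 2 = k" if "x = 0 \<or> x = 1" for k l x :: int
    using that by auto
  obtain s1 s2 s3 l1 l2 l3 k1 k2 k3 where x: "x = ((s1, s2, s3), (l1, l2, l3), (k1, k2, k3))"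
    by (metis surj_pair)
  have s: "s1 = 0 \<or> s1 = 1" "s2 = 0 \<or> s2 = 1" "s3 = 0 \<or> s3 = 1" using 3 by (auto simp: x)
  show ?case
    unfolding x sumdiff_def prod.case
    by (simp only: e[OF s(1)] e[OF s(2)] e[OF s(3)] diff_add_cancel)
next
  case (4 y)
  obtain p1 p2 p3 q1 q2 q3 where y: "y = ((p1, p2, p3), (q1, q2, q3))" by (metis surj_pair)
  have n: "(p - q) div 2 + (q + (p - q) div 2) + (p - q) mod 2 = p" for p q :: int by presburger
  show ?case
    unfolding y sumdiff_def prod.case by (simp only: n add_diff_cancel_right')
qed

text \<open>The change of variables \<open>p = k + l + \<sigma>\<close>, \<open>q = l - k\<close> with \<open>\<sigma> \<equiv> p - q\<close> modulo 2
  separates the two sums because \<open>Q(p) + Q(q) = 2 Q((p + q) / 2) + 2 Q((p - q) / 2)\<close>.\<close>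

lemma theta_product:
  assumes S: "siegel6 a b c d e f"
  shows "th3 a b c d e f (of_int \<alpha> / 2) 0 0 (of_int \<beta> / 2) 0 (of_int \<eta> / 2) *
     th3 a b c d e f (of_int \<alpha> / 2) 0 0 (of_int \<beta> / 2) (1 / 2) (of_int \<eta> / 2) =
   (\<Sum>x\<in>{0, 1}. \<Sum>z\<in>{0, 1}. exp (of_real pi * \<i> * (of_int (\<beta> * (x + \<alpha>) + \<eta> * z))) *
      (Ysum a b c d e f (x + \<alpha>) 0 z * Ysum a b c d e f x 0 z))"
proof -
  let ?f = "th3_term a b c d e f (of_int \<alpha> / 2) 0 0 (of_int \<beta> / 2) 0 (of_int \<eta> / 2)"
  let ?g = "th3_term a b c d e f (of_int \<alpha> / 2) 0 0 (of_int \<beta> / 2) (1 / 2) (of_int \<eta> / 2)"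
  let ?Y = "Ysum_term a b c d e f"
  let ?h = "\<lambda>(p, q). ?f p * ?g q"
  note fg = th3_abs_summable[OF S]
  have hs: "?h summable_on UNIV"
    by (rule Infinite_Sum.abs_summable_summable)
       (use infsum_times(1)[OF fg fg, of "of_int \<alpha> / 2" 0 0 "of_int \<beta> / 2" 0 "of_int \<eta> / 2" "of_int \<alpha> / 2" 0 0 "of_int \<beta>
           / 2" "1 / 2" "of_int \<eta> / 2"]
         in \<open>simp add: case_prod_unfold\<close>)
  have hs': "(\<lambda>x. ?h (sumdiff x)) summable_on ({0, 1} \<times> {0, 1} \<times> {0, 1}) \<times> UNIV"
    using hs by (subst summable_on_reindex_bij_betw[OF bij_sumdiff])
  have hterm: "?h (sumdiff ((x, y, z), l, k)) = exp (of_real pi * \<i> * of_int (\<beta> * (x + \<alpha>) + \<eta> * z)) * (?Y (x + \<alpha>) y z l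
      * ?Y x y z k)" for x y z l k
  proof -
    obtain l1 l2 l3 where l: "l = (l1, l2, l3)" by (cases l) auto
    obtain k1 k2 k3 where k: "k = (k1, k2, k3)" by (cases k) auto
    have "of_real pi * \<i> * (qf a b c d e f (of_int (k1 + l1 + x) + of_int \<alpha> / 2) (of_int (k2 + l2 + y) + 0) (of_int (k3
        + l3 + z) + 0) +
        2 * ((of_int (k1 + l1 + x) + of_int \<alpha> / 2) * (of_int \<beta> / 2) + (of_int (k2 + l2 + y) + 0) * 0 + (of_int (k3 + l3
            + z) + 0) * (of_int \<eta> / 2))) +
      of_real pi * \<i> * (qf a b c d e f (of_int (l1 - k1) + of_int \<alpha> / 2) (of_int (l2 - k2) + 0) (of_int (l3 - k3) + 0) +
        2 * ((of_int (l1 - k1) + of_int \<alpha> / 2) * (of_int \<beta> / 2) + (of_int (l2 - k2) + 0) * (1 / 2) + (of_int (l3 - k3) +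
            0) * (of_int \<eta> / 2)))
      = of_real pi * \<i> * of_int (\<beta> * (x + \<alpha>) + \<eta> * z) +
       (of_real pi * \<i> * (2 * qf a b c d e f (of_int l1 + of_int (x + \<alpha>) / 2) (of_int l2 + of_int y / 2) (of_int l3 +
           of_int z / 2) + of_int l2) +
        of_real pi * \<i> * (2 * qf a b c d e f (of_int k1 + of_int x / 2) (of_int k2 + of_int y / 2) (of_int k3 + of_int z
            / 2) + of_int k2)) +
       2 * of_real pi * \<i> * of_int (\<beta> * l1 + \<eta> * l3 - k2)"
      by (simp add: qf_def power2_eq_square algebra_simps add_divide_distrib diff_divide_distrib)
    then show ?thesis
      unfolding l k sumdiff_def prod.case th3_term_def Ysum_term_def exp_add[symmetric]
      by (simp only: exp_add exp_2pi_of_int mult_1_right)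
  qed
  have inner: "(\<Sum>\<^sub>\<infinity>v. ?h (sumdiff ((x, y, z), v))) = exp (of_real pi * \<i> * of_int (\<beta> * (x + \<alpha>) + \<eta> * z)) *
      (Ysum a b c d e f (x + \<alpha>) y z * Ysum a b c d e f x y z)" for x y z
  proof -
    have "(\<Sum>\<^sub>\<infinity>v. ?h (sumdiff ((x, y, z), v))) = (\<Sum>\<^sub>\<infinity>v. exp (of_real pi * \<i> * of_int (\<beta> * (x + \<alpha>) + \<eta> * z)) * (case v of
        (l, k) \<Rightarrow> ?Y (x + \<alpha>) y z l * ?Y x y z k))"
    proof (intro infsum_cong)
      fix v :: "(int \<times> int \<times> int) \<times> (int \<times> int \<times> int)"
      show "?h (sumdiff ((x, y, z), v)) = exp (of_real pi * \<i> * of_int (\<beta> * (x + \<alpha>) + \<eta> * z)) * (case v of (l, k) \<Rightarrow> ?Y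
          (x + \<alpha>) y z l * ?Y x y z k)"
        using hterm[of x y z "fst v" "snd v"] by (simp only: prod.collapse case_prod_unfold)
    qed
    also have "\<dots> = exp (of_real pi * \<i> * of_int (\<beta> * (x + \<alpha>) + \<eta> * z)) * (\<Sum>\<^sub>\<infinity>(l, k). ?Y (x + \<alpha>) y z l * ?Y x y z k)"
      by (rule infsum_cmult_right')
    also have "(\<Sum>\<^sub>\<infinity>(l, k). ?Y (x + \<alpha>) y z l * ?Y x y z k) = Ysum a b c d e f (x + \<alpha>) y z * Ysum a b c d e f x y z"
      unfolding Ysum_def by (rule infsum_times(2)[OF Ysum_term_abs_summable Ysum_term_abs_summable, symmetric]) (rule S)+
    finally show ?thesis .
  qed
  have "infsum ?f UNIV * infsum ?g UNIV = (\<Sum>\<^sub>\<infinity>p. ?h p)"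
    by (rule infsum_times(2)[OF fg fg])
  also have "\<dots> = (\<Sum>\<^sub>\<infinity>x\<in>({0, 1} \<times> {0, 1} \<times> {0, 1}) \<times> UNIV. ?h (sumdiff x))"
    by (rule infsum_reindex_bij_betw[OF bij_sumdiff, symmetric])
  also have "\<dots> = (\<Sum>\<^sub>\<infinity>s\<in>{0, 1} \<times> {0, 1} \<times> {0, 1}. \<Sum>\<^sub>\<infinity>v. ?h (sumdiff (s, v)))"
    by (rule infsum_Sigma_banach[OF hs', symmetric])
  also have "\<dots> = (\<Sum>s\<in>{0, 1} \<times> {0, 1} \<times> {0, 1}. \<Sum>\<^sub>\<infinity>v. ?h (sumdiff (s, v)))"
    by (rule infsum_finite) simp
  also have "\<dots> = (\<Sum>x\<in>{0, 1}. \<Sum>y\<in>{0, 1}. \<Sum>z\<in>{0, 1}. \<Sum>\<^sub>\<infinity>v. ?h (sumdiff ((x, y, z), v)))"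
    by (simp only: sum.cartesian_product' case_prod_unfold)
  also have "\<dots> = (\<Sum>x\<in>{0, 1}. \<Sum>z\<in>{0, 1}. exp (of_real pi * \<i> * (of_int (\<beta> * (x + \<alpha>) + \<eta> * z))) *
      (Ysum a b c d e f (x + \<alpha>) 0 z * Ysum a b c d e f x 0 z))"
    unfolding inner by (simp add: Ysum_odd)
  finally show ?thesis by (simp only: th3_def)
qed

lemma riemann_relation:
  assumes S: "siegel6 a b c d e f"
  defines "\<theta> \<equiv> \<lambda>m. theta m (sm a b c d e f) 0"
  shows "\<theta> (cc 0 0 0 0 0 0) * \<theta> (cc 0 0 0 0 1 0) * (\<theta> (cc 0 0 0 0 0 1) * \<theta> (cc 0 0 0 0 1 1)) =
    \<theta> (cc 0 0 0 1 0 0) * \<theta> (cc 0 0 0 1 1 0) * (\<theta> (cc 0 0 0 1 0 1) * \<theta> (cc 0 0 0 1 1 1)) +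
    \<theta> (cc 1 0 0 0 0 0) * \<theta> (cc 1 0 0 0 1 0) * (\<theta> (cc 1 0 0 0 0 1) * \<theta> (cc 1 0 0 0 1 1))"
proof -
  let ?Y = "Ysum a b c d e f"
  have Y2: "?Y 2 0 z = ?Y 0 0 z" for z using Ysum_shift2[of a b c d e f 0 0 z] by simp
  note P = theta_product[OF S]
  show ?thesis
    unfolding \<theta>_def theta_cc
    using P[of 0 0 0] P[of 0 0 1] P[of 0 1 0] P[of 0 1 1] P[of 1 0 0] P[of 1 0 1]
    by (simp add: exp_pi_i_values Y2) (simp add: power2_eq_square algebra_simps exp_pi_i_values)
qed

section \<open>A point where no even theta constant vanishes\<close>

definition int_form :: "int \<Rightarrow> int \<Rightarrow> int \<Rightarrow> int" where
  "int_form x y z = 2 * (x + y)\<^sup>2 + 2 * (x + z)\<^sup>2 + (y + z)\<^sup>2 + x\<^sup>2 + y\<^sup>2 + z\<^sup>2"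

lemma int_form_qf: "of_int (int_form x y z) = qf 5 2 2 4 1 4 (of_int x) (of_int y) (of_int z :: 'a :: comm_ring_1)"
  by (simp add: int_form_def qf_def power2_eq_square algebra_simps)

definition minvec :: "bool \<Rightarrow> bool \<Rightarrow> bool \<Rightarrow> int \<times> int \<times> int" where
  "minvec a1 a2 a3 = (of_bool a1, (if a1 then -1 else 1) * of_bool a2, (if a1 \<or> a2 then -1 else 1) * of_bool a3)"

lemma minvec_unique_aux:
  "\<forall>x\<in>set [-2..2]. \<forall>y\<in>set [-2..2]. \<forall>z\<in>set [-2..2].
     (case minvec (odd x) (odd y) (odd z) of (x', y', z') \<Rightarrow>
        int_form x y z \<le> int_form x' y' z' \<longrightarrow> (x, y, z) = (x', y', z') \<or> (x, y, z) = (- x', - y', - z'))"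
  by code_simp

lemma int_form_minvec_le: "(case minvec a1 a2 a3 of (x', y', z') \<Rightarrow> int_form x' y' z') \<le> 7"
  by (cases a1; cases a2; cases a3) (simp_all add: minvec_def int_form_def)

lemma minvec_unique:
  assumes "minvec (odd x) (odd y) (odd z) = (x', y', z')" "int_form x y z \<le> int_form x' y' z'"
  shows "(x, y, z) = (x', y', z') \<or> (x, y, z) = (- x', - y', - z')"
proof -
  have le: "int_form x y z \<le> 7" using int_form_minvec_le[of "odd x" "odd y" "odd z"] assms by simp
  have bound: "v \<in> set [-2..2]" if "v\<^sup>2 \<le> 7" for v :: int
  proof -
    have "\<bar>v\<bar> < 3"
    proof (rule ccontr)
      assume "\<not> \<bar>v\<bar> < 3"
      then have "3 * 3 \<le> \<bar>v\<bar> * \<bar>v\<bar>" by (intro mult_mono) auto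
      then show False using that by (simp add: power2_eq_square)
    qed
    then show ?thesis by auto
  qed
  have nn: "0 \<le> (x + y)\<^sup>2" "0 \<le> (x + z)\<^sup>2" "0 \<le> (y + z)\<^sup>2" "0 \<le> x\<^sup>2" "0 \<le> y\<^sup>2" "0 \<le> z\<^sup>2" by auto
  have "x\<^sup>2 \<le> 7" "y\<^sup>2 \<le> 7" "z\<^sup>2 \<le> 7"
    using le nn unfolding int_form_def by linarith+
  from minvec_unique_aux[rule_format, OF this[THEN bound]] show ?thesis using assms by simp
qed

definition ray_point :: "real \<Rightarrow> complex^3^3" where
  "ray_point T = sm (\<i> * of_real (5 * T)) (\<i> * of_real (2 * T)) (\<i> * of_real (2 * T)) (\<i> * of_real (4 * T)) (\<i> * of_real
      T) (\<i> * of_real (4 * T))"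

lemma ray_point_siegel: "T > 0 \<Longrightarrow> ray_point T \<in> siegel"
proof -
  assume T: "T > 0"
  have "0 < qf (5 * T) (2 * T) (2 * T) (4 * T) T (4 * T) x y z" if "(x, y, z) \<noteq> (0, 0, 0)" for x y z
  proof -
    have "qf (5 * T) (2 * T) (2 * T) (4 * T) T (4 * T) x y z = T * ((2 * (x + y)\<^sup>2 + 2 * (x + z)\<^sup>2 + (y + z)\<^sup>2) + (x\<^sup>2 +
        y\<^sup>2 + z\<^sup>2))"
      by (simp add: qf_def power2_eq_square algebra_simps)
    moreover have "0 < x\<^sup>2 + y\<^sup>2 + z\<^sup>2"
      using that by (auto simp: add_nonneg_pos add_pos_nonneg)
    ultimately show ?thesis using T by (simp add: add_nonneg_pos)
  qed
  then show ?thesis by (simp add: ray_point_def siegel6_def posdef_def)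
qed

lemma theta_wpt_nonzero:
  fixes a1 a2 a3 :: bool and d1 d2 d3 :: int
  assumes ev: "even (of_bool a1 * d1 + of_bool a2 * d2 + of_bool a3 * d3)"
  defines "\<theta> T \<equiv> th3 (\<i> * of_real (5 * T)) (\<i> * of_real (2 * T)) (\<i> * of_real (2 * T)) (\<i> * of_real (4 * T)) (\<i> *
      of_real T) (\<i> * of_real (4 * T))
     (of_bool a1 / 2) (of_bool a2 / 2) (of_bool a3 / 2) (of_int d1 / 2) (of_int d2 / 2) (of_int d3 / 2)"
  shows "\<forall>\<^sub>F T in at_top. \<theta> T \<noteq> 0"
proof -
  obtain x' y' z' where mv: "minvec a1 a2 a3 = (x', y', z')" by (cases "minvec a1 a2 a3") auto
  have par: "odd x' = a1" "odd y' = a2" "odd z' = a3"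
    using mv by (auto simp: minvec_def split: if_splits)
  define N where "N = int_form x' y' z'"
  define v :: "int \<times> int \<times> int \<Rightarrow> int \<times> int \<times> int" where "v = (\<lambda>(k, l, m). (2 * k + of_bool a1, 2 * l + of_bool a2, 2 * m
      + of_bool a3))"
  define g where "g p = (case v p of (x, y, z) \<Rightarrow> int_form x y z)" for p
  define ph where "ph p = (case v p of (x, y, z) \<Rightarrow> exp (of_real pi * \<i> * of_int (x * d1 + y * d2 + z * d3) / 2))" for p
  define t where "t T = th3_term (\<i> * of_real (5 * T)) (\<i> * of_real (2 * T)) (\<i> * of_real (2 * T)) (\<i> * of_real (4 * T))
      (\<i> * of_real T) (\<i> * of_real (4 * T))
     (of_bool a1 / 2) (of_bool a2 / 2) (of_bool a3 / 2) (of_int d1 / 2) (of_int d2 / 2) (of_int d3 / 2)" for T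
  have t: "t T p = of_real (exp (- (pi * T * of_int (g p) / 4))) * ph p" for T p
  proof -
    obtain k l m where p: "p = (k, l, m)" by (rule prod_cases3)
    have h: "of_int k + of_bool a1 / 2 = (of_int (2 * k + of_bool a1) / 2 :: complex)" "of_int l + of_bool a2 / 2 =
        (of_int (2 * l + of_bool a2) / 2 :: complex)"
      "of_int m + of_bool a3 / 2 = (of_int (2 * m + of_bool a3) / 2 :: complex)"
      by (simp_all add: field_simps)
    show ?thesis
      unfolding p t_def th3_term_def g_def ph_def v_def prod.case h exp_of_real[symmetric] exp_add[symmetric]
      by (rule arg_cong[where f = exp], simp only: of_real_minus of_real_mult of_real_divide of_real_of_int_eq int_form_qf)
         (simp add: qf_def power2_eq_square field_simps)
  qed
  define M where "M = {p. g p \<le> N}"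
  have Mv: "v p = (x', y', z') \<or> v p = (- x', - y', - z')" if "p \<in> M" for p
  proof -
    obtain k l m where p: "p = (k, l, m)" by (rule prod_cases3)
    have "odd (2 * k + of_bool a1) = a1" "odd (2 * l + of_bool a2) = a2" "odd (2 * m + of_bool a3) = a3" by auto
    then have "minvec (odd (2 * k + of_bool a1)) (odd (2 * l + of_bool a2)) (odd (2 * m + of_bool a3)) = (x', y', z')"
      using mv by simp
    from minvec_unique[OF this] that show ?thesis
      by (auto simp: M_def g_def v_def N_def p)
  qed
  have injv: "inj v" by (auto simp: inj_def v_def)
  have "v ` M \<subseteq> {(x', y', z'), (- x', - y', - z')}" using Mv by blast
  then have finM: "finite M" using injv by (metis finite.emptyI finite.insertI finite_subset finite_imageD inj_on_subset
      subset_UNIV)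
  have evN: "even (x' * d1 + y' * d2 + z' * d3)"
    using ev par by (auto simp: even_add)
  define \<omega> where "\<omega> = exp (of_real pi * \<i> * of_int (x' * d1 + y' * d2 + z' * d3) / 2)"
  obtain r where r: "x' * d1 + y' * d2 + z' * d3 = 2 * r" using evN by blast
  have phM: "ph p = \<omega>" if "p \<in> M" for p
    using Mv[OF that]
  proof
    assume "v p = (x', y', z')" then show ?thesis by (simp add: ph_def \<omega>_def)
  next
    assume "v p = (- x', - y', - z')"
    moreover have "- x' * d1 + - y' * d2 + - z' * d3 = - (x' * d1 + y' * d2 + z' * d3)" by simp
    ultimately have "ph p = exp (of_real pi * \<i> * of_int (- (x' * d1 + y' * d2 + z' * d3)) / 2)"
      by (simp only: ph_def prod.case)
    also have "of_real pi * \<i> * of_int (- (x' * d1 + y' * d2 + z' * d3)) / 2 = of_real pi * \<i> * of_int (x' * d1 + y' *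
        d2 + z' * d3) / 2 + - (2 * of_real pi * \<i> * of_int r)"
      unfolding r by simp
    finally show ?thesis by (simp only: exp_add exp_2pi_of_int mult_1_right \<omega>_def)
  qed
  have gM: "g p = N" if "p \<in> M" for p
    using Mv[OF that] by (auto simp: g_def N_def int_form_def power2_eq_square algebra_simps)
  have M1: "card M \<ge> 1"
  proof -
    define p where "p = ((x' - of_bool a1) div 2, (y' - of_bool a2) div 2, (z' - of_bool a3) div 2)"
    have "v p = (x', y', z')" unfolding p_def v_def using par by auto
    then have "p \<in> M" by (simp add: M_def g_def N_def)
    then show ?thesis using finM by (metis One_nat_def Suc_leI card_gt_0_iff empty_iff)
  qed
  have S1: "siegel6 (\<i> * of_real (5 * T)) (\<i> * of_real (2 * T)) (\<i> * of_real (2 * T)) (\<i> * of_real (4 * T)) (\<i> * of_real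
      T) (\<i> * of_real (4 * T))" if "T > 0" for T
    using ray_point_siegel[OF that] by (simp only: ray_point_def sm_in_siegel)
  have nph: "norm (ph p) = 1" for p
    unfolding ph_def by (cases "v p") (simp add: norm_exp_eq_Re)
  have abss: "(\<lambda>p. exp (- (pi * T * of_int (g p) / 4))) summable_on UNIV" if "T > 0" for T
  proof -
    have "(\<lambda>p. norm (t T p)) summable_on UNIV" unfolding t_def by (rule th3_abs_summable[OF S1[OF that]])
    then show ?thesis by (simp add: t norm_mult nph)
  qed
  define K where "K = exp (pi * of_int N / 4) * (\<Sum>\<^sub>\<infinity>p. exp (- (pi * 1 * of_int (g p) / 4)))"
  have "((\<lambda>T. K * exp (- (pi * (T - 1) / 4))) \<longlongrightarrow> 0) at_top" by real_asymp
  then have "\<forall>\<^sub>F T in at_top. K * exp (- (pi * (T - 1) / 4)) < 1"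
    by (rule order_tendstoD) simp
  moreover have "\<forall>\<^sub>F T in at_top. T > (1::real)" by (rule eventually_gt_at_top)
  ultimately show ?thesis
  proof eventually_elim
    case (elim T)
    have T0: "T > 0" using elim by simp
    have ts: "t T summable_on A" for A
      unfolding t_def by (rule summable_on_subset_banach[OF th3_summable[OF S1[OF T0]] subset_UNIV])
    have "\<theta> T = (\<Sum>\<^sub>\<infinity>p. t T p)" by (simp only: \<theta>_def th3_def t_def)
    also have "\<dots> = (\<Sum>\<^sub>\<infinity>p\<in>M \<union> - M. t T p)" by simp
    also have "\<dots> = (\<Sum>\<^sub>\<infinity>p\<in>M. t T p) + (\<Sum>\<^sub>\<infinity>p\<in>-M. t T p)"
      by (rule infsum_Un_disjoint) (auto intro: ts)
    also have "(\<Sum>\<^sub>\<infinity>p\<in>M. t T p) = of_nat (card M) * (of_real (exp (- (pi * T * of_int N / 4))) * \<omega>)"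
      using finM by (simp add: t phM gM)
    finally have th: "\<theta> T = of_nat (card M) * (of_real (exp (- (pi * T * of_int N / 4))) * \<omega>) + (\<Sum>\<^sub>\<infinity>p\<in>-M. t T p)" .
    have "norm (\<Sum>\<^sub>\<infinity>p\<in>-M. t T p) \<le> (\<Sum>\<^sub>\<infinity>p\<in>-M. norm (t T p))"
      unfolding t_def by (rule norm_infsum_bound) (rule summable_on_subset_banach[OF th3_abs_summable[OF S1[OF T0]] subset_UNIV])
    also have "\<dots> = (\<Sum>\<^sub>\<infinity>p\<in>-M. exp (- (pi * T * of_int (g p) / 4)))" by (simp add: t norm_mult nph)
    also have "\<dots> \<le> (\<Sum>\<^sub>\<infinity>p\<in>-M. exp (- (pi * T * of_int N / 4)) * exp (- (pi * (T - 1) / 4)) * exp (pi * of_int N / 4) *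
        exp (- (pi * 1 * of_int (g p) / 4)))"
    proof (rule infsum_mono)
      show "(\<lambda>p. exp (- (pi * T * of_int (g p) / 4))) summable_on - M"
        using abss[OF T0] summable_on_subset_banach by blast
      have "(\<lambda>p. exp (- (pi * 1 * of_int (g p) / 4))) summable_on - M"
        using abss[of 1] summable_on_subset_banach[OF _ subset_UNIV] by auto
      then show "(\<lambda>p. exp (- (pi * T * of_int N / 4)) * exp (- (pi * (T - 1) / 4)) * exp (pi * of_int N / 4) * exp (-
          (pi * 1 * of_int (g p) / 4))) summable_on - M"
        by (rule summable_on_cmult_right)
      fix p assume "p \<in> - M"
      then have "N + 1 \<le> g p" by (simp add: M_def)
      then have "0 \<le> real_of_int (g p) - of_int N - 1"
        by (metis (no_types, opaque_lifting) diff_diff_eq diff_ge_0_iff_ge of_int_1 of_int_add of_int_le_iff)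
      then have "0 \<le> pi * (T - 1) / 4 * (real_of_int (g p) - of_int N - 1)" using elim by simp
      then have "- (pi * T * of_int (g p) / 4) \<le> - (pi * T * of_int N / 4) + - (pi * (T - 1) / 4) + pi * of_int N / 4 +
          - (pi * 1 * of_int (g p) / 4)"
        by (simp add: field_simps)
      then show "exp (- (pi * T * of_int (g p) / 4)) \<le> exp (- (pi * T * of_int N / 4)) * exp (- (pi * (T - 1) / 4)) *
          exp (pi * of_int N / 4) * exp (- (pi * 1 * of_int (g p) / 4))"
        by (simp only: exp_add[symmetric] exp_le_cancel_iff)
    qed
    also have "\<dots> = exp (- (pi * T * of_int N / 4)) * exp (- (pi * (T - 1) / 4)) * exp (pi * of_int N / 4) * (\<Sum>\<^sub>\<infinity>p\<in>-M.
        exp (- (pi * 1 * of_int (g p) / 4)))"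
      by (rule infsum_cmult_right')
    also have "\<dots> \<le> exp (- (pi * T * of_int N / 4)) * exp (- (pi * (T - 1) / 4)) * exp (pi * of_int N / 4) * (\<Sum>\<^sub>\<infinity>p. exp
        (- (pi * 1 * of_int (g p) / 4)))"
      by (intro mult_left_mono infsum_mono2 abss summable_on_subset_banach[OF abss subset_UNIV]) auto
    also have "\<dots> = exp (- (pi * T * of_int N / 4)) * (K * exp (- (pi * (T - 1) / 4)))"
      by (simp only: K_def mult_ac)
    also have "\<dots> < exp (- (pi * T * of_int N / 4)) * 1"
      using elim by (intro mult_strict_left_mono) auto
    also have "\<dots> \<le> norm (of_nat (card M) * (of_real (exp (- (pi * T * of_int N / 4))) * \<omega>))"
    proof -
      have "norm \<omega> = 1" by (simp add: \<omega>_def norm_exp_eq_Re)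
      then show ?thesis using M1 by (simp add: norm_mult)
    qed
    finally have lt: "norm (\<Sum>\<^sub>\<infinity>p\<in>-M. t T p) < norm (of_nat (card M) * (of_real (exp (- (pi * T * of_int N / 4))) * \<omega>))" .
    show "\<theta> T \<noteq> 0"
    proof
      assume "\<theta> T = 0"
      then have "(\<Sum>\<^sub>\<infinity>p\<in>-M. t T p) = - (of_nat (card M) * (of_real (exp (- (pi * T * of_int N / 4))) * \<omega>))"
        using th by (simp add: add_eq_0_iff)
      then show False using lt by simp
    qed
  qed
qed

lemma even_chars_cc: "cc a1 a2 a3 d1 d2 d3 \<in> even_chars \<longleftrightarrow> a1 * d1 + a2 * d2 + a3 * d3 = 0"
  by (simp add: even_chars_def cc_def)

lemma exists_nonvanishing:
  obtains \<tau> where "\<tau> \<in> siegel" "\<And>m. m \<in> even_chars \<Longrightarrow> theta m \<tau> 0 \<noteq> 0"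
proof -
  have "\<forall>\<^sub>F T in at_top. theta m (ray_point T) 0 \<noteq> 0" if m: "m \<in> even_chars" for m
  proof (cases m rule: cc_cases)
    case (1 a1 a2 a3 d1 d2 d3)
    have b: "bitc b = of_bool (b = 1)" "bitc b = of_int (of_bool (b = 1))" for b by (auto simp: bitc_def)
    have "even (of_bool (a1 = 1) * of_bool (d1 = 1) + of_bool (a2 = 1) * of_bool (d2 = 1) + of_bool (a3 = 1) * of_bool
        (d3 = 1) :: int)"
      using m unfolding 1 even_chars_cc
      by (cases a1 rule: bit_cases01; cases a2 rule: bit_cases01; cases a3 rule: bit_cases01;
          cases d1 rule: bit_cases01; cases d2 rule: bit_cases01; cases d3 rule: bit_cases01) simp_all
    from theta_wpt_nonzero[OF this] show ?thesis
      unfolding 1 ray_point_def theta_cc b(1)[of a1] b(1)[of a2] b(1)[of a3] b(2)[of d1] b(2)[of d2] b(2)[of d3] .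
  qed
  then have "\<forall>\<^sub>F T in at_top. \<forall>m\<in>even_chars. theta m (ray_point T) 0 \<noteq> 0"
    by (intro eventually_ball_finite) auto
  moreover have "\<forall>\<^sub>F T in at_top. T > (0::real)" by (rule eventually_gt_at_top)
  ultimately have "\<forall>\<^sub>F T in at_top. T > 0 \<and> (\<forall>m\<in>even_chars. theta m (ray_point T) 0 \<noteq> 0)"
    by eventually_elim auto
  then obtain T :: real where T: "T > 0" "\<forall>m\<in>even_chars. theta m (ray_point T) 0 \<noteq> 0"
    using eventually_happens'[OF trivial_limit_at_top_linorder] by blast
  show ?thesis by (rule that[OF ray_point_siegel[OF T(1)]]) (rule T(2)[rule_format])
qed

section \<open>Forms attached to Fano configurations\<close>

definition fanoL :: "bit^3 \<Rightarrow> characteristic set" where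
  "fanoL u = {m. (fst m = 0 \<or> fst m = u) \<and> cdot u (snd m) = 0}"

definition fanoK :: "bit^3 \<Rightarrow> characteristic set" where
  "fanoK v = {m. (snd m = 0 \<or> snd m = v) \<and> cdot v (fst m) = 0}"

text \<open>The signs are chosen such that the formula becomes symmetric under \<open>GL\<^sub>3(F\<^sub>2)\<close>; they absorb
  the minus signs of \<open>s\<^sub>1\<^sub>0\<close>.\<close>

definition SL :: "bit^3 \<Rightarrow> complex^3^3 \<Rightarrow> complex" where
  "SL u \<tau> = (if u = bv 1 1 1 then -1 else 1) * fano_form (fanoL u) \<tau>"

definition SK :: "bit^3 \<Rightarrow> complex^3^3 \<Rightarrow> complex" where
  "SK v \<tau> = fano_form (fanoK v) \<tau>"

lemma cc_fanoL [simp]: "cc a1 a2 a3 d1 d2 d3 \<in> fanoL (bv u1 u2 u3) \<longleftrightarrow>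
   (a1 = 0 \<and> a2 = 0 \<and> a3 = 0 \<or> a1 = u1 \<and> a2 = u2 \<and> a3 = u3) \<and> u1 * d1 + u2 * d2 + u3 * d3 = 0"
  by (simp add: fanoL_def cc_def)

lemma cc_fanoK [simp]: "cc a1 a2 a3 d1 d2 d3 \<in> fanoK (bv v1 v2 v3) \<longleftrightarrow>
   (d1 = 0 \<and> d2 = 0 \<and> d3 = 0 \<or> d1 = v1 \<and> d2 = v2 \<and> d3 = v3) \<and> v1 * a1 + v2 * a2 + v3 * a3 = 0"
  by (simp add: fanoK_def cc_def)

declare even_chars_cc [simp]

lemma card_chars: "card (A :: characteristic set) =
  (\<Sum>a1\<in>UNIV. \<Sum>a2\<in>UNIV. \<Sum>a3\<in>UNIV. \<Sum>d1\<in>UNIV. \<Sum>d2\<in>UNIV. \<Sum>d3\<in>UNIV. of_bool (cc a1 a2 a3 d1 d2 d3 \<in> A))"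
proof -
  have bij: "bij_betw (\<lambda>(a1, a2, a3, d1, d2, d3). cc a1 a2 a3 d1 d2 d3) UNIV UNIV"
    by (rule bij_betwI[where g = "\<lambda>m. (fst m $ 1, fst m $ 2, fst m $ 3, snd m $ 1, snd m $ 2, snd m $ 3)"])
       (auto simp: cc_def vec3_eq_iff)
  have "card A = (\<Sum>m\<in>UNIV. of_bool (m \<in> A))" by simp
  also have "\<dots> = (\<Sum>(a1, a2, a3, d1, d2, d3)\<in>UNIV \<times> UNIV \<times> UNIV \<times> UNIV \<times> UNIV \<times> UNIV. of_bool (cc a1 a2 a3 d1 d2 d3 \<in> A))"
    unfolding sum.reindex_bij_betw[OF bij, of "\<lambda>m. of_bool (m \<in> A)", symmetric]
    by (simp only: UNIV_Times_UNIV case_prod_unfold)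
  finally show ?thesis by (simp only: sum.cartesian_product' case_prod_unfold fst_conv snd_conv)
qed

lemma prod_if_const: "(\<Prod>m\<in>A. if P m then c else 1) = (c :: complex) ^ card (A \<inter> {m :: characteristic. P m})"
  by (simp add: prod.If_cases)

lemma characteristic_all: "(\<forall>m::characteristic. P m) \<longleftrightarrow>
   (\<forall>a1\<in>{0,1}. \<forall>a2\<in>{0,1}. \<forall>a3\<in>{0,1}. \<forall>d1\<in>{0,1}. \<forall>d2\<in>{0,1}. \<forall>d3\<in>{0,1}. P (cc a1 a2 a3 d1 d2 d3))"
  (is "?l = ?r")
proof
  assume r: ?r
  have b: "x \<in> {0, 1}" for x :: bit by (cases x rule: bit_cases01) auto
  show ?l
  proof
    fix m
    obtain a1 a2 a3 d1 d2 d3 where "m = cc a1 a2 a3 d1 d2 d3" by (rule cc_cases)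
    then show "P m" using r b by blast
  qed
qed blast

lemma characteristic_set_eq: "(A = B) \<longleftrightarrow>
   (\<forall>a1\<in>{0,1}. \<forall>a2\<in>{0,1}. \<forall>a3\<in>{0,1}. \<forall>d1\<in>{0,1}. \<forall>d2\<in>{0,1}. \<forall>d3\<in>{0,1}. cc a1 a2 a3 d1 d2 d3 \<in> A \<longleftrightarrow> cc a1 a2 a3 d1 d2 d3 \<in> B)"
  using characteristic_all[of "\<lambda>m. m \<in> A \<longleftrightarrow> m \<in> B"] by (simp only: set_eq_iff)

lemma characteristic_subset: "(A \<subseteq> B) \<longleftrightarrow>
   (\<forall>a1\<in>{0,1}. \<forall>a2\<in>{0,1}. \<forall>a3\<in>{0,1}. \<forall>d1\<in>{0,1}. \<forall>d2\<in>{0,1}. \<forall>d3\<in>{0,1}. cc a1 a2 a3 d1 d2 d3 \<in> A \<longrightarrow> cc a1 a2 a3 d1 d2 d3 \<in> B)"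
  using characteristic_all[of "\<lambda>m. m \<in> A \<longrightarrow> m \<in> B"] by (simp only: subset_iff)

text \<open>The translation generator acts on characteristics by affine maps, which carry Fano configurations
  to cosets of them; the forms are therefore treated for all sets of this size.\<close>

definition even_octad :: "characteristic set \<Rightarrow> bool" where
  "even_octad F \<longleftrightarrow> F \<subseteq> even_chars \<and> card F = 8"

lemma card_even_chars: "card even_chars = 36"
  by (simp add: card_chars UNIV_bit)

lemma fano_form_transform:
  assumes \<tau>: "\<tau> \<in> siegel" "\<tau>' \<in> siegel" and invol: "\<And>m. \<beta> (\<beta> m) = m"
    and ev: "\<And>m. m \<in> even_chars \<Longrightarrow> \<beta> m \<in> even_chars"
    and law: "\<And>m. theta m \<tau>' 0 = \<kappa> * \<phi> m * theta (\<beta> m) \<tau> 0"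
    and nz: "\<And>m. \<phi> m \<noteq> 0" and F: "even_octad F"
  shows "fano_form F \<tau>' = \<kappa> ^ 28 * ((\<Prod>m\<in>even_chars. \<phi> m) / (\<Prod>m\<in>F. \<phi> m)) * fano_form (\<beta> ` F) \<tau>"
proof -
  have fin: "finite even_chars" by simp
  have FE: "F \<subseteq> even_chars" "card F = 8" using F by (auto simp: even_octad_def)
  have inj: "inj \<beta>" by (rule inj_on_inverseI[where g = \<beta>]) (rule invol)
  have im: "\<beta> ` even_chars = even_chars"
    using ev invol by (metis image_subsetI subset_antisym image_eqI subsetI)
  have c: "card (even_chars - F) = 28"
    using FE card_even_chars by (simp add: card_Diff_subset)
  have "fano_form F \<tau>' = (\<Prod>m\<in>even_chars - F. \<kappa> * \<phi> m * theta (\<beta> m) \<tau> 0)"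
    using \<tau> by (simp add: fano_form_def law)
  also have "\<dots> = \<kappa> ^ 28 * (\<Prod>m\<in>even_chars - F. \<phi> m) * (\<Prod>m\<in>even_chars - F. theta (\<beta> m) \<tau> 0)"
    by (simp add: prod.distrib c)
  also have "(\<Prod>m\<in>even_chars - F. \<phi> m) = (\<Prod>m\<in>even_chars. \<phi> m) / (\<Prod>m\<in>F. \<phi> m)"
  proof -
    have "(\<Prod>m\<in>F. \<phi> m) \<noteq> 0" using nz by (simp add: prod_zero_iff)
    then show ?thesis using prod.subset_diff[OF FE(1) fin, of \<phi>] by (simp add: field_simps)
  qed
  also have "(\<Prod>m\<in>even_chars - F. theta (\<beta> m) \<tau> 0) = (\<Prod>m\<in>\<beta> ` (even_chars - F). theta m \<tau> 0)"
    by (subst prod.reindex) (auto intro: inj_on_subset[OF inj])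
  also have "\<beta> ` (even_chars - F) = even_chars - \<beta> ` F"
    using inj im by (simp add: image_set_diff)
  also have "(\<Prod>m\<in>even_chars - \<beta> ` F. theta m \<tau> 0) = fano_form (\<beta> ` F) \<tau>"
    using \<tau> by (simp add: fano_form_def)
  finally show ?thesis .
qed

lemma even_octad_image:
  assumes "\<And>m. \<beta> (\<beta> m) = m" "\<And>m. m \<in> even_chars \<Longrightarrow> \<beta> m \<in> even_chars" "even_octad F"
  shows "even_octad (\<beta> ` F)"
proof -
  have "inj_on \<beta> F" by (rule inj_on_inverseI[where g = \<beta>]) (rule assms(1))
  then show ?thesis using assms by (auto simp: even_octad_def card_image)
qed

lemma even_octad_fanoL: "even_octad (fanoL u)"
proof (cases u rule: bv_cases)
  case (1 u1 u2 u3)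
  show ?thesis
    unfolding even_octad_def card_chars characteristic_subset 1
    by (cases u1 rule: bit_cases01; cases u2 rule: bit_cases01; cases u3 rule: bit_cases01) (simp_all add: UNIV_bit)
qed

lemma even_octad_fanoK: "even_octad (fanoK u)"
proof (cases u rule: bv_cases)
  case (1 u1 u2 u3)
  show ?thesis
    unfolding even_octad_def card_chars characteristic_subset 1
    by (cases u1 rule: bit_cases01; cases u2 rule: bit_cases01; cases u3 rule: bit_cases01) (simp_all add: UNIV_bit)
qed

subsection \<open>Action of the generators on characteristics\<close>

definition actT11 :: "characteristic \<Rightarrow> characteristic" where
  "actT11 m = (fst m, snd m + bv (fst m $ 1 + 1) 0 0)"
definition actT12 :: "characteristic \<Rightarrow> characteristic" where
  "actT12 m = (fst m, snd m + bv (fst m $ 2) (fst m $ 1) 0)"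
definition actU :: "characteristic \<Rightarrow> characteristic" where
  "actU m = (bv (fst m $ 1) (fst m $ 1 + fst m $ 2) (fst m $ 3), bv (snd m $ 1 + snd m $ 2) (snd m $ 2) (snd m $ 3))"
definition actP12 :: "characteristic \<Rightarrow> characteristic" where
  "actP12 m = (bv (fst m $ 2) (fst m $ 1) (fst m $ 3), bv (snd m $ 2) (snd m $ 1) (snd m $ 3))"
definition actP23 :: "characteristic \<Rightarrow> characteristic" where
  "actP23 m = (bv (fst m $ 1) (fst m $ 3) (fst m $ 2), bv (snd m $ 1) (snd m $ 3) (snd m $ 2))"
definition actJ :: "characteristic \<Rightarrow> characteristic" where
  "actJ m = (bv (snd m $ 1) (fst m $ 2) (fst m $ 3), bv (fst m $ 1) (snd m $ 2) (snd m $ 3))"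

lemma act_cc [simp]:
  "actT11 (cc a1 a2 a3 d1 d2 d3) = cc a1 a2 a3 (d1 + a1 + 1) d2 d3"
  "actT12 (cc a1 a2 a3 d1 d2 d3) = cc a1 a2 a3 (d1 + a2) (d2 + a1) d3"
  "actU (cc a1 a2 a3 d1 d2 d3) = cc a1 (a1 + a2) a3 (d1 + d2) d2 d3"
  "actP12 (cc a1 a2 a3 d1 d2 d3) = cc a2 a1 a3 d2 d1 d3"
  "actP23 (cc a1 a2 a3 d1 d2 d3) = cc a1 a3 a2 d1 d3 d2"
  "actJ (cc a1 a2 a3 d1 d2 d3) = cc d1 a2 a3 a1 d2 d3"
  by (simp_all add: actT11_def actT12_def actU_def actP12_def actP23_def actJ_def cc_def add.assoc)

lemma act_invol [simp]:
  "actT11 (actT11 m) = m" "actT12 (actT12 m) = m" "actU (actU m) = m"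
  "actP12 (actP12 m) = m" "actP23 (actP23 m) = m" "actJ (actJ m) = m"
proof -
  obtain a1 a2 a3 d1 d2 d3 where m: "m = cc a1 a2 a3 d1 d2 d3" by (rule cc_cases)
  have b: "x + (x + y) = y" "x + y + x = y" "x + 1 + y + y + 1 = x" for x y :: bit
    by (cases x rule: bit_cases01; cases y rule: bit_cases01; simp)+
  have b2: "x + y + 1 + y + 1 = x" "x + y + y = x" for x y :: bit
    by (cases x rule: bit_cases01; cases y rule: bit_cases01; simp)+
  show "actT11 (actT11 m) = m" "actT12 (actT12 m) = m" "actU (actU m) = m"
    "actP12 (actP12 m) = m" "actP23 (actP23 m) = m" "actJ (actJ m) = m"
    by (simp_all only: m act_cc b b2)
qed

lemma act_even:
  assumes "m \<in> even_chars"
  shows "actT11 m \<in> even_chars" "actT12 m \<in> even_chars" "actU m \<in> even_chars"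
    "actP12 m \<in> even_chars" "actP23 m \<in> even_chars" "actJ m \<in> even_chars"
proof -
  have "\<forall>m. m \<in> even_chars \<longrightarrow> actT11 m \<in> even_chars \<and> actT12 m \<in> even_chars \<and> actU m \<in> even_chars
     \<and> actP12 m \<in> even_chars \<and> actP23 m \<in> even_chars \<and> actJ m \<in> even_chars"
    unfolding characteristic_all by simp
  then show "actT11 m \<in> even_chars" "actT12 m \<in> even_chars" "actU m \<in> even_chars"
    "actP12 m \<in> even_chars" "actP23 m \<in> even_chars" "actJ m \<in> even_chars" using assms by blast+
qed

lemma image_invol:
  assumes "\<And>m. \<beta> (\<beta> m) = m"
  shows "m \<in> \<beta> ` F \<longleftrightarrow> \<beta> m \<in> F"
  using assms by (metis image_eqI imageE)

lemmas cc_image [simp] =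
  image_invol[of actT11 "cc a1 a2 a3 d1 d2 d3" for a1 a2 a3 d1 d2 d3, OF act_invol(1)]
  image_invol[of actT12 "cc a1 a2 a3 d1 d2 d3" for a1 a2 a3 d1 d2 d3, OF act_invol(2)]
  image_invol[of actU "cc a1 a2 a3 d1 d2 d3" for a1 a2 a3 d1 d2 d3, OF act_invol(3)]
  image_invol[of actP12 "cc a1 a2 a3 d1 d2 d3" for a1 a2 a3 d1 d2 d3, OF act_invol(4)]
  image_invol[of actP23 "cc a1 a2 a3 d1 d2 d3" for a1 a2 a3 d1 d2 d3, OF act_invol(5)]
  image_invol[of actJ "cc a1 a2 a3 d1 d2 d3" for a1 a2 a3 d1 d2 d3, OF act_invol(6)]

lemma even_octad_act:
  assumes "even_octad F"
  shows "even_octad (actT11 ` F)" "even_octad (actT12 ` F)" "even_octad (actU ` F)" "even_octad (actP12 ` F)"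
      "even_octad (actP23 ` F)" "even_octad (actJ ` F)"
  using assms by (auto intro!: even_octad_image act_even)

lemma siegel6_T11: "siegel6 a b c d e f \<Longrightarrow> siegel6 (a + 1) b c d e f"
  by (simp add: siegel6_def)
lemma siegel6_T12: "siegel6 a b c d e f \<Longrightarrow> siegel6 a (b + 1) c d e f"
  by (simp add: siegel6_def)

lemma siegel6_swap12: "siegel6 a b c d e f \<Longrightarrow> siegel6 d b e a c f"
  unfolding siegel6_def posdef_def
proof (intro allI impI)
  fix x y z :: real
  assume *: "\<forall>x y z. (x, y, z) \<noteq> (0, 0, 0) \<longrightarrow> 0 < qf (Im a) (Im b) (Im c) (Im d) (Im e) (Im f) x y z" and "(x, y, z) \<noteq> (0, 0, 0)"
  then have "0 < qf (Im a) (Im b) (Im c) (Im d) (Im e) (Im f) y x z" by auto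
  then show "0 < qf (Im d) (Im b) (Im e) (Im a) (Im c) (Im f) x y z" by (simp add: qf_def algebra_simps)
qed

lemma siegel6_swap23: "siegel6 a b c d e f \<Longrightarrow> siegel6 a c b f e d"
  unfolding siegel6_def posdef_def
proof (intro allI impI)
  fix x y z :: real
  assume *: "\<forall>x y z. (x, y, z) \<noteq> (0, 0, 0) \<longrightarrow> 0 < qf (Im a) (Im b) (Im c) (Im d) (Im e) (Im f) x y z" and "(x, y, z) \<noteq> (0, 0, 0)"
  then have "0 < qf (Im a) (Im b) (Im c) (Im d) (Im e) (Im f) x z y" by auto
  then show "0 < qf (Im a) (Im c) (Im b) (Im f) (Im e) (Im d) x y z" by (simp add: qf_def algebra_simps)
qed

lemma siegel6_shear: "siegel6 a b c d e f \<Longrightarrow> siegel6 (a + 2 * b + d) (b + d) (c + e) d e f"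
  unfolding siegel6_def posdef_def
proof (intro allI impI)
  fix x y z :: real
  assume *: "\<forall>x y z. (x, y, z) \<noteq> (0, 0, 0) \<longrightarrow> 0 < qf (Im a) (Im b) (Im c) (Im d) (Im e) (Im f) x y z" and "(x, y, z) \<noteq> (0, 0, 0)"
  then have "0 < qf (Im a) (Im b) (Im c) (Im d) (Im e) (Im f) x (x + y) z" by auto
  then show "0 < qf (Im (a + 2 * b + d)) (Im (b + d)) (Im (c + e)) (Im d) (Im e) (Im f) x y z"
    by (simp add: qf_def power2_eq_square algebra_simps)
qed

lemma theta_law_all:
  assumes "\<And>a1 a2 a3 d1 d2 d3. theta (cc a1 a2 a3 d1 d2 d3) \<tau>' 0 = \<kappa> * \<phi> (cc a1 a2 a3 d1 d2 d3) * theta (\<beta> (cc a1 a2 a3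
      d1 d2 d3)) \<tau> 0"
  shows "theta m \<tau>' 0 = \<kappa> * \<phi> m * theta (\<beta> m) \<tau> 0"
  using assms by (metis cc_cases)

definition phU :: "characteristic \<Rightarrow> complex" where
  "phU m = (if fst m $ 1 = 1 \<and> snd m $ 1 = 0 \<and> snd m $ 2 = 1 then -1 else 1)"

definition phT11 :: "characteristic \<Rightarrow> complex" where
  "phT11 m = (if fst m $ 1 = 1 then zeta8 else 1)"

definition phT12 :: "characteristic \<Rightarrow> complex" where
  "phT12 m = (if fst m $ 1 = 1 \<and> fst m $ 2 = 1 then (if snd m $ 1 = snd m $ 2 then - \<i> else \<i>) else 1)"

definition phJ :: "characteristic \<Rightarrow> complex" where
  "phJ m = (if fst m $ 1 = 1 \<and> snd m $ 1 = 1 then - \<i> else 1)"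

lemma ph_cc [simp]:
  "phU (cc a1 a2 a3 d1 d2 d3) = (if a1 = 1 \<and> d1 = 0 \<and> d2 = 1 then -1 else 1)"
  "phT11 (cc a1 a2 a3 d1 d2 d3) = (if a1 = 1 then zeta8 else 1)"
  "phT12 (cc a1 a2 a3 d1 d2 d3) = (if a1 = 1 \<and> a2 = 1 then (if d1 = d2 then - \<i> else \<i>) else 1)"
  "phJ (cc a1 a2 a3 d1 d2 d3) = (if a1 = 1 \<and> d1 = 1 then - \<i> else 1)"
  by (simp_all add: phU_def phT11_def phT12_def phJ_def cc_def)

lemma prod_phU: "prod phU A = (-1) ^ card (A \<inter> {m. fst m $ 1 = 1 \<and> snd m $ 1 = 0 \<and> snd m $ 2 = 1})"
  unfolding phU_def prod_if_const ..

lemma prod_phT11: "prod phT11 A = zeta8 ^ card (A \<inter> {m. fst m $ 1 = 1})"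
  unfolding phT11_def prod_if_const ..

lemma prod_phJ: "prod phJ A = (- \<i>) ^ card (A \<inter> {m. fst m $ 1 = 1 \<and> snd m $ 1 = 1})"
  unfolding phJ_def prod_if_const ..

lemma prod_phT12: "prod phT12 A = (- \<i>) ^ card (A \<inter> {m. fst m $ 1 = 1 \<and> fst m $ 2 = 1 \<and> snd m $ 1 = snd m $ 2}) *
    \<i> ^ card (A \<inter> {m. fst m $ 1 = 1 \<and> fst m $ 2 = 1 \<and> snd m $ 1 \<noteq> snd m $ 2})"
proof -
  have "prod phT12 A = (\<Prod>m\<in>A. (if fst m $ 1 = 1 \<and> fst m $ 2 = 1 \<and> snd m $ 1 = snd m $ 2 then - \<i> else 1) *
     (if fst m $ 1 = 1 \<and> fst m $ 2 = 1 \<and> snd m $ 1 \<noteq> snd m $ 2 then \<i> else 1))"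
    by (rule prod.cong) (simp_all add: phT12_def)
  then show ?thesis by (simp only: prod.distrib prod_if_const)
qed

lemma cc_coord [simp]:
  "fst (cc a1 a2 a3 d1 d2 d3) $ 1 = a1" "fst (cc a1 a2 a3 d1 d2 d3) $ 2 = a2" "fst (cc a1 a2 a3 d1 d2 d3) $ 3 = a3"
  "snd (cc a1 a2 a3 d1 d2 d3) $ 1 = d1" "snd (cc a1 a2 a3 d1 d2 d3) $ 2 = d2" "snd (cc a1 a2 a3 d1 d2 d3) $ 3 = d3"
  by (simp_all add: cc_def)

lemma i_power_4 [simp]: "\<i> ^ 4 = 1" "(- \<i>) ^ 4 = 1"
  by (simp_all add: power4_eq_xxxx)

lemma zeta8_power_16 [simp]: "zeta8 ^ 16 = 1"
proof -
  have "zeta8 ^ 16 = (zeta8 ^ 4) ^ 4" by (simp flip: power_mult)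
  then show ?thesis by (simp add: zeta8_power)
qed

lemmas ph_simps = prod_phU prod_phT11 prod_phJ prod_phT12 card_chars UNIV_bit

lemma prod_even_chars_ph:
  "prod phU even_chars = 1" "prod phT11 even_chars = 1" "prod phT12 even_chars = 1" "prod phJ even_chars = -1"
proof -
  have "(- \<i>) ^ 6 = -1" "\<i> ^ 6 = -1" by (simp_all add: eval_nat_numeral)
  then show "prod phU even_chars = 1" "prod phT12 even_chars = 1" "prod phJ even_chars = -1"
    by (simp_all add: ph_simps)
  have "card (even_chars \<inter> {m. fst m $ 1 = 1}) = 16" by (simp add: card_chars UNIV_bit)
  then show "prod phT11 even_chars = 1" by (simp add: prod_phT11)
qed

context
  fixes a b c d e f :: complex
  assumes S: "siegel6 a b c d e f"
begin

lemma ff_P12: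
  assumes F: "even_octad F"
  shows "fano_form F (sm d b e a c f) = fano_form (actP12 ` F) (sm a b c d e f)"
proof -
  have law: "theta m (sm d b e a c f) 0 = 1 * (\<lambda>_. 1) m * theta (actP12 m) (sm a b c d e f) 0" for m
    by (rule theta_law_all) (simp add: theta_swap12)
  show ?thesis
    using fano_form_transform[OF _ _ act_invol(4) act_even(4) law _ F] S siegel6_swap12[OF S] by simp
qed

lemma ff_P23:
  assumes F: "even_octad F"
  shows "fano_form F (sm a c b f e d) = fano_form (actP23 ` F) (sm a b c d e f)"
proof -
  have law: "theta m (sm a c b f e d) 0 = 1 * (\<lambda>_. 1) m * theta (actP23 m) (sm a b c d e f) 0" for m
    by (rule theta_law_all) (simp add: theta_swap23)
  show ?thesis
    using fano_form_transform[OF _ _ act_invol(5) act_even(5) law _ F] S siegel6_swap23[OF S] by simp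
qed

lemma ff_U:
  assumes F: "even_octad F"
  shows "fano_form F (sm (a + 2 * b + d) (b + d) (c + e) d e f) = (1 / prod phU F) * fano_form (actU ` F) (sm a b c d e f)"
proof -
  have law: "theta m (sm (a + 2 * b + d) (b + d) (c + e) d e f) 0 = 1 * phU m * theta (actU m) (sm a b c d e f) 0" for m
    by (rule theta_law_all) (simp add: theta_shear)
  have "phU m \<noteq> 0" for m by (simp add: phU_def)
  from fano_form_transform[OF _ _ act_invol(3) act_even(3) law this F] show ?thesis
    using S siegel6_shear[OF S] by (simp add: prod_even_chars_ph)
qed

lemma ff_T11:
  assumes F: "even_octad F"
  shows "fano_form F (sm (a + 1) b c d e f) = (1 / prod phT11 F) * fano_form (actT11 ` F) (sm a b c d e f)"
proof -
  have law: "theta m (sm (a + 1) b c d e f) 0 = 1 * phT11 m * theta (actT11 m) (sm a b c d e f) 0" for m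
    by (rule theta_law_all) (simp add: theta_T11)
  have "phT11 m \<noteq> 0" for m by (simp add: phT11_def zeta8_def)
  from fano_form_transform[OF _ _ act_invol(1) act_even(1) law this F] show ?thesis
    using S siegel6_T11[OF S] by (simp add: prod_even_chars_ph)
qed

lemma ff_T12:
  assumes F: "even_octad F"
  shows "fano_form F (sm a (b + 1) c d e f) = (1 / prod phT12 F) * fano_form (actT12 ` F) (sm a b c d e f)"
proof -
  have law: "theta m (sm a (b + 1) c d e f) 0 = 1 * phT12 m * theta (actT12 m) (sm a b c d e f) 0" for m
    by (rule theta_law_all) (simp add: theta_T12)
  have "phT12 m \<noteq> 0" for m by (simp add: phT12_def)
  from fano_form_transform[OF _ _ act_invol(2) act_even(2) law this F] show ?thesis
    using S siegel6_T12[OF S] by (simp add: prod_even_chars_ph)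
qed

lemma ff_J:
  assumes F: "even_octad F"
  shows "fano_form F (sm (- 1 / a) (b / a) (c / a) (d - b\<^sup>2 / a) (e - b * c / a) (f - c\<^sup>2 / a)) =
    a ^ 14 * (1 / prod phJ F) * fano_form (actJ ` F) (sm a b c d e f)"
proof -
  have "gauss_c0 a ^ 28 = ((gauss_c0 a)\<^sup>2) ^ 14" by (simp flip: power_mult)
  also have "\<dots> = (- \<i> * a) ^ 14" by (simp only: gauss_c0_square[OF siegel6_Im_pos[OF S]])
  also have "\<dots> = - (a ^ 14)"
  proof -
    have "(- \<i>) ^ 14 = -1" by (simp add: eval_nat_numeral)
    then show ?thesis by (simp only: power_mult_distrib) simp
  qed
  finally have g: "gauss_c0 a ^ 28 = - (a ^ 14)" .
  have law: "theta m (sm (- 1 / a) (b / a) (c / a) (d - b\<^sup>2 / a) (e - b * c / a) (f - c\<^sup>2 / a)) 0 =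
      gauss_c0 a * phJ m * theta (actJ m) (sm a b c d e f) 0" for m
    by (rule theta_law_all, unfold ph_cc act_cc) (rule theta_inv[OF S])
  have "phJ m \<noteq> 0" for m by (simp add: phJ_def)
  from fano_form_transform[OF _ _ act_invol(6) act_even(6) law this F] show ?thesis
    using S siegel6_inversion[OF S] by (simp add: prod_even_chars_ph g)
qed

end

subsection \<open>Three-term relations\<close>

definition rel3 :: "characteristic set \<Rightarrow> characteristic set \<Rightarrow> characteristic set \<Rightarrow> complex \<Rightarrow> complex \<Rightarrow> complex \<Rightarrow> bool" where
  "rel3 X Y Z x y z \<longleftrightarrow> even_octad X \<and> even_octad Y \<and> even_octad Z \<and> (\<forall>\<tau>\<in>siegel. x * fano_form X \<tau> + y * fano_form Y \<tau> + z
      * fano_form Z \<tau> = 0)"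

lemma rel3_sm: "rel3 X Y Z x y z \<Longrightarrow> siegel6 a b c d e f \<Longrightarrow>
   x * fano_form X (sm a b c d e f) + y * fano_form Y (sm a b c d e f) + z * fano_form Z (sm a b c d e f) = 0"
  by (simp add: rel3_def)

lemma rel3_P12: "rel3 X Y Z x y z \<Longrightarrow> rel3 (actP12 ` X) (actP12 ` Y) (actP12 ` Z) x y z"
  unfolding rel3_def
proof (intro conjI ballI even_octad_act; (elim conjE)?; assumption?)
  fix \<tau> assume r: "even_octad X" "even_octad Y" "even_octad Z" "\<forall>\<tau>\<in>siegel. x * fano_form X \<tau> + y * fano_form Y \<tau> + z *
      fano_form Z \<tau> = 0" and t: "\<tau> \<in> siegel"
  from t obtain a b c d e f where \<tau>: "\<tau> = sm a b c d e f" "siegel6 a b c d e f" by (rule siegel_cases)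
  show "x * fano_form (actP12 ` X) \<tau> + y * fano_form (actP12 ` Y) \<tau> + z * fano_form (actP12 ` Z) \<tau> = 0"
    using r(4)[rule_format, of "sm d b e a c f"] siegel6_swap12[OF \<tau>(2)] r(1-3) by (simp add: \<tau> ff_P12[OF \<tau>(2)])
qed

lemma rel3_P23: "rel3 X Y Z x y z \<Longrightarrow> rel3 (actP23 ` X) (actP23 ` Y) (actP23 ` Z) x y z"
  unfolding rel3_def
proof (intro conjI ballI even_octad_act; (elim conjE)?; assumption?)
  fix \<tau> assume r: "even_octad X" "even_octad Y" "even_octad Z" "\<forall>\<tau>\<in>siegel. x * fano_form X \<tau> + y * fano_form Y \<tau> + z *
      fano_form Z \<tau> = 0" and t: "\<tau> \<in> siegel"
  from t obtain a b c d e f where \<tau>: "\<tau> = sm a b c d e f" "siegel6 a b c d e f" by (rule siegel_cases)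
  show "x * fano_form (actP23 ` X) \<tau> + y * fano_form (actP23 ` Y) \<tau> + z * fano_form (actP23 ` Z) \<tau> = 0"
    using r(4)[rule_format, of "sm a c b f e d"] siegel6_swap23[OF \<tau>(2)] r(1-3) by (simp add: \<tau> ff_P23[OF \<tau>(2)])
qed

lemma rel3_J: "rel3 X Y Z x y z \<Longrightarrow> rel3 (actJ ` X) (actJ ` Y) (actJ ` Z) (x / prod phJ X) (y / prod phJ Y) (z / prod phJ Z)"
  unfolding rel3_def
proof (intro conjI ballI even_octad_act; (elim conjE)?; assumption?)
  fix \<tau> assume r: "even_octad X" "even_octad Y" "even_octad Z" "\<forall>\<tau>\<in>siegel. x * fano_form X \<tau> + y * fano_form Y \<tau> + z *
      fano_form Z \<tau> = 0" and t: "\<tau> \<in> siegel"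
  from t obtain a b c d e f where \<tau>: "\<tau> = sm a b c d e f" "siegel6 a b c d e f" by (rule siegel_cases)
  have a: "a \<noteq> 0" using siegel6_Im_pos[OF \<tau>(2)] by auto
  have "a ^ 14 * (x / prod phJ X * fano_form (actJ ` X) \<tau> + y / prod phJ Y * fano_form (actJ ` Y) \<tau> + z / prod phJ Z *
      fano_form (actJ ` Z) \<tau>) = 0"
    using r(4)[rule_format, OF sm_in_siegel[THEN iffD2, OF siegel6_inversion[OF \<tau>(2)]]]
    unfolding ff_J[OF \<tau>(2) r(1)] ff_J[OF \<tau>(2) r(2)] ff_J[OF \<tau>(2) r(3)] \<tau>(1)
    by (simp add: algebra_simps)
  then show "x / prod phJ X * fano_form (actJ ` X) \<tau> + y / prod phJ Y * fano_form (actJ ` Y) \<tau> + z / prod phJ Z *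
      fano_form (actJ ` Z) \<tau> = 0"
    using a by simp
qed

lemma rel3_base: "rel3 (actT11 ` fanoL (bv 1 0 0)) (fanoL (bv 1 0 0)) (fanoL (bv 0 0 0)) 1 (-1) (-1)"
  unfolding rel3_def
proof (intro conjI ballI even_octad_act even_octad_fanoL)
  fix \<tau> assume "\<tau> \<in> siegel"
  then obtain a b c d e f where \<tau>: "\<tau> = sm a b c d e f" "siegel6 a b c d e f" by (rule siegel_cases)
  define A where "A = {cc 0 0 0 0 0 0, cc 0 0 0 0 1 0, cc 0 0 0 0 0 1, cc 0 0 0 0 1 1}"
  define B where "B = {cc 0 0 0 1 0 0, cc 0 0 0 1 1 0, cc 0 0 0 1 0 1, cc 0 0 0 1 1 1}"
  define C where "C = {cc 1 0 0 0 0 0, cc 1 0 0 0 1 0, cc 1 0 0 0 0 1, cc 1 0 0 0 1 1}"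
  define R where "R = even_chars - (A \<union> B \<union> C)"
  let ?th = "\<lambda>m. theta m \<tau> 0"
  have dis: "A \<inter> B = {}" "A \<inter> C = {}" "B \<inter> C = {}" by (simp_all add: A_def B_def C_def)
  have sub: "A \<union> B \<union> C \<subseteq> even_chars" by (simp add: A_def B_def C_def)
  have X: "actT11 ` fanoL (bv 1 0 0) = B \<union> C" "fanoL (bv 1 0 0) = A \<union> C" "fanoL (bv 0 0 0) = A \<union> B"
    unfolding characteristic_set_eq by (simp_all add: A_def B_def C_def)
  have ff: "fano_form (B \<union> C) \<tau> = prod ?th A * prod ?th R" "fano_form (A \<union> C) \<tau> = prod ?th B * prod ?th R"
    "fano_form (A \<union> B) \<tau> = prod ?th C * prod ?th R"
  proof -
    have "even_chars - (B \<union> C) = A \<union> R" "even_chars - (A \<union> C) = B \<union> R" "even_chars - (A \<union> B) = C \<union> R"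
      using dis sub by (auto simp: R_def)
    moreover have "A \<inter> R = {}" "B \<inter> R = {}" "C \<inter> R = {}" by (auto simp: R_def)
    ultimately show "fano_form (B \<union> C) \<tau> = prod ?th A * prod ?th R" "fano_form (A \<union> C) \<tau> = prod ?th B * prod ?th R"
      "fano_form (A \<union> B) \<tau> = prod ?th C * prod ?th R"
      using \<open>\<tau> \<in> siegel\<close> by (simp_all add: fano_form_def prod.union_disjoint)
  qed
  have "prod ?th A = prod ?th B + prod ?th C"
    using riemann_relation[OF \<tau>(2)] by (simp add: A_def B_def C_def \<tau>(1) mult.assoc)
  then show "1 * fano_form (actT11 ` fanoL (bv 1 0 0)) \<tau> + - 1 * fano_form (fanoL (bv 1 0 0)) \<tau> + - 1 * fano_form (fanoL
      (bv 0 0 0)) \<tau> = 0"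
    unfolding X(1) unfolding X(2,3) ff by (simp add: algebra_simps)
qed

lemma rel3_cong: "rel3 X Y Z x y z \<Longrightarrow> X = X' \<Longrightarrow> Y = Y' \<Longrightarrow> Z = Z' \<Longrightarrow> x = x' \<Longrightarrow> y = y' \<Longrightarrow> z = z' \<Longrightarrow> rel3 X' Y' Z' x' y' z'"
  by simp

lemma rel3_second: "rel3 (actT11 ` fanoK (bv 0 1 0)) (fanoK (bv 0 1 0)) (fanoL (bv 0 0 1)) 1 (-1) (-1)"
proof -
  note r = rel3_P12[OF rel3_P23[OF rel3_P12[OF rel3_J[OF rel3_P12[OF rel3_P23[OF rel3_P12[OF rel3_base]]]]]]]
  show ?thesis
    by (rule rel3_cong[OF r]; (unfold characteristic_set_eq)?; simp add: ph_simps)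
qed

lemma rel3_third: "rel3 (actT11 ` fanoK (bv 0 0 0)) (fanoK (bv 0 0 0)) (fanoK (bv 1 0 0)) 1 (-1) (-1)"
proof -
  note r = rel3_P12[OF rel3_J[OF rel3_P12[OF rel3_second]]]
  show ?thesis
    by (rule rel3_cong[OF r]; (unfold characteristic_set_eq)?; simp add: ph_simps)
qed

section \<open>Transformation of the fifteen forms\<close>

lemma SL_bv: "SL (bv u1 u2 u3) \<tau> = (if u1 = 1 \<and> u2 = 1 \<and> u3 = 1 then -1 else 1) * fano_form (fanoL (bv u1 u2 u3)) \<tau>"
  by (simp add: SL_def)

abbreviation "invm a b c d e f \<equiv> sm (- 1 / a) (b / a) (c / a) (d - b\<^sup>2 / a) (e - b * c / a) (f - c\<^sup>2 / a)"

context
  fixes a b c d e f :: complex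
  assumes S: "siegel6 a b c d e f"
begin

lemma S_P12:
  "SL (bv u1 u2 u3) (sm d b e a c f) = SL (bv u2 u1 u3) (sm a b c d e f)"
  "SK (bv u1 u2 u3) (sm d b e a c f) = SK (bv u2 u1 u3) (sm a b c d e f)"
proof -
  have "actP12 ` fanoL (bv u1 u2 u3) = fanoL (bv u2 u1 u3)" "actP12 ` fanoK (bv u1 u2 u3) = fanoK (bv u2 u1 u3)"
    unfolding characteristic_set_eq
    by (cases u1 rule: bit_cases01; cases u2 rule: bit_cases01; cases u3 rule: bit_cases01; simp)+
  then show "SL (bv u1 u2 u3) (sm d b e a c f) = SL (bv u2 u1 u3) (sm a b c d e f)"
    "SK (bv u1 u2 u3) (sm d b e a c f) = SK (bv u2 u1 u3) (sm a b c d e f)"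
    by (auto simp: SL_bv SK_def ff_P12[OF S] even_octad_fanoL even_octad_fanoK)
qed

lemma S_P23:
  "SL (bv u1 u2 u3) (sm a c b f e d) = SL (bv u1 u3 u2) (sm a b c d e f)"
  "SK (bv u1 u2 u3) (sm a c b f e d) = SK (bv u1 u3 u2) (sm a b c d e f)"
proof -
  have "actP23 ` fanoL (bv u1 u2 u3) = fanoL (bv u1 u3 u2)" "actP23 ` fanoK (bv u1 u2 u3) = fanoK (bv u1 u3 u2)"
    unfolding characteristic_set_eq
    by (cases u1 rule: bit_cases01; cases u2 rule: bit_cases01; cases u3 rule: bit_cases01; simp)+
  then show "SL (bv u1 u2 u3) (sm a c b f e d) = SL (bv u1 u3 u2) (sm a b c d e f)"
    "SK (bv u1 u2 u3) (sm a c b f e d) = SK (bv u1 u3 u2) (sm a b c d e f)"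
    by (auto simp: SL_bv SK_def ff_P23[OF S] even_octad_fanoL even_octad_fanoK)
qed

lemma S_U:
  "SL (bv u1 u2 u3) (sm (a + 2 * b + d) (b + d) (c + e) d e f) = SL (bv u1 (u1 + u2) u3) (sm a b c d e f)"
  "SK (bv u1 u2 u3) (sm (a + 2 * b + d) (b + d) (c + e) d e f) = SK (bv (u1 + u2) u2 u3) (sm a b c d e f)"
proof -
  have "actU ` fanoL (bv u1 u2 u3) = fanoL (bv u1 (u1 + u2) u3)" "actU ` fanoK (bv u1 u2 u3) = fanoK (bv (u1 + u2) u2 u3)"
    unfolding characteristic_set_eq
    by (cases u1 rule: bit_cases01; cases u2 rule: bit_cases01; cases u3 rule: bit_cases01; simp)+
  moreover have "prod phU (fanoL (bv u1 u2 u3)) = (if u1 = 1 \<and> u3 = 1 then -1 else 1)" "prod phU (fanoK (bv u1 u2 u3)) = 1"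
    by (cases u1 rule: bit_cases01; cases u2 rule: bit_cases01; cases u3 rule: bit_cases01; simp add: ph_simps)+
  ultimately show "SL (bv u1 u2 u3) (sm (a + 2 * b + d) (b + d) (c + e) d e f) = SL (bv u1 (u1 + u2) u3) (sm a b c d e f)"
    "SK (bv u1 u2 u3) (sm (a + 2 * b + d) (b + d) (c + e) d e f) = SK (bv (u1 + u2) u2 u3) (sm a b c d e f)"
    by (cases u1 rule: bit_cases01; cases u2 rule: bit_cases01; cases u3 rule: bit_cases01;
        simp add: SL_bv SK_def ff_U[OF S] even_octad_fanoL even_octad_fanoK)+
qed

lemma S_T11_fixed:
  "SL (bv 0 u2 u3) (sm (a + 1) b c d e f) = SL (bv 0 u2 u3) (sm a b c d e f)"
  "SK (bv 1 0 0) (sm (a + 1) b c d e f) = SK (bv 1 0 0) (sm a b c d e f)"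
proof -
  have "actT11 ` fanoL (bv 0 u2 u3) = fanoL (bv 0 u2 u3)" "actT11 ` fanoK (bv 1 0 0) = fanoK (bv 1 0 0)"
    unfolding characteristic_set_eq
    by (cases u2 rule: bit_cases01; cases u3 rule: bit_cases01; simp)+
  moreover have "prod phT11 (fanoL (bv 0 u2 u3)) = 1" "prod phT11 (fanoK (bv 1 0 0)) = 1"
    by (cases u2 rule: bit_cases01; cases u3 rule: bit_cases01; simp add: ph_simps)+
  ultimately show "SL (bv 0 u2 u3) (sm (a + 1) b c d e f) = SL (bv 0 u2 u3) (sm a b c d e f)"
    "SK (bv 1 0 0) (sm (a + 1) b c d e f) = SK (bv 1 0 0) (sm a b c d e f)"
    by (simp_all add: SL_bv SK_def ff_T11[OF S] even_octad_fanoL even_octad_fanoK)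
qed

lemma phT11_four:
  "prod phT11 (fanoL (bv 1 0 0)) = -1" "prod phT11 (fanoK (bv 0 1 0)) = -1" "prod phT11 (fanoK (bv 0 0 0)) = -1"
proof -
  have "card (fanoL (bv 1 0 0) \<inter> {m. fst m $ 1 = 1}) = 4" "card (fanoK (bv 0 1 0) \<inter> {m. fst m $ 1 = 1}) = 4"
    "card (fanoK (bv 0 0 0) \<inter> {m. fst m $ 1 = 1}) = 4"
    by (simp_all add: card_chars UNIV_bit)
  then show "prod phT11 (fanoL (bv 1 0 0)) = -1" "prod phT11 (fanoK (bv 0 1 0)) = -1" "prod phT11 (fanoK (bv 0 0 0)) = -1"
    by (simp_all add: prod_phT11 zeta8_power)
qed

lemma S_T11_base:
  "SL (bv 1 0 0) (sm (a + 1) b c d e f) = - SL (bv 0 0 0) (sm a b c d e f) - SL (bv 1 0 0) (sm a b c d e f)"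
  "SK (bv 0 1 0) (sm (a + 1) b c d e f) = - SL (bv 0 0 1) (sm a b c d e f) - SK (bv 0 1 0) (sm a b c d e f)"
  "SK (bv 0 0 0) (sm (a + 1) b c d e f) = - SK (bv 0 0 0) (sm a b c d e f) - SK (bv 1 0 0) (sm a b c d e f)"
  using rel3_sm[OF rel3_base S] rel3_sm[OF rel3_second S] rel3_sm[OF rel3_third S]
  unfolding SL_bv SK_def ff_T11[OF S even_octad_fanoL] ff_T11[OF S even_octad_fanoK] phT11_four
  by (simp_all add: algebra_simps)

lemma S_J:
  "SL (bv 1 0 0) (invm a b c d e f) = a ^ 14 * SL (bv 0 0 0) (sm a b c d e f)"
  "SL (bv 0 0 0) (invm a b c d e f) = a ^ 14 * SL (bv 1 0 0) (sm a b c d e f)"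
  "SK (bv 0 0 1) (invm a b c d e f) = a ^ 14 * SL (bv 0 1 0) (sm a b c d e f)"
  "SL (bv 0 1 0) (invm a b c d e f) = a ^ 14 * SK (bv 0 0 1) (sm a b c d e f)"
  "SK (bv 0 0 0) (invm a b c d e f) = a ^ 14 * SK (bv 1 0 0) (sm a b c d e f)"
proof -
  have "actJ ` fanoL (bv 1 0 0) = fanoL (bv 0 0 0)" "actJ ` fanoL (bv 0 0 0) = fanoL (bv 1 0 0)"
    "actJ ` fanoK (bv 0 0 1) = fanoL (bv 0 1 0)" "actJ ` fanoL (bv 0 1 0) = fanoK (bv 0 0 1)"
    "actJ ` fanoK (bv 0 0 0) = fanoK (bv 1 0 0)"
    unfolding characteristic_set_eq by simp_all
  moreover have "prod phJ (fanoL (bv 1 0 0)) = 1" "prod phJ (fanoL (bv 0 0 0)) = 1" "prod phJ (fanoK (bv 0 0 1)) = 1"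
    "prod phJ (fanoL (bv 0 1 0)) = 1" "prod phJ (fanoK (bv 0 0 0)) = 1"
    by (simp_all add: ph_simps)
  ultimately show
  "SL (bv 1 0 0) (invm a b c d e f) = a ^ 14 * SL (bv 0 0 0) (sm a b c d e f)"
  "SL (bv 0 0 0) (invm a b c d e f) = a ^ 14 * SL (bv 1 0 0) (sm a b c d e f)"
  "SK (bv 0 0 1) (invm a b c d e f) = a ^ 14 * SL (bv 0 1 0) (sm a b c d e f)"
  "SL (bv 0 1 0) (invm a b c d e f) = a ^ 14 * SK (bv 0 0 1) (sm a b c d e f)"
  "SK (bv 0 0 0) (invm a b c d e f) = a ^ 14 * SK (bv 1 0 0) (sm a b c d e f)"
    unfolding SL_bv SK_def ff_J[OF S even_octad_fanoL] ff_J[OF S even_octad_fanoK] by simp_all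
qed

lemma S_JT12:
  "SK (bv 0 0 1) (sm (- 1 / a) (b / a + 1) (c / a) (d - b\<^sup>2 / a) (e - b * c / a) (f - c\<^sup>2 / a)) = a ^ 14 * SL (bv 1 1 0)
      (sm a b c d e f)"
  "SK (bv 0 0 0) (sm (- 1 / a) (b / a + 1) (c / a) (d - b\<^sup>2 / a) (e - b * c / a) (f - c\<^sup>2 / a)) = a ^ 14 * SK (bv 1 1 0)
      (sm a b c d e f)"
proof -
  have "actJ ` actT12 ` fanoK (bv 0 0 1) = fanoL (bv 1 1 0)" "actJ ` actT12 ` fanoK (bv 0 0 0) = fanoK (bv 1 1 0)"
    unfolding characteristic_set_eq by simp_all
  moreover have "prod phT12 (fanoK (bv 0 0 1)) = -1" "prod phT12 (fanoK (bv 0 0 0)) = -1"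
     "prod phJ (actT12 ` fanoK (bv 0 0 1)) = -1" "prod phJ (actT12 ` fanoK (bv 0 0 0)) = -1"
    by (simp_all add: ph_simps)
  ultimately show
  "SK (bv 0 0 1) (sm (- 1 / a) (b / a + 1) (c / a) (d - b\<^sup>2 / a) (e - b * c / a) (f - c\<^sup>2 / a)) = a ^ 14 * SL (bv 1 1 0)
      (sm a b c d e f)"
  "SK (bv 0 0 0) (sm (- 1 / a) (b / a + 1) (c / a) (d - b\<^sup>2 / a) (e - b * c / a) (f - c\<^sup>2 / a)) = a ^ 14 * SK (bv 1 1 0)
      (sm a b c d e f)"
    unfolding SL_bv SK_def ff_T12[OF siegel6_inversion[OF S] even_octad_fanoK] ff_J[OF S even_octad_act(2)[OF
        even_octad_fanoK]] by simp_all
qed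

end


lemma siegel6_unshear: "siegel6 a b c d e f \<Longrightarrow> siegel6 (a - 2 * b + d) (b - d) (c - e) d e f"
  unfolding siegel6_def posdef_def
proof (intro allI impI)
  fix x y z :: real
  assume *: "\<forall>x y z. (x, y, z) \<noteq> (0, 0, 0) \<longrightarrow> 0 < qf (Im a) (Im b) (Im c) (Im d) (Im e) (Im f) x y z" and "(x, y, z) \<noteq> (0, 0, 0)"
  then have "0 < qf (Im a) (Im b) (Im c) (Im d) (Im e) (Im f) x (y - x) z" by auto
  then show "0 < qf (Im (a - 2 * b + d)) (Im (b - d)) (Im (c - e)) (Im d) (Im e) (Im f) x y z"
    by (simp add: qf_def power2_eq_square algebra_simps)
qed

lemma siegel6_shear23:
  assumes S: "siegel6 a b c d e f"
  shows "siegel6 a (b + c) c (d + 2 * e + f) (e + f) f"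
  using siegel6_swap12[OF siegel6_swap23[OF siegel6_shear[OF siegel6_swap23[OF siegel6_swap12[OF S]]]]] .

lemma S_shear23:
  assumes S: "siegel6 a b c d e f"
  shows "SL (bv u1 u2 u3) (sm a (b + c) c (d + 2 * e + f) (e + f) f) = SL (bv u1 u2 (u2 + u3)) (sm a b c d e f)"
    and "SK (bv u1 u2 u3) (sm a (b + c) c (d + 2 * e + f) (e + f) f) = SK (bv u1 (u2 + u3) u3) (sm a b c d e f)"
proof -
  note S1 = siegel6_swap12[OF S] note S2 = siegel6_swap23[OF S1] note S3 = siegel6_shear[OF S2] note S4 = siegel6_swap23[OF S3]
  show "SL (bv u1 u2 u3) (sm a (b + c) c (d + 2 * e + f) (e + f) f) = SL (bv u1 u2 (u2 + u3)) (sm a b c d e f)"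
    unfolding S_P12(1)[OF S4] S_P23(1)[OF S3] S_U(1)[OF S2] S_P23(1)[OF S1] S_P12(1)[OF S] ..
  show "SK (bv u1 u2 u3) (sm a (b + c) c (d + 2 * e + f) (e + f) f) = SK (bv u1 (u2 + u3) u3) (sm a b c d e f)"
    unfolding S_P12(2)[OF S4] S_P23(2)[OF S3] S_U(2)[OF S2] S_P23(2)[OF S1] S_P12(2)[OF S] ..
qed

lemma SL_T11:
  assumes S: "siegel6 a b c d e f"
  shows "SL (bv 1 u2 u3) (sm (a + 1) b c d e f) = - SL (bv 0 0 0) (sm a b c d e f) - SL (bv 1 u2 u3) (sm a b c d e f)"
proof -
  define P where "P u2 u3 \<longleftrightarrow> (\<forall>a b c d e f. siegel6 a b c d e f \<longrightarrow>
    SL (bv 1 u2 u3) (sm (a + 1) b c d e f) = - SL (bv 0 0 0) (sm a b c d e f) - SL (bv 1 u2 u3) (sm a b c d e f))" for u2 u3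
  have P0: "P 0 0" using S_T11_base(1) by (simp add: P_def)
  have PU: "P (1 + u2) u3" if "P u2 u3" for u2 u3
    unfolding P_def
  proof (intro allI impI)
    fix a b c d e f assume S: "siegel6 a b c d e f"
    have e: "a + 1 + 2 * b + d = a + 2 * b + d + 1" by simp
    from that[unfolded P_def, rule_format, OF siegel6_shear[OF S]]
    show "SL (bv 1 (1 + u2) u3) (sm (a + 1) b c d e f) = - SL (bv 0 0 0) (sm a b c d e f) - SL (bv 1 (1 + u2) u3) (sm a
        b c d e f)"
      unfolding S_U(1)[OF S] e[symmetric] S_U(1)[OF siegel6_T11[OF S]] by simp
  qed
  have PS: "P u3 u2" if "P u2 u3" for u2 u3
    unfolding P_def
  proof (intro allI impI)
    fix a b c d e f assume S: "siegel6 a b c d e f"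
    from that[unfolded P_def, rule_format, OF siegel6_swap23[OF S]]
    show "SL (bv 1 u3 u2) (sm (a + 1) b c d e f) = - SL (bv 0 0 0) (sm a b c d e f) - SL (bv 1 u3 u2) (sm a b c d e f)"
      unfolding S_P23(1)[OF S] S_P23(1)[OF siegel6_T11[OF S]] .
  qed
  have "P 1 0" using PU[OF P0] by simp
  moreover from PS[OF this] have "P 0 1" .
  moreover from PU[OF this] have "P 1 1" by simp
  ultimately have "P u2 u3" using P0 by (cases u2 rule: bit_cases01; cases u3 rule: bit_cases01) simp_all
  then show ?thesis using S by (simp add: P_def)
qed

lemma SK_T11:
  assumes S: "siegel6 a b c d e f" and v: "v2 = 1 \<or> v3 = 1"
  shows "SK (bv v1 v2 v3) (sm (a + 1) b c d e f) = - SL (bv 0 v3 v2) (sm a b c d e f) - SK (bv v1 v2 v3) (sm a b c d e f)"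
proof -
  define P where "P v1 v2 v3 \<longleftrightarrow> (\<forall>a b c d e f. siegel6 a b c d e f \<longrightarrow>
    SK (bv v1 v2 v3) (sm (a + 1) b c d e f) = - SL (bv 0 v3 v2) (sm a b c d e f) - SK (bv v1 v2 v3) (sm a b c d e f))"
        for v1 v2 v3
  have P0: "P 0 1 0" using S_T11_base(2) by (simp add: P_def)
  have PU: "P (v1 + v2) v2 v3" if "P v1 v2 v3" for v1 v2 v3
    unfolding P_def
  proof (intro allI impI)
    fix a b c d e f assume S: "siegel6 a b c d e f"
    have e: "a + 1 + 2 * b + d = a + 2 * b + d + 1" by simp
    from that[unfolded P_def, rule_format, OF siegel6_shear[OF S]]
    show "SK (bv (v1 + v2) v2 v3) (sm (a + 1) b c d e f) = - SL (bv 0 v3 v2) (sm a b c d e f) - SK (bv (v1 + v2) v2 v3)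
        (sm a b c d e f)"
      unfolding S_U[OF S] e[symmetric] S_U[OF siegel6_T11[OF S]] by simp
  qed
  have PS: "P v1 v3 v2" if "P v1 v2 v3" for v1 v2 v3
    unfolding P_def
  proof (intro allI impI)
    fix a b c d e f assume S: "siegel6 a b c d e f"
    from that[unfolded P_def, rule_format, OF siegel6_swap23[OF S]]
    show "SK (bv v1 v3 v2) (sm (a + 1) b c d e f) = - SL (bv 0 v2 v3) (sm a b c d e f) - SK (bv v1 v3 v2) (sm a b c d e f)"
      unfolding S_P23[OF S] S_P23[OF siegel6_T11[OF S]] .
  qed
  have PV: "P v1 (v2 + v3) v3" if "P v1 v2 v3" for v1 v2 v3
    unfolding P_def
  proof (intro allI impI)
    fix a b c d e f assume S: "siegel6 a b c d e f"
    from that[unfolded P_def, rule_format, OF siegel6_shear23[OF S]]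
    show "SK (bv v1 (v2 + v3) v3) (sm (a + 1) b c d e f) = - SL (bv 0 v3 (v2 + v3)) (sm a b c d e f) - SK (bv v1 (v2 +
        v3) v3) (sm a b c d e f)"
      unfolding S_shear23[OF S] S_shear23[OF siegel6_T11[OF S]] by (simp only: add.commute[of v3])
  qed
  have "P 1 1 0" using PU[OF P0] by simp
  moreover from PS[OF this] have "P 1 0 1" .
  moreover from PS[OF P0] have P1: "P 0 0 1" .
  moreover from PV[OF P1] have P2: "P 0 1 1" by simp
  moreover from PU[OF P2] have "P 1 1 1" by simp
  ultimately have "P v1 v2 v3" using P0 v
    by (cases v1 rule: bit_cases01; cases v2 rule: bit_cases01; cases v3 rule: bit_cases01) simp_all
  then show ?thesis using S by (simp add: P_def)
qed

text \<open>The sixteenth product-type configuration is \<open>fanoK 0\<close>; its form is a combination of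
  the other fifteen. The defect \<open>y\<close> of this identity is invariant under \<open>GL\<^sub>3(\<int>)\<close> and changes
  sign under each of the translations by \<open>u u\<^sup>t\<close>; as the all-ones matrix is a sum of six
  translations that change the sign of \<open>y\<close>, but is also of the form \<open>u u\<^sup>t\<close>, \<open>y\<close> is zero.\<close>

definition form_defect :: "complex^3^3 \<Rightarrow> complex" where
  "form_defect \<tau> = 2 * SK (bv 0 0 0) \<tau> + 2 * SL (bv 0 0 0) \<tau> +
    (SL (bv 0 0 1) \<tau> + SL (bv 0 1 0) \<tau> + SL (bv 0 1 1) \<tau> + SL (bv 1 0 0) \<tau> + SL (bv 1 0 1) \<tau> + SL (bv 1 1 0) \<tau> + SL (bv
        1 1 1) \<tau>) +
    (SK (bv 0 0 1) \<tau> + SK (bv 0 1 0) \<tau> + SK (bv 0 1 1) \<tau> + SK (bv 1 0 0) \<tau> + SK (bv 1 0 1) \<tau> + SK (bv 1 1 0) \<tau> + SK (bv 1 1 1) \<tau>)"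

lemma form_defect_zero:
  assumes S: "siegel6 a b c d e f"
  shows "form_defect (sm a b c d e f) = 0"
proof -
  have Y12: "form_defect (sm d b e a c f) = form_defect (sm a b c d e f)" if "siegel6 a b c d e f" for a b c d e f
    by (simp add: form_defect_def S_P12[OF that])
  have Y23: "form_defect (sm a c b f e d) = form_defect (sm a b c d e f)" if "siegel6 a b c d e f" for a b c d e f
    by (simp add: form_defect_def S_P23[OF that])
  have YU: "form_defect (sm (a + 2 * b + d) (b + d) (c + e) d e f) = form_defect (sm a b c d e f)" if "siegel6 a b c d e
      f" for a b c d e f
    by (simp add: form_defect_def S_U[OF that])
  have Ya: "form_defect (sm (a + 1) b c d e f) = - form_defect (sm a b c d e f)" if "siegel6 a b c d e f" for a b c d e f
    by (simp add: form_defect_def SL_T11[OF that] SK_T11[OF that] S_T11_fixed[OF that] S_T11_base(3)[OF that])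
  have Yd: "form_defect (sm a b c (d + 1) e f) = - form_defect (sm a b c d e f)" if "siegel6 a b c d e f" for a b c d e f
    using Ya[OF siegel6_swap12[OF that]] Y12[OF that] Y12[of a b c "d + 1" e f] that by (simp add: siegel6_def)
  have Yf: "form_defect (sm a b c d e (f + 1)) = - form_defect (sm a b c d e f)" if "siegel6 a b c d e f" for a b c d e f
    using Yd[OF siegel6_swap23[OF that]] Y23[OF that] Y23[of a b c d e "f + 1"] that by (simp add: siegel6_def)
  have Yb: "form_defect (sm a (b + 1) c d e f) = - form_defect (sm a b c d e f)" if T: "siegel6 a b c d e f" for a b c d e f
  proof -
    note T' = siegel6_unshear[OF T]
    have T'': "siegel6 (a - 2 * b + d) (b - d) (c - e) (d + 1) e f" using T' by (simp add: siegel6_def)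
    have "form_defect (sm (a + 1) (b + 1) c (d + 1) e f) = form_defect (sm (a - 2 * b + d) (b - d) (c - e) (d + 1) e f)"
      using YU[OF T''] by (simp add: algebra_simps)
    also have "\<dots> = - form_defect (sm (a - 2 * b + d) (b - d) (c - e) d e f)" by (rule Yd[OF T'])
    also have "\<dots> = - form_defect (sm a b c d e f)" using YU[OF T'] by (simp add: algebra_simps)
    finally have "form_defect (sm (a + 1) (b + 1) c (d + 1) e f) = - form_defect (sm a b c d e f)" .
    moreover have "form_defect (sm (a + 1) (b + 1) c (d + 1) e f) = - form_defect (sm a (b + 1) c (d + 1) e f)"
      by (rule Ya) (use T in \<open>simp add: siegel6_def\<close>)
    moreover have "form_defect (sm a (b + 1) c (d + 1) e f) = - form_defect (sm a (b + 1) c d e f)"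
      by (rule Yd) (use T in \<open>simp add: siegel6_def\<close>)
    ultimately show ?thesis by simp
  qed
  have Yc: "form_defect (sm a b (c + 1) d e f) = - form_defect (sm a b c d e f)" if "siegel6 a b c d e f" for a b c d e f
    using Yb[OF siegel6_swap23[OF that]] Y23[OF that] Y23[of a b "c + 1" d e f] that by (simp add: siegel6_def)
  have Ye: "form_defect (sm a b c d (e + 1) f) = - form_defect (sm a b c d e f)" if "siegel6 a b c d e f" for a b c d e f
    using Yc[OF siegel6_swap12[OF that]] Y12[OF that] Y12[of a b c d "e + 1" f] that by (simp add: siegel6_def)
  note S' = siegel6_unshear[OF S]
  have S1: "siegel6 (a - 2 * b + d) (b - d) (c - e) (d + 1) (e + 1) (f + 1)"
    "siegel6 (a - 2 * b + d) (b - d) (c - e) (d + 1) (e + 1) f" "siegel6 (a - 2 * b + d) (b - d) (c - e) (d + 1) e f"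
    using S' by (simp_all add: siegel6_def)
  have "form_defect (sm (a + 1) (b + 1) (c + 1) (d + 1) (e + 1) (f + 1)) = form_defect (sm (a - 2 * b + d) (b - d) (c -
      e) (d + 1) (e + 1) (f + 1))"
    using YU[OF S1(1)] by (simp add: algebra_simps)
  also have "\<dots> = - form_defect (sm (a - 2 * b + d) (b - d) (c - e) d e f)"
    by (simp only: Yf[OF S1(2)] Ye[OF S1(3)] Yd[OF S'] minus_minus)
  also have "\<dots> = - form_defect (sm a b c d e f)" using YU[OF S'] by (simp add: algebra_simps)
  finally have 1: "form_defect (sm (a + 1) (b + 1) (c + 1) (d + 1) (e + 1) (f + 1)) = - form_defect (sm a b c d e f)" .
  have S2: "siegel6 a (b + 1) (c + 1) (d + 1) (e + 1) (f + 1)" "siegel6 a b (c + 1) (d + 1) (e + 1) (f + 1)"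
     "siegel6 a b c (d + 1) (e + 1) (f + 1)" "siegel6 a b c d (e + 1) (f + 1)" "siegel6 a b c d e (f + 1)"
    using S by (simp_all add: siegel6_def)
  have 2: "form_defect (sm (a + 1) (b + 1) (c + 1) (d + 1) (e + 1) (f + 1)) = form_defect (sm a b c d e f)"
    by (simp only: Ya[OF S2(1)] Yb[OF S2(2)] Yc[OF S2(3)] Yd[OF S2(4)] Ye[OF S2(5)] Yf[OF S] minus_minus)
  show ?thesis using 1 2 by simp
qed

section \<open>Quartics\<close>

lemma UNIV_bit3: "(UNIV :: (bit^3) set) = {bv 0 0 0, bv 0 0 1, bv 0 1 0, bv 0 1 1, bv 1 0 0, bv 1 0 1, bv 1 1 0, bv 1 1 1}"
proof -
  have "e \<in> {bv 0 0 0, bv 0 0 1, bv 0 1 0, bv 0 1 1, bv 1 0 0, bv 1 0 1, bv 1 1 0, bv 1 1 1}" for e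
  proof (cases e rule: bv_cases)
    case (1 a b c)
    then show ?thesis
      by (cases a rule: bit_cases01; cases b rule: bit_cases01; cases c rule: bit_cases01) simp_all
  qed
  then show ?thesis by blast
qed

lemma sum_bit3: "(\<Sum>e\<in>UNIV. f e) = f (bv 0 0 0) + f (bv 0 0 1) + f (bv 0 1 0) + f (bv 0 1 1) + f (bv 1 0 0) + f (bv 1 0
    1) + f (bv 1 1 0) + f (bv 1 1 1)"
  for f :: "bit^3 \<Rightarrow> 'a :: comm_monoid_add"
  unfolding UNIV_bit3 by (simp add: add.assoc)

lemma prod_bit3: "(\<Prod>m\<in>{m. P m}. f m) = (\<Prod>m\<in>{bv 0 0 0, bv 0 0 1, bv 0 1 0, bv 0 1 1, bv 1 0 0, bv 1 0 1, bv 1 1 0, bv 1 1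
    1}. if P m then f m else 1)"
  for f :: "bit^3 \<Rightarrow> 'a :: comm_monoid_mult"
  unfolding UNIV_bit3[symmetric] using prod.inter_restrict[of UNIV f "{m. P m}"] by simp

lemma sum_bit3_if: "(\<Sum>m\<in>{m. P m}. f m) = (\<Sum>m\<in>UNIV. if P m then f m else 0)"
  for f :: "bit^3 \<Rightarrow> 'a :: comm_monoid_add"
  using sum.inter_restrict[of UNIV f "{m. P m}"] by simp

lemma sum_nonzero_bit3: "(\<Sum>e\<in>UNIV - {0}. f e) = f (bv 0 0 1) + f (bv 0 1 0) + f (bv 0 1 1) + f (bv 1 0 0) + f (bv 1 0 1)
    + f (bv 1 1 0) + f (bv 1 1 1)"
  for f :: "bit^3 \<Rightarrow> 'a :: comm_monoid_add"
proof -
  have "UNIV - {0} = {bv 0 0 1, bv 0 1 0, bv 0 1 1, bv 1 0 0, bv 1 0 1, bv 1 1 0, bv 1 1 1}"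
    unfolding UNIV_bit3 bv_zero by (auto simp del: bv_eq_zero_iff)
  then show ?thesis by (simp add: add.assoc)
qed

abbreviation "QQ \<equiv> quartic_Q id"
abbreviation "QP \<equiv> quartic_Q' id"

lemma QQ_explicit:
  "QQ (bv 0 0 0) x = x (bv 0 0 0) ^ 4 + x (bv 0 0 1) ^ 4 + x (bv 0 1 0) ^ 4 + x (bv 0 1 1) ^ 4 + x (bv 1 0 0) ^ 4 + x
      (bv 1 0 1) ^ 4 + x (bv 1 1 0) ^ 4 + x (bv 1 1 1) ^ 4"
  "QQ (bv 0 0 1) x = (x (bv 0 0 0) * x (bv 0 0 1))\<^sup>2 + (x (bv 0 1 0) * x (bv 0 1 1))\<^sup>2 + (x (bv 1 0 0) * x (bv 1 0 1))\<^sup>2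
      + (x (bv 1 1 0) * x (bv 1 1 1))\<^sup>2"
  "QQ (bv 0 1 0) x = (x (bv 0 0 0) * x (bv 0 1 0))\<^sup>2 + (x (bv 0 0 1) * x (bv 0 1 1))\<^sup>2 + (x (bv 1 0 0) * x (bv 1 1 0))\<^sup>2
      + (x (bv 1 0 1) * x (bv 1 1 1))\<^sup>2"
  "QQ (bv 0 1 1) x = (x (bv 0 0 0) * x (bv 0 1 1))\<^sup>2 + (x (bv 0 0 1) * x (bv 0 1 0))\<^sup>2 + (x (bv 1 0 0) * x (bv 1 1 1))\<^sup>2
      + (x (bv 1 0 1) * x (bv 1 1 0))\<^sup>2"
  "QQ (bv 1 0 0) x = (x (bv 0 0 0) * x (bv 1 0 0))\<^sup>2 + (x (bv 0 0 1) * x (bv 1 0 1))\<^sup>2 + (x (bv 0 1 0) * x (bv 1 1 0))\<^sup>2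
      + (x (bv 0 1 1) * x (bv 1 1 1))\<^sup>2"
  "QQ (bv 1 0 1) x = (x (bv 0 0 0) * x (bv 1 0 1))\<^sup>2 + (x (bv 0 0 1) * x (bv 1 0 0))\<^sup>2 + (x (bv 0 1 0) * x (bv 1 1 1))\<^sup>2
      + (x (bv 0 1 1) * x (bv 1 1 0))\<^sup>2"
  "QQ (bv 1 1 0) x = (x (bv 0 0 0) * x (bv 1 1 0))\<^sup>2 + (x (bv 0 0 1) * x (bv 1 1 1))\<^sup>2 + (x (bv 0 1 0) * x (bv 1 0 0))\<^sup>2
      + (x (bv 0 1 1) * x (bv 1 0 1))\<^sup>2"
  "QQ (bv 1 1 1) x = (x (bv 0 0 0) * x (bv 1 1 1))\<^sup>2 + (x (bv 0 0 1) * x (bv 1 1 0))\<^sup>2 + (x (bv 0 1 0) * x (bv 1 0 1))\<^sup>2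
      + (x (bv 0 1 1) * x (bv 1 0 0))\<^sup>2"
  by (simp_all add: quartic_Q_def sum_bit3 power_mult_distrib)

lemma QP_explicit:
  "QP (bv 0 0 1) x = x (bv 0 0 0) * x (bv 0 1 0) * x (bv 1 0 0) * x (bv 1 1 0) + x (bv 0 0 1) * x (bv 0 1 1) * x (bv 1 0
      1) * x (bv 1 1 1)"
  "QP (bv 0 1 0) x = x (bv 0 0 0) * x (bv 0 0 1) * x (bv 1 0 0) * x (bv 1 0 1) + x (bv 0 1 0) * x (bv 0 1 1) * x (bv 1 1
      0) * x (bv 1 1 1)"
  "QP (bv 0 1 1) x = x (bv 0 0 0) * x (bv 0 1 1) * x (bv 1 0 0) * x (bv 1 1 1) + x (bv 0 0 1) * x (bv 0 1 0) * x (bv 1 0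
      1) * x (bv 1 1 0)"
  "QP (bv 1 0 0) x = x (bv 0 0 0) * x (bv 0 0 1) * x (bv 0 1 0) * x (bv 0 1 1) + x (bv 1 0 0) * x (bv 1 0 1) * x (bv 1 1
      0) * x (bv 1 1 1)"
  "QP (bv 1 0 1) x = x (bv 0 0 0) * x (bv 0 1 0) * x (bv 1 0 1) * x (bv 1 1 1) + x (bv 0 0 1) * x (bv 0 1 1) * x (bv 1 0
      0) * x (bv 1 1 0)"
  "QP (bv 1 1 0) x = x (bv 0 0 0) * x (bv 0 0 1) * x (bv 1 1 0) * x (bv 1 1 1) + x (bv 0 1 0) * x (bv 0 1 1) * x (bv 1 0
      0) * x (bv 1 0 1)"
  "QP (bv 1 1 1) x = x (bv 0 0 0) * x (bv 0 1 1) * x (bv 1 0 1) * x (bv 1 1 0) + x (bv 0 0 1) * x (bv 0 1 0) * x (bv 1 0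
      0) * x (bv 1 1 1)"
  by (simp_all add: quartic_Q'_def sum_bit3 prod_bit3)

definition qcomb :: "(bit^3 \<Rightarrow> complex) \<Rightarrow> (bit^3 \<Rightarrow> complex) \<Rightarrow> (bit^3 \<Rightarrow> complex) \<Rightarrow> complex" where
  "qcomb b b' x = (\<Sum>u\<in>UNIV. b u * QQ u x) + (\<Sum>v\<in>UNIV - {0}. b' v * QP v x)"

lemma cspan_zero: "(\<lambda>_. 0) \<in> cspan B"
  unfolding cspan_def by (rule CollectI, intro exI[of _ "{}"]) auto

lemma cspan_base: "b \<in> B \<Longrightarrow> b \<in> cspan B"
  unfolding cspan_def by (rule CollectI, intro exI[of _ "{b}"] exI[of _ "\<lambda>_. 1"]) auto

lemma cspan_scale: "f \<in> cspan B \<Longrightarrow> (\<lambda>x. k * f x) \<in> cspan B"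
proof -
  assume "f \<in> cspan B"
  then obtain T c where T: "finite T" "T \<subseteq> B" "f = (\<lambda>x. \<Sum>b\<in>T. c b * b x)" by (auto simp: cspan_def)
  then have "(\<lambda>x. k * f x) = (\<lambda>x. \<Sum>b\<in>T. (k * c b) * b x)" by (simp add: sum_distrib_left mult.assoc)
  with T(1,2) show ?thesis by (auto simp: cspan_def)
qed

lemma cspan_add: "f \<in> cspan B \<Longrightarrow> g \<in> cspan B \<Longrightarrow> (\<lambda>x. f x + g x) \<in> cspan B"
proof -
  assume "f \<in> cspan B" "g \<in> cspan B"
  then obtain T c S d where T: "finite T" "T \<subseteq> B" "f = (\<lambda>x. \<Sum>b\<in>T. c b * b x)"
    and S: "finite S" "S \<subseteq> B" "g = (\<lambda>x. \<Sum>b\<in>S. d b * b x)" by (auto simp: cspan_def)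
  have fT: "f x = (\<Sum>b\<in>T \<union> S. (if b \<in> T then c b else 0) * b x)" for x
    unfolding T(3) using T S by (intro sum.mono_neutral_cong_left) auto
  have gS: "g x = (\<Sum>b\<in>T \<union> S. (if b \<in> S then d b else 0) * b x)" for x
    unfolding S(3) using T S by (intro sum.mono_neutral_cong_left) auto
  have "(\<lambda>x. f x + g x) = (\<lambda>x. \<Sum>b\<in>T \<union> S. ((if b \<in> T then c b else 0) + (if b \<in> S then d b else 0)) * b x)"
    by (simp only: fT gS sum.distrib ring_distribs)
  moreover have "finite (T \<union> S)" "T \<union> S \<subseteq> B" using T S by auto
  ultimately show ?thesis unfolding cspan_def mem_Collect_eq by (intro exI conjI)
qed

lemma cspan_sum: "(\<And>i. i \<in> I \<Longrightarrow> f i \<in> cspan B) \<Longrightarrow> (\<lambda>x. \<Sum>i\<in>I. f i x) \<in> cspan B"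
  by (induction I rule: infinite_finite_induct) (auto simp: cspan_zero intro: cspan_add)

lemma W'_iff: "q \<in> W' \<longleftrightarrow> (\<exists>b b'. q = qcomb b b')"
proof
  assume "\<exists>b b'. q = qcomb b b'"
  then obtain b b' where q: "q = qcomb b b'" by blast
  have "(\<lambda>x. (\<Sum>u\<in>UNIV. b u * QQ u x) + (\<Sum>v\<in>UNIV - {0}. b' v * QP v x)) \<in> W'"
    unfolding W'_def by (intro cspan_add cspan_sum cspan_scale cspan_base) auto
  then show "q \<in> W'" unfolding q qcomb_def[abs_def] .
next
  assume "q \<in> W'"
  then obtain T c where T: "finite T" "T \<subseteq> range QQ \<union> {QP a | a. a \<noteq> 0}" "q = (\<lambda>x. \<Sum>p\<in>T. c p * p x)"
    unfolding W'_def cspan_def by blast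
  have "\<exists>b b'. (\<lambda>x. \<Sum>p\<in>T. c p * p x) = qcomb b b'"
    using T(1,2)
  proof (induction T rule: finite_induct)
    case empty
    have "(\<lambda>x. \<Sum>p\<in>{}. c p * p x) = qcomb (\<lambda>_. 0) (\<lambda>_. 0)" by (simp add: qcomb_def fun_eq_iff)
    then show ?case by blast
  next
    case (insert p T)
    then obtain b b' where IH: "(\<lambda>x. \<Sum>p\<in>T. c p * p x) = qcomb b b'" by auto
    have step: "(\<lambda>x. \<Sum>p\<in>insert p T. c p * p x) = (\<lambda>x. c p * p x + qcomb b b' x)"
      using insert(1,2) by (simp add: fun_eq_iff flip: IH)
    have d: "(if w = z then k else 0) * (y :: complex) = (if w = z then k * y else 0)" for w z :: "bit^3" and k y by simp
    have "p \<in> range QQ \<or> p \<in> {QP a | a. a \<noteq> 0}" using insert.prems by (simp only: insert_subset Un_iff)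
    then consider u where "p = QQ u" | v where "v \<noteq> 0" "p = QP v" unfolding image_iff mem_Collect_eq by metis
    then show ?case
    proof cases
      case (1 u)
      have e: "c (QQ u) * QQ u x + qcomb b b' x = qcomb (\<lambda>w. b w + (if w = u then c (QQ u) else 0)) b' x" for x
        by (simp add: qcomb_def distrib_right sum.distrib d)
      then show ?thesis unfolding step unfolding 1 e by (intro exI ext refl)
    next
      case (2 v)
      have e: "c (QP v) * QP v x + qcomb b b' x = qcomb b (\<lambda>w. b' w + (if w = v then c (QP v) else 0)) x" for x
        using 2(1) by (simp add: qcomb_def distrib_right sum.distrib d)
      then show ?thesis unfolding step unfolding 2(2) e by (intro exI ext refl)
    qed
  qed
  then show "\<exists>b b'. q = qcomb b b'" unfolding T(3) .
qed

lemma qcomb_scale: "qcomb b b' (\<lambda>e. k * x e) = k ^ 4 * qcomb b b' x"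
proof -
  have "QQ u (\<lambda>e. k * x e) = k ^ 4 * QQ u x" for u
    by (simp add: quartic_Q_def power_mult_distrib sum_distrib_left mult_ac power4_eq_xxxx power2_eq_square)
  moreover have "QP v (\<lambda>e. k * x e) = k ^ 4 * QP v x" if "v \<noteq> 0" for v
  proof -
    have "QP v (\<lambda>e. k * x e) = k ^ 4 * QP v x"
      using that
    proof (cases v rule: bv_cases)
      case (1 v1 v2 v3)
      then show ?thesis using that
        by (cases v1 rule: bit_cases01; cases v2 rule: bit_cases01; cases v3 rule: bit_cases01)
           (simp_all add: QP_explicit power4_eq_xxxx algebra_simps)
    qed
    then show ?thesis .
  qed
  ultimately show ?thesis by (simp add: qcomb_def sum_distrib_left algebra_simps)
qed

subsection \<open>The explicit formula in terms of the signed forms\<close>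

definition cob :: "(bit^3 \<Rightarrow> complex) \<Rightarrow> (bit^3 \<Rightarrow> complex) \<Rightarrow> (bit^3 \<Rightarrow> complex) \<Rightarrow> complex" where
  "cob L K x = L 0 * QQ 0 x - 2 * (\<Sum>u\<in>UNIV - {0}. (L 0 + 2 * L u) * QQ u x)
     + 8 * (\<Sum>v\<in>UNIV - {0}. ((\<Sum>u | cdot u v = 0. L u) + 2 * K v) * QP v x)"

definition CF :: "complex^3^3 \<Rightarrow> (bit^3 \<Rightarrow> complex) \<Rightarrow> complex" where
  "CF \<tau> x = cob (\<lambda>u. SL u \<tau>) (\<lambda>v. SK v \<tau>) x"

lemma cob_explicit: "cob L K x = L (bv 0 0 0) * QQ (bv 0 0 0) x
   - 2 * ((L (bv 0 0 0) + 2 * L (bv 0 0 1)) * QQ (bv 0 0 1) x + (L (bv 0 0 0) + 2 * L (bv 0 1 0)) * QQ (bv 0 1 0) x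
      + (L (bv 0 0 0) + 2 * L (bv 0 1 1)) * QQ (bv 0 1 1) x + (L (bv 0 0 0) + 2 * L (bv 1 0 0)) * QQ (bv 1 0 0) x
      + (L (bv 0 0 0) + 2 * L (bv 1 0 1)) * QQ (bv 1 0 1) x + (L (bv 0 0 0) + 2 * L (bv 1 1 0)) * QQ (bv 1 1 0) x
      + (L (bv 0 0 0) + 2 * L (bv 1 1 1)) * QQ (bv 1 1 1) x)
   + 8 * ((L (bv 0 0 0) + L (bv 0 1 0) + L (bv 1 0 0) + L (bv 1 1 0) + 2 * K (bv 0 0 1)) * QP (bv 0 0 1) x
      + (L (bv 0 0 0) + L (bv 0 0 1) + L (bv 1 0 0) + L (bv 1 0 1) + 2 * K (bv 0 1 0)) * QP (bv 0 1 0) x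
      + (L (bv 0 0 0) + L (bv 0 1 1) + L (bv 1 0 0) + L (bv 1 1 1) + 2 * K (bv 0 1 1)) * QP (bv 0 1 1) x
      + (L (bv 0 0 0) + L (bv 0 0 1) + L (bv 0 1 0) + L (bv 0 1 1) + 2 * K (bv 1 0 0)) * QP (bv 1 0 0) x
      + (L (bv 0 0 0) + L (bv 0 1 0) + L (bv 1 0 1) + L (bv 1 1 1) + 2 * K (bv 1 0 1)) * QP (bv 1 0 1) x
      + (L (bv 0 0 0) + L (bv 0 0 1) + L (bv 1 1 0) + L (bv 1 1 1) + 2 * K (bv 1 1 0)) * QP (bv 1 1 0) x
      + (L (bv 0 0 0) + L (bv 0 1 1) + L (bv 1 0 1) + L (bv 1 1 0) + 2 * K (bv 1 1 1)) * QP (bv 1 1 1) x)"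
  unfolding cob_def sum_nonzero_bit3 sum_bit3_if sum_bit3 unfolding bv_zero by (simp add: algebra_simps)

lemma fano_list_eq:
  "fano_list = [fanoL (bv 0 0 0), fanoL (bv 1 0 0), fanoL (bv 0 1 0), fanoL (bv 1 1 0), fanoK (bv 0 0 1), fanoL (bv 0 0
      1), fanoL (bv 1 0 1),
     fanoK (bv 0 1 0), fanoL (bv 0 1 1), fanoL (bv 1 1 1), fanoK (bv 0 1 1), fanoK (bv 1 0 0), fanoK (bv 1 0 1), fanoK
         (bv 1 1 0), fanoK (bv 1 1 1)]"
proof -
  have m: "cc a1 a2 a3 d1 d2 d3 \<in> X \<times> Y \<longleftrightarrow> bv a1 a2 a3 \<in> X \<and> bv d1 d2 d3 \<in> Y" for a1 a2 a3 d1 d2 d3 X Y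
    by (simp add: cc_def)
  show ?thesis
    unfolding fano_list_def list.inject
    by (intro conjI refl; unfold characteristic_set_eq m; simp)
qed

lemma coble_formula_CF: "coble_formula \<tau> x = CF \<tau> x"
  unfolding coble_formula_def coble_expr_def Let_def CF_def cob_explicit fano_list_eq SL_def SK_def
  by (simp add: eval_nat_numeral algebra_simps)

definition coefQ :: "complex^3^3 \<Rightarrow> bit^3 \<Rightarrow> complex" where
  "coefQ \<tau> u = (if u = 0 then SL 0 \<tau> else - 2 * (SL 0 \<tau> + 2 * SL u \<tau>))"

definition coefP :: "complex^3^3 \<Rightarrow> bit^3 \<Rightarrow> complex" where
  "coefP \<tau> v = 8 * ((\<Sum>u | cdot u v = 0. SL u \<tau>) + 2 * SK v \<tau>)"

lemma CF_coef: "CF \<tau> = qcomb (coefQ \<tau>) (coefP \<tau>)"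
    unfolding CF_def cob_def qcomb_def coefQ_def coefP_def
    by (rule ext, subst sum.remove[of UNIV 0]) (simp_all add: sum_distrib_left mult_ac flip: sum_negf, simp add: algebra_simps)

lemma CF_qcomb: "\<exists>b b'. CF \<tau> = qcomb b b'"
  using CF_coef by blast

subsection \<open>Evaluation at fifteen points\<close>

definition dvec :: "(bit^3) set \<Rightarrow> bit^3 \<Rightarrow> complex" where "dvec A e = (if e \<in> A then 1 else 0)"

lemma qcomb_explicit: "qcomb b b' x = b (bv 0 0 0) * QQ (bv 0 0 0) x + b (bv 0 0 1) * QQ (bv 0 0 1) x + b (bv 0 1 0) *
    QQ (bv 0 1 0) x
   + b (bv 0 1 1) * QQ (bv 0 1 1) x + b (bv 1 0 0) * QQ (bv 1 0 0) x + b (bv 1 0 1) * QQ (bv 1 0 1) x + b (bv 1 1 0) *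
       QQ (bv 1 1 0) x
   + b (bv 1 1 1) * QQ (bv 1 1 1) x + (b' (bv 0 0 1) * QP (bv 0 0 1) x + b' (bv 0 1 0) * QP (bv 0 1 0) x
   + b' (bv 0 1 1) * QP (bv 0 1 1) x + b' (bv 1 0 0) * QP (bv 1 0 0) x + b' (bv 1 0 1) * QP (bv 1 0 1) x + b' (bv 1 1 0)
       * QP (bv 1 1 0) x
   + b' (bv 1 1 1) * QP (bv 1 1 1) x)"
  unfolding qcomb_def sum_nonzero_bit3 sum_bit3 ..

definition perp :: "bit^3 \<Rightarrow> (bit^3) set" where "perp v = {e. cdot v e = 0}"

text \<open>The points are stabilizer vectors: the group permutes them up to scalars, and the values of the
  Coble quartic there are multiples of the forms attached to Fano configurations.\<close>

lemma qcomb_determined: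
  assumes "\<And>u. qcomb b b' (dvec {0, u}) = 0" "\<And>v. v \<noteq> 0 \<Longrightarrow> qcomb b b' (dvec (perp v)) = 0"
  shows "b u = 0" "v \<noteq> 0 \<Longrightarrow> b' v = 0" "qcomb b b' x = 0"
proof -
  have b0: "b (bv 0 0 0) = 0" using assms(1)[of "bv 0 0 0"]
    by (simp add: qcomb_explicit QQ_explicit QP_explicit dvec_def bv_zero)
  show b: "b u = 0" for u
  proof (cases u rule: bv_cases)
    case (1 u1 u2 u3)
    then show ?thesis using assms(1)[of u] b0
      by (cases u1 rule: bit_cases01; cases u2 rule: bit_cases01; cases u3 rule: bit_cases01)
         (simp_all add: qcomb_explicit QQ_explicit QP_explicit dvec_def bv_zero)
  qed
  show b': "b' v = 0" if "v \<noteq> 0" for v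
  proof (cases v rule: bv_cases)
    case (1 v1 v2 v3)
    then show ?thesis using assms(2)[OF that] that
      by (cases v1 rule: bit_cases01; cases v2 rule: bit_cases01; cases v3 rule: bit_cases01)
         (simp_all add: qcomb_explicit QQ_explicit QP_explicit dvec_def perp_def b)
  qed
  show "qcomb b b' x = 0" unfolding qcomb_def using b b' by simp
qed

lemma cob_dvec:
  "cob L K (dvec {0}) = L 0"
  "u \<noteq> 0 \<Longrightarrow> cob L K (dvec {0, u}) = - 4 * L u"
  "v \<noteq> 0 \<Longrightarrow> cob L K (dvec (perp v)) = 16 * K v"
  "cob L K (\<lambda>_. 1) = 64 * L 0 + 32 * (\<Sum>u\<in>UNIV - {0}. L u) + 32 * (\<Sum>v\<in>UNIV - {0}. K v)"
proof -
  show "cob L K (dvec {0}) = L 0"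
    by (simp add: cob_explicit QQ_explicit QP_explicit dvec_def bv_zero)
  show "cob L K (dvec {0, u}) = - 4 * L u" if "u \<noteq> 0"
  proof (cases u rule: bv_cases)
    case (1 u1 u2 u3)
    then show ?thesis using that
      by (cases u1 rule: bit_cases01; cases u2 rule: bit_cases01; cases u3 rule: bit_cases01)
         (simp_all add: cob_explicit QQ_explicit QP_explicit dvec_def bv_zero)
  qed
  show "cob L K (dvec (perp v)) = 16 * K v" if "v \<noteq> 0"
  proof (cases v rule: bv_cases)
    case (1 v1 v2 v3)
    then show ?thesis using that
      by (cases v1 rule: bit_cases01; cases v2 rule: bit_cases01; cases v3 rule: bit_cases01)
         (simp_all add: cob_explicit QQ_explicit QP_explicit dvec_def perp_def)
  qed
  show "cob L K (\<lambda>_. 1) = 64 * L 0 + 32 * (\<Sum>u\<in>UNIV - {0}. L u) + 32 * (\<Sum>v\<in>UNIV - {0}. K v)"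
    unfolding cob_explicit sum_nonzero_bit3 unfolding bv_zero by (simp add: QQ_explicit QP_explicit)
qed

subsection \<open>Linear substitutions\<close>

definition linpair :: "(bit^3 \<Rightarrow> bit^3) \<Rightarrow> (bit^3 \<Rightarrow> bit^3) \<Rightarrow> bool" where
  "linpair A B \<longleftrightarrow> bij A \<and> bij B \<and> (\<forall>x y. A (x + y) = A x + A y) \<and> A 0 = 0 \<and> B 0 = 0 \<and> (\<forall>x y. cdot (A x) (B y) = cdot x y)"

lemma bij_nonzero:
  fixes A :: "bit^3 \<Rightarrow> bit^3"
  assumes "bij A" "A 0 = 0"
  shows "bij_betw A (UNIV - {0}) (UNIV - {0})"
proof -
  have "A u = 0 \<longleftrightarrow> u = 0" for u using assms by (metis bij_pointE)
  then have "bij_betw A {u \<in> UNIV. u \<noteq> 0} {u \<in> UNIV. u \<noteq> 0}"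
    by (intro bij_betw_Collect[OF assms(1)]) simp
  moreover have "{u \<in> UNIV. u \<noteq> 0} = UNIV - {0 :: bit^3}" by auto
  ultimately show ?thesis by simp
qed

lemma linpair_quartics:
  assumes "linpair A B"
  shows "QQ u (x \<circ> A) = QQ (A u) x" "QP v (x \<circ> A) = QP (B v) x"
proof -
  have A: "bij A" "\<And>x y. A (x + y) = A x + A y" "A 0 = 0" "\<And>x y. cdot (A x) (B y) = cdot x y"
    using assms by (auto simp: linpair_def)
  have Au: "A u = 0 \<longleftrightarrow> u = 0" for u using A(1,3) by (metis bij_pointE)
  have re: "(\<Sum>e\<in>UNIV. f (A e)) = (\<Sum>e\<in>UNIV. f e)" for f :: "bit^3 \<Rightarrow> complex"
    using sum.reindex_bij_betw[OF A(1)] .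
  show "QQ u (x \<circ> A) = QQ (A u) x"
    using re[of "\<lambda>e. x e ^ 4"] re[of "\<lambda>e. (x e)\<^sup>2 * (x (e + A u))\<^sup>2"] by (simp add: quartic_Q_def Au A(2))
  have "(\<Prod>m\<in>{m. cdot v m = 0}. x (A e + A m)) = (\<Prod>m\<in>{m. cdot (B v) m = 0}. x (A e + m))" for e
  proof (rule prod.reindex_bij_betw)
    have c: "cdot (B v) (A m) = cdot v m" for m
      using A(4)[of m v] unfolding cdot_def by (simp only: mult.commute)
    show "bij_betw A {m. cdot v m = 0} {m. cdot (B v) m = 0}"
      using bij_betw_Collect[OF A(1), of "\<lambda>m. cdot (B v) m = 0" "\<lambda>m. cdot v m = 0"] by (simp add: c)
  qed
  then show "QP v (x \<circ> A) = QP (B v) x"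
    using re[of "\<lambda>e. \<Prod>m\<in>{m. cdot (B v) m = 0}. x (e + m)"] by (simp add: quartic_Q'_def A(2))
qed

lemma cob_linpair:
  assumes AB: "linpair A B"
  shows "cob (\<lambda>u. L (A u)) (\<lambda>v. K (B v)) (x \<circ> A) = cob L K x"
proof -
  have A: "bij A" "bij B" "A 0 = 0" "B 0 = 0" "\<And>x y. cdot (A x) (B y) = cdot x y"
    using AB by (auto simp: linpair_def)
  have bA: "bij_betw A (UNIV - {0}) (UNIV - {0})" and bB: "bij_betw B (UNIV - {0}) (UNIV - {0})"
    using bij_nonzero A(1-4) by auto
  have "(\<Sum>u | cdot u v = 0. L (A u)) = (\<Sum>u | cdot u (B v) = 0. L u)" for v
  proof (rule sum.reindex_bij_betw)
    show "bij_betw A {u. cdot u v = 0} {u. cdot u (B v) = 0}"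
      using bij_betw_Collect[OF A(1), of "\<lambda>u. cdot u (B v) = 0" "\<lambda>u. cdot u v = 0"] by (simp add: A(5))
  qed
  then show ?thesis
    unfolding cob_def linpair_quartics[OF AB] A(3)
    using sum.reindex_bij_betw[OF bA, of "\<lambda>u. (L 0 + 2 * L u) * QQ u x"]
      sum.reindex_bij_betw[OF bB, of "\<lambda>v. ((\<Sum>u | cdot u v = 0. L u) + 2 * K v) * QP v x"]
    by simp
qed

lemma qcomb_linpair:
  assumes AB: "linpair A B"
  shows "\<exists>c c'. \<forall>x. qcomb b b' (x \<circ> A) = qcomb c c' x"
proof -
  have A: "bij A" "bij B" "A 0 = 0" "B 0 = 0" using AB by (auto simp: linpair_def)
  have bB: "bij_betw B (UNIV - {0}) (UNIV - {0})"
    using bij_nonzero A(2,4) by auto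
  have "qcomb b b' (x \<circ> A) = qcomb (\<lambda>u. b (inv A u)) (\<lambda>v. b' (inv B v)) x" for x
    unfolding qcomb_def linpair_quartics[OF AB]
    using sum.reindex_bij_betw[OF A(1), of "\<lambda>u. b (inv A u) * QQ u x"]
      sum.reindex_bij_betw[OF bB, of "\<lambda>v. b' (inv B v) * QP v x"] A(1,2)
    by (simp add: bij_is_inj)
  then show ?thesis by blast
qed

lemma linpairI:
  assumes "\<And>x. A (A x) = x" "\<And>x. B (B x) = x" "\<And>x y. A (x + y) = A x + A y" "\<And>x y. B (x + y) = B x + B y"
    "\<And>x y. cdot (A x) (B y) = cdot x y"
  shows "linpair A B"
proof -
  have "A 0 = 0" using assms(3)[of 0 0] by simp
  moreover have "B 0 = 0" using assms(4)[of 0 0] by simp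
  ultimately show ?thesis
    using assms by (auto simp: linpair_def intro: involuntory_imp_bij)
qed

definition sw12 :: "bit^3 \<Rightarrow> bit^3" where "sw12 e = bv (e $ 2) (e $ 1) (e $ 3)"
definition sw23 :: "bit^3 \<Rightarrow> bit^3" where "sw23 e = bv (e $ 1) (e $ 3) (e $ 2)"
definition sh12 :: "bit^3 \<Rightarrow> bit^3" where "sh12 e = bv (e $ 1) (e $ 1 + e $ 2) (e $ 3)"
definition sh12' :: "bit^3 \<Rightarrow> bit^3" where "sh12' e = bv (e $ 1 + e $ 2) (e $ 2) (e $ 3)"
definition sh23 :: "bit^3 \<Rightarrow> bit^3" where "sh23 e = bv (e $ 1) (e $ 2) (e $ 2 + e $ 3)"
definition sh23' :: "bit^3 \<Rightarrow> bit^3" where "sh23' e = bv (e $ 1) (e $ 2 + e $ 3) (e $ 3)"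

lemma bit_add_cancel: "x + (x + y) = y" "x + y + y = x" "x + (y + x) = y" for x y :: bit
  by (cases x rule: bit_cases01; cases y rule: bit_cases01; simp)+

lemma linpair_sw12: "linpair sw12 sw12"
  by (rule linpairI) (auto simp: sw12_def vec3_eq_iff cdot_def sum_3)
lemma linpair_sw23: "linpair sw23 sw23"
  by (rule linpairI) (auto simp: sw23_def vec3_eq_iff cdot_def sum_3)
lemma linpair_sh12: "linpair sh12 sh12'"
proof (rule linpairI)
  show "cdot (sh12 x) (sh12' y) = cdot x y" for x y
    by (cases x rule: bv_cases; cases y rule: bv_cases; cases "x $ 1" rule: bit_cases01; cases "x $ 2" rule:
        bit_cases01; cases "x $ 3" rule: bit_cases01; cases "y $ 1" rule: bit_cases01; cases "y $ 2" rule: bit_cases01;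
        cases "y $ 3" rule: bit_cases01)
       (simp_all add: sh12_def sh12'_def add_ac bit_add_cancel)
  show "sh12 (sh12 x) = x" for x by (cases "x $ 1" rule: bit_cases01; cases "x $ 2" rule: bit_cases01; cases "x $ 3"
      rule: bit_cases01; simp add: sh12_def vec3_eq_iff)
  show "sh12 (x + y) = sh12 x + sh12 y" for x y by (cases "x $ 1" rule: bit_cases01; cases "x $ 2" rule: bit_cases01;
      cases "x $ 3" rule: bit_cases01; cases "y $ 1" rule: bit_cases01; cases "y $ 2" rule: bit_cases01; cases "y $ 3"
      rule: bit_cases01; simp add: sh12_def vec3_eq_iff)
  show "sh12' (sh12' x) = x" for x by (cases "x $ 1" rule: bit_cases01; cases "x $ 2" rule: bit_cases01; cases "x $ 3"
      rule: bit_cases01; simp add: sh12'_def vec3_eq_iff)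
  show "sh12' (x + y) = sh12' x + sh12' y" for x y by (cases "x $ 1" rule: bit_cases01; cases "x $ 2" rule: bit_cases01;
      cases "x $ 3" rule: bit_cases01; cases "y $ 1" rule: bit_cases01; cases "y $ 2" rule: bit_cases01; cases "y $ 3"
      rule: bit_cases01; simp add: sh12'_def vec3_eq_iff)
qed
lemma linpair_sh23: "linpair sh23 sh23'"
proof (rule linpairI)
  show "cdot (sh23 x) (sh23' y) = cdot x y" for x y
    by (cases x rule: bv_cases; cases y rule: bv_cases; cases "x $ 1" rule: bit_cases01; cases "x $ 2" rule:
        bit_cases01; cases "x $ 3" rule: bit_cases01; cases "y $ 1" rule: bit_cases01; cases "y $ 2" rule: bit_cases01;
        cases "y $ 3" rule: bit_cases01)
       (simp_all add: sh23_def sh23'_def add_ac bit_add_cancel)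
  show "sh23 (sh23 x) = x" for x by (cases "x $ 1" rule: bit_cases01; cases "x $ 2" rule: bit_cases01; cases "x $ 3"
      rule: bit_cases01; simp add: sh23_def vec3_eq_iff)
  show "sh23 (x + y) = sh23 x + sh23 y" for x y by (cases "x $ 1" rule: bit_cases01; cases "x $ 2" rule: bit_cases01;
      cases "x $ 3" rule: bit_cases01; cases "y $ 1" rule: bit_cases01; cases "y $ 2" rule: bit_cases01; cases "y $ 3"
      rule: bit_cases01; simp add: sh23_def vec3_eq_iff)
  show "sh23' (sh23' x) = x" for x by (cases "x $ 1" rule: bit_cases01; cases "x $ 2" rule: bit_cases01; cases "x $ 3"
      rule: bit_cases01; simp add: sh23'_def vec3_eq_iff)
  show "sh23' (x + y) = sh23' x + sh23' y" for x y by (cases "x $ 1" rule: bit_cases01; cases "x $ 2" rule: bit_cases01;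
      cases "x $ 3" rule: bit_cases01; cases "y $ 1" rule: bit_cases01; cases "y $ 2" rule: bit_cases01; cases "y $ 3"
      rule: bit_cases01; simp add: sh23'_def vec3_eq_iff)
qed

lemma CF_sw12:
  assumes S: "siegel6 a b c d e f"
  shows "CF (sm d b e a c f) (x \<circ> sw12) = CF (sm a b c d e f) x"
proof -
  have "SL u (sm d b e a c f) = SL (sw12 u) (sm a b c d e f)" "SK u (sm d b e a c f) = SK (sw12 u) (sm a b c d e f)" for u
    by (cases u rule: bv_cases; simp add: S_P12[OF S] sw12_def)+
  then show ?thesis using cob_linpair[OF linpair_sw12] by (simp add: CF_def)
qed

lemma CF_sw23:
  assumes S: "siegel6 a b c d e f"
  shows "CF (sm a c b f e d) (x \<circ> sw23) = CF (sm a b c d e f) x"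
proof -
  have "SL u (sm a c b f e d) = SL (sw23 u) (sm a b c d e f)" "SK u (sm a c b f e d) = SK (sw23 u) (sm a b c d e f)" for u
    by (cases u rule: bv_cases; simp add: S_P23[OF S] sw23_def)+
  then show ?thesis using cob_linpair[OF linpair_sw23] by (simp add: CF_def)
qed

lemma CF_sh12:
  assumes S: "siegel6 a b c d e f"
  shows "CF (sm (a + 2 * b + d) (b + d) (c + e) d e f) (x \<circ> sh12) = CF (sm a b c d e f) x"
proof -
  have "SL u (sm (a + 2 * b + d) (b + d) (c + e) d e f) = SL (sh12 u) (sm a b c d e f)"
    "SK u (sm (a + 2 * b + d) (b + d) (c + e) d e f) = SK (sh12' u) (sm a b c d e f)" for u
    by (cases u rule: bv_cases; simp add: S_U[OF S] sh12_def sh12'_def)+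
  then show ?thesis using cob_linpair[OF linpair_sh12] by (simp add: CF_def)
qed

lemma CF_sh23:
  assumes S: "siegel6 a b c d e f"
  shows "CF (sm a (b + c) c (d + 2 * e + f) (e + f) f) (x \<circ> sh23) = CF (sm a b c d e f) x"
proof -
  have "SL u (sm a (b + c) c (d + 2 * e + f) (e + f) f) = SL (sh23 u) (sm a b c d e f)"
    "SK u (sm a (b + c) c (d + 2 * e + f) (e + f) f) = SK (sh23' u) (sm a b c d e f)" for u
    by (cases u rule: bv_cases; simp add: S_shear23[OF S] sh23_def sh23'_def)+
  then show ?thesis using cob_linpair[OF linpair_sh23] by (simp add: CF_def)
qed

subsection \<open>Translations\<close>

definition rhoT11 :: "(bit^3 \<Rightarrow> complex) \<Rightarrow> bit^3 \<Rightarrow> complex" where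
  "rhoT11 x e = (if e $ 1 = 1 then \<i> else 1) * x e"

lemma quartics_T11:
  "QQ (bv u1 u2 u3) (rhoT11 x) = (if u1 = 1 then -1 else 1) * QQ (bv u1 u2 u3) x"
  "v2 = 1 \<or> v3 = 1 \<Longrightarrow> QP (bv v1 v2 v3) (rhoT11 x) = - QP (bv v1 v2 v3) x"
  "QP (bv 1 0 0) (rhoT11 x) = QP (bv 1 0 0) x"
proof -
  have i4: "(\<i> * y) ^ 4 = y ^ 4" "(\<i> * y)\<^sup>2 = - y\<^sup>2" for y by (simp_all add: power_mult_distrib)
  show "QQ (bv u1 u2 u3) (rhoT11 x) = (if u1 = 1 then -1 else 1) * QQ (bv u1 u2 u3) x"
    by (cases u1 rule: bit_cases01; cases u2 rule: bit_cases01; cases u3 rule: bit_cases01)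
       (simp_all add: QQ_explicit rhoT11_def i4 power_mult_distrib)
  show "v2 = 1 \<or> v3 = 1 \<Longrightarrow> QP (bv v1 v2 v3) (rhoT11 x) = - QP (bv v1 v2 v3) x"
    by (cases v1 rule: bit_cases01; cases v2 rule: bit_cases01; cases v3 rule: bit_cases01)
       (simp_all add: QP_explicit rhoT11_def algebra_simps)
  show "QP (bv 1 0 0) (rhoT11 x) = QP (bv 1 0 0) x"
    by (simp add: QP_explicit rhoT11_def algebra_simps)
qed

lemma qcomb_rhoT11: "\<exists>c c'. \<forall>x. qcomb b b' (rhoT11 x) = qcomb c c' x"
proof -
  have "qcomb b b' (rhoT11 x) = qcomb (\<lambda>u. (if u $ 1 = 1 then -1 else 1) * b u) (\<lambda>v. (if v = bv 1 0 0 then 1 else -1) *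
      b' v) x" for x
    by (simp add: qcomb_explicit quartics_T11)
  then show ?thesis by blast
qed

lemma CF_T11:
  assumes S: "siegel6 a b c d e f"
  shows "CF (sm (a + 1) b c d e f) (rhoT11 x) = CF (sm a b c d e f) x"
  unfolding CF_def cob_explicit
  by (simp add: quartics_T11 SL_T11[OF S] SK_T11[OF S] S_T11_fixed[OF S]) (simp add: algebra_simps)

definition rhoT22 :: "(bit^3 \<Rightarrow> complex) \<Rightarrow> bit^3 \<Rightarrow> complex" where
  "rhoT22 x e = (if e $ 2 = 1 then \<i> else 1) * x e"
definition rhoT12 :: "(bit^3 \<Rightarrow> complex) \<Rightarrow> bit^3 \<Rightarrow> complex" where
  "rhoT12 x e = (if e $ 1 = 1 \<and> e $ 2 = 1 then -1 else 1) * x e"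

lemma sh_invol [simp]: "sw12 (sw12 e) = e" "sw23 (sw23 e) = e" "sh12 (sh12 e) = e" "sh23 (sh23 e) = e"
  by (cases "e $ 1" rule: bit_cases01; cases "e $ 2" rule: bit_cases01; cases "e $ 3" rule: bit_cases01; simp add:
      sw12_def sw23_def sh12_def sh23_def vec3_eq_iff)+

lemma comp_invol [simp]: "x \<circ> sw12 \<circ> sw12 = x" "x \<circ> sw23 \<circ> sw23 = x" "x \<circ> sh12 \<circ> sh12 = x" "x \<circ> sh23 \<circ> sh23 = x"
  by (simp_all add: fun_eq_iff)

lemma CF_T22:
  assumes S: "siegel6 a b c d e f"
  shows "CF (sm a b c (d + 1) e f) (rhoT22 x) = CF (sm a b c d e f) x"
proof -
  note S1 = siegel6_swap12[OF S]
  have "rhoT22 x = rhoT11 (x \<circ> sw12) \<circ> sw12"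
    by (simp add: fun_eq_iff rhoT22_def rhoT11_def) (simp add: sw12_def)
  then have "CF (sm a b c (d + 1) e f) (rhoT22 x) = CF (sm (d + 1) b e a c f) (rhoT11 (x \<circ> sw12))"
    by (simp only: CF_sw12[OF siegel6_T11[OF S1]])
  also have "\<dots> = CF (sm d b e a c f) (x \<circ> sw12)" by (rule CF_T11[OF S1])
  also have "\<dots> = CF (sm a b c d e f) x" by (rule CF_sw12[OF S])
  finally show ?thesis .
qed

lemma CF_T12:
  assumes S: "siegel6 a b c d e f"
  shows "CF (sm a (b + 1) c d e f) (rhoT12 x) = CF (sm a b c d e f) x"
proof -
  note S' = siegel6_unshear[OF S]
  have S'': "siegel6 (a - 2 * b + d) (b - d) (c - e) (d + 1) e f" using S' by (simp add: siegel6_def)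
  have S1: "siegel6 a (b + 1) c (d + 1) e f" using S by (simp add: siegel6_def)
  have "CF (sm (a + 1) (b + 1) c (d + 1) e f) (rhoT22 (x \<circ> sh12) \<circ> sh12) =
      CF (sm (a - 2 * b + d) (b - d) (c - e) (d + 1) e f) (rhoT22 (x \<circ> sh12))"
    using CF_sh12[OF S''] by (simp add: algebra_simps)
  also have "\<dots> = CF (sm (a - 2 * b + d) (b - d) (c - e) d e f) (x \<circ> sh12)" by (rule CF_T22[OF S'])
  also have "\<dots> = CF (sm a b c d e f) (x \<circ> sh12 \<circ> sh12)"
    using CF_sh12[OF S', of "x \<circ> sh12"] by (simp add: algebra_simps)
  finally have 1: "CF (sm (a + 1) (b + 1) c (d + 1) e f) (rhoT22 (x \<circ> sh12) \<circ> sh12) = CF (sm a b c d e f) x" by simp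
  have "rhoT22 (x \<circ> sh12) \<circ> sh12 = rhoT11 (rhoT22 (rhoT12 x))"
  proof
    fix e :: "bit^3"
    show "(rhoT22 (x \<circ> sh12) \<circ> sh12) e = rhoT11 (rhoT22 (rhoT12 x)) e"
    proof (cases e rule: bv_cases)
      case (1 e1 e2 e3)
      show ?thesis unfolding 1
        by (cases e1 rule: bit_cases01; cases e2 rule: bit_cases01)
           (simp_all add: rhoT22_def rhoT11_def rhoT12_def sh12_def)
    qed
  qed
  then have "CF (sm (a + 1) (b + 1) c (d + 1) e f) (rhoT22 (x \<circ> sh12) \<circ> sh12) = CF (sm a (b + 1) c (d + 1) e f) (rhoT22
      (rhoT12 x))"
    by (simp only: CF_T11[OF S1])
  also have "\<dots> = CF (sm a (b + 1) c d e f) (rhoT12 x)" by (rule CF_T22) (use S in \<open>simp add: siegel6_def\<close>)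
  finally show ?thesis using 1 by simp
qed

subsection \<open>The partial inversion\<close>

text \<open>The fourth power of the factor \<open>c\<close> in the inversion formula for the second order theta functions
  is \<open>- a\<^sup>2 / 4\<close>; \<open>kappa\<close> is a fourth root of what remains of it after division by the square of the
  automorphy factor \<open>a\<close>.\<close>

definition kappa :: complex where "kappa = zeta8 / of_real (sqrt 2)"

lemma kappa_power: "kappa ^ 4 = - 1 / 4"
proof -
  have "sqrt 2 ^ 4 = 4" by (simp add: power4_eq_xxxx)
  then have "(of_real (sqrt 2) :: complex) ^ 4 = 4"
    by (metis of_real_power of_real_numeral)
  then show ?thesis by (simp add: kappa_def power_divide zeta8_power)
qed

definition rhoJ0 :: "(bit^3 \<Rightarrow> complex) \<Rightarrow> bit^3 \<Rightarrow> complex" where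
  "rhoJ0 x e = x (bv 0 (e $ 2) (e $ 3)) + (if e $ 1 = 1 then -1 else 1) * x (bv 1 (e $ 2) (e $ 3))"

definition rhoJ :: "(bit^3 \<Rightarrow> complex) \<Rightarrow> bit^3 \<Rightarrow> complex" where
  "rhoJ x e = kappa * rhoJ0 x e"

lemma quartics_J:
  "QQ (bv 0 0 0) (rhoJ0 x) = 2 * QQ (bv 0 0 0) x + 12 * QQ (bv 1 0 0) x"
  "QQ (bv 1 0 0) (rhoJ0 x) = QQ (bv 0 0 0) x - 2 * QQ (bv 1 0 0) x"
  "QQ (bv 0 0 1) (rhoJ0 x) = 2 * QQ (bv 0 0 1) x + 2 * QQ (bv 1 0 1) x + 8 * QP (bv 0 1 0) x"
  "QQ (bv 0 1 0) (rhoJ0 x) = 2 * QQ (bv 0 1 0) x + 2 * QQ (bv 1 1 0) x + 8 * QP (bv 0 0 1) x"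
  "QQ (bv 0 1 1) (rhoJ0 x) = 2 * QQ (bv 0 1 1) x + 2 * QQ (bv 1 1 1) x + 8 * QP (bv 0 1 1) x"
  "QQ (bv 1 0 1) (rhoJ0 x) = 2 * QQ (bv 0 0 1) x + 2 * QQ (bv 1 0 1) x - 8 * QP (bv 0 1 0) x"
  "QQ (bv 1 1 0) (rhoJ0 x) = 2 * QQ (bv 0 1 0) x + 2 * QQ (bv 1 1 0) x - 8 * QP (bv 0 0 1) x"
  "QQ (bv 1 1 1) (rhoJ0 x) = 2 * QQ (bv 0 1 1) x + 2 * QQ (bv 1 1 1) x - 8 * QP (bv 0 1 1) x"
  "QP (bv 0 0 1) (rhoJ0 x) = QQ (bv 0 1 0) x - QQ (bv 1 1 0) x"
  "QP (bv 0 1 0) (rhoJ0 x) = QQ (bv 0 0 1) x - QQ (bv 1 0 1) x"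
  "QP (bv 0 1 1) (rhoJ0 x) = QQ (bv 0 1 1) x - QQ (bv 1 1 1) x"
  "QP (bv 1 0 0) (rhoJ0 x) = 2 * (QP (bv 1 0 0) x + QP (bv 1 0 1) x + QP (bv 1 1 0) x + QP (bv 1 1 1) x)"
  "QP (bv 1 0 1) (rhoJ0 x) = 2 * (QP (bv 1 0 0) x + QP (bv 1 0 1) x - QP (bv 1 1 0) x - QP (bv 1 1 1) x)"
  "QP (bv 1 1 0) (rhoJ0 x) = 2 * (QP (bv 1 0 0) x - QP (bv 1 0 1) x + QP (bv 1 1 0) x - QP (bv 1 1 1) x)"
  "QP (bv 1 1 1) (rhoJ0 x) = 2 * (QP (bv 1 0 0) x - QP (bv 1 0 1) x - QP (bv 1 1 0) x + QP (bv 1 1 1) x)"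
  unfolding QQ_explicit QP_explicit
  by (simp_all add: rhoJ0_def power4_eq_xxxx power2_eq_square algebra_simps)

lemma W'_intros:
  "QQ u \<in> W'" "v \<noteq> 0 \<Longrightarrow> QP v \<in> W'" "q \<in> W' \<Longrightarrow> r \<in> W' \<Longrightarrow> (\<lambda>x. q x + r x) \<in> W'"
  "q \<in> W' \<Longrightarrow> (\<lambda>x. k * q x) \<in> W'"
  unfolding W'_def by (auto intro: cspan_base cspan_add cspan_scale)

lemma W'_diff: "q \<in> W' \<Longrightarrow> r \<in> W' \<Longrightarrow> (\<lambda>x. q x - r x) \<in> W'"
  using W'_intros(3)[OF _ W'_intros(4), of q r "-1"] by simp

lemma W'_sum: "(\<And>i. i \<in> I \<Longrightarrow> f i \<in> W') \<Longrightarrow> (\<lambda>x. \<Sum>i\<in>I. f i x) \<in> W'"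
  unfolding W'_def by (rule cspan_sum)

lemma qcomb_W': "qcomb b b' \<in> W'" unfolding W'_iff by blast

lemma W'_rhoJ:
  assumes "q \<in> W'"
  shows "(\<lambda>x. q (rhoJ x)) \<in> W'"
proof -
  obtain b b' where q: "q = qcomb b b'" using assms W'_iff by blast
  have QQ: "(\<lambda>x. QQ u (rhoJ0 x)) \<in> W'" for u
  proof (cases u rule: bv_cases)
    case (1 u1 u2 u3)
    show ?thesis unfolding 1
      by (cases u1 rule: bit_cases01; cases u2 rule: bit_cases01; cases u3 rule: bit_cases01; simp only: quartics_J)
         (intro W'_intros W'_diff; simp)+
  qed
  have QP: "(\<lambda>x. QP v (rhoJ0 x)) \<in> W'" if "v \<noteq> 0" for v
  proof (cases v rule: bv_cases)
    case (1 v1 v2 v3)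
    show ?thesis using that unfolding 1
      by (cases v1 rule: bit_cases01; cases v2 rule: bit_cases01; cases v3 rule: bit_cases01; simp only: quartics_J
          bv_eq_zero_iff simp_thms)
         (intro W'_intros W'_diff; simp)+
  qed
  have "(\<lambda>x. (\<Sum>u\<in>UNIV. b u * QQ u (rhoJ0 x)) + (\<Sum>v\<in>UNIV - {0}. b' v * QP v (rhoJ0 x))) \<in> W'"
    by (intro W'_intros(3) W'_sum W'_intros(4) QQ QP) auto
  then have "(\<lambda>x. kappa ^ 4 * qcomb b b' (rhoJ0 x)) \<in> W'"
    unfolding qcomb_def by (rule W'_intros(4))
  then show ?thesis unfolding q rhoJ_def[abs_def] qcomb_scale .
qed

lemma CF_W': "CF \<tau> \<in> W'" using CF_qcomb[of \<tau>] W'_iff by blast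

lemma CF_scale: "CF \<tau> (\<lambda>e. k * x e) = k ^ 4 * CF \<tau> x"
  using CF_qcomb[of \<tau>] qcomb_scale by auto

lemma CF_dvec:
  "CF \<tau> (dvec {0}) = SL 0 \<tau>"
  "u \<noteq> 0 \<Longrightarrow> CF \<tau> (dvec {0, u}) = - 4 * SL u \<tau>"
  "v \<noteq> 0 \<Longrightarrow> CF \<tau> (dvec (perp v)) = 16 * SK v \<tau>"
  by (simp_all add: CF_def cob_dvec)

lemma CF_ones:
  assumes "siegel6 a b c d e f"
  shows "CF (sm a b c d e f) (\<lambda>_. 1) = - 64 * SK (bv 0 0 0) (sm a b c d e f)"
proof -
  have "CF (sm a b c d e f) (\<lambda>_. 1) = 32 * form_defect (sm a b c d e f) - 64 * SK (bv 0 0 0) (sm a b c d e f)"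
    unfolding CF_def cob_dvec sum_nonzero_bit3 form_defect_def unfolding bv_zero by simp
  then show ?thesis by (simp add: form_defect_zero[OF assms])
qed

definition inversion_ok :: "(bit^3 \<Rightarrow> complex) \<Rightarrow> bool" where
  "inversion_ok x \<longleftrightarrow> (\<forall>a b c d e f. siegel6 a b c d e f \<longrightarrow> CF (invm a b c d e f) (rhoJ x) = a ^ 14 * CF (sm a b c d e f) x)"

lemma inversion_ok_sw23: "inversion_ok x \<Longrightarrow> inversion_ok (x \<circ> sw23)"
  unfolding inversion_ok_def
proof (intro allI impI)
  fix a b c d e f
  assume g: "\<forall>a b c d e f. siegel6 a b c d e f \<longrightarrow> CF (invm a b c d e f) (rhoJ x) = a ^ 14 * CF (sm a b c d e f) x"
    and S: "siegel6 a b c d e f"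
  have r: "rhoJ (x \<circ> sw23) = rhoJ x \<circ> sw23"
    by (simp add: fun_eq_iff rhoJ_def rhoJ0_def sw23_def)
  have "CF (invm a b c d e f) (rhoJ x \<circ> sw23) = CF (sm (- 1 / a) (c / a) (b / a) (f - c\<^sup>2 / a) (e - b * c / a) (d - b\<^sup>2
      / a)) (rhoJ x \<circ> sw23 \<circ> sw23)"
    by (rule CF_sw23[OF siegel6_inversion[OF S], symmetric])
  also have "\<dots> = CF (invm a c b f e d) (rhoJ x)" by (simp add: mult.commute)
  also have "\<dots> = a ^ 14 * CF (sm a c b f e d) x" using g siegel6_swap23[OF S] by blast
  also have "CF (sm a c b f e d) x = CF (sm a b c d e f) (x \<circ> sw23)"
    using CF_sw23[OF S, of "x \<circ> sw23"] by simp
  finally show "CF (invm a b c d e f) (rhoJ (x \<circ> sw23)) = a ^ 14 * CF (sm a b c d e f) (x \<circ> sw23)" unfolding r .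
qed

lemma inversion_ok_sh23: "inversion_ok x \<Longrightarrow> inversion_ok (x \<circ> sh23)"
  unfolding inversion_ok_def
proof (intro allI impI)
  fix a b c d e f
  assume g: "\<forall>a b c d e f. siegel6 a b c d e f \<longrightarrow> CF (invm a b c d e f) (rhoJ x) = a ^ 14 * CF (sm a b c d e f) x"
    and S: "siegel6 a b c d e f"
  have a: "a \<noteq> 0" using siegel6_Im_pos[OF S] by auto
  have r: "rhoJ (x \<circ> sh23) = rhoJ x \<circ> sh23"
    by (simp add: fun_eq_iff rhoJ_def rhoJ0_def sh23_def)
  have "CF (invm a b c d e f) (rhoJ x \<circ> sh23) = CF (sm (- 1 / a) (b / a + c / a) (c / a) ((d - b\<^sup>2 / a) + 2 * (e - b * c
      / a) + (f - c\<^sup>2 / a)) ((e - b * c / a) + (f - c\<^sup>2 / a)) (f - c\<^sup>2 / a)) (rhoJ x \<circ> sh23 \<circ> sh23)"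
    by (rule CF_sh23[OF siegel6_inversion[OF S], symmetric])
  also have "sm (- 1 / a) (b / a + c / a) (c / a) ((d - b\<^sup>2 / a) + 2 * (e - b * c / a) + (f - c\<^sup>2 / a)) ((e - b * c / a)
      + (f - c\<^sup>2 / a)) (f - c\<^sup>2 / a)
     = invm a (b + c) c (d + 2 * e + f) (e + f) f"
  proof -
    have "b / a + c / a = (b + c) / a" "(d - b\<^sup>2 / a) + 2 * (e - b * c / a) + (f - c\<^sup>2 / a) = d + 2 * e + f - (b + c)\<^sup>2 / a"
      "(e - b * c / a) + (f - c\<^sup>2 / a) = e + f - (b + c) * c / a"
      using a by (simp_all add: field_simps power2_eq_square)
    then show ?thesis by (simp only:)
  qed
  also have "CF (invm a (b + c) c (d + 2 * e + f) (e + f) f) (rhoJ x \<circ> sh23 \<circ> sh23) = a ^ 14 * CF (sm a (b + c) c (d + 2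
      * e + f) (e + f) f) x"
    using g siegel6_shear23[OF S] by simp
  also have "CF (sm a (b + c) c (d + 2 * e + f) (e + f) f) x = CF (sm a b c d e f) (x \<circ> sh23)"
    using CF_sh23[OF S, of "x \<circ> sh23"] by simp
  finally show "CF (invm a b c d e f) (rhoJ (x \<circ> sh23)) = a ^ 14 * CF (sm a b c d e f) (x \<circ> sh23)" unfolding r .
qed

lemma dvec_comp:
  "dvec {0, u} \<circ> sw23 = dvec {0, sw23 u}" "dvec {0, u} \<circ> sh23 = dvec {0, sh23 u}"
  "dvec (perp v) \<circ> sw23 = dvec (perp (sw23 v))" "dvec (perp v) \<circ> sh23 = dvec (perp (sh23' v))"
proof -
  have z: "sw23 0 = 0" "sh23 0 = 0" by (simp_all add: sw23_def sh23_def)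
  have "sw23 e = 0 \<longleftrightarrow> e = 0" "sh23 e = 0 \<longleftrightarrow> e = 0" "sw23 e = u \<longleftrightarrow> e = sw23 u" "sh23 e = u \<longleftrightarrow> e = sh23 u" for e
    using sh_invol z by metis+
  then show "dvec {0, u} \<circ> sw23 = dvec {0, sw23 u}" "dvec {0, u} \<circ> sh23 = dvec {0, sh23 u}"
    by (simp_all add: fun_eq_iff dvec_def)
  have "cdot v (sw23 e) = cdot (sw23 v) e" "cdot v (sh23 e) = cdot (sh23' v) e" for e
    by (cases "e $ 1" rule: bit_cases01; cases "e $ 2" rule: bit_cases01; cases "e $ 3" rule: bit_cases01; cases "v $ 1"
        rule: bit_cases01; cases "v $ 2" rule: bit_cases01; cases "v $ 3" rule: bit_cases01; simp add: cdot_def sum_3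
        sw23_def sh23_def sh23'_def)+
  then show "dvec (perp v) \<circ> sw23 = dvec (perp (sw23 v))" "dvec (perp v) \<circ> sh23 = dvec (perp (sh23' v))"
    by (simp_all add: fun_eq_iff dvec_def perp_def)
qed

lemma rhoJ0_vectors:
  "rhoJ0 (dvec {0}) = dvec {0, bv 1 0 0}"
  "rhoJ0 (dvec {0, bv 1 0 0}) = (\<lambda>e. 2 * dvec {0} e)"
  "rhoJ0 (dvec {0, bv 0 1 0}) = dvec (perp (bv 0 0 1))"
  "rhoJ0 (dvec (perp (bv 0 0 1))) = (\<lambda>e. 2 * dvec {0, bv 0 1 0} e)"
  "rhoJ0 (dvec {0, bv 1 1 0}) = rhoT12 (dvec (perp (bv 0 0 1)))"
  "rhoJ0 (dvec (perp (bv 1 0 0))) = (\<lambda>_. 1)"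
  "rhoJ0 (dvec (perp (bv 1 1 0))) = rhoT12 (\<lambda>_. 1)"
proof -
  have ext: "x = y" if "\<forall>e1\<in>{0,1}. \<forall>e2\<in>{0,1}. \<forall>e3\<in>{0,1}. x (bv e1 e2 e3) = y (bv e1 e2 e3)" for x y :: "bit^3 \<Rightarrow> complex"
  proof
    fix e
    have b: "t \<in> {0, 1}" for t :: bit by (cases t rule: bit_cases01) auto
    show "x e = y e" using that b by (cases e rule: bv_cases) blast
  qed
  show "rhoJ0 (dvec {0}) = dvec {0, bv 1 0 0}"
  "rhoJ0 (dvec {0, bv 1 0 0}) = (\<lambda>e. 2 * dvec {0} e)"
  "rhoJ0 (dvec {0, bv 0 1 0}) = dvec (perp (bv 0 0 1))"
  "rhoJ0 (dvec (perp (bv 0 0 1))) = (\<lambda>e. 2 * dvec {0, bv 0 1 0} e)"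
  "rhoJ0 (dvec {0, bv 1 1 0}) = rhoT12 (dvec (perp (bv 0 0 1)))"
  "rhoJ0 (dvec (perp (bv 1 0 0))) = (\<lambda>_. 1)"
  "rhoJ0 (dvec (perp (bv 1 1 0))) = rhoT12 (\<lambda>_. 1)"
    by (rule ext; simp add: rhoJ0_def dvec_def perp_def rhoT12_def)+
qed

lemma CF_rhoT12_shift:
  assumes "siegel6 a b c d e f"
  shows "CF (sm a b c d e f) (rhoT12 x) = CF (sm a (b + 1) c d e f) x"
proof -
  have "rhoT12 (rhoT12 x) = x" by (simp add: fun_eq_iff rhoT12_def)
  then show ?thesis using CF_T12[OF assms, of "rhoT12 x"] by simp
qed

lemma CF_inversion:
  assumes S: "siegel6 a b c d e f"
  shows "CF (invm a b c d e f) (rhoJ x) = a ^ 14 * CF (sm a b c d e f) x"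
proof -
  have rJ: "CF \<tau> (rhoJ x) = - 1 / 4 * CF \<tau> (rhoJ0 x)" for \<tau> x
    unfolding rhoJ_def[abs_def] CF_scale kappa_power ..
  note nz = bv_eq_zero_iff one_neq_zero simp_thms
  have g0: "inversion_ok (dvec {0})"
    unfolding inversion_ok_def rJ rhoJ0_vectors by (intro allI impI, simp only: CF_dvec nz, simp only: bv_zero S_J, simp)
  have g1: "inversion_ok (dvec {0, bv 1 0 0})"
    unfolding inversion_ok_def rJ rhoJ0_vectors CF_scale by (intro allI impI, simp only: CF_dvec nz, simp only: bv_zero S_J, simp)
  have g2: "inversion_ok (dvec {0, bv 0 1 0})"
    unfolding inversion_ok_def rJ rhoJ0_vectors by (intro allI impI, simp only: CF_dvec nz, simp only: bv_zero S_J, simp)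
  have g3: "inversion_ok (dvec (perp (bv 0 0 1)))"
    unfolding inversion_ok_def rJ rhoJ0_vectors CF_scale by (intro allI impI, simp only: CF_dvec nz, simp only: bv_zero S_J, simp)
  have g4: "inversion_ok (dvec {0, bv 1 1 0})"
    unfolding inversion_ok_def rJ rhoJ0_vectors
    by (intro allI impI, simp only: CF_rhoT12_shift[OF siegel6_inversion] CF_dvec nz, simp only: bv_zero S_JT12, simp)
  have g5: "inversion_ok (dvec (perp (bv 1 0 0)))"
    unfolding inversion_ok_def rJ rhoJ0_vectors
    by (intro allI impI, simp only: CF_ones[OF siegel6_inversion] CF_dvec nz, simp only: bv_zero S_J, simp)
  have g6: "inversion_ok (dvec (perp (bv 1 1 0)))"
    unfolding inversion_ok_def rJ rhoJ0_vectors
    by (intro allI impI, simp only: CF_rhoT12_shift[OF siegel6_inversion] CF_ones[OF siegel6_T12[OF siegel6_inversion]]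
        CF_dvec nz, simp only: bv_zero S_JT12, simp)
  have sv: "sw23 (bv u1 u2 u3) = bv u1 u3 u2" "sh23 (bv u1 u2 u3) = bv u1 u2 (u2 + u3)" "sh23' (bv u1 u2 u3) = bv u1 (u2
      + u3) u3" for u1 u2 u3
    by (simp_all add: sw23_def sh23_def sh23'_def)
  have g7: "inversion_ok (dvec {0, bv 0 0 1})" using inversion_ok_sw23[OF g2] by (simp add: dvec_comp sv)
  have g8: "inversion_ok (dvec {0, bv 0 1 1})" using inversion_ok_sh23[OF g2] by (simp add: dvec_comp sv)
  have g9: "inversion_ok (dvec {0, bv 1 0 1})" using inversion_ok_sw23[OF g4] by (simp add: dvec_comp sv)
  have g10: "inversion_ok (dvec {0, bv 1 1 1})" using inversion_ok_sh23[OF g4] by (simp add: dvec_comp sv)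
  have g11: "inversion_ok (dvec (perp (bv 0 1 0)))" using inversion_ok_sw23[OF g3] by (simp add: dvec_comp sv)
  have g12: "inversion_ok (dvec (perp (bv 0 1 1)))" using inversion_ok_sh23[OF g3] by (simp add: dvec_comp sv)
  have g13: "inversion_ok (dvec (perp (bv 1 0 1)))" using inversion_ok_sw23[OF g6] by (simp add: dvec_comp sv)
  have g14: "inversion_ok (dvec (perp (bv 1 1 1)))" using inversion_ok_sh23[OF g13] by (simp add: dvec_comp sv)
  have gu: "inversion_ok (dvec {0, u})" for u
  proof (cases u rule: bv_cases)
    case (1 u1 u2 u3)
    show ?thesis unfolding 1 using g0 g1 g2 g4 g7 g8 g9 g10
      by (cases u1 rule: bit_cases01; cases u2 rule: bit_cases01; cases u3 rule: bit_cases01)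
         (simp_all flip: bv_zero)
  qed
  have gv: "inversion_ok (dvec (perp v))" if "v \<noteq> 0" for v
  proof (cases v rule: bv_cases)
    case (1 v1 v2 v3)
    show ?thesis using that unfolding 1 using g3 g5 g6 g11 g12 g13 g14
      by (cases v1 rule: bit_cases01; cases v2 rule: bit_cases01; cases v3 rule: bit_cases01) simp_all
  qed
  have "(\<lambda>x. CF (invm a b c d e f) (rhoJ x) - a ^ 14 * CF (sm a b c d e f) x) \<in> W'"
    by (intro W'_diff W'_rhoJ W'_intros(4) CF_W')
  then obtain q q' where q: "(\<lambda>x. CF (invm a b c d e f) (rhoJ x) - a ^ 14 * CF (sm a b c d e f) x) = qcomb q q'"
    unfolding W'_iff by blast
  have q0: "qcomb q q' x = CF (invm a b c d e f) (rhoJ x) - a ^ 14 * CF (sm a b c d e f) x" for x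
    unfolding q[symmetric] ..
  have "qcomb q q' x = 0"
  proof (rule qcomb_determined(3))
    show "qcomb q q' (dvec {0, u}) = 0" for u using gu[of u] S unfolding q0 inversion_ok_def by simp
    show "qcomb q q' (dvec (perp v)) = 0" if "v \<noteq> 0" for v using gv[OF that] S unfolding q0 inversion_ok_def by simp
  qed
  then show ?thesis by (simp add: q0)
qed

section \<open>Generators of the integral symplectic group\<close>

lemma sum_UNIV_plus: "(\<Sum>p\<in>UNIV. f p) = (\<Sum>i\<in>UNIV. f (Inl i)) + (\<Sum>i\<in>UNIV. f (Inr i))"
  for f :: "'a::finite + 'b::finite \<Rightarrow> 'c::comm_monoid_add"
  using sum.Plus[of "UNIV :: 'a set" "UNIV :: 'b set" f] by (simp add: UNIV_Plus_UNIV comp_def)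

definition omega :: "int^(3 + 3) \<Rightarrow> int^(3 + 3) \<Rightarrow> int" where
  "omega x y = (\<Sum>i\<in>UNIV. x $ Inl i * y $ Inr i - x $ Inr i * y $ Inl i)"

lemma Sp6Z_iff: "g \<in> Sp6Z \<longleftrightarrow> (\<forall>p q. omega (column p g) (column q g) = symp_form $ p $ q)"
proof -
  have "(transpose g ** symp_form ** g) $ p $ q = omega (column p g) (column q g)" for p q
    by (simp add: matrix_matrix_mult_def transpose_def symp_form_def omega_def column_def sum_UNIV_plus sum_3)
  then show ?thesis by (simp add: Sp6Z_def vec_eq_iff)
qed

lemma omega_axis:
  "omega (axis (Inl i) c) y = c * y $ Inr i" "omega (axis (Inr i) c) y = - c * y $ Inl i"
  using exhaust_3[of i] by (auto simp: omega_def axis_def sum_3)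

lemma mult_axis: "g *v axis p 1 = column p g" for g :: mat6
  by (simp add: vec_eq_iff matrix_vector_mult_def column_def axis_def if_distrib[of "\<lambda>u. _ * u"] cong: if_cong)

lemma Sp6Z_one: "mat 1 \<in> Sp6Z"
  by (simp add: Sp6Z_def)

lemma Sp6Z_mult: "g \<in> Sp6Z \<Longrightarrow> h \<in> Sp6Z \<Longrightarrow> g ** h \<in> Sp6Z"
  unfolding Sp6Z_def mem_Collect_eq matrix_transpose_mul by (metis matrix_mul_assoc)

lemma vec6_eqI: "(\<And>i. x $ Inl i = y $ Inl i) \<Longrightarrow> (\<And>i. x $ Inr i = y $ Inr i) \<Longrightarrow> x = y"
  for x y :: "'a^('b::finite + 'c::finite)"
  by (simp add: vec_eq_iff split_sum_all)

definition blk :: "(3 \<Rightarrow> 3 \<Rightarrow> int) \<Rightarrow> (3 \<Rightarrow> 3 \<Rightarrow> int) \<Rightarrow> (3 \<Rightarrow> 3 \<Rightarrow> int) \<Rightarrow> (3 \<Rightarrow> 3 \<Rightarrow> int) \<Rightarrow> mat6" where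
  "blk A B C D = (\<chi> p q. case p of Inl i \<Rightarrow> (case q of Inl j \<Rightarrow> A i j | Inr j \<Rightarrow> B i j)
     | Inr i \<Rightarrow> (case q of Inl j \<Rightarrow> C i j | Inr j \<Rightarrow> D i j))"

lemma blk_apply:
  "(blk A B C D *v x) $ Inl i = (\<Sum>j\<in>UNIV. A i j * x $ Inl j) + (\<Sum>j\<in>UNIV. B i j * x $ Inr j)"
  "(blk A B C D *v x) $ Inr i = (\<Sum>j\<in>UNIV. C i j * x $ Inl j) + (\<Sum>j\<in>UNIV. D i j * x $ Inr j)"
  by (simp_all add: matrix_vector_mult_def blk_def sum_UNIV_plus)

lemma blk_Sp6Z:
  assumes "\<And>x y. omega (blk A B C D *v x) (blk A B C D *v y) = omega x y"
  shows "blk A B C D \<in> Sp6Z"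
proof -
  have "omega (axis p 1) (axis q 1) = symp_form $ p $ q" for p q :: "3 + 3"
  proof (cases p)
    case (Inl a) then show ?thesis unfolding Inl omega_axis by (cases q) (auto simp: symp_form_def axis_def)
  next
    case (Inr a) then show ?thesis unfolding Inr omega_axis by (cases q) (auto simp: symp_form_def axis_def)
  qed
  then show ?thesis
    unfolding Sp6Z_iff mult_axis[symmetric] assms by blast
qed

definition embE :: "3 \<Rightarrow> int \<Rightarrow> int \<Rightarrow> int \<Rightarrow> int \<Rightarrow> mat6" where
  "embE k a b c d = blk (\<lambda>i j. if i = j then (if i = k then a else 1) else 0) (\<lambda>i j. if i = k \<and> j = k then b else 0)
     (\<lambda>i j. if i = k \<and> j = k then c else 0) (\<lambda>i j. if i = j then (if i = k then d else 1) else 0)"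

definition shearU :: "3 \<Rightarrow> 3 \<Rightarrow> int \<Rightarrow> mat6" where
  "shearU j k n = blk (\<lambda>i l. if i = l then 1 else if i = j \<and> l = k then n else 0) (\<lambda>_ _. 0) (\<lambda>_ _. 0)
     (\<lambda>i l. if i = l then 1 else if i = k \<and> l = j then - n else 0)"

definition permP :: "(3 \<Rightarrow> 3) \<Rightarrow> mat6" where
  "permP s = blk (\<lambda>i j. if j = s i then 1 else 0) (\<lambda>_ _. 0) (\<lambda>_ _. 0) (\<lambda>i j. if j = s i then 1 else 0)"

lemma embE_apply:
  "(embE k a b c d *v x) $ Inl i = (if i = k then a * x $ Inl k + b * x $ Inr k else x $ Inl i)"
  "(embE k a b c d *v x) $ Inr i = (if i = k then c * x $ Inl k + d * x $ Inr k else x $ Inr i)"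
  using exhaust_3[of i] exhaust_3[of k] unfolding embE_def blk_apply sum_3 by auto

lemma shearU_apply:
  assumes "j \<noteq> k"
  shows "(shearU j k n *v x) $ Inl i = (if i = j then x $ Inl j + n * x $ Inl k else x $ Inl i)"
    "(shearU j k n *v x) $ Inr i = (if i = k then x $ Inr k - n * x $ Inr j else x $ Inr i)"
  using exhaust_3[of i] exhaust_3[of j] exhaust_3[of k] assms unfolding shearU_def blk_apply sum_3 by auto

lemma permP_apply: "(permP s *v x) $ Inl i = x $ Inl (s i)" "(permP s *v x) $ Inr i = x $ Inr (s i)"
  using exhaust_3[of "s i"] unfolding permP_def blk_apply sum_3 by auto

lemma embE_mult: "embE k a b c d ** embE k a' b' c' d' =
    embE k (a * a' + b * c') (a * b' + b * d') (c * a' + d * c') (c * b' + d * d')"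
  unfolding matrix_eq matrix_vector_mul_assoc[symmetric]
  by (intro allI vec6_eqI) (auto simp: embE_apply algebra_simps)

lemma embE_one: "embE k 1 0 0 1 = mat 1"
  unfolding matrix_eq by (intro allI vec6_eqI) (auto simp: embE_apply)

lemma shearU_mult: "j \<noteq> k \<Longrightarrow> shearU j k m ** shearU j k n = shearU j k (m + n)"
  unfolding matrix_eq matrix_vector_mul_assoc[symmetric]
  by (intro allI vec6_eqI) (auto simp: shearU_apply algebra_simps)

lemma shearU_zero: "j \<noteq> k \<Longrightarrow> shearU j k 0 = mat 1"
  unfolding matrix_eq by (intro allI vec6_eqI) (auto simp: shearU_apply)

lemma permP_embE:
  assumes "\<And>i. s (s i) = i"
  shows "permP s ** embE k a b c d ** permP s = embE (s k) a b c d"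
  unfolding matrix_eq matrix_vector_mul_assoc[symmetric]
proof (intro allI vec6_eqI)
  have "s i = k \<longleftrightarrow> i = s k" for i using assms by metis
  then show "(permP s *v (embE k a b c d *v (permP s *v x))) $ Inl i = (embE (s k) a b c d *v x) $ Inl i"
    "(permP s *v (embE k a b c d *v (permP s *v x))) $ Inr i = (embE (s k) a b c d *v x) $ Inr i" for x i
    by (simp_all add: permP_apply embE_apply assms)
qed

lemma permP_shearU:
  assumes "\<And>i. s (s i) = i" "j \<noteq> k"
  shows "permP s ** shearU j k n ** permP s = shearU (s j) (s k) n"
  unfolding matrix_eq matrix_vector_mul_assoc[symmetric]
proof (intro allI vec6_eqI)
  have e: "s i = l \<longleftrightarrow> i = s l" for i l using assms(1) by metis
  have n: "s j \<noteq> s k" using assms by metis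
  show "(permP s *v (shearU j k n *v (permP s *v x))) $ Inl i = (shearU (s j) (s k) n *v x) $ Inl i"
    "(permP s *v (shearU j k n *v (permP s *v x))) $ Inr i = (shearU (s j) (s k) n *v x) $ Inr i" for x i
    by (simp_all add: permP_apply shearU_apply[OF assms(2)] shearU_apply[OF n] assms(1) e)
qed

abbreviation s12 :: "3 \<Rightarrow> 3" where "s12 \<equiv> Transposition.transpose 1 2"
abbreviation s23 :: "3 \<Rightarrow> 3" where "s23 \<equiv> Transposition.transpose 2 3"

inductive_set SpG :: "mat6 set" where
  one: "mat 1 \<in> SpG"
| S: "embE 1 0 (-1) 1 0 \<in> SpG"
| T: "embE 1 1 1 0 1 \<in> SpG"
| P12: "permP s12 \<in> SpG"
| P23: "permP s23 \<in> SpG"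
| U: "shearU 1 2 1 \<in> SpG"
| mult: "g \<in> SpG \<Longrightarrow> h \<in> SpG \<Longrightarrow> g ** h \<in> SpG"

lemma SpG_Sp6Z: "g \<in> SpG \<Longrightarrow> g \<in> Sp6Z"
proof (induction rule: SpG.induct)
  case one show ?case by (rule Sp6Z_one)
next
  case (mult g h) then show ?case by (intro Sp6Z_mult)
next
  case S
  have "omega (embE 1 0 (-1) 1 0 *v x) (embE 1 0 (-1) 1 0 *v y) = omega x y" for x y
    unfolding omega_def sum_3 by (simp add: embE_apply)
  then show ?case unfolding embE_def by (rule blk_Sp6Z)
next
  case T
  have "omega (embE 1 1 1 0 1 *v x) (embE 1 1 1 0 1 *v y) = omega x y" for x y
    unfolding omega_def sum_3 by (simp add: embE_apply algebra_simps)
  then show ?case unfolding embE_def by (rule blk_Sp6Z)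
next
  case P12
  have "omega (permP s12 *v x) (permP s12 *v y) = omega x y" for x y
    unfolding omega_def sum_3 by (simp add: permP_apply Transposition.transpose_def)
  then show ?case unfolding permP_def by (rule blk_Sp6Z)
next
  case P23
  have "omega (permP s23 *v x) (permP s23 *v y) = omega x y" for x y
    unfolding omega_def sum_3 by (simp add: permP_apply Transposition.transpose_def)
  then show ?case unfolding permP_def by (rule blk_Sp6Z)
next
  case U
  have "omega (shearU 1 2 1 *v x) (shearU 1 2 1 *v y) = omega x y" for x y
    unfolding omega_def sum_3 by (simp add: shearU_apply algebra_simps)
  then show ?case unfolding shearU_def by (rule blk_Sp6Z)
qed

lemma SpG_embE1_T: "embE 1 1 n 0 1 \<in> SpG"
proof (induction n rule: int_induct[where k = 0])
  case base show ?case unfolding embE_one by (rule SpG.one)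
next
  case (step1 n)
  then show ?case using SpG.mult[OF step1(2) SpG.T] by (simp add: embE_mult add.commute)
next
  case (step2 n)
  let ?S = "embE 1 0 (-1) 1 0" and ?T = "embE 1 1 1 0 1"
  have "?S ** ?T ** (?S ** ?T) ** (?S ** ?T) ** (?S ** ?T) ** (?S ** ?T) ** ?S \<in> SpG"
    by (intro SpG.intros)
  then have "embE 1 1 (-1) 0 1 \<in> SpG" by (simp add: embE_mult)
  from SpG.mult[OF step2(2) this] show ?case by (simp add: embE_mult add.commute)
qed

lemma SpG_embE1: "a * d - b * c = 1 \<Longrightarrow> embE 1 a b c d \<in> SpG"
proof (induction "nat \<bar>c\<bar>" arbitrary: a b c d rule: less_induct)
  case less
  have S2: "embE 1 (-1) 0 0 (-1) \<in> SpG"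
    using SpG.mult[OF SpG.S SpG.S] by (simp add: embE_mult)
  show ?case
  proof (cases "c = 0")
    case True
    then have "a * d = 1" using less.prems by simp
    then have "a = 1 \<and> d = 1 \<or> a = -1 \<and> d = -1" by (simp add: zmult_eq_1_iff)
    then show ?thesis
    proof
      assume "a = 1 \<and> d = 1" then show ?thesis using SpG_embE1_T True by simp
    next
      assume "a = -1 \<and> d = -1"
      then show ?thesis using SpG.mult[OF S2 SpG_embE1_T[of "- b"]] True by (simp add: embE_mult)
    qed
  next
    case False
    define q where "q = a div c"
    have r: "a - q * c = a mod c" by (simp add: q_def minus_div_mult_eq_mod)
    have "\<bar>a - q * c\<bar> < \<bar>c\<bar>" unfolding r using False by (simp add: abs_mod_less)
    moreover have "(- c) * (b - q * d) - (- d) * (a - q * c) = 1" using less.prems by (simp add: algebra_simps)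
    ultimately have 1: "embE 1 (- c) (- d) (a - q * c) (b - q * d) \<in> SpG"
      using False by (intro less.hyps) (simp_all add: nat_less_eq_zless)
    have "embE 1 0 (-1) 1 0 ** embE 1 0 (-1) 1 0 ** embE 1 0 (-1) 1 0 \<in> SpG" by (intro SpG.intros)
    then have 2: "embE 1 0 1 (-1) 0 \<in> SpG" by (simp add: embE_mult)
    show ?thesis using SpG.mult[OF SpG_embE1_T[of q] SpG.mult[OF 2 1]] by (simp add: embE_mult algebra_simps)
  qed
qed

lemma SpG_embE: "a * d - b * c = 1 \<Longrightarrow> embE k a b c d \<in> SpG"
proof -
  assume d: "a * d - b * c = 1"
  have 1: "embE 1 a b c d \<in> SpG" by (rule SpG_embE1[OF d])
  have "permP s12 ** embE 1 a b c d ** permP s12 \<in> SpG" using 1 by (intro SpG.intros)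
  then have 2: "embE 2 a b c d \<in> SpG" by (simp add: permP_embE)
  have "permP s23 ** embE 2 a b c d ** permP s23 \<in> SpG" using 2 by (intro SpG.intros)
  then have 3: "embE 3 a b c d \<in> SpG" by (simp add: permP_embE)
  show ?thesis using exhaust_3[of k] 1 2 3 by auto
qed

lemma SpG_shearU1: "shearU 1 2 n \<in> SpG"
proof -
  have "embE 1 (-1) 0 0 (-1) ** shearU 1 2 1 ** embE 1 (-1) 0 0 (-1) = shearU 1 2 (-1)"
    unfolding matrix_eq matrix_vector_mul_assoc[symmetric]
    by (intro allI vec6_eqI) (auto simp: shearU_apply embE_apply)
  moreover have "embE 1 (-1) 0 0 (-1) ** shearU 1 2 1 ** embE 1 (-1) 0 0 (-1) \<in> SpG"
    by (intro SpG.mult SpG.U SpG_embE) simp_all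
  ultimately have m: "shearU 1 2 (-1) \<in> SpG" by simp
  show ?thesis
  proof (induction n rule: int_induct[where k = 0])
    case base show ?case by (simp add: shearU_zero SpG.one)
  next
    case (step1 n)
    then show ?case using SpG.mult[OF step1(2) SpG.U] by (simp add: shearU_mult)
  next
    case (step2 n)
    then show ?case using SpG.mult[OF step2(2) m] by (simp add: shearU_mult)
  qed
qed

lemma SpG_shearU: "j \<noteq> k \<Longrightarrow> shearU j k n \<in> SpG"
proof -
  assume jk: "j \<noteq> k"
  have P: "permP s ** shearU j k n ** permP s \<in> SpG" if "shearU j k n \<in> SpG" "permP s \<in> SpG" for s j k
    using that by (intro SpG.mult)
  have tr: "s12 3 = 3" "s23 1 = 1" by (simp_all add: Transposition.transpose_def)
  have u12: "shearU 1 2 n \<in> SpG" by (rule SpG_shearU1)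
  have u13: "shearU 1 3 n \<in> SpG" using P[OF u12 SpG.P23] by (simp add: permP_shearU tr)
  have u21: "shearU 2 1 n \<in> SpG" using P[OF u12 SpG.P12] by (simp add: permP_shearU tr)
  have u23: "shearU 2 3 n \<in> SpG" using P[OF u13 SpG.P12] by (simp add: permP_shearU tr)
  have u31: "shearU 3 1 n \<in> SpG" using P[OF u21 SpG.P23] by (simp add: permP_shearU tr)
  have u32: "shearU 3 2 n \<in> SpG" using P[OF u23 SpG.P23] by (simp add: permP_shearU tr)
  show ?thesis using exhaust_3[of j] exhaust_3[of k] jk u12 u13 u21 u23 u31 u32 by auto
qed

subsection \<open>Reduction to the identity matrix\<close>

definition fixes_outside :: "3 set \<Rightarrow> mat6 \<Rightarrow> bool" where
  "fixes_outside R g \<longleftrightarrow> (\<forall>j. j \<notin> R \<longrightarrow> g *v axis (Inl j) 1 = axis (Inl j) 1 \<and> g *v axis (Inr j) 1 = axis (Inr j) 1)"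

definition reducers :: "3 set \<Rightarrow> mat6 set" where
  "reducers R = {h \<in> SpG. fixes_outside R h \<and> (\<exists>h'\<in>SpG. h' ** h = mat 1)}"

lemma reducers_mult: "g \<in> reducers R \<Longrightarrow> h \<in> reducers R \<Longrightarrow> g ** h \<in> reducers R"
proof -
  assume g: "g \<in> reducers R" and h: "h \<in> reducers R"
  obtain g' h' where "g' \<in> SpG" "g' ** g = mat 1" "h' \<in> SpG" "h' ** h = mat 1"
    using g h by (auto simp: reducers_def)
  moreover have "h' ** g' ** (g ** h) = h' ** (g' ** g) ** h" by (simp add: matrix_mul_assoc)
  ultimately have "h' ** g' \<in> SpG" "h' ** g' ** (g ** h) = mat 1" by (auto intro: SpG.mult)
  then show ?thesis using g h
    by (auto simp: reducers_def fixes_outside_def matrix_vector_mul_assoc[symmetric] intro: SpG.mult)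
qed

lemma reducers_one: "mat 1 \<in> reducers R"
  unfolding reducers_def fixes_outside_def using SpG.one by auto

lemma reducers_embE: "k \<in> R \<Longrightarrow> a * d - b * c = 1 \<Longrightarrow> embE k a b c d \<in> reducers R"
proof -
  assume k: "k \<in> R" and d: "a * d - b * c = 1"
  have "embE k d (- b) (- c) a ** embE k a b c d = mat 1"
    using d unfolding embE_mult embE_one[of k, symmetric] by (simp add: algebra_simps)
  moreover have "embE k d (- b) (- c) a \<in> SpG" using d by (intro SpG_embE) (simp add: algebra_simps)
  moreover have "fixes_outside R (embE k a b c d)" unfolding fixes_outside_def
  proof (intro allI impI)
    fix j assume j: "j \<notin> R"
    then have "j \<noteq> k" using k by auto
    then show "embE k a b c d *v axis (Inl j) 1 = axis (Inl j) 1 \<and> embE k a b c d *v axis (Inr j) 1 = axis (Inr j) 1"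
      by (intro conjI vec6_eqI) (auto simp: embE_apply axis_def)
  qed
  ultimately show ?thesis using SpG_embE[OF d] by (auto simp: reducers_def)
qed

lemma reducers_shearU: "j \<in> R \<Longrightarrow> k \<in> R \<Longrightarrow> j \<noteq> k \<Longrightarrow> shearU j k n \<in> reducers R"
proof -
  assume j: "j \<in> R" and k: "k \<in> R" and jk: "j \<noteq> k"
  have "shearU j k (- n) ** shearU j k n = mat 1" using jk by (simp add: shearU_mult shearU_zero)
  moreover have "fixes_outside R (shearU j k n)" unfolding fixes_outside_def
  proof (intro allI impI)
    fix i assume "i \<notin> R"
    then have "i \<noteq> j" "i \<noteq> k" using j k by auto
    then show "shearU j k n *v axis (Inl i) 1 = axis (Inl i) 1 \<and> shearU j k n *v axis (Inr i) 1 = axis (Inr i) 1"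
      using jk by (intro conjI vec6_eqI) (auto simp: shearU_apply axis_def)
  qed
  ultimately show ?thesis using SpG_shearU[OF jk] by (auto simp: reducers_def)
qed

lemma bezout_SL2: "\<exists>a b c d. a * d - b * c = 1 \<and> a * x + b * y = gcd x y \<and> c * x + d * y = 0" for x y :: int
proof (cases "gcd x y = 0")
  case True
  then show ?thesis by (intro exI[of _ 1] exI[of _ 0]) simp
next
  case False
  obtain a b where ab: "a * x + b * y = gcd x y" using bezout_int by blast
  obtain x' y' where xy: "x = gcd x y * x'" "y = gcd x y * y'" by (meson dvdE gcd_dvd1 gcd_dvd2)
  have "gcd x y * (a * x' + b * y') = a * (gcd x y * x') + b * (gcd x y * y')" by (simp add: algebra_simps)
  also have "\<dots> = gcd x y" using ab xy by simp
  finally have "gcd x y * (a * x' + b * y') = gcd x y * 1" by simp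
  then have "a * x' - b * (- y') = 1" using False by (simp only: mult_cancel_left minus_mult_right[symmetric]
      diff_minus_eq_add) simp
  moreover have "(- y') * x + x' * y = 0" using xy by (metis add.left_inverse mult.commute mult.left_commute mult_minus_left)
  ultimately show ?thesis using ab by blast
qed

lemma reduce_coordinate:
  assumes "k \<in> R"
  obtains h where "h \<in> reducers R" "(h *v x) $ Inl k = gcd (x $ Inl k) (x $ Inr k)" "(h *v x) $ Inr k = 0"
    "\<And>j. j \<noteq> k \<Longrightarrow> (h *v x) $ Inl j = x $ Inl j \<and> (h *v x) $ Inr j = x $ Inr j"
    "\<And>z. z $ Inl k = 0 \<Longrightarrow> z $ Inr k = 0 \<Longrightarrow> h *v z = z"
proof -
  obtain a b c d where M: "a * d - b * c = 1" "a * x $ Inl k + b * x $ Inr k = gcd (x $ Inl k) (x $ Inr k)" "c * x $ Inl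
      k + d * x $ Inr k = 0"
    using bezout_SL2 by blast
  show ?thesis
  proof (rule that[of "embE k a b c d"])
    show "embE k a b c d *v z = z" if "z $ Inl k = 0" "z $ Inr k = 0" for z
      using that by (intro vec6_eqI) (auto simp: embE_apply)
  qed (use M assms in \<open>auto simp: embE_apply intro: reducers_embE\<close>)
qed

text \<open>After both pairs of coordinates have been brought to the form \<open>(*, 0)\<close>, one shear mixes them so that
  two further Euclidean steps give equal entries, which the inverse shear cancels.\<close>

lemma reduce_pair:
  assumes j: "j \<in> R" and k: "k \<in> R" and jk: "j \<noteq> k"
  obtains h where "h \<in> reducers R" "(h *v x) $ Inl j = 0" "(h *v x) $ Inr j = 0"
    "\<And>i. i \<noteq> j \<Longrightarrow> i \<noteq> k \<Longrightarrow> (h *v x) $ Inl i = x $ Inl i \<and> (h *v x) $ Inr i = x $ Inr i"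
proof -
  obtain h1 where h1: "h1 \<in> reducers R" "(h1 *v x) $ Inr j = 0"
    "\<And>i. i \<noteq> j \<Longrightarrow> (h1 *v x) $ Inl i = x $ Inl i \<and> (h1 *v x) $ Inr i = x $ Inr i"
    using reduce_coordinate[OF j] by metis
  define x1 where "x1 = h1 *v x"
  obtain h2 where h2: "h2 \<in> reducers R" "(h2 *v x1) $ Inr k = 0"
    "\<And>i. i \<noteq> k \<Longrightarrow> (h2 *v x1) $ Inl i = x1 $ Inl i \<and> (h2 *v x1) $ Inr i = x1 $ Inr i"
    using reduce_coordinate[OF k] by metis
  define x2 where "x2 = h2 *v x1"
  define h3 where "h3 = shearU j k 1 ** embE j 0 (-1) 1 0"
  have h3: "h3 \<in> reducers R" unfolding h3_def using j k jk by (intro reducers_mult reducers_shearU reducers_embE) simp_all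
  define x3 where "x3 = h3 *v x2"
  have x2: "x2 $ Inr j = 0" "x2 $ Inr k = 0" "\<And>i. i \<noteq> j \<Longrightarrow> i \<noteq> k \<Longrightarrow> x2 $ Inl i = x $ Inl i \<and> x2 $ Inr i = x $ Inr i"
    using h1 h2 jk by (auto simp: x1_def x2_def)
  have x3: "x3 $ Inl j = x2 $ Inl k" "x3 $ Inr j = x2 $ Inl j" "x3 $ Inl k = x2 $ Inl k" "x3 $ Inr k = - x2 $ Inl j"
    "\<And>i. i \<noteq> j \<Longrightarrow> i \<noteq> k \<Longrightarrow> x3 $ Inl i = x $ Inl i \<and> x3 $ Inr i = x $ Inr i"
    using x2 jk by (auto simp: x3_def h3_def matrix_vector_mul_assoc[symmetric] shearU_apply embE_apply)
  obtain h4 where h4: "h4 \<in> reducers R" "(h4 *v x3) $ Inl j = gcd (x3 $ Inl j) (x3 $ Inr j)" "(h4 *v x3) $ Inr j = 0"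
    "\<And>i. i \<noteq> j \<Longrightarrow> (h4 *v x3) $ Inl i = x3 $ Inl i \<and> (h4 *v x3) $ Inr i = x3 $ Inr i"
    using reduce_coordinate[OF j] by metis
  define x4 where "x4 = h4 *v x3"
  obtain h5 where h5: "h5 \<in> reducers R" "(h5 *v x4) $ Inl k = gcd (x4 $ Inl k) (x4 $ Inr k)" "(h5 *v x4) $ Inr k = 0"
    "\<And>i. i \<noteq> k \<Longrightarrow> (h5 *v x4) $ Inl i = x4 $ Inl i \<and> (h5 *v x4) $ Inr i = x4 $ Inr i"
    using reduce_coordinate[OF k] by metis
  define x5 where "x5 = h5 *v x4"
  have x5: "x5 $ Inl j = gcd (x2 $ Inl k) (x2 $ Inl j)" "x5 $ Inl k = gcd (x2 $ Inl k) (x2 $ Inl j)" "x5 $ Inr j = 0"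
      "x5 $ Inr k = 0"
    "\<And>i. i \<noteq> j \<Longrightarrow> i \<noteq> k \<Longrightarrow> x5 $ Inl i = x $ Inl i \<and> x5 $ Inr i = x $ Inr i"
    using h4 h5 x3 jk by (auto simp: x5_def x4_def)
  show ?thesis
  proof (rule that[of "shearU j k (-1) ** h5 ** h4 ** h3 ** h2 ** h1"])
    have e: "(shearU j k (-1) ** h5 ** h4 ** h3 ** h2 ** h1) *v x = shearU j k (-1) *v x5"
      by (simp add: x5_def x4_def x3_def x2_def x1_def matrix_vector_mul_assoc[symmetric])
    show "shearU j k (-1) ** h5 ** h4 ** h3 ** h2 ** h1 \<in> reducers R"
      using h1(1) h2(1) h3 h4(1) h5(1) j k jk by (intro reducers_mult reducers_shearU)
    show "((shearU j k (-1) ** h5 ** h4 ** h3 ** h2 ** h1) *v x) $ Inl j = 0"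
      "((shearU j k (-1) ** h5 ** h4 ** h3 ** h2 ** h1) *v x) $ Inr j = 0"
      unfolding e using x5 jk by (simp_all add: shearU_apply)
    show "((shearU j k (-1) ** h5 ** h4 ** h3 ** h2 ** h1) *v x) $ Inl i = x $ Inl i \<and> ((shearU j k (-1) ** h5 ** h4 **
        h3 ** h2 ** h1) *v x) $ Inr i = x $ Inr i"
      if "i \<noteq> j" "i \<noteq> k" for i
      unfolding e using x5 jk that by (simp add: shearU_apply)
  qed
qed

lemma reduce_vector:
  assumes k: "k \<in> R" and out: "\<And>j. j \<notin> R \<Longrightarrow> x $ Inl j = 0 \<and> x $ Inr j = 0"
  obtains h c where "h \<in> reducers R" "h *v x = axis (Inl k) c"
proof -
  have "\<exists>h\<in>reducers R. \<forall>j. j \<notin> R \<or> j \<in> J \<longrightarrow> (h *v x) $ Inl j = 0 \<and> (h *v x) $ Inr j = 0"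
    if "J \<subseteq> R - {k}" for J
    using finite[of J] that
  proof (induction J rule: finite_induct)
    case empty
    show ?case using out by (intro bexI[OF _ reducers_one]) simp
  next
    case (insert j J)
    then obtain h where h: "h \<in> reducers R" "\<And>i. i \<notin> R \<or> i \<in> J \<Longrightarrow> (h *v x) $ Inl i = 0 \<and> (h *v x) $ Inr i = 0"
      by (meson insert_subset)
    have j: "j \<in> R" "j \<noteq> k" using insert.prems by auto
    obtain h' where h': "h' \<in> reducers R" "(h' *v (h *v x)) $ Inl j = 0" "(h' *v (h *v x)) $ Inr j = 0"
      "\<And>i. i \<noteq> j \<Longrightarrow> i \<noteq> k \<Longrightarrow> (h' *v (h *v x)) $ Inl i = (h *v x) $ Inl i \<and> (h' *v (h *v x)) $ Inr i = (h *v x) $ Inr i"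
      using reduce_pair[OF j(1) k j(2), of "h *v x"] by metis
    show ?case
    proof (intro bexI allI impI)
      show "h' ** h \<in> reducers R" using h h' by (intro reducers_mult)
      fix i assume i: "i \<notin> R \<or> i \<in> insert j J"
      then have "i \<noteq> k" using k insert.prems by auto
      then show "(h' ** h *v x) $ Inl i = 0 \<and> (h' ** h *v x) $ Inr i = 0"
        using h(2)[of i] h'(2-4) i by (cases "i = j") (auto simp: matrix_vector_mul_assoc[symmetric])
    qed
  qed
  from this[of "R - {k}"] obtain h where h: "h \<in> reducers R" "\<And>j. j \<noteq> k \<Longrightarrow> (h *v x) $ Inl j = 0 \<and> (h *v x) $ Inr j = 0"
    by auto
  obtain h' where h': "h' \<in> reducers R" "(h' *v (h *v x)) $ Inr k = 0"
    "\<And>i. i \<noteq> k \<Longrightarrow> (h' *v (h *v x)) $ Inl i = (h *v x) $ Inl i \<and> (h' *v (h *v x)) $ Inr i = (h *v x) $ Inr i"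
    using reduce_coordinate[OF k] by metis
  show ?thesis
  proof (rule that)
    show "h' ** h \<in> reducers R" using h h' by (intro reducers_mult)
    show "h' ** h *v x = axis (Inl k) ((h' *v (h *v x)) $ Inl k)"
      using h(2) h'(2,3) by (intro vec6_eqI; case_tac "i = k") (auto simp: matrix_vector_mul_assoc[symmetric] axis_def)
  qed
qed

lemma reduce_conjugate_vector:
  assumes k: "k \<in> R" and out: "\<And>j. j \<notin> R \<Longrightarrow> x $ Inl j = 0 \<and> x $ Inr j = 0" and xk: "x $ Inr k = 1"
  obtains h where "h \<in> reducers R" "h *v x = axis (Inr k) 1" "h *v axis (Inl k) 1 = axis (Inl k) 1"
proof -
  have "\<exists>h\<in>reducers R. h *v axis (Inl k) 1 = axis (Inl k) 1 \<and> (h *v x) $ Inr k = 1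
       \<and> (\<forall>j. j \<notin> R \<or> j \<in> J \<longrightarrow> (h *v x) $ Inl j = 0 \<and> (h *v x) $ Inr j = 0)"
    if "J \<subseteq> R - {k}" for J
    using finite[of J] that
  proof (induction J rule: finite_induct)
    case empty
    show ?case using out xk by (intro bexI[OF _ reducers_one]) simp
  next
    case (insert j J)
    then obtain h where h: "h \<in> reducers R" "h *v axis (Inl k) 1 = axis (Inl k) 1" "(h *v x) $ Inr k = 1"
      "\<And>i. i \<notin> R \<or> i \<in> J \<Longrightarrow> (h *v x) $ Inl i = 0 \<and> (h *v x) $ Inr i = 0"
      by (meson insert_subset)
    have j: "j \<in> R" "j \<noteq> k" using insert.prems by auto
    define y where "y = h *v x"
    obtain h1 where h1: "h1 \<in> reducers R" "(h1 *v y) $ Inr j = 0"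
      "\<And>i. i \<noteq> j \<Longrightarrow> (h1 *v y) $ Inl i = y $ Inl i \<and> (h1 *v y) $ Inr i = y $ Inr i"
      "\<And>z. z $ Inl j = 0 \<Longrightarrow> z $ Inr j = 0 \<Longrightarrow> h1 *v z = z"
      using reduce_coordinate[OF j(1), of y] by metis
    define n where "n = (h1 *v y) $ Inl j"
    let ?h = "shearU k j n ** embE j 0 (-1) 1 0 ** h1 ** h"
    show ?case
    proof (intro bexI conjI allI impI)
      show "?h \<in> reducers R" using h h1 j k by (intro reducers_mult reducers_shearU reducers_embE) auto
      have e: "?h *v x = shearU k j n *v (embE j 0 (-1) 1 0 *v (h1 *v y))"
        by (simp add: y_def matrix_vector_mul_assoc[symmetric])
      have "h1 *v axis (Inl k) 1 = axis (Inl k) 1" using j by (intro h1(4)) (auto simp: axis_def)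
      then show "?h *v axis (Inl k) 1 = axis (Inl k) 1"
        unfolding matrix_vector_mul_assoc[symmetric] h(2)
        using j by (intro vec6_eqI) (auto simp: shearU_apply embE_apply axis_def)
      have yk: "(h1 *v y) $ Inr k = 1" using h(3) h1(3)[of k] j by (simp add: y_def)
      show "(?h *v x) $ Inr k = 1" unfolding e using j yk by (simp add: shearU_apply embE_apply)
      fix i assume i: "i \<notin> R \<or> i \<in> insert j J"
      then have ik: "i \<noteq> k" using k insert.prems by auto
      show "(?h *v x) $ Inl i = 0" "(?h *v x) $ Inr i = 0"
        unfolding e using ik j yk h1(2) h1(3)[of i] h(4)[of i] i
        by (auto simp: shearU_apply embE_apply n_def[symmetric] y_def[symmetric])
    qed
  qed
  from this[of "R - {k}"] obtain h where h: "h \<in> reducers R" "h *v axis (Inl k) 1 = axis (Inl k) 1" "(h *v x) $ Inr k = 1"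
    "\<And>j. j \<noteq> k \<Longrightarrow> (h *v x) $ Inl j = 0 \<and> (h *v x) $ Inr j = 0"
    by auto
  let ?E = "embE k 1 (- (h *v x) $ Inl k) 0 1"
  show ?thesis
  proof (rule that)
    show "?E ** h \<in> reducers R" using h k by (intro reducers_mult reducers_embE) auto
    show "?E ** h *v x = axis (Inr k) 1"
      using h(3,4) by (intro vec6_eqI; case_tac "i = k") (auto simp: matrix_vector_mul_assoc[symmetric] embE_apply axis_def)
    show "?E ** h *v axis (Inl k) 1 = axis (Inl k) 1"
      unfolding matrix_vector_mul_assoc[symmetric] h(2) by (intro vec6_eqI) (auto simp: embE_apply axis_def)
  qed
qed

lemma omega_columns: "g \<in> Sp6Z \<Longrightarrow> omega (g *v axis p 1) (g *v axis q 1) = symp_form $ p $ q"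
  by (simp add: Sp6Z_iff mult_axis)

lemma column_outside:
  assumes g: "g \<in> Sp6Z" "fixes_outside R g" and k: "k \<in> R" and j: "j \<notin> R" and p: "p = Inl k \<or> p = Inr k"
  shows "(g *v axis p 1) $ Inl j = 0 \<and> (g *v axis p 1) $ Inr j = 0"
proof -
  have "omega (g *v axis (Inl j) 1) (g *v axis p 1) = 0" "omega (g *v axis (Inr j) 1) (g *v axis p 1) = 0"
    unfolding omega_columns[OF g(1)] using p j k by (auto simp: symp_form_def)
  moreover have "g *v axis (Inl j) 1 = axis (Inl j) 1" "g *v axis (Inr j) 1 = axis (Inr j) 1"
    using g(2) j by (auto simp: fixes_outside_def)
  ultimately show ?thesis by (simp add: omega_axis)
qed

lemma fixes_outside_mult: "fixes_outside R g \<Longrightarrow> fixes_outside R h \<Longrightarrow> fixes_outside R (g ** h)"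
  by (simp add: fixes_outside_def matrix_vector_mul_assoc[symmetric])

lemma reduce_step:
  assumes g: "g \<in> Sp6Z" "fixes_outside R g" and k: "k \<in> R"
  obtains h where "h \<in> reducers R" "h ** g \<in> Sp6Z" "fixes_outside (R - {k}) (h ** g)"
proof -
  have reducers: "h ** g \<in> Sp6Z" "fixes_outside R (h ** g)" if "h \<in> reducers R" for h
    using that g by (auto simp: reducers_def intro: Sp6Z_mult SpG_Sp6Z fixes_outside_mult)
  have om: "omega (g *v axis (Inl k) 1) (g *v axis (Inr k) 1) = 1" if "g \<in> Sp6Z" for g
    unfolding omega_columns[OF that] by (simp add: symp_form_def)
  obtain h1 c where h1: "h1 \<in> reducers R" "h1 *v (g *v axis (Inl k) 1) = axis (Inl k) c"
    using reduce_vector[OF k column_outside[OF g k]] by blast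
  have "c * (h1 ** g *v axis (Inr k) 1) $ Inr k = 1"
    using om[OF reducers(1)[OF h1(1)]] h1(2) by (simp add: matrix_vector_mul_assoc[symmetric] omega_axis)
  then have c: "c = 1 \<or> c = -1" by (auto simp: zmult_eq_1_iff)
  have "\<exists>h\<in>reducers R. h ** g *v axis (Inl k) 1 = axis (Inl k) 1"
  proof (cases "c = 1")
    case True then show ?thesis using h1 by (intro bexI[of _ h1]) (auto simp: matrix_vector_mul_assoc[symmetric])
  next
    case False
    then have "c = -1" using c by simp
    then have "embE k (-1) 0 0 (-1) *v axis (Inl k) c = axis (Inl k) 1"
      by (intro vec6_eqI) (auto simp: embE_apply axis_def)
    then show ?thesis using h1 k
      by (intro bexI[of _ "embE k (-1) 0 0 (-1) ** h1"]) (auto simp: matrix_vector_mul_assoc[symmetric] intro!: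
          reducers_mult reducers_embE)
  qed
  then obtain h2 where h2: "h2 \<in> reducers R" "h2 ** g *v axis (Inl k) 1 = axis (Inl k) 1" by blast
  note g2 = reducers[OF h2(1)]
  have "(h2 ** g *v axis (Inr k) 1) $ Inr k = 1"
    using om[OF g2(1)] h2(2) by (simp add: omega_axis)
  then obtain h3 where h3: "h3 \<in> reducers R" "h3 *v (h2 ** g *v axis (Inr k) 1) = axis (Inr k) 1" "h3 *v axis (Inl k) 1
      = axis (Inl k) 1"
    using reduce_conjugate_vector[OF k column_outside[OF g2 k]] by blast
  show ?thesis
  proof (rule that)
    show h: "h3 ** h2 \<in> reducers R" using h2 h3 by (intro reducers_mult)
    show "h3 ** h2 ** g \<in> Sp6Z" by (rule reducers[OF h])
    have "h3 ** h2 ** g *v axis (Inl k) 1 = axis (Inl k) 1" "h3 ** h2 ** g *v axis (Inr k) 1 = axis (Inr k) 1"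
      using h3(2,3) h2(2) by (simp_all add: matrix_vector_mul_assoc[symmetric])
    then show "fixes_outside (R - {k}) (h3 ** h2 ** g)"
      using reducers(2)[OF h] unfolding fixes_outside_def by blast
  qed
qed

lemma Sp6Z_generated: "g \<in> Sp6Z \<Longrightarrow> g \<in> SpG"
proof -
  assume g: "g \<in> Sp6Z"
  have "fixes_outside UNIV g" by (simp add: fixes_outside_def)
  then obtain h1 where h1: "h1 \<in> reducers UNIV" "h1 ** g \<in> Sp6Z" "fixes_outside (UNIV - {1}) (h1 ** g)"
    using reduce_step[OF g, of UNIV 1] by blast
  obtain h2 where h2: "h2 \<in> reducers (UNIV - {1})" "h2 ** (h1 ** g) \<in> Sp6Z" "fixes_outside (UNIV - {1} - {2}) (h2 ** (h1 ** g))"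
    using reduce_step[OF h1(2,3), of 2] by auto
  obtain h3 where h3: "h3 \<in> reducers (UNIV - {1} - {2})" "fixes_outside (UNIV - {1} - {2} - {3}) (h3 ** (h2 ** (h1 ** g)))"
    using reduce_step[OF h2(2,3), of 3] by auto
  have "UNIV - {1} - {2} - {3} = ({} :: 3 set)" using exhaust_3 by auto
  then have "h3 ** (h2 ** (h1 ** g)) *v axis p 1 = axis p 1" for p
    using h3(2) unfolding fixes_outside_def by (cases p) (simp_all only: empty_iff not_False_eq_True simp_thms)
  then have "column p (h3 ** (h2 ** (h1 ** g))) = column p (mat 1)" for p
    unfolding mult_axis[symmetric] by simp
  then have 1: "h3 ** (h2 ** (h1 ** g)) = mat 1" by (auto simp: vec_eq_iff column_def)
  have cancel: "\<exists>h'\<in>SpG. a = h' ** (h ** a)" if "h \<in> reducers R" for h a R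
    using that by (auto simp: reducers_def matrix_mul_assoc) (metis matrix_mul_lid)
  obtain k3 k2 k1 where "k3 \<in> SpG" "k2 \<in> SpG" "k1 \<in> SpG" "h2 ** (h1 ** g) = k3 ** mat 1" "h1 ** g = k2 ** (h2 ** (h1 **
      g))" "g = k1 ** (h1 ** g)"
    using cancel[OF h1(1)] cancel[OF h2(1)] cancel[OF h3(1)] 1 by metis
  then show ?thesis by (metis SpG.mult matrix_mul_rid)
qed

section \<open>The automorphy factor\<close>

declare transpose_matrix_vector [simp del]

lemma matrix_add_rdistrib: "(A + B) ** C = A ** C + B ** C" for A B :: "'a::semiring_1^'n^'m"
  by (simp add: vec_eq_iff matrix_matrix_mult_def sum.distrib distrib_right)

lemma blocks_mult:
  "blockA (g ** h) = blockA g ** blockA h + blockB g ** blockC h"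
  "blockB (g ** h) = blockA g ** blockB h + blockB g ** blockD h"
  "blockC (g ** h) = blockC g ** blockA h + blockD g ** blockC h"
  "blockD (g ** h) = blockC g ** blockB h + blockD g ** blockD h"
  by (simp_all add: vec_eq_iff blockA_def blockB_def blockC_def blockD_def matrix_matrix_mult_def sum_UNIV_plus)

lemma blocks_one: "blockA (mat 1) = mat 1" "blockB (mat 1) = 0" "blockC (mat 1) = 0" "blockD (mat 1) = mat 1"
  by (simp_all add: vec_eq_iff blockA_def blockB_def blockC_def blockD_def mat_def)

lemma symplectic_blocks:
  assumes "g \<in> Sp6Z"
  shows "transpose (blockC g) ** blockA g = transpose (blockA g) ** blockC g"
    "transpose (blockD g) ** blockA g = mat 1 + transpose (blockB g) ** blockC g"
proof -
  have "omega (column (Inl i) g) (column (Inl j) g) = 0" "omega (column (Inl i) g) (column (Inr j) g) = (if i = j then 1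
      else 0)" for i j
    using assms unfolding Sp6Z_iff by (simp_all add: symp_form_def)
  then have a: "of_int (omega (column (Inl i) g) (column (Inl j) g)) = (0::complex)"
    "of_int (omega (column (Inl i) g) (column (Inr j) g)) = (if i = j then 1 else 0 :: complex)" for i j
    by simp_all
  show "transpose (blockC g) ** blockA g = transpose (blockA g) ** blockC g"
    using a(1) unfolding vec_eq_iff
    by (simp add: blockA_def blockC_def transpose_def matrix_matrix_mult_def omega_def column_def sum_subtractf)
  show "transpose (blockD g) ** blockA g = mat 1 + transpose (blockB g) ** blockC g"
  proof -
    have "(\<Sum>k\<in>UNIV. of_int (g $ Inr k $ Inr i) * of_int (g $ Inl k $ Inl j)) =
       (if i = j then 1 else 0 :: complex) + (\<Sum>k\<in>UNIV. of_int (g $ Inl k $ Inr i) * of_int (g $ Inr k $ Inl j))" for i j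
      using a(2)[of j i] by (simp add: omega_def column_def sum_subtractf algebra_simps eq_commute[of i j])
    then show ?thesis
      by (simp add: vec_eq_iff blockA_def blockB_def blockC_def blockD_def transpose_def matrix_matrix_mult_def mat_def)
  qed
qed

lemma matrix_inv_eqI:
  fixes J K :: "complex^'n^'n"
  assumes "J ** K = mat 1"
  shows "matrix_inv J = K" "det J \<noteq> 0" "K ** J = mat 1"
proof -
  show KJ: "K ** J = mat 1" using assms matrix_left_right_inverse by blast
  show "matrix_inv J = K"
  proof -
    have "J ** matrix_inv J = mat 1"
      unfolding matrix_inv_def by (rule someI2[of _ K]) (simp_all add: assms KJ)
    then have "K ** J ** matrix_inv J = K" by (simp flip: matrix_mul_assoc)
    then show ?thesis by (simp add: KJ)
  qed
  have "det J * det K = 1" using arg_cong[OF assms, of det] by (simp add: det_mul)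
  then show "det J \<noteq> 0" by auto
qed

lemma matrix_inv_mult_right:
  fixes J :: "complex^'n^'n"
  assumes "det J \<noteq> 0"
  shows "J ** matrix_inv J = mat 1"
proof -
  obtain K where "J ** K = mat 1" using assms invertible_det_nz[of J] by (auto simp: invertible_def)
  then show ?thesis using matrix_inv_eqI(1) by metis
qed

definition theta_factor :: "mat6 \<Rightarrow> complex^3^3 \<Rightarrow> complex^3 \<Rightarrow> complex" where
  "theta_factor g \<tau> z = exp (- 8 * of_real pi * \<i> * cdot z (matrix_inv (automorphy g \<tau>) *v (blockC g *v z)))
     / det (automorphy g \<tau>) ^ 2"

definition theta_arg :: "mat6 \<Rightarrow> complex^3^3 \<Rightarrow> complex^3 \<Rightarrow> complex^3" where
  "theta_arg g \<tau> z = transpose (matrix_inv (automorphy g \<tau>)) *v z"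

definition regular_at :: "mat6 \<Rightarrow> complex^3^3 \<Rightarrow> bool" where
  "regular_at g \<tau> \<longleftrightarrow> moebius g \<tau> \<in> siegel \<and> det (automorphy g \<tau>) \<noteq> 0"

lemma moebius_mult:
  assumes "det (automorphy h \<tau>) \<noteq> 0" "det (automorphy g (moebius h \<tau>)) \<noteq> 0"
  shows "automorphy (g ** h) \<tau> = automorphy g (moebius h \<tau>) ** automorphy h \<tau>"
    "matrix_inv (automorphy (g ** h) \<tau>) = matrix_inv (automorphy h \<tau>) ** matrix_inv (automorphy g (moebius h \<tau>))"
    "moebius (g ** h) \<tau> = moebius g (moebius h \<tau>)"
proof -
  let ?J = "automorphy h \<tau>" and ?t = "moebius h \<tau>"
  let ?K = "matrix_inv ?J" and ?I = "automorphy g ?t"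
  let ?L = "matrix_inv ?I"
  note JK = matrix_inv_mult_right[OF assms(1)] and IL = matrix_inv_mult_right[OF assms(2)]
  have KJ: "?K ** ?J = mat 1" using JK by (rule matrix_inv_eqI)
  have tJ: "?t ** ?J = blockA h ** \<tau> + blockB h"
    unfolding moebius_def using KJ by (simp flip: matrix_mul_assoc)
  show aut: "automorphy (g ** h) \<tau> = ?I ** ?J"
  proof -
    have "?I ** ?J = blockC g ** (?t ** ?J) + blockD g ** ?J"
      by (simp add: automorphy_def[of g] matrix_add_rdistrib matrix_mul_assoc)
    also have "\<dots> = automorphy (g ** h) \<tau>"
      unfolding tJ by (simp add: automorphy_def blocks_mult matrix_add_ldistrib matrix_add_rdistrib matrix_mul_assoc)
    finally show ?thesis by simp
  qed
  have "?I ** ?J ** (?K ** ?L) = ?I ** (?J ** ?K) ** ?L" by (simp add: matrix_mul_assoc)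
  then have 1: "?I ** ?J ** (?K ** ?L) = mat 1" by (simp add: JK IL)
  then show inv: "matrix_inv (automorphy (g ** h) \<tau>) = ?K ** ?L"
    unfolding aut by (rule matrix_inv_eqI)
  have "blockA (g ** h) ** \<tau> + blockB (g ** h) = blockA g ** (?t ** ?J) + blockB g ** ?J"
    unfolding tJ by (simp add: automorphy_def blocks_mult matrix_add_ldistrib matrix_add_rdistrib matrix_mul_assoc)
  also have "\<dots> = (blockA g ** ?t + blockB g) ** ?J"
    by (simp add: matrix_add_rdistrib matrix_mul_assoc)
  finally have "moebius (g ** h) \<tau> = (blockA g ** ?t + blockB g) ** (?J ** ?K) ** ?L"
    unfolding moebius_def[of "g ** h"] inv by (simp add: matrix_mul_assoc)
  then show "moebius (g ** h) \<tau> = moebius g ?t" by (simp add: JK moebius_def[of g])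
qed

lemma automorphy_inv_transpose:
  assumes g: "g \<in> Sp6Z" and \<tau>: "\<tau> \<in> siegel" and r: "regular_at g \<tau>"
  shows "blockA g = transpose (matrix_inv (automorphy g \<tau>)) + moebius g \<tau> ** blockC g"
proof -
  let ?t = "transpose :: complex^3^3 \<Rightarrow> _"
  let ?J = "automorphy g \<tau>" and ?m = "moebius g \<tau>"
  let ?K = "matrix_inv ?J"
  have JK: "?J ** ?K = mat 1" using r by (intro matrix_inv_mult_right) (simp add: regular_at_def)
  have tK: "?t ?J ** ?t ?K = mat 1" using matrix_inv_eqI(3)[OF JK] by (metis matrix_transpose_mul transpose_mat)
  have Kt: "?t ?K ** ?t ?J = mat 1" using JK by (metis matrix_transpose_mul transpose_mat)
  have sym: "?t \<tau> = \<tau>" "?t ?m = ?m" using \<tau> r by (simp_all add: siegel_def regular_at_def)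
  have tadd: "?t (X + Y) = ?t X + ?t Y" for X Y by (simp add: vec_eq_iff transpose_def)
  have m: "?m = ?t ?K ** (\<tau> ** ?t (blockA g) + ?t (blockB g))"
    using sym(2) unfolding moebius_def matrix_transpose_mul tadd sym(1) by simp
  have "?t ?J ** (?t ?K + ?m ** blockC g) = mat 1 + (?t ?J ** ?t ?K) ** (\<tau> ** ?t (blockA g) + ?t (blockB g)) ** blockC g"
    by (subst m) (simp add: matrix_add_ldistrib tK matrix_mul_assoc)
  also have "\<dots> = mat 1 + \<tau> ** (?t (blockA g) ** blockC g) + ?t (blockB g) ** blockC g"
    unfolding tK by (simp add: matrix_add_rdistrib matrix_mul_assoc add.assoc)
  also have "\<dots> = \<tau> ** (?t (blockC g) ** blockA g) + ?t (blockD g) ** blockA g"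
    unfolding symplectic_blocks[OF g] by (simp add: ac_simps)
  also have "\<dots> = ?t ?J ** blockA g"
    unfolding automorphy_def tadd matrix_transpose_mul sym(1) by (simp add: matrix_add_rdistrib matrix_mul_assoc)
  finally have "?t ?K ** (?t ?J ** (?t ?K + ?m ** blockC g)) = ?t ?K ** (?t ?J ** blockA g)" by simp
  then show ?thesis unfolding matrix_mul_assoc Kt by simp
qed

lemma cdot_matrix: "cdot z (M *v y) = cdot (transpose M *v z) y" for z y :: "complex^3"
  by (simp add: cdot_def sum_3 matrix_vector_mult_def transpose_def algebra_simps)

lemma cdot_add_right: "cdot z (x + y) = cdot z x + cdot z y" for z :: "complex^3"
  by (simp add: cdot_def sum.distrib algebra_simps)

lemma theta_cocycle:
  assumes g: "g \<in> Sp6Z" and h: "h \<in> Sp6Z" and \<tau>: "\<tau> \<in> siegel" and r: "regular_at h \<tau>" "regular_at g (moebius h \<tau>)"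
  shows "theta_arg (g ** h) \<tau> z = theta_arg g (moebius h \<tau>) (theta_arg h \<tau> z)"
    "theta_factor (g ** h) \<tau> z = theta_factor g (moebius h \<tau>) (theta_arg h \<tau> z) * theta_factor h \<tau> z"
proof -
  let ?J = "automorphy h \<tau>" and ?t = "moebius h \<tau>"
  let ?K = "matrix_inv ?J" and ?I = "automorphy g ?t"
  let ?L = "matrix_inv ?I" and ?w = "theta_arg h \<tau> z"
  have d: "det ?J \<noteq> 0" "det ?I \<noteq> 0" using r by (auto simp: regular_at_def)
  note mm = moebius_mult[OF d]
  have LI: "?L ** ?I = mat 1" using matrix_inv_mult_right[OF d(2)] by (rule matrix_inv_eqI)
  show "theta_arg (g ** h) \<tau> z = theta_arg g ?t ?w"
    unfolding theta_arg_def mm(2,3) by (simp add: matrix_transpose_mul matrix_vector_mul_assoc)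
  have "blockC (g ** h) = blockC g ** (transpose ?K + ?t ** blockC h) + blockD g ** blockC h"
    unfolding blocks_mult automorphy_inv_transpose[OF h \<tau> r(1), symmetric] ..
  also have "\<dots> = blockC g ** transpose ?K + ?I ** blockC h"
    unfolding automorphy_def[of g] matrix_add_ldistrib matrix_add_rdistrib matrix_mul_assoc by (simp only: add.assoc)
  finally have "?L ** blockC (g ** h) = ?L ** (blockC g ** transpose ?K + ?I ** blockC h)" by simp
  then have C: "?L ** blockC (g ** h) = ?L ** blockC g ** transpose ?K + blockC h"
    by (simp only: matrix_add_ldistrib matrix_mul_assoc LI matrix_mul_lid)
  have "cdot z (matrix_inv (automorphy (g ** h) \<tau>) *v (blockC (g ** h) *v z)) = cdot z (?K *v ((?L ** blockC (g ** h)) *v z))"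
    unfolding mm(2) by (simp add: matrix_vector_mul_assoc matrix_mul_assoc)
  also have "\<dots> = cdot z (?K *v (?L *v (blockC g *v ?w))) + cdot z (?K *v (blockC h *v z))"
    unfolding C theta_arg_def
    by (simp add: matrix_vector_mult_add_rdistrib matrix_vector_right_distrib cdot_add_right matrix_vector_mul_assoc
        matrix_mul_assoc)
  also have "cdot z (?K *v (?L *v (blockC g *v ?w))) = cdot ?w (?L *v (blockC g *v ?w))"
    by (subst cdot_matrix) (simp add: theta_arg_def)
  finally have e: "cdot z (matrix_inv (automorphy (g ** h) \<tau>) *v (blockC (g ** h) *v z)) =
     cdot ?w (?L *v (blockC g *v ?w)) + cdot z (?K *v (blockC h *v z))" .
  show "theta_factor (g ** h) \<tau> z = theta_factor g ?t ?w * theta_factor h \<tau> z"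
    unfolding theta_factor_def e unfolding mm(1) det_mul distrib_left exp_add power_mult_distrib by simp
qed

subsection \<open>Group elements and substitutions of the coordinates\<close>

definition realizes :: "mat6 \<Rightarrow> ((bit^3 \<Rightarrow> complex) \<Rightarrow> bit^3 \<Rightarrow> complex) \<Rightarrow> bool" where
  "realizes g \<rho> \<longleftrightarrow> g \<in> Sp6Z \<and> (\<forall>q\<in>W'. (\<lambda>x. q (\<rho> x)) \<in> W') \<and>
    (\<forall>\<tau>\<in>siegel. regular_at g \<tau> \<and> (\<forall>x. CF (moebius g \<tau>) (\<rho> x) = det (automorphy g \<tau>) ^ 14 * CF \<tau> x) \<and>
      (\<forall>z. \<forall>q\<in>W'. theta_factor g \<tau> z * q (Theta2 (moebius g \<tau>) (theta_arg g \<tau> z)) = q (\<rho> (Theta2 \<tau> z))))"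

lemma realizes_mult:
  assumes "realizes g \<rho>" "realizes h \<sigma>"
  shows "realizes (g ** h) (\<rho> \<circ> \<sigma>)"
  unfolding realizes_def
proof (intro conjI ballI allI)
  have g: "g \<in> Sp6Z" and h: "h \<in> Sp6Z" using assms by (auto simp: realizes_def)
  then show "g ** h \<in> Sp6Z" by (rule Sp6Z_mult)
  show "(\<lambda>x. q ((\<rho> \<circ> \<sigma>) x)) \<in> W'" if "q \<in> W'" for q
  proof -
    have "(\<lambda>x. q (\<rho> x)) \<in> W'" using assms(1) that by (auto simp: realizes_def)
    then show ?thesis using assms(2) by (auto simp: realizes_def)
  qed
  fix \<tau> assume \<tau>: "\<tau> \<in> siegel"
  have r: "regular_at h \<tau>" using assms(2) \<tau> by (auto simp: realizes_def)
  then have s: "moebius h \<tau> \<in> siegel" by (simp add: regular_at_def)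
  then have r': "regular_at g (moebius h \<tau>)" using assms(1) by (auto simp: realizes_def)
  have "det (automorphy h \<tau>) \<noteq> 0" "det (automorphy g (moebius h \<tau>)) \<noteq> 0" using r r' by (auto simp: regular_at_def)
  note mm = moebius_mult[OF this]
  show "regular_at (g ** h) \<tau>" using r r' by (simp add: regular_at_def mm det_mul)
  have 1: "CF (moebius h \<tau>) (\<sigma> x) = det (automorphy h \<tau>) ^ 14 * CF \<tau> x" for x
    using assms(2) \<tau> by (auto simp: realizes_def)
  have 2: "CF (moebius g (moebius h \<tau>)) (\<rho> x) = det (automorphy g (moebius h \<tau>)) ^ 14 * CF (moebius h \<tau>) x" for x
    using assms(1) s by (auto simp: realizes_def)
  show "CF (moebius (g ** h) \<tau>) ((\<rho> \<circ> \<sigma>) x) = det (automorphy (g ** h) \<tau>) ^ 14 * CF \<tau> x" for x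
    by (simp add: mm 1 2 det_mul power_mult_distrib)
  fix z q assume q: "q \<in> W'"
  then have q': "(\<lambda>x. q (\<rho> x)) \<in> W'" using assms(1) by (auto simp: realizes_def)
  have 3: "theta_factor g (moebius h \<tau>) w * q (Theta2 (moebius g (moebius h \<tau>)) (theta_arg g (moebius h \<tau>) w)) = q (\<rho>
      (Theta2 (moebius h \<tau>) w))" for w
    using assms(1) s q by (auto simp: realizes_def)
  have 4: "theta_factor h \<tau> z * q (\<rho> (Theta2 (moebius h \<tau>) (theta_arg h \<tau> z))) = q (\<rho> (\<sigma> (Theta2 \<tau> z)))"
  proof -
    have "\<forall>q\<in>W'. theta_factor h \<tau> z * q (Theta2 (moebius h \<tau>) (theta_arg h \<tau> z)) = q (\<sigma> (Theta2 \<tau> z))"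
      using assms(2) \<tau> by (auto simp: realizes_def)
    from bspec[OF this q'] show ?thesis .
  qed
  show "theta_factor (g ** h) \<tau> z * q (Theta2 (moebius (g ** h) \<tau>) (theta_arg (g ** h) \<tau> z)) = q ((\<rho> \<circ> \<sigma>) (Theta2 \<tau> z))"
    unfolding mm(3) theta_cocycle[OF g h \<tau> r r'] comp_apply 4[symmetric] 3[symmetric] by (simp add: mult_ac)
qed

definition moves_to :: "mat6 \<Rightarrow> complex^3^3 \<Rightarrow> complex^3^3 \<Rightarrow> complex^3^3 \<Rightarrow> complex^3^3 \<Rightarrow> bool" where
  "moves_to g \<tau> \<tau>' J K \<longleftrightarrow> automorphy g \<tau> = J \<and> J ** K = mat 1 \<and> blockA g ** \<tau> + blockB g = \<tau>' ** J \<and> \<tau>' \<in> siegel"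

lemma moves_toD:
  assumes "moves_to g \<tau> \<tau>' J K"
  shows "automorphy g \<tau> = J" "moebius g \<tau> = \<tau>'" "matrix_inv J = K" "regular_at g \<tau>"
proof -
  have M: "J ** K = mat 1" "blockA g ** \<tau> + blockB g = \<tau>' ** J" "\<tau>' \<in> siegel" using assms by (auto simp: moves_to_def)
  show J: "automorphy g \<tau> = J" using assms by (simp add: moves_to_def)
  note K = matrix_inv_eqI[OF M(1)]
  show "matrix_inv J = K" by (rule K)
  have "moebius g \<tau> = \<tau>' ** J ** K" using M K(1) by (simp add: moebius_def J)
  then show m: "moebius g \<tau> = \<tau>'" by (simp add: M(1) flip: matrix_mul_assoc)
  show "regular_at g \<tau>" using M K(2) by (simp add: regular_at_def m J)
qed

lemma realizes_generatorI:
  assumes "g \<in> Sp6Z" and W: "\<And>q. q \<in> W' \<Longrightarrow> (\<lambda>x. q (\<rho> x)) \<in> W'"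
    and M: "\<And>a b c d e f. siegel6 a b c d e f \<Longrightarrow> moves_to g (sm a b c d e f) (\<tau>' a b c d e f) (J a b c d e f) (K a b c d e f)"
    and C: "\<And>a b c d e f x. siegel6 a b c d e f \<Longrightarrow> CF (\<tau>' a b c d e f) (\<rho> x) = det (J a b c d e f) ^ 14 * CF (sm a b c d e f) x"
    and T: "\<And>a b c d e f z q. siegel6 a b c d e f \<Longrightarrow> q \<in> W' \<Longrightarrow>
       exp (- 8 * of_real pi * \<i> * cdot z (K a b c d e f *v (blockC g *v z))) / det (J a b c d e f) ^ 2
        * q (Theta2 (\<tau>' a b c d e f) (transpose (K a b c d e f) *v z)) = q (\<rho> (Theta2 (sm a b c d e f) z))"
  shows "realizes g \<rho>"
  unfolding realizes_def
proof (intro conjI, rule assms(1), intro ballI, erule W, rule ballI)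
  fix \<tau> assume "\<tau> \<in> siegel"
  then show "regular_at g \<tau> \<and> (\<forall>x. CF (moebius g \<tau>) (\<rho> x) = det (automorphy g \<tau>) ^ 14 * CF \<tau> x) \<and>
      (\<forall>z. \<forall>q\<in>W'. theta_factor g \<tau> z * q (Theta2 (moebius g \<tau>) (theta_arg g \<tau> z)) = q (\<rho> (Theta2 \<tau> z)))"
  proof (cases rule: siegel_cases)
    case (1 a b c d e f)
    note D = moves_toD[OF M[OF 1(2)]]
    have J: "automorphy g \<tau> = J a b c d e f" and m: "moebius g \<tau> = \<tau>' a b c d e f" and r: "regular_at g \<tau>"
      unfolding 1(1) using D by auto
    note K = D(3)
    show ?thesis
    proof (intro conjI allI ballI)
      show "regular_at g \<tau>" by (rule r)
      show "CF (moebius g \<tau>) (\<rho> x) = det (automorphy g \<tau>) ^ 14 * CF \<tau> x" for x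
        unfolding m J unfolding 1(1) by (rule C[OF 1(2)])
      show "theta_factor g \<tau> z * q (Theta2 (moebius g \<tau>) (theta_arg g \<tau> z)) = q (\<rho> (Theta2 \<tau> z))" if "q \<in> W'" for z q
        unfolding m theta_factor_def theta_arg_def J K unfolding 1(1) by (rule T[OF 1(2) that])
    qed
  qed
qed

definition m33 :: "complex \<Rightarrow> complex \<Rightarrow> complex \<Rightarrow> complex \<Rightarrow> complex \<Rightarrow> complex \<Rightarrow> complex \<Rightarrow> complex \<Rightarrow> complex \<Rightarrow> complex^3^3" where
  "m33 a b c d e f g h i = vector [vector [a, b, c], vector [d, e, f], vector [g, h, i]]"

lemma m33_nth [simp]:
  "m33 a b c d e f g h i $ 1 $ 1 = a" "m33 a b c d e f g h i $ 1 $ 2 = b" "m33 a b c d e f g h i $ 1 $ 3 = c"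
  "m33 a b c d e f g h i $ 2 $ 1 = d" "m33 a b c d e f g h i $ 2 $ 2 = e" "m33 a b c d e f g h i $ 2 $ 3 = f"
  "m33 a b c d e f g h i $ 3 $ 1 = g" "m33 a b c d e f g h i $ 3 $ 2 = h" "m33 a b c d e f g h i $ 3 $ 3 = i"
  by (simp_all add: m33_def)

lemma m33_apply: "m33 a b c d e f g h i *v z = vector [a * z $ 1 + b * z $ 2 + c * z $ 3, d * z $ 1 + e * z $ 2 + f * z
    $ 3, g * z $ 1 + h * z $ 2 + i * z $ 3]"
  by (simp add: vec3_eq_iff matrix_vector_mult_def sum_3)

lemma m33_transpose: "transpose (m33 a b c d e f g h i) = m33 a d g b e h c f i"
  by (simp add: vec3_eq_iff transpose_def)

lemma mat_1_m33: "mat 1 = m33 1 0 0 0 1 0 0 0 1"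
  by (simp add: vec3_eq_iff mat_def)

lemma sm_m33: "sm a b c d e f = m33 a b c b d e c e f"
  by (simp add: vec3_eq_iff)

lemma m33_mult: "m33 a b c d e f g h i ** m33 a' b' c' d' e' f' g' h' i' = m33
   (a * a' + b * d' + c * g') (a * b' + b * e' + c * h') (a * c' + b * f' + c * i')
   (d * a' + e * d' + f * g') (d * b' + e * e' + f * h') (d * c' + e * f' + f * i')
   (g * a' + h * d' + i * g') (g * b' + h * e' + i * h') (g * c' + h * f' + i * i')"
  by (simp add: vec3_eq_iff matrix_matrix_mult_def sum_3)

lemma m33_add: "m33 a b c d e f g h i + m33 a' b' c' d' e' f' g' h' i' =
   m33 (a + a') (b + b') (c + c') (d + d') (e + e') (f + f') (g + g') (h + h') (i + i')"
  by (simp add: vec3_eq_iff)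

lemma m33_eq_iff: "m33 a b c d e f g h i = m33 a' b' c' d' e' f' g' h' i' \<longleftrightarrow>
   a = a' \<and> b = b' \<and> c = c' \<and> d = d' \<and> e = e' \<and> f = f' \<and> g = g' \<and> h = h' \<and> i = i'"
  by (auto simp: vec3_eq_iff)

lemma m33_det: "det (m33 a b c d e f g h i) = a * e * i + b * f * g + c * d * h - a * f * h - b * d * i - c * e * g"
  by (simp add: det_3)

lemma vector3_eta: "vector [z $ 1, z $ 2, z $ 3] = (z :: complex^3)"
  by (simp add: vec3_eq_iff)

lemma generator_blocks:
  "blockA (embE 1 a b c d) = m33 (of_int a) 0 0 0 1 0 0 0 1" "blockB (embE 1 a b c d) = m33 (of_int b) 0 0 0 0 0 0 0 0"
  "blockC (embE 1 a b c d) = m33 (of_int c) 0 0 0 0 0 0 0 0" "blockD (embE 1 a b c d) = m33 (of_int d) 0 0 0 1 0 0 0 1"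
  "blockA (permP s12) = m33 0 1 0 1 0 0 0 0 1" "blockB (permP s12) = 0" "blockC (permP s12) = 0" "blockD (permP s12) =
      m33 0 1 0 1 0 0 0 0 1"
  "blockA (permP s23) = m33 1 0 0 0 0 1 0 1 0" "blockB (permP s23) = 0" "blockC (permP s23) = 0" "blockD (permP s23) =
      m33 1 0 0 0 0 1 0 1 0"
  "blockA (shearU 1 2 1) = m33 1 1 0 0 1 0 0 0 1" "blockB (shearU 1 2 1) = 0" "blockC (shearU 1 2 1) = 0" "blockD
      (shearU 1 2 1) = m33 1 0 0 (-1) 1 0 0 0 1"
  by (simp_all add: vec3_eq_iff blockA_def blockB_def blockC_def blockD_def embE_def permP_def shearU_def blk_def
      Transposition.transpose_def)

lemma realizes_one: "realizes (mat 1) (\<lambda>x. x)"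
  by (rule realizes_generatorI[where J = "\<lambda>_ _ _ _ _ _. mat 1" and K = "\<lambda>_ _ _ _ _ _. mat 1" and \<tau>' = sm])
     (auto simp: Sp6Z_one moves_to_def automorphy_def blocks_one cdot_def transpose_mat)

lemma Theta2_comp:
  "Theta2 (sm (a + 1) b c d e f) z = rhoT11 (Theta2 (sm a b c d e f) z)"
  "Theta2 (sm d b e a c f) (vector [z $ 2, z $ 1, z $ 3]) = Theta2 (sm a b c d e f) z \<circ> sw12"
  "Theta2 (sm a c b f e d) (vector [z $ 1, z $ 3, z $ 2]) = Theta2 (sm a b c d e f) z \<circ> sw23"
  "Theta2 (sm (a + 2 * b + d) (b + d) (c + e) d e f) (vector [z $ 1 + z $ 2, z $ 2, z $ 3]) = Theta2 (sm a b c d e f) z \<circ> sh12"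
proof -
  have ext: "x = y" if "\<And>e1 e2 e3. x (bv e1 e2 e3) = y (bv e1 e2 e3)" for x y :: "bit^3 \<Rightarrow> complex"
    using that by (metis bv_cases ext)
  show "Theta2 (sm (a + 1) b c d e f) z = rhoT11 (Theta2 (sm a b c d e f) z)"
    by (rule ext) (simp add: Theta2_T11 rhoT11_def)
  show "Theta2 (sm d b e a c f) (vector [z $ 2, z $ 1, z $ 3]) = Theta2 (sm a b c d e f) z \<circ> sw12"
    by (rule ext) (simp add: Theta2_swap12 sw12_def vector3_eta)
  show "Theta2 (sm a c b f e d) (vector [z $ 1, z $ 3, z $ 2]) = Theta2 (sm a b c d e f) z \<circ> sw23"
    by (rule ext) (simp add: Theta2_swap23 sw23_def vector3_eta)
  show "Theta2 (sm (a + 2 * b + d) (b + d) (c + e) d e f) (vector [z $ 1 + z $ 2, z $ 2, z $ 3]) = Theta2 (sm a b c d e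
      f) z \<circ> sh12"
    by (rule ext) (simp add: Theta2_shear sh12_def vector3_eta)
qed

lemma W'_linpair: "linpair A B \<Longrightarrow> q \<in> W' \<Longrightarrow> (\<lambda>x. q (x \<circ> A)) \<in> W'"
proof -
  assume AB: "linpair A B" and "q \<in> W'"
  then obtain b b' where q: "q = qcomb b b'" using W'_iff by blast
  obtain c c' where "\<forall>x. qcomb b b' (x \<circ> A) = qcomb c c' x" using qcomb_linpair[OF AB] by blast
  then have "(\<lambda>x. q (x \<circ> A)) = qcomb c c'" by (simp add: q fun_eq_iff)
  then show ?thesis using W'_iff by blast
qed

lemma W'_rhoT11: "q \<in> W' \<Longrightarrow> (\<lambda>x. q (rhoT11 x)) \<in> W'"
proof -
  assume "q \<in> W'"
  then obtain b b' where q: "q = qcomb b b'" using W'_iff by blast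
  obtain c c' where "\<forall>x. qcomb b b' (rhoT11 x) = qcomb c c' x" using qcomb_rhoT11 by blast
  then have "(\<lambda>x. q (rhoT11 x)) = qcomb c c'" by (simp add: q fun_eq_iff)
  then show ?thesis using W'_iff by blast
qed

lemmas m33_simps = m33_mult m33_add m33_apply m33_det m33_transpose m33_eq_iff

lemma moves_to_T:
  assumes S: "siegel6 a b c d e f"
  shows "moves_to (embE 1 1 1 0 1) (sm a b c d e f) (sm (a + 1) b c d e f) (mat 1) (mat 1)"
  using siegel6_T11[OF S] by (simp add: moves_to_def automorphy_def generator_blocks sm_m33 mat_1_m33 m33_simps del:
      sm_in_siegel) (simp flip: sm_m33)

lemma realizes_T: "realizes (embE 1 1 1 0 1) rhoT11"
proof (rule realizes_generatorI[where J = "\<lambda>_ _ _ _ _ _. mat 1" and K = "\<lambda>_ _ _ _ _ _. mat 1" and \<tau>' = "\<lambda>a b c d e f. sm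
    (a + 1) b c d e f"])
  show "embE 1 1 1 0 1 \<in> Sp6Z" by (intro SpG_Sp6Z SpG.intros)
  fix a b c d e f assume S: "siegel6 a b c d e f"
  show "moves_to (embE 1 1 1 0 1) (sm a b c d e f) (sm (a + 1) b c d e f) (mat 1) (mat 1)"
    by (rule moves_to_T[OF S])
  show "CF (sm (a + 1) b c d e f) (rhoT11 x) = det (mat 1 :: complex^3^3) ^ 14 * CF (sm a b c d e f) x" for x
    by (simp add: CF_T11[OF S])
  show "exp (- 8 * of_real pi * \<i> * cdot z (mat 1 *v (blockC (embE 1 1 1 0 1) *v z))) / det (mat 1 :: complex^3^3) ^ 2
        * q (Theta2 (sm (a + 1) b c d e f) (transpose (mat 1) *v z)) = q (rhoT11 (Theta2 (sm a b c d e f) z))" for z q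
    by (simp add: generator_blocks m33_apply transpose_mat Theta2_comp) (simp add: cdot_def sum_3)
qed (rule W'_rhoT11)

lemma moves_to_P12:
  assumes S: "siegel6 a b c d e f"
  shows "moves_to (permP s12) (sm a b c d e f) (sm d b e a c f) (m33 0 1 0 1 0 0 0 0 1) (m33 0 1 0 1 0 0 0 0 1)"
  using siegel6_swap12[OF S] by (simp add: moves_to_def automorphy_def generator_blocks sm_m33 mat_1_m33 m33_simps del:
      sm_in_siegel) (simp flip: sm_m33)

lemma realizes_P12: "realizes (permP s12) (\<lambda>x. x \<circ> sw12)"
proof (rule realizes_generatorI[where J = "\<lambda>_ _ _ _ _ _. m33 0 1 0 1 0 0 0 0 1" and K = "\<lambda>_ _ _ _ _ _. m33 0 1 0 1 0 0 0 0 1"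
     and \<tau>' = "\<lambda>a b c d e f. sm d b e a c f"])
  show "permP s12 \<in> Sp6Z" by (intro SpG_Sp6Z SpG.intros)
  fix a b c d e f assume S: "siegel6 a b c d e f"
  show "moves_to (permP s12) (sm a b c d e f) (sm d b e a c f) (m33 0 1 0 1 0 0 0 0 1) (m33 0 1 0 1 0 0 0 0 1)"
    by (rule moves_to_P12[OF S])
  show "CF (sm d b e a c f) (x \<circ> sw12) = det (m33 0 1 0 1 0 0 0 0 1) ^ 14 * CF (sm a b c d e f) x" for x
    by (simp add: CF_sw12[OF S] m33_det)
  show "exp (- 8 * of_real pi * \<i> * cdot z (m33 0 1 0 1 0 0 0 0 1 *v (blockC (permP s12) *v z))) / det (m33 0 1 0 1 0 0 0 0 1) ^ 2
        * q (Theta2 (sm d b e a c f) (transpose (m33 0 1 0 1 0 0 0 0 1) *v z)) = q (Theta2 (sm a b c d e f) z \<circ> sw12)" for z q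
    by (simp add: generator_blocks m33_simps Theta2_comp) (simp add: cdot_def sum_3)
qed (rule W'_linpair[OF linpair_sw12])

lemma moves_to_P23:
  assumes S: "siegel6 a b c d e f"
  shows "moves_to (permP s23) (sm a b c d e f) (sm a c b f e d) (m33 1 0 0 0 0 1 0 1 0) (m33 1 0 0 0 0 1 0 1 0)"
  using siegel6_swap23[OF S] by (simp add: moves_to_def automorphy_def generator_blocks sm_m33 mat_1_m33 m33_simps del:
      sm_in_siegel) (simp flip: sm_m33)

lemma realizes_P23: "realizes (permP s23) (\<lambda>x. x \<circ> sw23)"
proof (rule realizes_generatorI[where J = "\<lambda>_ _ _ _ _ _. m33 1 0 0 0 0 1 0 1 0" and K = "\<lambda>_ _ _ _ _ _. m33 1 0 0 0 0 1 0 1 0"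
     and \<tau>' = "\<lambda>a b c d e f. sm a c b f e d"])
  show "permP s23 \<in> Sp6Z" by (intro SpG_Sp6Z SpG.intros)
  fix a b c d e f assume S: "siegel6 a b c d e f"
  show "moves_to (permP s23) (sm a b c d e f) (sm a c b f e d) (m33 1 0 0 0 0 1 0 1 0) (m33 1 0 0 0 0 1 0 1 0)"
    by (rule moves_to_P23[OF S])
  show "CF (sm a c b f e d) (x \<circ> sw23) = det (m33 1 0 0 0 0 1 0 1 0) ^ 14 * CF (sm a b c d e f) x" for x
    by (simp add: CF_sw23[OF S] m33_det)
  show "exp (- 8 * of_real pi * \<i> * cdot z (m33 1 0 0 0 0 1 0 1 0 *v (blockC (permP s23) *v z))) / det (m33 1 0 0 0 0 1 0 1 0) ^ 2
        * q (Theta2 (sm a c b f e d) (transpose (m33 1 0 0 0 0 1 0 1 0) *v z)) = q (Theta2 (sm a b c d e f) z \<circ> sw23)" for z q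
    by (simp add: generator_blocks m33_simps Theta2_comp) (simp add: cdot_def sum_3)
qed (rule W'_linpair[OF linpair_sw23])

lemma moves_to_U:
  assumes S: "siegel6 a b c d e f"
  shows "moves_to (shearU 1 2 1) (sm a b c d e f) (sm (a + 2 * b + d) (b + d) (c + e) d e f) (m33 1 0 0 (-1) 1 0 0 0 1)
      (m33 1 0 0 1 1 0 0 0 1)"
  using siegel6_shear[OF S] by (simp add: moves_to_def automorphy_def generator_blocks sm_m33 mat_1_m33 m33_simps del:
      sm_in_siegel) (simp flip: sm_m33)

lemma realizes_U: "realizes (shearU 1 2 1) (\<lambda>x. x \<circ> sh12)"
proof (rule realizes_generatorI[where J = "\<lambda>_ _ _ _ _ _. m33 1 0 0 (-1) 1 0 0 0 1" and K = "\<lambda>_ _ _ _ _ _. m33 1 0 0 1 1 0 0 0 1"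
     and \<tau>' = "\<lambda>a b c d e f. sm (a + 2 * b + d) (b + d) (c + e) d e f"])
  show "shearU 1 2 1 \<in> Sp6Z" by (intro SpG_Sp6Z SpG.intros)
  fix a b c d e f assume S: "siegel6 a b c d e f"
  show "moves_to (shearU 1 2 1) (sm a b c d e f) (sm (a + 2 * b + d) (b + d) (c + e) d e f) (m33 1 0 0 (-1) 1 0 0 0 1)
      (m33 1 0 0 1 1 0 0 0 1)"
    by (rule moves_to_U[OF S])
  show "CF (sm (a + 2 * b + d) (b + d) (c + e) d e f) (x \<circ> sh12) = det (m33 1 0 0 (-1) 1 0 0 0 1) ^ 14 * CF (sm a b c d
      e f) x" for x
    by (simp add: CF_sh12[OF S] m33_det)
  show "exp (- 8 * of_real pi * \<i> * cdot z (m33 1 0 0 1 1 0 0 0 1 *v (blockC (shearU 1 2 1) *v z))) / det (m33 1 0 0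
      (-1) 1 0 0 0 1) ^ 2
        * q (Theta2 (sm (a + 2 * b + d) (b + d) (c + e) d e f) (transpose (m33 1 0 0 1 1 0 0 0 1) *v z)) = q (Theta2 (sm
            a b c d e f) z \<circ> sh12)" for z q
    by (simp add: generator_blocks m33_simps Theta2_comp) (simp add: cdot_def sum_3)
qed (rule W'_linpair[OF linpair_sh12])

lemma moves_to_S:
  assumes S: "siegel6 a b c d e f"
  shows "moves_to (embE 1 0 (-1) 1 0) (sm a b c d e f) (invm a b c d e f) (m33 a b c 0 1 0 0 0 1) (m33 (1 / a) (- b / a)
      (- c / a) 0 1 0 0 0 1)"
proof -
  have a: "a \<noteq> 0" using siegel6_Im_pos[OF S] by auto
  have "invm a b c d e f \<in> siegel" unfolding sm_in_siegel by (rule siegel6_inversion[OF S])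
  moreover have "m33 a b c 0 1 0 0 0 1 ** m33 (1 / a) (- b / a) (- c / a) 0 1 0 0 0 1 = mat 1"
    using a by (simp add: mat_1_m33 m33_simps)
  moreover have "blockA (embE 1 0 (-1) 1 0) ** sm a b c d e f + blockB (embE 1 0 (-1) 1 0) = invm a b c d e f ** m33 a b
      c 0 1 0 0 0 1"
    using a by (simp add: generator_blocks sm_m33 m33_simps power2_eq_square)
  moreover have "automorphy (embE 1 0 (-1) 1 0) (sm a b c d e f) = m33 a b c 0 1 0 0 0 1"
    by (simp add: automorphy_def generator_blocks sm_m33 m33_simps)
  ultimately show ?thesis unfolding moves_to_def by (intro conjI)
qed

lemma realizes_S: "realizes (embE 1 0 (-1) 1 0) rhoJ"
proof (rule realizes_generatorI[where J = "\<lambda>a b c d e f. m33 a b c 0 1 0 0 0 1" and K = "\<lambda>a b c d e f. m33 (1 / a) (- b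
    / a) (- c / a) 0 1 0 0 0 1"
     and \<tau>' = "\<lambda>a b c d e f. invm a b c d e f"])
  show "embE 1 0 (-1) 1 0 \<in> Sp6Z" by (intro SpG_Sp6Z SpG.intros)
  fix a b c d e f assume S: "siegel6 a b c d e f"
  have a: "a \<noteq> 0" "0 < Im a" using siegel6_Im_pos[OF S] by auto
  show "moves_to (embE 1 0 (-1) 1 0) (sm a b c d e f) (invm a b c d e f) (m33 a b c 0 1 0 0 0 1) (m33 (1 / a) (- b / a)
      (- c / a) 0 1 0 0 0 1)"
    by (rule moves_to_S[OF S])
  show "CF (invm a b c d e f) (rhoJ x) = det (m33 a b c 0 1 0 0 0 1) ^ 14 * CF (sm a b c d e f) x" for x
    using CF_inversion[OF S, of x] by (simp only: m33_det) simp
  fix z :: "complex^3" and q assume q: "q \<in> W'"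
  have arg: "transpose (m33 (1 / a) (- b / a) (- c / a) 0 1 0 0 0 1) *v z = vector [z $ 1 / a, z $ 2 - b * z $ 1 / a, z
      $ 3 - c * z $ 1 / a]"
    by (simp add: m33_simps vec3_eq_iff)
  have cd: "cdot z (m33 (1 / a) (- b / a) (- c / a) 0 1 0 0 0 1 *v (blockC (embE 1 0 (-1) 1 0) *v z)) = (z $ 1)\<^sup>2 / a"
    by (simp add: generator_blocks m33_simps cdot_def sum_3 power2_eq_square)
  let ?k = "gauss_c0 (a / 2) * exp (2 * of_real pi * \<i> * ((z $ 1)\<^sup>2 / a))"
  have th: "Theta2 (invm a b c d e f) (vector [z $ 1 / a, z $ 2 - b * z $ 1 / a, z $ 3 - c * z $ 1 / a]) = (\<lambda>e'. ?k *
      rhoJ0 (Theta2 (sm a b c d e f) z) e')"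
  proof
    fix u :: "bit^3"
    show "Theta2 (invm a b c d e f) (vector [z $ 1 / a, z $ 2 - b * z $ 1 / a, z $ 3 - c * z $ 1 / a]) u = ?k * rhoJ0
        (Theta2 (sm a b c d e f) z) u"
    proof (cases u rule: bv_cases)
      case (1 u1 u2 u3)
      show ?thesis unfolding 1 Theta2_inv[OF S] rhoJ0_def bv_nth vector3_eta by simp
    qed
  qed
  have g4: "gauss_c0 (a / 2) ^ 4 = - (a\<^sup>2) / 4"
  proof -
    have "gauss_c0 (a / 2) ^ 4 = ((gauss_c0 (a / 2))\<^sup>2)\<^sup>2" by (simp flip: power_mult)
    also have "\<dots> = (- \<i> * (a / 2))\<^sup>2" using a by (subst gauss_c0_square) auto
    finally show ?thesis by (simp add: power_mult_distrib power_divide)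
  qed
  have e4: "exp (2 * of_real pi * \<i> * ((z $ 1)\<^sup>2 / a)) ^ 4 = exp (8 * of_real pi * \<i> * ((z $ 1)\<^sup>2 / a))"
    unfolding exp_of_nat_mult[symmetric] by (simp add: mult_ac)
  have k4: "exp (- 8 * of_real pi * \<i> * ((z $ 1)\<^sup>2 / a)) / a\<^sup>2 * ?k ^ 4 = - 1 / 4"
  proof -
    have "exp (- 8 * of_real pi * \<i> * ((z $ 1)\<^sup>2 / a)) * exp (8 * of_real pi * \<i> * ((z $ 1)\<^sup>2 / a)) = 1"
      unfolding exp_add[symmetric] by simp
    moreover have "exp (- 8 * of_real pi * \<i> * ((z $ 1)\<^sup>2 / a)) / a\<^sup>2 * ?k ^ 4 =
       (exp (- 8 * of_real pi * \<i> * ((z $ 1)\<^sup>2 / a)) * exp (8 * of_real pi * \<i> * ((z $ 1)\<^sup>2 / a))) * (- (a\<^sup>2) / 4 / a\<^sup>2)"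
      unfolding power_mult_distrib g4 e4 by simp
    ultimately show ?thesis using a by simp
  qed
  obtain b1 b2 where qb: "q = qcomb b1 b2" using q W'_iff by blast
  have "q (rhoJ (Theta2 (sm a b c d e f) z)) = - 1 / 4 * q (rhoJ0 (Theta2 (sm a b c d e f) z))"
    unfolding rhoJ_def[abs_def] qb qcomb_scale kappa_power ..
  moreover have "q (\<lambda>e'. ?k * rhoJ0 (Theta2 (sm a b c d e f) z) e') = ?k ^ 4 * q (rhoJ0 (Theta2 (sm a b c d e f) z))"
    unfolding qb qcomb_scale ..
  moreover have "det (m33 a b c 0 1 0 0 0 1) = a" by (simp add: m33_det)
  ultimately show "exp (- 8 * of_real pi * \<i> * cdot z (m33 (1 / a) (- b / a) (- c / a) 0 1 0 0 0 1 *v (blockC (embE 1 0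
      (-1) 1 0) *v z))) / det (m33 a b c 0 1 0 0 0 1) ^ 2
        * q (Theta2 (invm a b c d e f) (transpose (m33 (1 / a) (- b / a) (- c / a) 0 1 0 0 0 1) *v z)) = q (rhoJ (Theta2
            (sm a b c d e f) z))"
    unfolding arg cd th using k4 by (simp only: mult.assoc[symmetric])
qed (rule W'_rhoJ)

lemma exists_realizes: "g \<in> Sp6Z \<Longrightarrow> \<exists>\<rho>. realizes g \<rho>"
proof -
  assume "g \<in> Sp6Z"
  then have "g \<in> SpG" by (rule Sp6Z_generated)
  then show ?thesis
    by (induction rule: SpG.induct) (blast intro: realizes_one realizes_S realizes_T realizes_P12 realizes_P23
        realizes_U realizes_mult)+
qed

section \<open>Quartics are determined by their restriction to theta functions\<close>

definition rhoT33 :: "(bit^3 \<Rightarrow> complex) \<Rightarrow> bit^3 \<Rightarrow> complex" where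
  "rhoT33 x e = (if e $ 3 = 1 then \<i> else 1) * x e"
definition rhoT13 :: "(bit^3 \<Rightarrow> complex) \<Rightarrow> bit^3 \<Rightarrow> complex" where
  "rhoT13 x e = (if e $ 1 = 1 \<and> e $ 3 = 1 then -1 else 1) * x e"
definition rhoT23 :: "(bit^3 \<Rightarrow> complex) \<Rightarrow> bit^3 \<Rightarrow> complex" where
  "rhoT23 x e = (if e $ 2 = 1 \<and> e $ 3 = 1 then -1 else 1) * x e"

definition realizable :: "((bit^3 \<Rightarrow> complex) \<Rightarrow> bit^3 \<Rightarrow> complex) \<Rightarrow> bool" where
  "realizable \<rho> \<longleftrightarrow> (\<exists>g. realizes g \<rho>)"

lemma realizable_comp: "realizable \<rho> \<Longrightarrow> realizable \<sigma> \<Longrightarrow> realizable (\<lambda>x. \<rho> (\<sigma> x))"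
  unfolding realizable_def using realizes_mult by (fastforce simp: comp_def)

lemma realizable_generators:
  "realizable rhoJ" "realizable (\<lambda>x. x \<circ> sw12)" "realizable (\<lambda>x. x \<circ> sw23)" "realizable (\<lambda>x. x \<circ> sh12)" "realizable rhoT11"
  unfolding realizable_def using realizes_S realizes_P12 realizes_P23 realizes_U realizes_T by blast+

lemma realizable_translations:
  "realizable rhoT22" "realizable rhoT33" "realizable rhoT12" "realizable rhoT13" "realizable rhoT23"
proof -
  note comp = realizable_comp
  note sw12 = realizable_generators(2) and sw23 = realizable_generators(3) and sh12 = realizable_generators(4) and T11 =
      realizable_generators(5)
  have "rhoT22 = (\<lambda>x. rhoT11 (x \<circ> sw12) \<circ> sw12)"
    by (simp add: fun_eq_iff rhoT22_def rhoT11_def) (simp add: sw12_def)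
  then show T22: "realizable rhoT22" using comp[OF sw12 comp[OF T11 sw12]] by simp
  have "rhoT33 = (\<lambda>x. rhoT22 (x \<circ> sw23) \<circ> sw23)"
    by (simp add: fun_eq_iff rhoT22_def rhoT33_def) (simp add: sw23_def)
  then show "realizable rhoT33" using comp[OF sw23 comp[OF T22 sw23]] by simp
  have "rhoT12 = (\<lambda>x. rhoT11 (rhoT11 (rhoT11 (rhoT22 (rhoT22 (rhoT22 (rhoT22 (x \<circ> sh12) \<circ> sh12)))))))"
  proof (intro ext)
    fix x :: "bit^3 \<Rightarrow> complex" and e :: "bit^3"
    show "rhoT12 x e = rhoT11 (rhoT11 (rhoT11 (rhoT22 (rhoT22 (rhoT22 (rhoT22 (x \<circ> sh12) \<circ> sh12)))))) e"
    proof (cases e rule: bv_cases)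
      case (1 e1 e2 e3)
      show ?thesis unfolding 1
        by (cases e1 rule: bit_cases01; cases e2 rule: bit_cases01)
           (simp_all add: rhoT22_def rhoT11_def rhoT12_def sh12_def)
    qed
  qed
  then show T12: "realizable rhoT12"
    using comp[OF T11 comp[OF T11 comp[OF T11 comp[OF T22 comp[OF T22 comp[OF T22 comp[OF sh12 comp[OF T22 sh12]]]]]]]] by simp
  have "rhoT13 = (\<lambda>x. rhoT12 (x \<circ> sw23) \<circ> sw23)"
    by (simp add: fun_eq_iff rhoT12_def rhoT13_def) (simp add: sw23_def)
  then show T13: "realizable rhoT13" using comp[OF sw23 comp[OF T12 sw23]] by simp
  have "rhoT23 = (\<lambda>x. rhoT13 (x \<circ> sw12) \<circ> sw12)"
    by (simp add: fun_eq_iff rhoT13_def rhoT23_def) (simp add: sw12_def)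
  then show T23: "realizable rhoT23" using comp[OF sw12 comp[OF T13 sw12]] by simp
qed

definition bit_sign :: "bit \<Rightarrow> complex" where "bit_sign u = (if u = 1 then -1 else 1)"

lemma bit_sign_simps [simp]: "bit_sign 0 = 1" "bit_sign 1 = -1" "bit_sign u * bit_sign u = 1" "bit_sign u * (bit_sign u * c) = c"
  by (simp_all add: bit_sign_def)

lemma quartics_off_diagonal:
  "QQ u (rhoT12 x) = QQ u x" "QQ u (rhoT13 x) = QQ u x" "QQ u (rhoT23 x) = QQ u x"
  "v \<noteq> 0 \<Longrightarrow> QP v (rhoT12 x) = bit_sign (v $ 3) * QP v x"
  "v \<noteq> 0 \<Longrightarrow> QP v (rhoT13 x) = bit_sign (v $ 2) * QP v x"
  "v \<noteq> 0 \<Longrightarrow> QP v (rhoT23 x) = bit_sign (v $ 1) * QP v x"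
proof -
  have Q: "QQ u (rhoT12 x) = QQ u x \<and> QQ u (rhoT13 x) = QQ u x \<and> QQ u (rhoT23 x) = QQ u x"
  proof (cases u rule: bv_cases)
    case (1 u1 u2 u3)
    show ?thesis unfolding 1
      by (cases u1 rule: bit_cases01; cases u2 rule: bit_cases01; cases u3 rule: bit_cases01)
         (simp_all add: QQ_explicit rhoT12_def rhoT13_def rhoT23_def)
  qed
  then show "QQ u (rhoT12 x) = QQ u x" "QQ u (rhoT13 x) = QQ u x" "QQ u (rhoT23 x) = QQ u x" by auto
  have P: "QP v (rhoT12 x) = bit_sign (v $ 3) * QP v x \<and> QP v (rhoT13 x) = bit_sign (v $ 2) * QP v x \<and> QP v (rhoT23 x) =
      bit_sign (v $ 1) * QP v x"
    if "v \<noteq> 0"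
  proof (cases v rule: bv_cases)
    case (1 v1 v2 v3)
    show ?thesis using that unfolding 1
      by (cases v1 rule: bit_cases01; cases v2 rule: bit_cases01; cases v3 rule: bit_cases01)
         (simp_all add: QP_explicit rhoT12_def rhoT13_def rhoT23_def)
  qed
  show "v \<noteq> 0 \<Longrightarrow> QP v (rhoT12 x) = bit_sign (v $ 3) * QP v x"
    "v \<noteq> 0 \<Longrightarrow> QP v (rhoT13 x) = bit_sign (v $ 2) * QP v x"
    "v \<noteq> 0 \<Longrightarrow> QP v (rhoT23 x) = bit_sign (v $ 1) * QP v x"
    using P by auto
qed

lemma qcomb_off_diagonal:
  "qcomb b b' (rhoT12 x) = qcomb b (\<lambda>v. bit_sign (v $ 3) * b' v) x"
  "qcomb b b' (rhoT13 x) = qcomb b (\<lambda>v. bit_sign (v $ 2) * b' v) x"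
  "qcomb b b' (rhoT23 x) = qcomb b (\<lambda>v. bit_sign (v $ 1) * b' v) x"
  by (simp_all add: qcomb_def quartics_off_diagonal mult_ac)

definition diag_char :: "3 \<Rightarrow> bit^3 \<Rightarrow> complex" where
  "diag_char i v = (if v = axis i 1 then 1 else -1)"

lemma axis_bv: "axis 1 1 = bv 1 0 0" "axis 2 1 = bv 0 1 0" "axis 3 1 = bv 0 0 1"
  by (simp_all add: vec3_eq_iff axis_def)

lemma quartics_diagonal:
  "QQ u (rhoT11 x) = bit_sign (u $ 1) * QQ u x" "QQ u (rhoT22 x) = bit_sign (u $ 2) * QQ u x" "QQ u (rhoT33 x) =
      bit_sign (u $ 3) * QQ u x"
  "v \<noteq> 0 \<Longrightarrow> QP v (rhoT11 x) = diag_char 1 v * QP v x"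
  "v \<noteq> 0 \<Longrightarrow> QP v (rhoT22 x) = diag_char 2 v * QP v x"
  "v \<noteq> 0 \<Longrightarrow> QP v (rhoT33 x) = diag_char 3 v * QP v x"
proof -
  have i4: "(\<i> * y) ^ 4 = y ^ 4" "(\<i> * y)\<^sup>2 = - y\<^sup>2" for y by (simp_all add: power_mult_distrib)
  have Q: "QQ u (rhoT11 x) = bit_sign (u $ 1) * QQ u x \<and> QQ u (rhoT22 x) = bit_sign (u $ 2) * QQ u x \<and> QQ u (rhoT33 x) =
      bit_sign (u $ 3) * QQ u x"
  proof (cases u rule: bv_cases)
    case (1 u1 u2 u3)
    show ?thesis unfolding 1
      by (cases u1 rule: bit_cases01; cases u2 rule: bit_cases01; cases u3 rule: bit_cases01)
         (simp_all add: QQ_explicit rhoT11_def rhoT22_def rhoT33_def i4 power_mult_distrib)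
  qed
  then show "QQ u (rhoT11 x) = bit_sign (u $ 1) * QQ u x" "QQ u (rhoT22 x) = bit_sign (u $ 2) * QQ u x" "QQ u (rhoT33 x)
      = bit_sign (u $ 3) * QQ u x" by auto
  have P: "QP v (rhoT11 x) = diag_char 1 v * QP v x \<and> QP v (rhoT22 x) = diag_char 2 v * QP v x \<and> QP v (rhoT33 x) =
      diag_char 3 v * QP v x"
    if "v \<noteq> 0"
  proof (cases v rule: bv_cases)
    case (1 v1 v2 v3)
    show ?thesis using that unfolding 1
      by (cases v1 rule: bit_cases01; cases v2 rule: bit_cases01; cases v3 rule: bit_cases01)
         (simp_all add: QP_explicit rhoT11_def rhoT22_def rhoT33_def diag_char_def axis_bv algebra_simps)
  qed
  show "v \<noteq> 0 \<Longrightarrow> QP v (rhoT11 x) = diag_char 1 v * QP v x"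
    "v \<noteq> 0 \<Longrightarrow> QP v (rhoT22 x) = diag_char 2 v * QP v x"
    "v \<noteq> 0 \<Longrightarrow> QP v (rhoT33 x) = diag_char 3 v * QP v x"
    using P by auto
qed

lemma qcomb_diagonal:
  "qcomb b b' (rhoT11 x) = qcomb (\<lambda>u. bit_sign (u $ 1) * b u) (\<lambda>v. diag_char 1 v * b' v) x"
  "qcomb b b' (rhoT22 x) = qcomb (\<lambda>u. bit_sign (u $ 2) * b u) (\<lambda>v. diag_char 2 v * b' v) x"
  "qcomb b b' (rhoT33 x) = qcomb (\<lambda>u. bit_sign (u $ 3) * b u) (\<lambda>v. diag_char 3 v * b' v) x"
  by (simp_all add: qcomb_def quartics_diagonal mult_ac)

lemma qcomb_lin: "k * qcomb b b' x + l * qcomb c c' x = qcomb (\<lambda>u. k * b u + l * c u) (\<lambda>v. k * b' v + l * c' v) x"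
  by (simp add: qcomb_def sum_distrib_left sum.distrib algebra_simps)

definition theta_null :: "((bit^3 \<Rightarrow> complex) \<Rightarrow> complex) set" where
  "theta_null = {q \<in> W'. \<forall>\<tau>\<in>siegel. \<forall>z. q (Theta2 \<tau> z) = 0}"

lemma theta_null_comp:
  assumes "realizable \<rho>" "q \<in> theta_null"
  shows "(\<lambda>x. q (\<rho> x)) \<in> theta_null"
proof -
  obtain g where g: "realizes g \<rho>" using assms(1) by (auto simp: realizable_def)
  have q: "q \<in> W'" "\<And>\<tau> z. \<tau> \<in> siegel \<Longrightarrow> q (Theta2 \<tau> z) = 0" using assms(2) by (auto simp: theta_null_def)
  have "q (\<rho> (Theta2 \<tau> z)) = 0" if "\<tau> \<in> siegel" for \<tau> z
  proof -
    have "regular_at g \<tau>" "theta_factor g \<tau> z * q (Theta2 (moebius g \<tau>) (theta_arg g \<tau> z)) = q (\<rho> (Theta2 \<tau> z))"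
      using g that q(1) by (auto simp: realizes_def)
    then show ?thesis using q(2)[of "moebius g \<tau>"] by (simp add: regular_at_def)
  qed
  moreover have "(\<lambda>x. q (\<rho> x)) \<in> W'" using g q(1) by (auto simp: realizes_def)
  ultimately show ?thesis by (simp add: theta_null_def)
qed

lemma theta_null_filter:
  assumes N: "qcomb b b' \<in> theta_null" and r: "realizable \<rho>"
    and e: "\<And>x. qcomb b b' (\<rho> x) = qcomb c c' x"
  shows "qcomb (\<lambda>u. (b u + s * c u) / 2) (\<lambda>v. (b' v + s * c' v) / 2) \<in> theta_null"
proof -
  have eq: "qcomb (\<lambda>u. (b u + s * c u) / 2) (\<lambda>v. (b' v + s * c' v) / 2) = (\<lambda>x. 1 / 2 * qcomb b b' x + (s / 2) * qcomb b b' (\<rho> x))"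
    unfolding e qcomb_lin by (simp add: add_divide_distrib)
  have "(\<lambda>x. qcomb b b' (\<rho> x)) \<in> theta_null" by (rule theta_null_comp[OF r N])
  then have "1 / 2 * qcomb b b' (Theta2 \<tau> z) + (s / 2) * qcomb b b' (\<rho> (Theta2 \<tau> z)) = 0" if "\<tau> \<in> siegel" for \<tau> z
    using N that by (simp add: theta_null_def)
  then show ?thesis
    using qcomb_W'[of "\<lambda>u. (b u + s * c u) / 2" "\<lambda>v. (b' v + s * c' v) / 2"]
    unfolding theta_null_def mem_Collect_eq eq by blast
qed

lemma theta_null_filter_off_diagonal:
  assumes "qcomb b b' \<in> theta_null"
  shows "qcomb (\<lambda>u. (1 + s) / 2 * ((1 + t) / 2 * ((1 + r) / 2 * b u)))
     (\<lambda>v. (1 + s * bit_sign (v $ 1)) / 2 * ((1 + t * bit_sign (v $ 2)) / 2 * ((1 + r * bit_sign (v $ 3)) / 2 * b' v))) \<in>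
         theta_null"
proof -
  have A: "(b u + s * b u) / 2 = (1 + s) / 2 * b u" "(b u + s * (k * b u)) / 2 = (1 + s * k) / 2 * b u" for s k :: complex and b u
    by (simp_all add: algebra_simps)
  note f1 = theta_null_filter[OF _ realizable_translations(3) qcomb_off_diagonal(1), of b b' r, unfolded A]
  note f2 = theta_null_filter[OF f1 realizable_translations(4) qcomb_off_diagonal(2), of t, unfolded A]
  show ?thesis using theta_null_filter[OF f2 realizable_translations(5) qcomb_off_diagonal(3), of s, unfolded A] assms by blast
qed

lemma theta_null_filter_diagonal:
  assumes "qcomb b (\<lambda>_. 0) \<in> theta_null"
  shows "qcomb (\<lambda>u. (1 + s * bit_sign (u $ 1)) / 2 * ((1 + t * bit_sign (u $ 2)) / 2 * ((1 + r * bit_sign (u $ 3)) / 2 *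
      b u))) (\<lambda>_. 0) \<in> theta_null"
proof -
  have A: "(b u + s * (k * b u)) / 2 = (1 + s * k) / 2 * b u" for s k :: complex and b u
    by (simp add: algebra_simps)
  have Z: "(0 + s * (k * 0)) / 2 = (0::complex)" for s k by simp
  note f1 = theta_null_filter[OF _ realizable_translations(2) qcomb_diagonal(3), of b "\<lambda>_. 0" r, unfolded A Z]
  note f2 = theta_null_filter[OF f1 realizable_translations(1) qcomb_diagonal(2), of t, unfolded A Z]
  show ?thesis using theta_null_filter[OF f2 realizable_generators(5) qcomb_diagonal(1), of s, unfolded A Z] assms by blast
qed

lemma Theta2_positive:
  obtains r where "\<And>e. 0 < r e" "Theta2 (sm \<i> 0 0 \<i> 0 \<i>) 0 = (\<lambda>e. complex_of_real (r e))"
    and "sm \<i> 0 0 \<i> 0 \<i> \<in> siegel"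
proof -
  have "0 < x * x + y * y + z * z" if "x \<noteq> 0 \<or> y \<noteq> 0 \<or> z \<noteq> 0" for x y z :: real
  proof -
    have "0 < x * x \<or> 0 < y * y \<or> 0 < z * z" using that not_real_square_gt_zero by blast
    then show ?thesis using zero_le_square[of x] zero_le_square[of y] zero_le_square[of z] by linarith
  qed
  then have S: "siegel6 \<i> 0 0 \<i> 0 \<i>"
    by (auto simp: siegel6_def posdef_def qf_def power2_eq_square)
  have S2: "siegel6 (2 * \<i>) 0 0 (2 * \<i>) 0 (2 * \<i>)"
    using siegel6_double[OF S] by simp
  have "\<exists>r>0. Theta2 (sm \<i> 0 0 \<i> 0 \<i>) 0 e = complex_of_real r" for e
  proof (cases e rule: bv_cases)
    case (1 e1 e2 e3)
    define s :: "bit \<Rightarrow> real" where "s u = (if u = 1 then 1 / 2 else 0)" for u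
    have s: "bitc u / 2 = of_real (s u)" for u by (simp add: s_def bitc_def)
    define f where "f = (\<lambda>(k, l, m). exp (- 2 * pi * ((of_int k + s e1)\<^sup>2 + (of_int l + s e2)\<^sup>2 + (of_int m + s e3)\<^sup>2)))"
    have t: "th3_term (2 * \<i>) 0 0 (2 * \<i>) 0 (2 * \<i>) (of_real (s e1)) (of_real (s e2)) (of_real (s e3)) 0 0 0 p =
        complex_of_real (f p)" for p
    proof (cases p)
      case (fields k l m)
      have "of_real pi * \<i> * (qf (2 * \<i>) 0 0 (2 * \<i>) 0 (2 * \<i>) (of_int k + of_real (s e1)) (of_int l + of_real (s e2))
          (of_int m + of_real (s e3))
          + 2 * ((of_int k + of_real (s e1)) * 0 + (of_int l + of_real (s e2)) * 0 + (of_int m + of_real (s e3)) * 0))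
        = complex_of_real (- 2 * pi * ((of_int k + s e1)\<^sup>2 + (of_int l + s e2)\<^sup>2 + (of_int m + s e3)\<^sup>2))"
        by (simp add: qf_def algebra_simps)
      then show ?thesis unfolding fields th3_term_def f_def prod.case by (simp only: exp_of_real)
    qed
    have "(\<lambda>p. complex_of_real (f p)) summable_on UNIV"
      using th3_summable[OF S2] unfolding t[symmetric] by simp
    then have sf: "f summable_on UNIV"
      using summable_on_Re by fastforce
    have fp: "0 < f p" for p by (cases p) (simp add: f_def)
    have "f (0, 0, 0) \<le> infsum f UNIV"
      using finite_sum_le_infsum[OF sf, of "{(0, 0, 0)}"] fp by (simp add: less_imp_le)
    then have "0 < infsum f UNIV" using fp[of "(0, 0, 0)"] by linarith
    moreover have "Theta2 (sm \<i> 0 0 \<i> 0 \<i>) 0 e = complex_of_real (infsum f UNIV)"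
      unfolding 1 Theta2_th3 s th3_def by (simp only: mult_zero_right zero_index t[THEN ext])
         (rule infsumI, rule iffD2[OF has_sum_of_real_iff], rule has_sum_infsum[OF sf])
    ultimately show ?thesis by blast
  qed
  then obtain r where "\<And>e. 0 < r e" "\<And>e. Theta2 (sm \<i> 0 0 \<i> 0 \<i>) 0 e = complex_of_real (r e)" by metis
  then show ?thesis using that[of r] S by (simp add: fun_eq_iff)
qed

lemma quartics_positive:
  assumes r: "\<And>e. 0 < r e"
  shows "QQ u (\<lambda>e. complex_of_real (r e)) \<noteq> 0" "v \<noteq> 0 \<Longrightarrow> QP v (\<lambda>e. complex_of_real (r e)) \<noteq> 0"
proof -
  have p: "s > 0 \<Longrightarrow> complex_of_real s \<noteq> 0" for s by simp
  show "QQ u (\<lambda>e. complex_of_real (r e)) \<noteq> 0"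
  proof (cases u rule: bv_cases)
    case (1 u1 u2 u3)
    show ?thesis unfolding 1
      by (cases u1 rule: bit_cases01; cases u2 rule: bit_cases01; cases u3 rule: bit_cases01;
          simp only: QQ_explicit of_real_mult[symmetric] of_real_power[symmetric] of_real_add[symmetric])
         (rule p, intro add_pos_pos zero_less_power mult_pos_pos r)+
  qed
  show "QP v (\<lambda>e. complex_of_real (r e)) \<noteq> 0" if "v \<noteq> 0"
  proof (cases v rule: bv_cases)
    case (1 v1 v2 v3)
    have "v1 = 1 \<or> v2 = 1 \<or> v3 = 1" using that 1 by (auto intro: bit.exhaust)
    then show ?thesis unfolding 1
      by (cases v1 rule: bit_cases01; cases v2 rule: bit_cases01; cases v3 rule: bit_cases01;
          simp only: QP_explicit of_real_mult[symmetric] of_real_add[symmetric] zero_neq_one simp_thms)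
         (rule p, intro add_pos_pos mult_pos_pos r)+
  qed
qed

lemma bit_sign_indicator: "(1 + bit_sign a * bit_sign b) / 2 = (if a = b then 1 else 0)"
  by (cases a rule: bit_cases01; cases b rule: bit_cases01) simp_all

text \<open>The fifteen basis quartics have pairwise distinct characters under the translations, so filtering
  isolates each of them; all are positive at \<open>\<tau> = \<i>\<close>, \<open>z = 0\<close>.\<close>

lemma theta_null_zero:
  assumes "q \<in> theta_null"
  shows "q = (\<lambda>_. 0)"
proof -
  obtain b b' where q: "q = qcomb b b'" using assms W'_iff by (auto simp: theta_null_def)
  have N: "qcomb b b' \<in> theta_null" using assms q by simp
  obtain r where r: "\<And>e. 0 < r e" "Theta2 (sm \<i> 0 0 \<i> 0 \<i>) 0 = (\<lambda>e. complex_of_real (r e))" "sm \<i> 0 0 \<i> 0 \<i> \<in> siegel"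
    by (rule Theta2_positive, rule that)
  have b': "b' w = 0" if w: "w \<noteq> 0" for w
  proof -
    have "bit_sign (w $ 1) = -1 \<or> bit_sign (w $ 2) = -1 \<or> bit_sign (w $ 3) = -1"
      using w by (auto simp: bit_sign_def vec3_eq_iff)
    then have z: "(1 + bit_sign (w $ 1)) / 2 * ((1 + bit_sign (w $ 2)) / 2 * ((1 + bit_sign (w $ 3)) / 2 * b u)) = 0"
        for u by auto
    have o: "(1 + bit_sign (w $ 1) * bit_sign (v $ 1)) / 2 * ((1 + bit_sign (w $ 2) * bit_sign (v $ 2)) / 2 * ((1 +
        bit_sign (w $ 3) * bit_sign (v $ 3)) / 2 * b' v))
        = (if v = w then b' w else 0)" for v
      unfolding bit_sign_indicator by (cases "v = w") (simp, auto simp: vec3_eq_iff)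
    have "qcomb (\<lambda>_. 0) (\<lambda>v. if v = w then b' w else 0) \<in> theta_null"
      using theta_null_filter_off_diagonal[OF N, of "bit_sign (w $ 1)" "bit_sign (w $ 2)" "bit_sign (w $ 3)"] unfolding z o .
    then have "qcomb (\<lambda>_. 0) (\<lambda>v. if v = w then b' w else 0) (\<lambda>e. complex_of_real (r e)) = 0"
      using r(3) unfolding theta_null_def r(2)[symmetric] by blast
    moreover have "qcomb (\<lambda>_. 0) (\<lambda>v. if v = w then b' w else 0) x = b' w * QP w x" for x
      using w by (simp add: qcomb_def if_distrib[of "\<lambda>u. u * _"] cong: if_cong)
    ultimately show ?thesis using quartics_positive(2)[of r w] r(1) w by simp
  qed
  have q0: "qcomb b b' = qcomb b (\<lambda>_. 0)" using b' by (simp add: qcomb_def fun_eq_iff)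
  have b: "b w = 0" for w
  proof -
    have o: "(1 + bit_sign (w $ 1) * bit_sign (v $ 1)) / 2 * ((1 + bit_sign (w $ 2) * bit_sign (v $ 2)) / 2 * ((1 +
        bit_sign (w $ 3) * bit_sign (v $ 3)) / 2 * b v))
        = (if v = w then b w else 0)" for v
      unfolding bit_sign_indicator by (cases "v = w") (simp, auto simp: vec3_eq_iff)
    have "qcomb (\<lambda>v. if v = w then b w else 0) (\<lambda>_. 0) \<in> theta_null"
      using theta_null_filter_diagonal[OF N[unfolded q0], of "bit_sign (w $ 1)" "bit_sign (w $ 2)" "bit_sign (w $ 3)"]
          unfolding o .
    then have "qcomb (\<lambda>v. if v = w then b w else 0) (\<lambda>_. 0) (\<lambda>e. complex_of_real (r e)) = 0"
      using r(3) unfolding theta_null_def r(2)[symmetric] by blast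
    moreover have "qcomb (\<lambda>v. if v = w then b w else 0) (\<lambda>_. 0) x = b w * QQ w x" for x
      by (simp add: qcomb_def if_distrib[of "\<lambda>u. u * _"] cong: if_cong)
    ultimately show ?thesis using quartics_positive(1)[of r w] r(1) by simp
  qed
  show ?thesis unfolding q q0 using b by (simp add: qcomb_def fun_eq_iff)
qed

lemma act_W'_eq:
  assumes g: "realizes g \<rho>" and q: "q \<in> W'"
  shows "act_W' g q = (\<lambda>x. q (\<rho> x))"
  unfolding act_W'_def
proof (rule the_equality)
  have r: "\<And>\<tau> z. \<tau> \<in> siegel \<Longrightarrow> theta_factor g \<tau> z * q (Theta2 (moebius g \<tau>) (theta_arg g \<tau> z)) = q (\<rho> (Theta2 \<tau> z))"
    and W: "(\<lambda>x. q (\<rho> x)) \<in> W'"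
    using g q by (auto simp: realizes_def)
  note r' = r[unfolded theta_factor_def theta_arg_def]
  show "(\<lambda>x. q (\<rho> x)) \<in> W' \<and> (\<forall>\<tau>\<in>siegel. \<forall>z. q (\<rho> (Theta2 \<tau> z)) =
       exp (- 8 * of_real pi * \<i> * cdot z (matrix_inv (automorphy g \<tau>) *v (blockC g *v z))) / det (automorphy g \<tau>) ^ 2
       * q (Theta2 (moebius g \<tau>) (transpose (matrix_inv (automorphy g \<tau>)) *v z)))"
    using W r' by (intro conjI ballI allI) simp_all
  fix q' assume q': "q' \<in> W' \<and> (\<forall>\<tau>\<in>siegel. \<forall>z. q' (Theta2 \<tau> z) =
       exp (- 8 * of_real pi * \<i> * cdot z (matrix_inv (automorphy g \<tau>) *v (blockC g *v z))) / det (automorphy g \<tau>) ^ 2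
       * q (Theta2 (moebius g \<tau>) (transpose (matrix_inv (automorphy g \<tau>)) *v z)))"
  then have "q' (Theta2 \<tau> z) - q (\<rho> (Theta2 \<tau> z)) = 0" if "\<tau> \<in> siegel" for \<tau> z
    using r'[OF that, of z] that by simp
  then have "(\<lambda>x. q' x - q (\<rho> x)) \<in> theta_null"
    using W q' by (auto simp: theta_null_def intro: W'_diff)
  then have "(\<lambda>x. q' x - q (\<rho> x)) = (\<lambda>_. 0)" by (rule theta_null_zero)
  then show "q' = (\<lambda>x. q (\<rho> x))" by (simp add: fun_eq_iff)
qed

lemma W_off_siegel: "h \<in> W \<Longrightarrow> \<tau> \<notin> siegel \<Longrightarrow> h \<tau> = 0"
  unfolding W_def cspan_def by (auto simp: fano_form_def intro!: sum.neutral)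

lemma invariant_iff:
  assumes t: "t \<in> WW'"
  shows "invariant t \<longleftrightarrow> (\<forall>g \<rho>. realizes g \<rho> \<longrightarrow>
    (\<forall>\<tau>\<in>siegel. \<forall>x. t (moebius g \<tau>) (\<rho> x) = det (automorphy g \<tau>) ^ 14 * t \<tau> x))"
proof -
  have act: "tensor_sum (map (\<lambda>(h, q). (act_W g h, act_W' g q)) ps) \<tau> x =
      (if \<tau> \<in> siegel then tensor_sum ps (moebius g \<tau>) (\<rho> x) / det (automorphy g \<tau>) ^ 14 else 0)"
    if "realizes g \<rho>" "set ps \<subseteq> W \<times> W'" for g \<rho> ps \<tau> x
    using that(2)
  proof (induction ps)
    case Nil show ?case by (simp add: tensor_sum_def)
  next
    case (Cons p ps)
    obtain h q where p: "p = (h, q)" by (cases p)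
    then have "q \<in> W'" using Cons.prems by auto
    note a = act_W'_eq[OF that(1) this]
    show ?case using Cons unfolding p by (simp add: tensor_sum_def a act_W_def add_divide_distrib)
  qed
  have off: "tensor_sum ps \<tau> x = 0" if "set ps \<subseteq> W \<times> W'" "\<tau> \<notin> siegel" for ps \<tau> x
    using that by (induction ps) (auto simp: tensor_sum_def W_off_siegel)
  show ?thesis
  proof
    assume inv: "invariant t"
    obtain ps where ps: "set ps \<subseteq> W \<times> W'" "t = tensor_sum ps" using t by (auto simp: WW'_def)
    show "\<forall>g \<rho>. realizes g \<rho> \<longrightarrow> (\<forall>\<tau>\<in>siegel. \<forall>x. t (moebius g \<tau>) (\<rho> x) = det (automorphy g \<tau>) ^ 14 * t \<tau> x)"
    proof (intro allI impI ballI)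
      fix g \<rho> \<tau> x assume g: "realizes g \<rho>" and \<tau>: "\<tau> \<in> siegel"
      then have "g \<in> Sp6Z" "det (automorphy g \<tau>) \<noteq> 0" by (auto simp: realizes_def regular_at_def)
      moreover have "tensor_sum (map (\<lambda>(h, q). (act_W g h, act_W' g q)) ps) = t"
        using inv ps \<open>g \<in> Sp6Z\<close> unfolding invariant_def by blast
      ultimately show "t (moebius g \<tau>) (\<rho> x) = det (automorphy g \<tau>) ^ 14 * t \<tau> x"
        using act[OF g ps(1), of \<tau> x] \<tau> by (simp add: ps(2)[symmetric] field_simps)
    qed
  next
    assume r: "\<forall>g \<rho>. realizes g \<rho> \<longrightarrow> (\<forall>\<tau>\<in>siegel. \<forall>x. t (moebius g \<tau>) (\<rho> x) = det (automorphy g \<tau>) ^ 14 * t \<tau> x)"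
    show "invariant t" unfolding invariant_def
    proof (intro ballI allI impI ext)
      fix g ps \<tau> x assume g: "g \<in> Sp6Z" and ps: "set ps \<subseteq> W \<times> W' \<and> tensor_sum ps = t"
      obtain \<rho> where \<rho>: "realizes g \<rho>" using exists_realizes[OF g] by blast
      have d: "det (automorphy g \<tau>) \<noteq> 0" if "\<tau> \<in> siegel" using \<rho> that by (auto simp: realizes_def regular_at_def)
      show "tensor_sum (map (\<lambda>(h, q). (act_W g h, act_W' g q)) ps) \<tau> x = t \<tau> x"
        using act[OF \<rho>, of ps \<tau> x] off[of ps \<tau> x] ps r \<rho> d by auto
    qed
  qed
qed

section \<open>The span of all forms attached to Fano configurations\<close>

definition CF_span :: "(complex^3^3 \<Rightarrow> complex) set" where
  "CF_span = cspan (range (\<lambda>x \<tau>. CF \<tau> x))"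

lemma CF_off_siegel: "\<tau> \<notin> siegel \<Longrightarrow> CF \<tau> x = 0"
  by (simp add: CF_def cob_def SL_def SK_def fano_form_def)

lemma act_W_CFspan:
  assumes g: "realizes g \<rho>" and \<sigma>: "\<And>x. \<rho> (\<sigma> x) = x" and h: "h \<in> CF_span"
  shows "act_W g h \<in> CF_span"
proof -
  have CF: "act_W g (\<lambda>\<tau>. CF \<tau> x) = (\<lambda>\<tau>. CF \<tau> (\<sigma> x))" for x
  proof
    fix \<tau>
    show "act_W g (\<lambda>\<tau>. CF \<tau> x) \<tau> = CF \<tau> (\<sigma> x)"
    proof (cases "\<tau> \<in> siegel")
      case True
      then have "det (automorphy g \<tau>) \<noteq> 0" "CF (moebius g \<tau>) (\<rho> (\<sigma> x)) = det (automorphy g \<tau>) ^ 14 * CF \<tau> (\<sigma> x)"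
        using g by (auto simp: realizes_def regular_at_def)
      then show ?thesis using True by (simp add: act_W_def \<sigma>)
    qed (simp add: act_W_def CF_off_siegel)
  qed
  obtain T c where T: "finite T" "T \<subseteq> range (\<lambda>x \<tau>. CF \<tau> x)" "h = (\<lambda>\<tau>. \<Sum>b\<in>T. c b * b \<tau>)"
    using h by (auto simp: CF_span_def cspan_def)
  have "act_W g h = (\<lambda>\<tau>. \<Sum>b\<in>T. c b * act_W g b \<tau>)"
    by (simp add: fun_eq_iff act_W_def T(3) sum_divide_distrib)
  moreover have "act_W g b \<in> CF_span" if "b \<in> T" for b
    using T(2) that CF unfolding CF_span_def by (fastforce intro: cspan_base)
  ultimately show ?thesis unfolding CF_span_def by (auto intro!: cspan_sum cspan_scale)
qed

definition additive_char :: "(characteristic \<Rightarrow> characteristic) \<Rightarrow> bool" where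
  "additive_char \<beta> \<longleftrightarrow> (\<forall>m n. \<beta> (m + n) = \<beta> m + \<beta> n)"

definition admissible_move :: "(characteristic \<Rightarrow> characteristic) \<Rightarrow> bool" where
  "admissible_move \<beta> \<longleftrightarrow> additive_char \<beta> \<and>
    (\<forall>F. even_octad F \<longrightarrow> even_octad (\<beta> ` F) \<and> (fano_form (\<beta> ` F) \<in> CF_span \<longrightarrow> fano_form F \<in> CF_span))"

lemma admissible_move_comp: "admissible_move \<beta> \<Longrightarrow> admissible_move \<gamma> \<Longrightarrow> admissible_move (\<lambda>m. \<beta> (\<gamma> m))"
proof -
  assume b: "admissible_move \<beta>" and c: "admissible_move \<gamma>"
  have "(\<lambda>m. \<beta> (\<gamma> m)) ` F = \<beta> ` (\<gamma> ` F)" for F by (simp add: image_image)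
  moreover have "additive_char (\<lambda>m. \<beta> (\<gamma> m))" using b c unfolding admissible_move_def additive_char_def by metis
  moreover have "even_octad (\<beta> ` (\<gamma> ` F))" "fano_form (\<beta> ` (\<gamma> ` F)) \<in> CF_span \<longrightarrow> fano_form F \<in> CF_span" if "even_octad F" for F
    using b c that unfolding admissible_move_def by blast+
  ultimately show ?thesis unfolding admissible_move_def by (intro conjI allI impI) (simp_all only:)
qed

lemma legalI:
  assumes g: "realizes g \<rho>" and \<sigma>: "\<And>x. \<rho> (\<sigma> x) = x" and lin: "additive_char \<beta>"
    and F8: "\<And>F. even_octad F \<Longrightarrow> even_octad (\<beta> ` F)" and inv: "\<And>m. \<beta> (\<beta> m) = m"
    and k: "\<And>F. k F \<noteq> 0"
    and ff: "\<And>F a b c d e f. siegel6 a b c d e f \<Longrightarrow> even_octad F \<Longrightarrow>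
       fano_form F (moebius g (sm a b c d e f)) = det (automorphy g (sm a b c d e f)) ^ 14 * k F * fano_form (\<beta> ` F) (sm
           a b c d e f)"
  shows "admissible_move \<beta>"
  unfolding admissible_move_def
proof (intro conjI allI impI)
  fix F assume F: "even_octad F" and V: "fano_form (\<beta> ` F) \<in> CF_span"
  have "fano_form F = (\<lambda>\<tau>. inverse (k (\<beta> ` F)) * act_W g (fano_form (\<beta> ` F)) \<tau>)"
  proof
    fix \<tau>
    show "fano_form F \<tau> = inverse (k (\<beta> ` F)) * act_W g (fano_form (\<beta> ` F)) \<tau>"
    proof (cases "\<tau> \<in> siegel")
      case True
      then have d: "det (automorphy g \<tau>) \<noteq> 0" using g by (auto simp: realizes_def regular_at_def)
      have "\<beta> ` \<beta> ` F = F" by (simp add: image_image inv)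
      moreover obtain a b c d e f where "\<tau> = sm a b c d e f" "siegel6 a b c d e f" using True by (rule siegel_cases)
      ultimately have "fano_form (\<beta> ` F) (moebius g \<tau>) = det (automorphy g \<tau>) ^ 14 * k (\<beta> ` F) * fano_form F \<tau>"
        using ff[OF _ F8[OF F]] by simp
      then show ?thesis using True d k by (simp add: act_W_def field_simps)
    qed (simp add: act_W_def fano_form_def)
  qed
  then show "fano_form F \<in> CF_span"
    using act_W_CFspan[OF g \<sigma> V] unfolding CF_span_def by (simp add: cspan_scale)
qed (use lin F8 in auto)

lemma ph_nonzero: "prod phU F \<noteq> 0" "prod phJ F \<noteq> 0"
  by (auto simp: phU_def phJ_def split: if_splits)

lemma rhoJ_inverse: "rhoJ (\<lambda>e. rhoJ x e / (2 * kappa\<^sup>2)) = x"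
proof -
  have k: "kappa \<noteq> 0" using kappa_power by auto
  have "rhoJ (\<lambda>e. rhoJ x e / (2 * kappa\<^sup>2)) (bv e1 e2 e3) = x (bv e1 e2 e3)" for e1 e2 e3
    using k by (cases e1 rule: bit_cases01) (simp_all add: rhoJ_def rhoJ0_def field_simps power2_eq_square)
  then show ?thesis by (metis bv_cases ext)
qed

lemma additive_acts: "additive_char actU" "additive_char actP12" "additive_char actP23" "additive_char actJ"
  unfolding additive_char_def actU_def actP12_def actP23_def actJ_def
  by (simp_all only: prod_eq_iff fst_add snd_add fst_conv snd_conv vec3_eq_iff vector_add_component bv_nth add_ac simp_thms)

lemma admissible_move_acts: "admissible_move actU" "admissible_move actP12" "admissible_move actP23" "admissible_move actJ"
proof -
  show "admissible_move actU"
  proof (rule legalI[OF realizes_U, where \<sigma> = "\<lambda>x. x \<circ> sh12" and k = "\<lambda>F. 1 / prod phU F"])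
    fix F a b c d e f assume S: "siegel6 a b c d e f" and F: "even_octad F"
    note D = moves_toD[OF moves_to_U[OF S]]
    show "fano_form F (moebius (shearU 1 2 1) (sm a b c d e f)) =
       det (automorphy (shearU 1 2 1) (sm a b c d e f)) ^ 14 * (1 / prod phU F) * fano_form (actU ` F) (sm a b c d e f)"
      unfolding D(1,2) ff_U[OF S F] m33_det by simp
  qed (simp_all add: ph_nonzero even_octad_act additive_acts)
  show "admissible_move actP12"
  proof (rule legalI[OF realizes_P12, where \<sigma> = "\<lambda>x. x \<circ> sw12" and k = "\<lambda>F. 1"])
    fix F a b c d e f assume S: "siegel6 a b c d e f" and F: "even_octad F"
    note D = moves_toD[OF moves_to_P12[OF S]]
    show "fano_form F (moebius (permP s12) (sm a b c d e f)) =
       det (automorphy (permP s12) (sm a b c d e f)) ^ 14 * 1 * fano_form (actP12 ` F) (sm a b c d e f)"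
      unfolding D(1,2) ff_P12[OF S F] m33_det by simp
  qed (simp_all add: even_octad_act additive_acts)
  show "admissible_move actP23"
  proof (rule legalI[OF realizes_P23, where \<sigma> = "\<lambda>x. x \<circ> sw23" and k = "\<lambda>F. 1"])
    fix F a b c d e f assume S: "siegel6 a b c d e f" and F: "even_octad F"
    note D = moves_toD[OF moves_to_P23[OF S]]
    show "fano_form F (moebius (permP s23) (sm a b c d e f)) =
       det (automorphy (permP s23) (sm a b c d e f)) ^ 14 * 1 * fano_form (actP23 ` F) (sm a b c d e f)"
      unfolding D(1,2) ff_P23[OF S F] m33_det by simp
  qed (simp_all add: even_octad_act additive_acts)
  show "admissible_move actJ"
  proof (rule legalI[OF realizes_S, where \<sigma> = "\<lambda>x e. rhoJ x e / (2 * kappa\<^sup>2)" and k = "\<lambda>F. 1 / prod phJ F"])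
    fix F a b c d e f assume S: "siegel6 a b c d e f" and F: "even_octad F"
    note D = moves_toD[OF moves_to_S[OF S]]
    show "fano_form F (moebius (embE 1 0 (-1) 1 0) (sm a b c d e f)) =
       det (automorphy (embE 1 0 (-1) 1 0) (sm a b c d e f)) ^ 14 * (1 / prod phJ F) * fano_form (actJ ` F) (sm a b c d e f)"
      unfolding D(1,2) ff_J[OF S F] m33_det by simp
  qed (simp_all add: ph_nonzero even_octad_act additive_acts rhoJ_inverse del: One_nat_def)
qed

definition even_octad_group :: "characteristic set \<Rightarrow> bool" where
  "even_octad_group F \<longleftrightarrow> even_octad F \<and> 0 \<in> F \<and> (\<forall>m\<in>F. \<forall>n\<in>F. m + n \<in> F)"

lemma even_octad_group_image:
  assumes "admissible_move \<beta>" "even_octad_group F"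
  shows "even_octad_group (\<beta> ` F)" "fano_form (\<beta> ` F) \<in> CF_span \<Longrightarrow> fano_form F \<in> CF_span"
proof -
  have b: "\<beta> (m + n) = \<beta> m + \<beta> n" for m n using assms(1) unfolding admissible_move_def additive_char_def by blast
  from b[of 0 0] have "\<beta> 0 + 0 = \<beta> 0 + \<beta> 0" unfolding add_0_right .
  from add_left_imp_eq[OF this] have "\<beta> 0 = 0" by (rule sym)
  then have "0 \<in> \<beta> ` F" using assms(2) unfolding even_octad_group_def by (metis image_eqI)
  moreover have "m + n \<in> \<beta> ` F" if mn: "m \<in> \<beta> ` F" "n \<in> \<beta> ` F" for m n
  proof -
    obtain m' n' where "m' \<in> F" "n' \<in> F" "m = \<beta> m'" "n = \<beta> n'" using mn by blast
    then show ?thesis using assms(2) b[of m' n'] by (metis image_eqI even_octad_group_def)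
  qed
  moreover have "even_octad (\<beta> ` F)" using assms unfolding even_octad_group_def admissible_move_def by blast
  ultimately show "even_octad_group (\<beta> ` F)" unfolding even_octad_group_def by blast
  show "fano_form (\<beta> ` F) \<in> CF_span \<Longrightarrow> fano_form F \<in> CF_span" using assms unfolding even_octad_group_def
      admissible_move_def by blast
qed

lemma even_octad_group_even_sum: "even_octad_group F \<Longrightarrow> m \<in> F \<Longrightarrow> n \<in> F \<Longrightarrow> m \<in> even_chars \<and> m + n \<in> even_chars"
  by (auto simp: even_octad_group_def even_octad_def)

lemma cc_add: "cc a1 a2 a3 d1 d2 d3 + cc a1' a2' a3' d1' d2' d3' = cc (a1 + a1') (a2 + a2') (a3 + a3') (d1 + d1') (d2 +
    d2') (d3 + d3')"
  by (simp add: cc_def)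

definition actJ2 where "actJ2 = (\<lambda>m. actP12 (actJ (actP12 m)))"
definition actJ3 where "actJ3 = (\<lambda>m. actP23 (actJ2 (actP23 m)))"
definition actS12 where "actS12 = (\<lambda>m. actJ2 (actU (actJ2 m)))"
definition actS13 where "actS13 = (\<lambda>m. actP23 (actS12 (actP23 m)))"
definition actS23 where "actS23 = (\<lambda>m. actP12 (actS13 (actP12 m)))"
definition actU13 where "actU13 = (\<lambda>m. actP23 (actU (actP23 m)))"
definition actU23 where "actU23 = (\<lambda>m. actP12 (actU13 (actP12 m)))"

lemmas moves_defs = actJ2_def actJ3_def actS12_def actS13_def actS23_def actU13_def actU23_def

lemma moves_cc:
  "actJ2 (cc a1 a2 a3 d1 d2 d3) = cc a1 d2 a3 d1 a2 d3" "actJ3 (cc a1 a2 a3 d1 d2 d3) = cc a1 a2 d3 d1 d2 a3"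
  "actS12 (cc a1 a2 a3 d1 d2 d3) = cc a1 a2 a3 (d1 + a2) (a1 + d2) d3"
  "actS13 (cc a1 a2 a3 d1 d2 d3) = cc a1 a2 a3 (d1 + a3) d2 (a1 + d3)"
  "actS23 (cc a1 a2 a3 d1 d2 d3) = cc a1 a2 a3 d1 (d2 + a3) (a2 + d3)"
  "actU13 (cc a1 a2 a3 d1 d2 d3) = cc a1 a2 (a1 + a3) (d1 + d3) d2 d3"
  "actU23 (cc a1 a2 a3 d1 d2 d3) = cc a1 a2 (a2 + a3) d1 (d2 + d3) d3"
  by (simp_all add: moves_defs)

lemma admissible_move_moves: "admissible_move actJ2" "admissible_move actJ3" "admissible_move actS12" "admissible_move
    actS13" "admissible_move actS23" "admissible_move actU13" "admissible_move actU23"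
proof -
  note U = admissible_move_acts(1) and P12 = admissible_move_acts(2) and P23 = admissible_move_acts(3) and J =
      admissible_move_acts(4)
  show J2: "admissible_move actJ2" unfolding actJ2_def by (rule admissible_move_comp[OF P12 admissible_move_comp[OF J P12]])
  show "admissible_move actJ3" unfolding actJ3_def by (rule admissible_move_comp[OF P23 admissible_move_comp[OF J2 P23]])
  show S12: "admissible_move actS12" unfolding actS12_def by (rule admissible_move_comp[OF J2 admissible_move_comp[OF U J2]])
  show S13: "admissible_move actS13" unfolding actS13_def by (rule admissible_move_comp[OF P23 admissible_move_comp[OF S12 P23]])
  show "admissible_move actS23" unfolding actS23_def by (rule admissible_move_comp[OF P12 admissible_move_comp[OF S13 P12]])
  show U13: "admissible_move actU13" unfolding actU13_def by (rule admissible_move_comp[OF P23 admissible_move_comp[OF U P23]])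
  show "admissible_move actU23" unfolding actU23_def by (rule admissible_move_comp[OF P12 admissible_move_comp[OF U13 P12]])
qed

lemmas bit_zero_one = bit_cases01[case_names "0" "1"]

text \<open>A Fano configuration is moved to \<open>fanoL 0\<close> by clearing the first, second and third coordinate of
  all first components in turn: once it contains a unit vector, evenness of sums forces the conjugate
  coordinate to vanish, and a partial inversion interchanges the two.\<close>

lemma fano_form_stage0:
  assumes F: "even_octad_group F" and z: "\<And>m. m \<in> F \<Longrightarrow> fst m = 0"
  shows "fano_form F \<in> CF_span"
proof -
  have "F \<subseteq> fanoL 0" using z by (auto simp: fanoL_def cdot_def)
  moreover have "card F = card (fanoL 0)" "finite (fanoL 0)" using F even_octad_fanoL by (auto simp:
      even_octad_group_def even_octad_def)
  ultimately have "F = fanoL 0" by (metis card_subset_eq)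
  moreover have "(0 :: bit^3) \<noteq> bv 1 1 1" unfolding bv_zero by simp
  ultimately have "fano_form F = (\<lambda>\<tau>. CF \<tau> (dvec {0}))" by (simp add: fun_eq_iff CF_dvec SL_def)
  then show ?thesis using cspan_base[OF rangeI[of "\<lambda>x \<tau>. CF \<tau> x" "dvec {0}"]] unfolding CF_span_def by simp
qed

lemma fano_form_stage1:
  assumes F: "even_octad_group F" and z: "\<And>m. m \<in> F \<Longrightarrow> fst m $ 1 = 0 \<and> fst m $ 2 = 0"
  shows "fano_form F \<in> CF_span"
proof (cases "\<exists>m\<in>F. fst m $ 3 = 1")
  case False
  then have "fst m = 0" if "m \<in> F" for m using z[OF that] that by (auto simp: vec3_eq_iff)
  then show ?thesis by (rule fano_form_stage0[OF F])
next
  case True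
  then obtain m where m: "m \<in> F" "fst m $ 3 = 1" by blast
  have "fst (actJ3 n) = 0" if n: "n \<in> F" for n
  proof (cases m rule: cc_cases)
    case m': (1 a1 a2 a3 d1 d2 d3)
    show ?thesis
    proof (cases n rule: cc_cases)
      case n': (1 b1 b2 b3 e1 e2 e3)
      have "cc a1 a2 a3 d1 d2 d3 \<in> even_chars \<and> cc a1 a2 a3 d1 d2 d3 + cc b1 b2 b3 e1 e2 e3 \<in> even_chars"
         "cc b1 b2 b3 e1 e2 e3 \<in> even_chars"
        using even_octad_group_even_sum[OF F m(1) n] even_octad_group_even_sum[OF F n n] unfolding m' n' by auto
      moreover have "a1 = 0" "a2 = 0" "a3 = 1" "b1 = 0" "b2 = 0"
        using z[OF m(1)] z[OF n] m(2) unfolding m' n' by (simp_all add: cc_def)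
      ultimately have "e3 = 0"
        by (cases b3 rule: bit_cases01) (auto simp: cc_add even_chars_cc)
      then show ?thesis unfolding n' moves_cc using \<open>b1 = 0\<close> \<open>b2 = 0\<close> by (simp add: cc_def)
    qed
  qed
  then have "fano_form (actJ3 ` F) \<in> CF_span"
    by (intro fano_form_stage0 even_octad_group_image(1)[OF admissible_move_moves(2) F]) auto
  then show ?thesis by (rule even_octad_group_image(2)[OF admissible_move_moves(2) F])
qed

lemma fano_form_stage2_normal:
  assumes F: "even_octad_group F" and z: "\<And>m. m \<in> F \<Longrightarrow> fst m $ 1 = 0" and m: "cc 0 1 0 d1 0 0 \<in> F"
  shows "fano_form F \<in> CF_span"
proof -
  have "fst (actJ2 n) $ 1 = 0 \<and> fst (actJ2 n) $ 2 = 0" if n: "n \<in> F" for n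
  proof (cases n rule: cc_cases)
    case n': (1 b1 b2 b3 e1 e2 e3)
    have "cc 0 1 0 d1 0 0 + cc b1 b2 b3 e1 e2 e3 \<in> even_chars" "cc b1 b2 b3 e1 e2 e3 \<in> even_chars" "b1 = 0"
      using even_octad_group_even_sum[OF F m n] even_octad_group_even_sum[OF F n n] z[OF n] unfolding n' by (auto simp: cc_def)
    then have "e2 = 0" "b1 = 0"
      by (cases e2 rule: bit_cases01; cases b2 rule: bit_cases01; auto simp: cc_add even_chars_cc)+
    then show ?thesis unfolding n' moves_cc by (simp add: cc_def)
  qed
  then have "fano_form (actJ2 ` F) \<in> CF_span"
    by (intro fano_form_stage1 even_octad_group_image(1)[OF admissible_move_moves(1) F]) auto
  then show ?thesis by (rule even_octad_group_image(2)[OF admissible_move_moves(1) F])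
qed

lemma fano_form_stage2:
  assumes F: "even_octad_group F" and z: "\<And>m. m \<in> F \<Longrightarrow> fst m $ 1 = 0"
  shows "fano_form F \<in> CF_span"
proof -
  have step: "fano_form F \<in> CF_span"
    if F: "even_octad_group F" "\<And>m. m \<in> F \<Longrightarrow> fst m $ 1 = 0" and b: "admissible_move \<beta>" "\<And>m. fst (\<beta> m) $ 1 = fst m $ 1"
      and m: "m \<in> F" "\<beta> m = m'"
      and go: "\<And>F. even_octad_group F \<Longrightarrow> (\<And>m. m \<in> F \<Longrightarrow> fst m $ 1 = 0) \<Longrightarrow> m' \<in> F \<Longrightarrow> fano_form F \<in> CF_span" for F \<beta> m m'
  proof (rule even_octad_group_image(2)[OF b(1) F(1)], rule go)
    show "even_octad_group (\<beta> ` F)" by (rule even_octad_group_image(1)[OF b(1) F(1)])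
    show "fst n $ 1 = 0" if "n \<in> \<beta> ` F" for n using that F(2) b(2) by auto
    show "m' \<in> \<beta> ` F" using m by blast
  qed
  have fstb: "fst (actP23 m) $ 1 = fst m $ 1" "fst (actS23 m) $ 1 = fst m $ 1" "fst (actU23 m) $ 1 = fst m $ 1" for m
    by (cases m rule: cc_cases; simp add: moves_cc; simp add: cc_def)+
  have n1: "fano_form F \<in> CF_span" if "even_octad_group F" "\<And>m. m \<in> F \<Longrightarrow> fst m $ 1 = 0" "cc 0 1 0 d1 0 d3 \<in> F" for F d1 d3
  proof (cases d3 rule: bit_zero_one)
    case 0 then show ?thesis using that fano_form_stage2_normal by blast
  next
    case 1
    then have e: "actS23 (cc 0 1 0 d1 0 d3) = cc 0 1 0 d1 0 0" by (simp add: moves_cc)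
    show ?thesis by (rule step[OF that(1,2) admissible_move_moves(5) fstb(2) that(3) e fano_form_stage2_normal])
  qed
  have n2: "fano_form F \<in> CF_span" if "even_octad_group F" "\<And>m. m \<in> F \<Longrightarrow> fst m $ 1 = 0" "cc 0 1 a3 d1 d2 d3 \<in> F" for F a3 d1 d2 d3
  proof (cases a3 rule: bit_zero_one)
    case 0
    then have "d2 = 0" using even_octad_group_even_sum[OF that(1) that(3) that(3)] by (simp add: even_chars_cc)
    then show ?thesis using that 0 n1 by blast
  next
    case 1
    then have "d2 + d3 = 0" using even_octad_group_even_sum[OF that(1) that(3) that(3)] by (simp add: even_chars_cc)
    then have e: "actU23 (cc 0 1 a3 d1 d2 d3) = cc 0 1 0 d1 0 d3" using 1 by (simp only: moves_cc) simp
    show ?thesis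
      by (rule step[OF that(1,2) admissible_move_moves(7) fstb(3) that(3) e n1])
  qed
  show ?thesis
  proof (cases "\<exists>m\<in>F. fst m $ 2 = 1 \<or> fst m $ 3 = 1")
    case False
    then show ?thesis using z by (intro fano_form_stage1[OF F]) auto
  next
    case True
    then obtain m where m: "m \<in> F" "fst m $ 2 = 1 \<or> fst m $ 3 = 1" by blast
    obtain a1 a2 a3 d1 d2 d3 where mc: "m = cc a1 a2 a3 d1 d2 d3" by (rule cc_cases)
    have a1: "a1 = 0" using z[OF m(1)] by (simp add: mc cc_def)
    show ?thesis
    proof (cases a2 rule: bit_zero_one)
      case 1 then show ?thesis using n2[OF F z] m(1) a1 mc by blast
    next
      case 0
      then have "a3 = 1" using m(2) by (simp add: mc cc_def)
      then have e: "actP23 m = cc 0 1 0 d1 d3 d2" using 0 a1 by (simp add: mc)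
      show ?thesis
        by (rule step[OF F z admissible_move_acts(3) fstb(1) m(1) e n2])
    qed
  qed
qed

lemma fano_form_stage3_normal:
  assumes F: "even_octad_group F" and m: "cc 1 0 0 0 0 0 \<in> F"
  shows "fano_form F \<in> CF_span"
proof -
  have "fst (actJ n) $ 1 = 0" if n: "n \<in> F" for n
  proof (cases n rule: cc_cases)
    case n': (1 b1 b2 b3 e1 e2 e3)
    have "cc 1 0 0 0 0 0 + cc b1 b2 b3 e1 e2 e3 \<in> even_chars" "cc b1 b2 b3 e1 e2 e3 \<in> even_chars"
      using even_octad_group_even_sum[OF F m n] even_octad_group_even_sum[OF F n n] unfolding n' by auto
    then have "e1 = 0"
      by (cases e1 rule: bit_cases01; cases b1 rule: bit_cases01; auto simp: cc_add even_chars_cc)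
    then show ?thesis unfolding n' act_cc by (simp add: cc_def)
  qed
  then have "fano_form (actJ ` F) \<in> CF_span"
    by (intro fano_form_stage2 even_octad_group_image(1)[OF admissible_move_acts(4) F]) auto
  then show ?thesis by (rule even_octad_group_image(2)[OF admissible_move_acts(4) F])
qed

lemma fano_form_CFspan:
  assumes F: "even_octad_group F"
  shows "fano_form F \<in> CF_span"
proof -
  have step: "fano_form F \<in> CF_span"
    if F: "even_octad_group F" and b: "admissible_move \<beta>" and m: "m \<in> F" "\<beta> m = m'" and go: "\<And>F. even_octad_group F \<Longrightarrow> m'
        \<in> F \<Longrightarrow> fano_form F \<in> CF_span" for F \<beta> m m'
    using even_octad_group_image[OF b F] go[of "\<beta> ` F"] m by blast
  have n1: "fano_form F \<in> CF_span" if "even_octad_group F" "cc 1 0 0 0 0 d3 \<in> F" for F d3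
  proof (cases d3 rule: bit_zero_one)
    case 0 then show ?thesis using that fano_form_stage3_normal by blast
  next
    case 1
    then have e: "actS13 (cc 1 0 0 0 0 d3) = cc 1 0 0 0 0 0" by (simp add: moves_cc)
    show ?thesis by (rule step[OF that(1) admissible_move_moves(4) that(2) e fano_form_stage3_normal])
  qed
  have n2: "fano_form F \<in> CF_span" if "even_octad_group F" "cc 1 0 0 0 d2 d3 \<in> F" for F d2 d3
  proof (cases d2 rule: bit_zero_one)
    case 0 then show ?thesis using that n1 by blast
  next
    case 1
    then have e: "actS12 (cc 1 0 0 0 d2 d3) = cc 1 0 0 0 0 d3" by (simp add: moves_cc)
    show ?thesis by (rule step[OF that(1) admissible_move_moves(3) that(2) e n1])
  qed
  have n3: "fano_form F \<in> CF_span" if "even_octad_group F" "cc 1 0 0 d1 d2 d3 \<in> F" for F d1 d2 d3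
  proof -
    have "d1 = 0" using even_octad_group_even_sum[OF that(1) that(2) that(2)] by (simp add: even_chars_cc)
    then show ?thesis using that n2 by blast
  qed
  have n4: "fano_form F \<in> CF_span" if "even_octad_group F" "cc 1 0 a3 d1 d2 d3 \<in> F" for F a3 d1 d2 d3
  proof (cases a3 rule: bit_zero_one)
    case 0 then show ?thesis using that n3 by blast
  next
    case 1
    then have e: "actU13 (cc 1 0 a3 d1 d2 d3) = cc 1 0 0 (d1 + d3) d2 d3" by (simp add: moves_cc)
    show ?thesis by (rule step[OF that(1) admissible_move_moves(6) that(2) e n3])
  qed
  have n5: "fano_form F \<in> CF_span" if "even_octad_group F" "cc 1 a2 a3 d1 d2 d3 \<in> F" for F a2 a3 d1 d2 d3
  proof (cases a2 rule: bit_zero_one)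
    case 0 then show ?thesis using that n4 by blast
  next
    case 1
    then have e: "actU (cc 1 a2 a3 d1 d2 d3) = cc 1 0 a3 (d1 + d2) d2 d3" by simp
    show ?thesis by (rule step[OF that(1) admissible_move_acts(1) that(2) e n4])
  qed
  have n6: "fano_form F \<in> CF_span" if "even_octad_group F" "cc a1 1 a3 d1 d2 d3 \<in> F" for F a1 a3 d1 d2 d3
    by (rule step[OF that(1) admissible_move_acts(2) that(2) act_cc(4) n5])
  have n7: "fano_form F \<in> CF_span" if "even_octad_group F" "cc a1 a2 1 d1 d2 d3 \<in> F" for F a1 a2 d1 d2 d3
    by (rule step[OF that(1) admissible_move_acts(3) that(2) act_cc(5) n6])
  show ?thesis
  proof (cases "\<exists>m\<in>F. fst m \<noteq> 0")
    case False then show ?thesis by (intro fano_form_stage0[OF F]) auto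
  next
    case True
    then obtain m where m: "m \<in> F" "fst m \<noteq> 0" by blast
    obtain a1 a2 a3 d1 d2 d3 where mc: "m = cc a1 a2 a3 d1 d2 d3" by (rule cc_cases)
    have "a1 = 1 \<or> a2 = 1 \<or> a3 = 1" using m(2) by (auto simp: mc cc_def)
    then show ?thesis using n5[OF F] n6[OF F] n7[OF F] m(1) mc by blast
  qed
qed

lemma fano_sub8: "fano F \<Longrightarrow> even_octad_group F"
  by (auto simp: fano_def lagrangian_def even_octad_group_def even_octad_def)

lemma W_CFspan: "W \<subseteq> CF_span"
proof
  fix h assume "h \<in> W"
  then obtain T c where T: "finite T" "T \<subseteq> {fano_form F | F. fano F}" "h = (\<lambda>\<tau>. \<Sum>b\<in>T. c b * b \<tau>)"
    by (auto simp: W_def cspan_def)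
  have "b \<in> CF_span" if "b \<in> T" for b
    using T(2) that fano_form_CFspan[OF fano_sub8] by blast
  then show "h \<in> CF_span" unfolding T(3) CF_span_def by (intro cspan_sum cspan_scale) auto
qed

lemma cdot_zero_left: "cdot 0 y = (0 :: bit)"
  by (simp add: cdot_def)

lemma fano_fanoL: "fano (fanoL u)"
proof -
  have uu: "u + u = 0" by (simp add: vec3_eq_iff)
  have "m + n \<in> fanoL u" if "m \<in> fanoL u" "n \<in> fanoL u" for m n
  proof -
    have "cdot u (snd m + snd n) = cdot u (snd m) + cdot u (snd n)"
      unfolding cdot_def by (simp only: vector_add_component distrib_left sum.distrib)
    then show ?thesis using that uu by (auto simp: fanoL_def)
  qed
  moreover have "cdot (fst m) (snd n) = 0" if "m \<in> fanoL u" "n \<in> fanoL u" for m n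
    using that by (auto simp: fanoL_def cdot_zero_left)
  moreover have "cdot (snd m) (fst n) = cdot (fst n) (snd m)" for m n :: characteristic
    unfolding cdot_def by (simp only: mult.commute)
  moreover have "0 \<in> fanoL u" by (simp add: fanoL_def cdot_def)
  ultimately show ?thesis using even_octad_fanoL[of u] by (simp add: fano_def lagrangian_def even_octad_def)
qed

lemma fano_fanoK: "fano (fanoK v)"
proof -
  have vv: "v + v = 0" by (simp add: vec3_eq_iff)
  have "m + n \<in> fanoK v" if "m \<in> fanoK v" "n \<in> fanoK v" for m n
  proof -
    have "cdot v (fst m + fst n) = cdot v (fst m) + cdot v (fst n)"
      unfolding cdot_def by (simp only: vector_add_component distrib_left sum.distrib)
    then show ?thesis using that vv by (auto simp: fanoK_def)
  qed
  moreover have "cdot (snd m) (fst n) = 0" if "m \<in> fanoK v" "n \<in> fanoK v" for m n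
    using that by (auto simp: fanoK_def cdot_zero_left)
  moreover have "cdot (snd m) (fst n) = cdot (fst n) (snd m)" for m n :: characteristic
    unfolding cdot_def by (simp only: mult.commute)
  moreover have "0 \<in> fanoK v" by (simp add: fanoK_def cdot_def)
  ultimately show ?thesis using even_octad_fanoK[of v] by (simp add: fano_def lagrangian_def even_octad_def)
qed

lemma S_in_W: "SL u \<in> W" "SK v \<in> W"
proof -
  have "SL u = (\<lambda>\<tau>. (if u = bv 1 1 1 then -1 else 1) * fano_form (fanoL u) \<tau>)" by (simp add: fun_eq_iff SL_def)
  then show "SL u \<in> W" unfolding W_def
    by (simp only:) (intro cspan_scale cspan_base CollectI exI[of _ "fanoL u"] conjI refl fano_fanoL)
  have "SK v = fano_form (fanoK v)" by (simp add: fun_eq_iff SK_def)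
  then show "SK v \<in> W" unfolding W_def by (simp only:) (intro cspan_base CollectI exI[of _ "fanoK v"] conjI refl fano_fanoK)
qed

lemma coef_in_W: "(\<lambda>\<tau>. coefQ \<tau> u) \<in> W" "(\<lambda>\<tau>. coefP \<tau> v) \<in> W"
proof -
  note W = S_in_W[unfolded W_def]
  have "(\<lambda>\<tau>. - 2 * (SL 0 \<tau> + 2 * SL u \<tau>)) \<in> W"
    unfolding W_def by (intro cspan_scale cspan_add) (use W in simp_all)
  moreover have "(\<lambda>\<tau>. SL 0 \<tau>) \<in> W" using S_in_W by simp
  ultimately show "(\<lambda>\<tau>. coefQ \<tau> u) \<in> W" unfolding coefQ_def by (cases "u = 0") simp_all
  show "(\<lambda>\<tau>. coefP \<tau> v) \<in> W"
    unfolding W_def coefP_def by (intro cspan_scale cspan_add cspan_sum) (use W in simp_all)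
qed

section \<open>Existence\<close>

lemma CF_WW': "(\<lambda>\<tau> x. c * CF \<tau> x) \<in> WW'"
proof -
  have cW: "(\<lambda>\<tau>. c * coefQ \<tau> u) \<in> W" "(\<lambda>\<tau>. c * coefP \<tau> u) \<in> W" for u
    using coef_in_W unfolding W_def by (auto intro!: cspan_scale)
  obtain us where us: "set us = (UNIV :: (bit^3) set)" "distinct us" using finite_distinct_list[OF finite[of "UNIV ::
      (bit^3) set"]] by auto
  obtain vs where vs: "set vs = UNIV - {0 :: bit^3}" "distinct vs" using finite_distinct_list[OF finite[of "UNIV - {0 ::
      bit^3}"]] by auto
  let ?ps = "map (\<lambda>u. ((\<lambda>\<tau>. c * coefQ \<tau> u), QQ u)) us @ map (\<lambda>v. ((\<lambda>\<tau>. c * coefP \<tau> v), QP v)) vs"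
  have "tensor_sum ?ps \<tau> x = c * CF \<tau> x" for \<tau> x
    unfolding tensor_sum_def CF_coef qcomb_def
    by (simp add: comp_def sum_list_distinct_conv_sum_set us vs sum_distrib_left distrib_left mult.assoc)
  then have "tensor_sum ?ps = (\<lambda>\<tau> x. c * CF \<tau> x)" by (simp add: fun_eq_iff)
  moreover have "set ?ps \<subseteq> W \<times> W'" using cW vs(1) W'_intros(1,2) by auto
  ultimately show ?thesis unfolding WW'_def by (intro CollectI exI[of _ ?ps]) simp
qed

lemma SL0_nonzero: "\<exists>\<tau>\<in>siegel. SL 0 \<tau> \<noteq> 0"
proof -
  obtain \<tau> where \<tau>: "\<tau> \<in> siegel" "\<And>m. m \<in> even_chars \<Longrightarrow> theta m \<tau> 0 \<noteq> 0" by (rule exists_nonvanishing, rule that)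
  then have "SL 0 \<tau> \<noteq> 0" by (auto simp: SL_def fano_form_def)
  then show ?thesis using \<tau> by blast
qed

lemma coble_quartic_CF:
  assumes "c \<noteq> 0"
  shows "coble_quartic (\<lambda>\<tau> x. c * CF \<tau> x)"
  unfolding coble_quartic_def
proof (intro conjI CF_WW')
  show "(\<lambda>\<tau> x. c * CF \<tau> x) \<noteq> (\<lambda>\<tau> x. 0)"
  proof
    assume e: "(\<lambda>\<tau> x. c * CF \<tau> x) = (\<lambda>\<tau> x. 0)"
    have "c * CF \<tau> (dvec {0}) = 0" for \<tau> using fun_cong[OF fun_cong[OF e, of \<tau>], of "dvec {0}"] by simp
    then show False using SL0_nonzero assms by (simp add: CF_dvec)
  qed
  show "invariant (\<lambda>\<tau> x. c * CF \<tau> x)"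
    unfolding invariant_iff[OF CF_WW'] by (auto simp: realizes_def)
qed

section \<open>Uniqueness\<close>

definition coef_sum :: "(bit^3 \<Rightarrow> complex) \<Rightarrow> (bit^3 \<Rightarrow> complex) \<Rightarrow> complex^3^3 \<Rightarrow> complex" where
  "coef_sum \<alpha> \<beta> \<tau> = (\<Sum>u\<in>UNIV. \<alpha> u * coefQ \<tau> u) + (\<Sum>v\<in>UNIV - {0}. \<beta> v * coefP \<tau> v)"

lemma CF_span_coef_sum:
  assumes "h \<in> CF_span"
  shows "\<exists>\<alpha> \<beta>. h = coef_sum \<alpha> \<beta>"
proof -
  obtain T c where T: "finite T" "T \<subseteq> range (\<lambda>x \<tau>. CF \<tau> x)" "h = (\<lambda>\<tau>. \<Sum>b\<in>T. c b * b \<tau>)"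
    using assms by (auto simp: CF_span_def cspan_def)
  have "\<forall>b\<in>T. \<exists>x. b = (\<lambda>\<tau>. CF \<tau> x)" using T(2) by blast
  then obtain X where X: "\<And>b. b \<in> T \<Longrightarrow> b = (\<lambda>\<tau>. CF \<tau> (X b))" by metis
  have "h \<tau> = coef_sum (\<lambda>u. \<Sum>b\<in>T. c b * QQ u (X b)) (\<lambda>v. \<Sum>b\<in>T. c b * QP v (X b)) \<tau>" for \<tau>
  proof -
    have "h \<tau> = (\<Sum>b\<in>T. c b * CF \<tau> (X b))"
      unfolding T(3) using fun_cong[OF X] by (intro sum.cong) auto
    also have "\<dots> = (\<Sum>b\<in>T. \<Sum>u\<in>UNIV. c b * QQ u (X b) * coefQ \<tau> u) + (\<Sum>b\<in>T. \<Sum>v\<in>UNIV - {0}. c b * QP v (X b) * coefP \<tau> v)"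
      by (simp add: CF_coef qcomb_def sum.distrib distrib_left sum_distrib_left mult_ac)
    also have "\<dots> = coef_sum (\<lambda>u. \<Sum>b\<in>T. c b * QQ u (X b)) (\<lambda>v. \<Sum>b\<in>T. c b * QP v (X b)) \<tau>"
      unfolding coef_sum_def sum_distrib_right by (simp add: sum.swap[of _ T])
    finally show ?thesis .
  qed
  then show ?thesis by (intro exI ext)
qed

lemma qcomb_eq_iff_coef:
  assumes "\<And>x. qcomb b b' x = qcomb c c' x"
  shows "b u = c u" "v \<noteq> 0 \<Longrightarrow> b' v = c' v"
proof -
  have "qcomb (\<lambda>u. 1 * b u + (-1) * c u) (\<lambda>v. 1 * b' v + (-1) * c' v) x = 0" for x
    unfolding qcomb_lin[symmetric] assms by simp
  then have z: "qcomb (\<lambda>u. b u - c u) (\<lambda>v. b' v - c' v) x = 0" for x by simp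
  have "b u - c u = 0" by (rule qcomb_determined(1)) (rule z)+
  then show "b u = c u" by simp
  show "b' v = c' v" if "v \<noteq> 0"
    using qcomb_determined(2)[OF z z that] by simp
qed

lemma coef_translate:
  assumes g: "realizes g \<rho>" and \<tau>: "\<tau> \<in> siegel"
    and q: "\<And>b b' x. qcomb b b' (\<rho> x) = qcomb (\<lambda>u. \<eta> u * b u) (\<lambda>v. \<psi> v * b' v) x"
    and sq: "\<And>u. \<eta> u * \<eta> u = 1" "\<And>v. \<psi> v * \<psi> v = 1"
    and h: "coef_sum \<alpha> \<beta> (moebius g \<tau>) = det (automorphy g \<tau>) ^ 14 * coef_sum \<alpha> \<beta> \<tau>"
  shows "coef_sum \<alpha> \<beta> \<tau> = coef_sum (\<lambda>u. (1 + \<eta> u) / 2 * \<alpha> u) (\<lambda>v. (1 + \<psi> v) / 2 * \<beta> v) \<tau>"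
proof -
  let ?d = "det (automorphy g \<tau>) ^ 14" and ?m = "moebius g \<tau>"
  have d: "?d \<noteq> 0" using g \<tau> by (auto simp: realizes_def regular_at_def)
  have e: "qcomb (\<lambda>u. \<eta> u * coefQ ?m u) (\<lambda>v. \<psi> v * coefP ?m v) x = qcomb (\<lambda>u. ?d * coefQ \<tau> u) (\<lambda>v. ?d * coefP \<tau> v) x" for x
  proof -
    have "CF ?m (\<rho> x) = ?d * CF \<tau> x" using g \<tau> by (auto simp: realizes_def)
    then show ?thesis
      unfolding CF_coef q using qcomb_lin[of ?d "coefQ \<tau>" "coefP \<tau>" x 0 "\<lambda>_. 0" "\<lambda>_. 0"] by simp
  qed
  have s: "x = k * y" if "k * x = y" "k * k = 1" for k x y :: complex
  proof -
    have "k * y = k * k * x" using that(1) by simp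
    then show ?thesis using that(2) by simp
  qed
  have Q: "coefQ ?m u = \<eta> u * (?d * coefQ \<tau> u)" for u
    by (rule s[OF qcomb_eq_iff_coef(1)[OF e] sq(1)])
  have P: "coefP ?m v = \<psi> v * (?d * coefP \<tau> v)" if "v \<noteq> 0" for v
    by (rule s[OF qcomb_eq_iff_coef(2)[OF e that] sq(2)])
  have "coef_sum \<alpha> \<beta> ?m = ?d * coef_sum (\<lambda>u. \<eta> u * \<alpha> u) (\<lambda>v. \<psi> v * \<beta> v) \<tau>"
    unfolding coef_sum_def by (simp add: Q P distrib_left sum_distrib_left mult_ac)
  then have "coef_sum \<alpha> \<beta> \<tau> = coef_sum (\<lambda>u. \<eta> u * \<alpha> u) (\<lambda>v. \<psi> v * \<beta> v) \<tau>" using h d by simp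
  then have "coef_sum \<alpha> \<beta> \<tau> = (coef_sum \<alpha> \<beta> \<tau> + coef_sum (\<lambda>u. \<eta> u * \<alpha> u) (\<lambda>v. \<psi> v * \<beta> v) \<tau>) / 2" by simp
  also have "\<dots> = coef_sum (\<lambda>u. (1 + \<eta> u) / 2 * \<alpha> u) (\<lambda>v. (1 + \<psi> v) / 2 * \<beta> v) \<tau>"
    unfolding coef_sum_def by (simp add: distrib_right add_divide_distrib sum.distrib sum_divide_distrib)
  finally show ?thesis .
qed

text \<open>The stabilizer of \<open>dvec {0}\<close> contains all translations, and averaging over them leaves only the
  coefficient of \<open>Q\<^sub>0\<^sub>0\<^sub>0\<close>.\<close>

lemma translation_invariant_form:
  assumes h: "h \<in> W"
    and inv: "\<And>g \<rho> \<tau>. realizes g \<rho> \<Longrightarrow> \<rho> (dvec {0}) = dvec {0} \<Longrightarrow> \<tau> \<in> siegel \<Longrightarrow>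
       h (moebius g \<tau>) = det (automorphy g \<tau>) ^ 14 * h \<tau>"
  obtains c where "\<And>\<tau>. \<tau> \<in> siegel \<Longrightarrow> h \<tau> = c * SL 0 \<tau>"
proof -
  obtain \<alpha> \<beta> where ab: "h = coef_sum \<alpha> \<beta>" using CF_span_coef_sum W_CFspan h by blast
  define P where "P = (\<lambda>\<alpha> \<beta>. \<forall>\<tau>\<in>siegel. h \<tau> = coef_sum \<alpha> \<beta> \<tau>)"
  have step: "P (\<lambda>u. (1 + \<eta> u) / 2 * \<alpha> u) (\<lambda>v. (1 + \<psi> v) / 2 * \<beta> v)"
    if r: "realizable \<rho>" and P: "P \<alpha> \<beta>" and d: "\<rho> (dvec {0}) = dvec {0}"
      and q: "\<And>b b' x. qcomb b b' (\<rho> x) = qcomb (\<lambda>u. \<eta> u * b u) (\<lambda>v. \<psi> v * b' v) x"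
      and sq: "\<And>u. \<eta> u * \<eta> u = 1" "\<And>v. \<psi> v * \<psi> v = 1" for \<alpha> \<beta> \<rho> \<eta> \<psi>
  proof -
    obtain g where g: "realizes g \<rho>" using r by (auto simp: realizable_def)
    show ?thesis unfolding P_def
    proof
      fix \<tau> assume \<tau>: "\<tau> \<in> siegel"
      then have "moebius g \<tau> \<in> siegel" using g by (auto simp: realizes_def regular_at_def)
      then have "coef_sum \<alpha> \<beta> (moebius g \<tau>) = det (automorphy g \<tau>) ^ 14 * coef_sum \<alpha> \<beta> \<tau>"
        using inv[OF g d \<tau>] P \<tau> unfolding P_def by simp
      from coef_translate[OF g \<tau> q sq this] P \<tau>
      show "h \<tau> = coef_sum (\<lambda>u. (1 + \<eta> u) / 2 * \<alpha> u) (\<lambda>v. (1 + \<psi> v) / 2 * \<beta> v) \<tau>"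
        unfolding P_def by simp
    qed
  qed
  have P0: "P \<alpha> \<beta>" by (simp add: P_def ab)
  have dv: "rhoT11 (dvec {0}) = dvec {0}" "rhoT22 (dvec {0}) = dvec {0}" "rhoT33 (dvec {0}) = dvec {0}"
    "rhoT12 (dvec {0}) = dvec {0}" "rhoT13 (dvec {0}) = dvec {0}" "rhoT23 (dvec {0}) = dvec {0}"
    by (simp_all add: fun_eq_iff dvec_def rhoT11_def rhoT22_def rhoT33_def rhoT12_def rhoT13_def rhoT23_def)
  have ch: "diag_char i v * diag_char i v = 1" for i v by (simp add: diag_char_def)
  have one: "1 * b = b" "(1 + 1) / 2 * b = b" for b :: complex by simp_all
  have q1: "qcomb b b' (rhoT12 x) = qcomb (\<lambda>u. 1 * b u) (\<lambda>v. bit_sign (v $ 3) * b' v) x"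
    "qcomb b b' (rhoT13 x) = qcomb (\<lambda>u. 1 * b u) (\<lambda>v. bit_sign (v $ 2) * b' v) x"
    "qcomb b b' (rhoT23 x) = qcomb (\<lambda>u. 1 * b u) (\<lambda>v. bit_sign (v $ 1) * b' v) x" for b b' x
    by (simp_all add: qcomb_off_diagonal)
  note P1 = step[OF realizable_translations(3) P0 dv(4) q1(1) one(1) bit_sign_simps(3), unfolded one]
  note P2 = step[OF realizable_translations(4) P1 dv(5) q1(2) one(1) bit_sign_simps(3), unfolded one]
  note P3 = step[OF realizable_translations(5) P2 dv(6) q1(3) one(1) bit_sign_simps(3), unfolded one]
  note P4 = step[OF realizable_translations(2) P3 dv(3) qcomb_diagonal(3) bit_sign_simps(3) ch]
  note P5 = step[OF realizable_translations(1) P4 dv(2) qcomb_diagonal(2) bit_sign_simps(3) ch]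
  note P6 = step[OF realizable_generators(5) P5 dv(1) qcomb_diagonal(1) bit_sign_simps(3) ch]
  have half: "(1 + bit_sign a) / 2 = (if a = 0 then 1 else 0)" for a
    by (cases a rule: bit_cases01) simp_all
  have A: "(1 + bit_sign (u $ 1)) / 2 * ((1 + bit_sign (u $ 2)) / 2 * ((1 + bit_sign (u $ 3)) / 2 * \<alpha> u)) = (if u = 0
      then \<alpha> 0 else 0)" for u
    unfolding half by (cases "u = 0") (simp, auto simp: vec3_eq_iff)
  have B: "(1 + diag_char 1 v) / 2 * ((1 + diag_char 2 v) / 2 * ((1 + diag_char 3 v) / 2 * ((1 + bit_sign (v $ 1)) / 2 *
      ((1 + bit_sign (v $ 2)) / 2 * ((1 + bit_sign (v $ 3)) / 2 * \<beta> v))))) = 0"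
    if "v \<noteq> 0" for v
    using that unfolding half by (auto simp: vec3_eq_iff)
  have "h \<tau> = \<alpha> 0 * SL 0 \<tau>" if "\<tau> \<in> siegel" for \<tau>
  proof -
    have "h \<tau> = (\<Sum>u\<in>UNIV. (if u = 0 then \<alpha> 0 else 0) * coefQ \<tau> u) + (\<Sum>v\<in>UNIV - {0}. 0 * coefP \<tau> v)"
    proof -
      have "(\<Sum>v\<in>UNIV - {0}. (1 + diag_char 1 v) / 2 * ((1 + diag_char 2 v) / 2 * ((1 + diag_char 3 v) / 2 *
          ((1 + bit_sign (v $ 1)) / 2 * ((1 + bit_sign (v $ 2)) / 2 * ((1 + bit_sign (v $ 3)) / 2 * \<beta> v))))) * coefP \<tau>
              v) = (\<Sum>v\<in>UNIV - {0}. 0 * coefP \<tau> v)"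
        by (rule sum.cong) (use B in auto)
      then show ?thesis using P6 that unfolding P_def coef_sum_def A by simp
    qed
    then show ?thesis by (simp add: if_distrib[of "\<lambda>x. x * _"] coefQ_def cong: if_cong)
  qed
  then show ?thesis by (rule that)
qed

lemma WW'_W': "t \<in> WW' \<Longrightarrow> t \<tau> \<in> W'"
proof -
  assume "t \<in> WW'"
  then obtain ps where "set ps \<subseteq> W \<times> W'" "t = tensor_sum ps" by (auto simp: WW'_def)
  moreover have "tensor_sum ps \<tau> \<in> W'" if "set ps \<subseteq> W \<times> W'" for ps
    using that
  proof (induction ps)
    case Nil
    have "(\<lambda>x. 0) \<in> W'" unfolding W'_def by (rule cspan_zero)
    then show ?case by (simp add: tensor_sum_def[abs_def])
  next
    case (Cons p ps)
    obtain h q where p: "p = (h, q)" by (cases p)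
    have "tensor_sum (p # ps) \<tau> = (\<lambda>x. h \<tau> * q x + tensor_sum ps \<tau> x)" by (simp add: fun_eq_iff tensor_sum_def p)
    then show ?case using Cons W'_intros(3)[OF W'_intros(4)] by (auto simp: p)
  qed
  ultimately show ?thesis by simp
qed

lemma WW'_W: "t \<in> WW' \<Longrightarrow> (\<lambda>\<tau>. t \<tau> x) \<in> W"
proof -
  assume "t \<in> WW'"
  then obtain ps where "set ps \<subseteq> W \<times> W'" "t = tensor_sum ps" by (auto simp: WW'_def)
  moreover have "(\<lambda>\<tau>. tensor_sum ps \<tau> x) \<in> W" if "set ps \<subseteq> W \<times> W'" for ps
    using that
  proof (induction ps)
    case Nil
    show ?case unfolding W_def by (simp add: tensor_sum_def cspan_zero)
  next
    case (Cons p ps)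
    obtain h q where p: "p = (h, q)" by (cases p)
    have "(\<lambda>\<tau>. tensor_sum (p # ps) \<tau> x) = (\<lambda>\<tau>. q x * h \<tau> + tensor_sum ps \<tau> x)" by (simp add: fun_eq_iff tensor_sum_def p)
    then show ?case using Cons unfolding W_def by (auto simp: p intro!: cspan_add cspan_scale)
  qed
  ultimately show ?thesis by simp
qed

lemma vanishing_orbit:
  assumes W: "\<And>\<tau>. t \<tau> \<in> W'"
    and inv: "\<And>g \<rho> \<tau> x. realizes g \<rho> \<Longrightarrow> \<tau> \<in> siegel \<Longrightarrow> t (moebius g \<tau>) (\<rho> x) = det (automorphy g \<tau>) ^ 14 * t \<tau> x"
    and z: "\<And>\<tau>. \<tau> \<in> siegel \<Longrightarrow> t \<tau> (dvec {0}) = 0" and \<tau>: "\<tau> \<in> siegel"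
  shows "t \<tau> x = 0"
proof -
  define Z where "Z = {x. \<forall>\<tau>\<in>siegel. t \<tau> x = 0}"
  have Z0: "dvec {0} \<in> Z" using z by (simp add: Z_def)
  have pull: "x \<in> Z" if r: "realizable \<rho>" and x: "\<rho> x \<in> Z" for \<rho> x
  proof -
    obtain g where g: "realizes g \<rho>" using r by (auto simp: realizable_def)
    have "t \<tau> x = 0" if "\<tau> \<in> siegel" for \<tau>
    proof -
      have m: "moebius g \<tau> \<in> siegel" "det (automorphy g \<tau>) \<noteq> 0" using g that by (auto simp: realizes_def regular_at_def)
      then show ?thesis using inv[OF g that, of x] x by (simp add: Z_def)
    qed
    then show ?thesis by (simp add: Z_def)
  qed
  have scale: "(\<lambda>e. k * x e) \<in> Z" if "x \<in> Z" for k x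
  proof -
    have "t \<tau> (\<lambda>e. k * x e) = k ^ 4 * t \<tau> x" for \<tau>
    proof -
      obtain b b' where "t \<tau> = qcomb b b'" using W W'_iff by blast
      then show ?thesis by (simp add: qcomb_scale)
    qed
    then show ?thesis using that by (simp add: Z_def)
  qed
  have J: "x \<in> Z" if "rhoJ0 x = (\<lambda>e. k * y e)" "y \<in> Z" for x y k
  proof (rule pull[OF realizable_generators(1)])
    have "rhoJ x = (\<lambda>e. (kappa * k) * y e)" using that(1) by (simp add: fun_eq_iff rhoJ_def)
    then show "rhoJ x \<in> Z" using scale[OF that(2)] by simp
  qed
  note sw12 = pull[OF realizable_generators(2)] and sw23 = pull[OF realizable_generators(3)] and sh12 = pull[OF
      realizable_generators(4)]
  have c12: "dvec {0, u} \<circ> sw12 = dvec {0, sw12 u}" "dvec {0, u} \<circ> sh12 = dvec {0, sh12 u}"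
    "dvec (perp v) \<circ> sw12 = dvec (perp (sw12 v))" "dvec (perp v) \<circ> sh12 = dvec (perp (sh12' v))" for u v
  proof -
    have z: "sw12 0 = 0" "sh12 0 = 0" by (simp_all add: sw12_def sh12_def)
    have "sw12 e = 0 \<longleftrightarrow> e = 0" "sh12 e = 0 \<longleftrightarrow> e = 0" "sw12 e = u \<longleftrightarrow> e = sw12 u" "sh12 e = u \<longleftrightarrow> e = sh12 u" for e
      using sh_invol z by metis+
    then show "dvec {0, u} \<circ> sw12 = dvec {0, sw12 u}" "dvec {0, u} \<circ> sh12 = dvec {0, sh12 u}"
      by (simp_all add: fun_eq_iff dvec_def)
    have a: "cdot x y = cdot y x" for x y :: "bit^3" unfolding cdot_def by (simp only: mult.commute)
    have "cdot (sw12 e) (sw12 (sw12 v)) = cdot e (sw12 v)" "cdot (sh12 (sh12 e)) (sh12' v) = cdot (sh12 e) v" for e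
      using linpair_sw12 linpair_sh12 unfolding linpair_def by blast+
    then have "cdot v (sw12 e) = cdot (sw12 v) e" "cdot v (sh12 e) = cdot (sh12' v) e" for e
      by (metis a sh_invol)+
    then show "dvec (perp v) \<circ> sw12 = dvec (perp (sw12 v))" "dvec (perp v) \<circ> sh12 = dvec (perp (sh12' v))"
      by (simp_all add: fun_eq_iff dvec_def perp_def)
  qed
  have L: "dvec {0, u} \<in> Z" if "dvec {0, sw12 u} \<in> Z \<or> dvec {0, sw23 u} \<in> Z \<or> dvec {0, sh12 u} \<in> Z" for u
    using that sw12[of "dvec {0, u}"] sw23[of "dvec {0, u}"] sh12[of "dvec {0, u}"] unfolding c12 dvec_comp by blast
  have K: "dvec (perp v) \<in> Z" if "dvec (perp (sw12 v)) \<in> Z \<or> dvec (perp (sw23 v)) \<in> Z \<or> dvec (perp (sh12' v)) \<in> Z" for v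
    using that sw12[of "dvec (perp v)"] sw23[of "dvec (perp v)"] sh12[of "dvec (perp v)"] unfolding c12 dvec_comp by blast
  note sv = sw12_def sw23_def sh12_def sh12'_def
  have L100: "dvec {0, bv 1 0 0} \<in> Z" by (rule J[OF rhoJ0_vectors(2) Z0])
  have L010: "dvec {0, bv 0 1 0} \<in> Z" by (rule L) (simp add: sv L100)
  have L001: "dvec {0, bv 0 0 1} \<in> Z" by (rule L) (simp add: sv L010)
  have L110: "dvec {0, bv 1 1 0} \<in> Z" by (rule L) (simp add: sv L100)
  have L101: "dvec {0, bv 1 0 1} \<in> Z" by (rule L) (simp add: sv L110)
  have L011: "dvec {0, bv 0 1 1} \<in> Z" by (rule L) (simp add: sv L101)
  have L111: "dvec {0, bv 1 1 1} \<in> Z" by (rule L) (simp add: sv L101)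
  have K001: "dvec (perp (bv 0 0 1)) \<in> Z" by (rule J[OF rhoJ0_vectors(4) L010])
  have K010: "dvec (perp (bv 0 1 0)) \<in> Z" by (rule K) (simp add: sv K001)
  have K100: "dvec (perp (bv 1 0 0)) \<in> Z" by (rule K) (simp add: sv K010)
  have K110: "dvec (perp (bv 1 1 0)) \<in> Z" by (rule K) (simp add: sv K010)
  have K101: "dvec (perp (bv 1 0 1)) \<in> Z" by (rule K) (simp add: sv K110)
  have K011: "dvec (perp (bv 0 1 1)) \<in> Z" by (rule K) (simp add: sv K101)
  have K111: "dvec (perp (bv 1 1 1)) \<in> Z" by (rule K) (simp add: sv K011)
  have Lu: "dvec {0, u} \<in> Z" for u
  proof (cases u rule: bv_cases)
    case (1 u1 u2 u3)
    show ?thesis unfolding 1 using Z0 L100 L010 L001 L110 L101 L011 L111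
      by (cases u1 rule: bit_cases01; cases u2 rule: bit_cases01; cases u3 rule: bit_cases01)
         (simp_all flip: bv_zero)
  qed
  have Kv: "dvec (perp v) \<in> Z" if "v \<noteq> 0" for v
  proof (cases v rule: bv_cases)
    case (1 v1 v2 v3)
    show ?thesis using that unfolding 1 using K100 K010 K001 K110 K101 K011 K111
      by (cases v1 rule: bit_cases01; cases v2 rule: bit_cases01; cases v3 rule: bit_cases01) simp_all
  qed
  obtain b b' where q: "t \<tau> = qcomb b b'" using W W'_iff by blast
  show ?thesis unfolding q
  proof (rule qcomb_determined(3))
    show "qcomb b b' (dvec {0, u}) = 0" for u using Lu \<tau> unfolding q[symmetric] Z_def by blast
    show "qcomb b b' (dvec (perp v)) = 0" if "v \<noteq> 0" for v using Kv[OF that] \<tau> unfolding q[symmetric] Z_def by blast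
  qed
qed

lemma coble_quartic_unique:
  assumes "coble_quartic t"
  shows "\<exists>c. c \<noteq> 0 \<and> t = (\<lambda>\<tau> x. c * CF \<tau> x)"
proof -
  have t: "t \<in> WW'" "t \<noteq> (\<lambda>\<tau> x. 0)" "invariant t" using assms by (auto simp: coble_quartic_def)
  have inv: "t (moebius g \<tau>) (\<rho> x) = det (automorphy g \<tau>) ^ 14 * t \<tau> x" if "realizes g \<rho>" "\<tau> \<in> siegel" for g \<rho> \<tau> x
    using t(3) that unfolding invariant_iff[OF t(1)] by blast
  have "t (moebius g \<tau>) (dvec {0}) = det (automorphy g \<tau>) ^ 14 * t \<tau> (dvec {0})"
    if "realizes g \<rho>" "\<rho> (dvec {0}) = dvec {0}" "\<tau> \<in> siegel" for g \<rho> \<tau>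
    using inv[OF that(1,3), of "dvec {0}"] that(2) by simp
  then obtain c where c: "\<And>\<tau>. \<tau> \<in> siegel \<Longrightarrow> t \<tau> (dvec {0}) = c * SL 0 \<tau>"
    using translation_invariant_form[OF WW'_W[OF t(1), of "dvec {0}"]] by blast
  have "t \<tau> x - c * CF \<tau> x = 0" if "\<tau> \<in> siegel" for \<tau> x
  proof (rule vanishing_orbit[where t = "\<lambda>\<tau> x. t \<tau> x - c * CF \<tau> x", OF _ _ _ that])
    show "(\<lambda>x. t \<tau> x - c * CF \<tau> x) \<in> W'" for \<tau>
      by (intro W'_diff W'_intros(4) CF_W') (use WW'_W'[OF t(1)] in simp)
    show "t (moebius g \<tau>) (\<rho> x) - c * CF (moebius g \<tau>) (\<rho> x) = det (automorphy g \<tau>) ^ 14 * (t \<tau> x - c * CF \<tau> x)"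
      if "realizes g \<rho>" "\<tau> \<in> siegel" for g \<rho> \<tau> x
    proof -
      have "CF (moebius g \<tau>) (\<rho> x) = det (automorphy g \<tau>) ^ 14 * CF \<tau> x" using that by (auto simp: realizes_def)
      then show ?thesis using inv[OF that, of x] by (simp add: algebra_simps)
    qed
    show "t \<tau> (dvec {0}) - c * CF \<tau> (dvec {0}) = 0" if "\<tau> \<in> siegel" for \<tau>
      using c[OF that] by (simp add: CF_dvec)
  qed
  moreover have "t \<tau> x = 0" if "\<tau> \<notin> siegel" for \<tau> x
    by (rule W_off_siegel[OF WW'_W[OF t(1)] that])
  ultimately have e: "t = (\<lambda>\<tau> x. c * CF \<tau> x)"
    by (intro ext) (metis CF_off_siegel eq_iff_diff_eq_0 mult_zero_right)
  then have "c \<noteq> 0" using t(2) by auto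
  then show ?thesis using e by blast
qed

section \<open>The number of monomials\<close>

definition verts :: "(bit^3) list" where
  "verts = [bv 0 0 0, bv 0 0 1, bv 0 1 0, bv 0 1 1, bv 1 0 0, bv 1 0 1, bv 1 1 0, bv 1 1 1]"

definition monQ :: "bit^3 \<Rightarrow> (bit^3) list list" where
  "monQ u = (if u = bv 0 0 0 then map (\<lambda>e. [e, e, e, e]) verts
     else map (\<lambda>e. [e, e, e + u, e + u]) (filter (\<lambda>e. if u $ 1 = 1 then e $ 1 = 0 else if u $ 2 = 1 then e $ 2 = 0 else
         e $ 3 = 0) verts))"

definition monP :: "bit^3 \<Rightarrow> (bit^3) list list" where
  "monP v = map (\<lambda>e. map (\<lambda>m. e + m) (filter (\<lambda>m. cdot v m = 0) verts))
     [bv 0 0 0, if v $ 1 = 1 then bv 1 0 0 else if v $ 2 = 1 then bv 0 1 0 else bv 0 0 1]"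

lemma mon_lists:
  "monQ (bv 0 0 0) = [[bv 0 0 0, bv 0 0 0, bv 0 0 0, bv 0 0 0], [bv 0 0 1, bv 0 0 1, bv 0 0 1, bv 0 0 1], [bv 0 1 0, bv
      0 1 0, bv 0 1 0, bv 0 1 0], [bv 0 1 1, bv 0 1 1, bv 0 1 1, bv 0 1 1], [bv 1 0 0, bv 1 0 0, bv 1 0 0, bv 1 0 0],
      [bv 1 0 1, bv 1 0 1, bv 1 0 1, bv 1 0 1], [bv 1 1 0, bv 1 1 0, bv 1 1 0, bv 1 1 0], [bv 1 1 1, bv 1 1 1, bv 1 1 1,
      bv 1 1 1]]"
  "monQ (bv 0 0 1) = [[bv 0 0 0, bv 0 0 0, bv 0 0 1, bv 0 0 1], [bv 0 1 0, bv 0 1 0, bv 0 1 1, bv 0 1 1], [bv 1 0 0, bv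
      1 0 0, bv 1 0 1, bv 1 0 1], [bv 1 1 0, bv 1 1 0, bv 1 1 1, bv 1 1 1]]"
  "monQ (bv 0 1 0) = [[bv 0 0 0, bv 0 0 0, bv 0 1 0, bv 0 1 0], [bv 0 0 1, bv 0 0 1, bv 0 1 1, bv 0 1 1], [bv 1 0 0, bv
      1 0 0, bv 1 1 0, bv 1 1 0], [bv 1 0 1, bv 1 0 1, bv 1 1 1, bv 1 1 1]]"
  "monQ (bv 0 1 1) = [[bv 0 0 0, bv 0 0 0, bv 0 1 1, bv 0 1 1], [bv 0 0 1, bv 0 0 1, bv 0 1 0, bv 0 1 0], [bv 1 0 0, bv
      1 0 0, bv 1 1 1, bv 1 1 1], [bv 1 0 1, bv 1 0 1, bv 1 1 0, bv 1 1 0]]"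
  "monQ (bv 1 0 0) = [[bv 0 0 0, bv 0 0 0, bv 1 0 0, bv 1 0 0], [bv 0 0 1, bv 0 0 1, bv 1 0 1, bv 1 0 1], [bv 0 1 0, bv
      0 1 0, bv 1 1 0, bv 1 1 0], [bv 0 1 1, bv 0 1 1, bv 1 1 1, bv 1 1 1]]"
  "monQ (bv 1 0 1) = [[bv 0 0 0, bv 0 0 0, bv 1 0 1, bv 1 0 1], [bv 0 0 1, bv 0 0 1, bv 1 0 0, bv 1 0 0], [bv 0 1 0, bv
      0 1 0, bv 1 1 1, bv 1 1 1], [bv 0 1 1, bv 0 1 1, bv 1 1 0, bv 1 1 0]]"
  "monQ (bv 1 1 0) = [[bv 0 0 0, bv 0 0 0, bv 1 1 0, bv 1 1 0], [bv 0 0 1, bv 0 0 1, bv 1 1 1, bv 1 1 1], [bv 0 1 0, bv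
      0 1 0, bv 1 0 0, bv 1 0 0], [bv 0 1 1, bv 0 1 1, bv 1 0 1, bv 1 0 1]]"
  "monQ (bv 1 1 1) = [[bv 0 0 0, bv 0 0 0, bv 1 1 1, bv 1 1 1], [bv 0 0 1, bv 0 0 1, bv 1 1 0, bv 1 1 0], [bv 0 1 0, bv
      0 1 0, bv 1 0 1, bv 1 0 1], [bv 0 1 1, bv 0 1 1, bv 1 0 0, bv 1 0 0]]"
  "monP (bv 0 0 1) = [[bv 0 0 0, bv 0 1 0, bv 1 0 0, bv 1 1 0], [bv 0 0 1, bv 0 1 1, bv 1 0 1, bv 1 1 1]]"
  "monP (bv 0 1 0) = [[bv 0 0 0, bv 0 0 1, bv 1 0 0, bv 1 0 1], [bv 0 1 0, bv 0 1 1, bv 1 1 0, bv 1 1 1]]"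
  "monP (bv 0 1 1) = [[bv 0 0 0, bv 0 1 1, bv 1 0 0, bv 1 1 1], [bv 0 1 0, bv 0 0 1, bv 1 1 0, bv 1 0 1]]"
  "monP (bv 1 0 0) = [[bv 0 0 0, bv 0 0 1, bv 0 1 0, bv 0 1 1], [bv 1 0 0, bv 1 0 1, bv 1 1 0, bv 1 1 1]]"
  "monP (bv 1 0 1) = [[bv 0 0 0, bv 0 1 0, bv 1 0 1, bv 1 1 1], [bv 1 0 0, bv 1 1 0, bv 0 0 1, bv 0 1 1]]"
  "monP (bv 1 1 0) = [[bv 0 0 0, bv 0 0 1, bv 1 1 0, bv 1 1 1], [bv 1 0 0, bv 1 0 1, bv 0 1 0, bv 0 1 1]]"
  "monP (bv 1 1 1) = [[bv 0 0 0, bv 0 1 1, bv 1 0 1, bv 1 1 0], [bv 1 0 0, bv 1 1 1, bv 0 0 1, bv 0 1 0]]"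
  by (simp_all add: monQ_def monP_def verts_def)

definition mon_value :: "(bit^3 \<Rightarrow> 'r::comm_ring_1) \<Rightarrow> (bit^3) list list \<Rightarrow> 'r" where
  "mon_value x ms = (\<Sum>es\<leftarrow>ms. \<Prod>e\<leftarrow>es. x e)"

lemma quartics_mon_value:
  fixes k :: "complex \<Rightarrow> 'r::comm_ring_1"
  assumes k2: "k (1 / 2) + k (1 / 2) = 1" and k4: "k (1 / 4) + k (1 / 4) + k (1 / 4) + k (1 / 4) = 1"
  shows "quartic_Q k (bv u1 u2 u3) x = mon_value x (monQ (bv u1 u2 u3))"
    "bv v1 v2 v3 \<noteq> 0 \<Longrightarrow> quartic_Q' k (bv v1 v2 v3) x = mon_value x (monP (bv v1 v2 v3))"
proof -
  have h: "k (1 / 2) * S = T" if "S = T + T" for S T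
  proof -
    have "k (1 / 2) * S = (k (1 / 2) + k (1 / 2)) * T" by (simp only: that distrib_left distrib_right)
    then show ?thesis by (simp only: k2 mult_1_left)
  qed
  have q: "k (1 / 4) * S = T" if "S = T + T + T + T" for S T
  proof -
    have "k (1 / 4) * S = (k (1 / 4) + k (1 / 4) + k (1 / 4) + k (1 / 4)) * T" by (simp only: that distrib_left distrib_right)
    then show ?thesis by (simp only: k4 mult_1_left)
  qed
  have m: "mon_value x [] = 0" "mon_value x ([e1, e2, e3, e4] # ms) = x e1 * (x e2 * (x e3 * x e4)) + mon_value x ms"
      for e1 e2 e3 e4 ms
    by (simp_all add: mon_value_def)
  show "quartic_Q k (bv u1 u2 u3) x = mon_value x (monQ (bv u1 u2 u3))"
  proof (cases "bv u1 u2 u3 = 0")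
    case True
    then have "u1 = 0" "u2 = 0" "u3 = 0" by simp_all
    then show ?thesis
      by (simp only: quartic_Q_def mon_lists m sum_bit3 power4_eq_xxxx mult.assoc add.assoc bv_eq_zero_iff simp_thms
          if_True add_0_right)
  next
    case False
    have "(\<Sum>e\<in>UNIV. (x e)\<^sup>2 * (x (e + bv u1 u2 u3))\<^sup>2) = mon_value x (monQ (bv u1 u2 u3)) + mon_value x (monQ (bv u1 u2 u3))"
      using False
      by (cases u1 rule: bit_cases01; cases u2 rule: bit_cases01; cases u3 rule: bit_cases01;
          simp add: mon_lists m sum_bit3 power2_eq_square; simp only: mult_ac add_ac)
    then show ?thesis using False unfolding quartic_Q_def by (simp only: if_False h)
  qed
  show "quartic_Q' k (bv v1 v2 v3) x = mon_value x (monP (bv v1 v2 v3))" if "bv v1 v2 v3 \<noteq> 0"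
  proof -
    have "(\<Sum>e\<in>UNIV. \<Prod>m\<in>{m. cdot (bv v1 v2 v3) m = 0}. x (e + m)) = mon_value x (monP (bv v1 v2 v3))
       + mon_value x (monP (bv v1 v2 v3)) + mon_value x (monP (bv v1 v2 v3)) + mon_value x (monP (bv v1 v2 v3))"
      using that
      by (cases v1 rule: bit_cases01; cases v2 rule: bit_cases01; cases v3 rule: bit_cases01;
          simp add: mon_lists m sum_bit3 prod_bit3; simp only: mult_ac add_ac)
    then show ?thesis unfolding quartic_Q'_def by (simp only: q)
  qed
qed

definition coble_table :: "(int \<times> nat \<times> (bit^3) list list) list" where
  "coble_table = [(1, 1, monQ (bv 0 0 0)),
    (-2, 1, monQ (bv 0 0 1)), (-4, 6, monQ (bv 0 0 1)), (-2, 1, monQ (bv 0 1 0)), (-4, 3, monQ (bv 0 1 0)),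
    (-2, 1, monQ (bv 0 1 1)), (-4, 9, monQ (bv 0 1 1)), (-2, 1, monQ (bv 1 0 0)), (-4, 2, monQ (bv 1 0 0)),
    (-2, 1, monQ (bv 1 0 1)), (-4, 7, monQ (bv 1 0 1)), (-2, 1, monQ (bv 1 1 0)), (-4, 4, monQ (bv 1 1 0)),
    (-2, 1, monQ (bv 1 1 1)), (4, 10, monQ (bv 1 1 1)),
    (8, 1, monP (bv 0 0 1)), (8, 2, monP (bv 0 0 1)), (8, 3, monP (bv 0 0 1)), (8, 4, monP (bv 0 0 1)), (16, 5, monP (bv 0 0 1)),
    (8, 1, monP (bv 0 1 0)), (8, 2, monP (bv 0 1 0)), (8, 6, monP (bv 0 1 0)), (8, 7, monP (bv 0 1 0)), (16, 8, monP (bv 0 1 0)),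
    (8, 1, monP (bv 0 1 1)), (8, 2, monP (bv 0 1 1)), (8, 9, monP (bv 0 1 1)), (-8, 10, monP (bv 0 1 1)), (16, 11, monP
        (bv 0 1 1)),
    (8, 1, monP (bv 1 0 0)), (8, 3, monP (bv 1 0 0)), (8, 6, monP (bv 1 0 0)), (8, 9, monP (bv 1 0 0)), (16, 12, monP (bv 1 0 0)),
    (8, 1, monP (bv 1 0 1)), (8, 3, monP (bv 1 0 1)), (8, 7, monP (bv 1 0 1)), (-8, 10, monP (bv 1 0 1)), (16, 13, monP
        (bv 1 0 1)),
    (8, 1, monP (bv 1 1 0)), (8, 4, monP (bv 1 1 0)), (8, 6, monP (bv 1 1 0)), (-8, 10, monP (bv 1 1 0)), (16, 14, monP
        (bv 1 1 0)),
    (8, 1, monP (bv 1 1 1)), (8, 4, monP (bv 1 1 1)), (8, 7, monP (bv 1 1 1)), (8, 9, monP (bv 1 1 1)), (16, 15, monP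
        (bv 1 1 1))]"

lemma coble_expr_table:
  fixes k :: "complex \<Rightarrow> 'r::comm_ring_1"
  assumes k: "k (1 / 2) + k (1 / 2) = 1" "k (1 / 4) + k (1 / 4) + k (1 / 4) + k (1 / 4) = 1"
  shows "coble_expr k s x = (\<Sum>(c, i, ms)\<leftarrow>coble_table. of_int c * s i * mon_value x ms)"
proof -
  have *: "quartic_Q' k (bv 0 0 1) x = mon_value x (monP (bv 0 0 1))" "quartic_Q' k (bv 0 1 0) x = mon_value x (monP (bv 0 1 0))"
    "quartic_Q' k (bv 0 1 1) x = mon_value x (monP (bv 0 1 1))" "quartic_Q' k (bv 1 0 0) x = mon_value x (monP (bv 1 0 0))"
    "quartic_Q' k (bv 1 0 1) x = mon_value x (monP (bv 1 0 1))" "quartic_Q' k (bv 1 1 0) x = mon_value x (monP (bv 1 1 0))"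
    "quartic_Q' k (bv 1 1 1) x = mon_value x (monP (bv 1 1 1))"
    by (rule quartics_mon_value[OF k]; simp)+
  have L: "(\<Sum>(c, i, ms)\<leftarrow>(c, i, ms) # R. of_int c * s i * mon_value x ms) = of_int c * s i * mon_value x ms + (\<Sum>(c, i,
      ms)\<leftarrow>R. of_int c * s i * mon_value x ms)"
    "(\<Sum>(c, i, ms)\<leftarrow>[]. of_int c * s i * mon_value x ms) = 0" for c i ms R
    by simp_all
  show ?thesis
    unfolding coble_expr_def Let_def quartics_mon_value(1)[OF k] * coble_table_def L
    by (simp add: algebra_simps del: One_nat_def)
qed

definition coble_terms :: "(int \<times> nat \<times> (bit^3) list) list" where
  "coble_terms = concat (map (\<lambda>(c, i, ms). map (\<lambda>es. (c, i, es)) ms) coble_table)"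

type_synonym sx_monomial = "(nat + bit^3) \<Rightarrow>\<^sub>0 nat"

definition monomial :: "int \<times> nat \<times> (bit^3) list \<Rightarrow> sx_monomial" where
  "monomial = (\<lambda>(c, i, es). Poly_Mapping.single (Inl i) 1 + (\<Sum>e\<leftarrow>es. Poly_Mapping.single (Inr e) 1))"

lemma prod_list_single: "(\<Prod>e\<leftarrow>es. Poly_Mapping.single (f e) (1 :: complex)) = Poly_Mapping.single (\<Sum>e\<leftarrow>es. f e) 1"
  by (induction es) (simp_all add: mult_single)

lemma coble_poly_terms:
  "coble_poly = (\<Sum>t\<leftarrow>coble_terms. Poly_Mapping.single (monomial t) (of_int (fst t)))"
proof -
  let ?k = "Poly_Mapping.single 0 :: complex \<Rightarrow> sx_monomial \<Rightarrow>\<^sub>0 complex"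
  let ?s = "\<lambda>i. Poly_Mapping.single (Poly_Mapping.single (Inl i) 1) 1 :: sx_monomial \<Rightarrow>\<^sub>0 complex"
  let ?x = "\<lambda>e. Poly_Mapping.single (Poly_Mapping.single (Inr e) 1) 1 :: sx_monomial \<Rightarrow>\<^sub>0 complex"
  have k: "?k (1 / 2) + ?k (1 / 2) = 1" "?k (1 / 4) + ?k (1 / 4) + ?k (1 / 4) + ?k (1 / 4) = 1"
    by (simp_all flip: single_add)
  have t: "of_int c * ?s i * (\<Prod>e\<leftarrow>es. ?x e) = Poly_Mapping.single (monomial (c, i, es)) (of_int c)" for c i es
  proof -
    have "(of_int c :: sx_monomial \<Rightarrow>\<^sub>0 complex) = ?k (of_int c)" by simp
    then show ?thesis unfolding prod_list_single monomial_def by (simp only: mult_single prod.case) simp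
  qed
  have "(\<Sum>t\<leftarrow>coble_terms. Poly_Mapping.single (monomial t) (of_int (fst t)))
     = (\<Sum>(c, i, ms)\<leftarrow>T. \<Sum>es\<leftarrow>ms. Poly_Mapping.single (monomial (c, i, es)) (of_int c :: complex))"
    if "T = coble_table" for T
    unfolding coble_terms_def that[symmetric] by (induction T) (auto simp: comp_def)
  moreover have "of_int c * ?s i * mon_value ?x ms = (\<Sum>es\<leftarrow>ms. Poly_Mapping.single (monomial (c, i, es)) (of_int c))" for c i ms
    unfolding mon_value_def t[symmetric] by (simp add: sum_list_const_mult)
  ultimately show ?thesis
    unfolding coble_poly_def coble_expr_table[OF k] by simp
qed

text \<open>A positional encoding of monomials by numbers; the values on the 134 monomials are distinct.\<close>

definition weight :: "sx_monomial \<Rightarrow> nat" where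
  "weight m = (\<Sum>i<16. Poly_Mapping.lookup m (Inl i) * (i * 1000000)) +
     (\<Sum>e\<in>UNIV. Poly_Mapping.lookup m (Inr e) * ((if e $ 1 = 1 then 625 else 1) * (if e $ 2 = 1 then 25 else 1) * (if e $
         3 = 1 then 5 else 1)))"

lemma weight_add: "weight (m + n) = weight m + weight n"
  by (simp add: weight_def lookup_add distrib_right sum.distrib)

lemma weight_zero: "weight 0 = 0"
  by (simp add: weight_def)

lemma weight_single:
  "i < 16 \<Longrightarrow> weight (Poly_Mapping.single (Inl i) 1) = i * 1000000"
  "weight (Poly_Mapping.single (Inr (bv a b c)) 1) = (if a = 1 then 625 else 1) * (if b = 1 then 25 else 1) * (if c = 1
      then 5 else 1)"
  by (simp_all add: weight_def lookup_single when_def if_distrib[of "\<lambda>u. u * _"] cong: if_cong)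

lemma keys_sum_list:
  assumes "distinct (map f L)" "\<And>t. t \<in> set L \<Longrightarrow> g t \<noteq> 0"
  shows "Poly_Mapping.keys (\<Sum>t\<leftarrow>L. Poly_Mapping.single (f t) (g t :: complex)) = f ` set L"
  using assms
proof (induction L)
  case (Cons t L)
  let ?r = "\<Sum>t\<leftarrow>L. Poly_Mapping.single (f t) (g t)"
  have r: "Poly_Mapping.keys ?r = f ` set L" using Cons by simp
  have "f t \<notin> Poly_Mapping.keys ?r" unfolding r using Cons.prems(1) by auto
  then have "Poly_Mapping.lookup ?r (f t) = 0" by (simp add: in_keys_iff)
  moreover have "g t \<noteq> 0" using Cons.prems(2) by simp
  ultimately have "m \<in> Poly_Mapping.keys (Poly_Mapping.single (f t) (g t) + ?r) \<longleftrightarrow> m = f t \<or> m \<in> Poly_Mapping.keys ?r" for m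
    by (auto simp: in_keys_iff lookup_add lookup_single when_def)
  then show ?case using r by auto
qed simp

lemma card_keys_coble_poly: "card (Poly_Mapping.keys coble_poly) = 134"
proof -
  have terms: "length coble_terms = 134" "\<forall>t\<in>set coble_terms. fst t \<noteq> 0" "distinct (map (\<lambda>t. weight (monomial t)) coble_terms)"
    unfolding coble_terms_def coble_table_def mon_lists
    by (simp_all add: monomial_def weight_add weight_zero weight_single del: One_nat_def)
  have "distinct (map weight (map monomial coble_terms))" using terms(3) by (simp add: comp_def)
  then have d: "distinct (map monomial coble_terms)" unfolding distinct_map by blast
  have "Poly_Mapping.keys coble_poly = monomial ` set coble_terms"
    unfolding coble_poly_terms using terms(2) by (intro keys_sum_list[OF d]) auto
  also have "\<dots> = set (map monomial coble_terms)" by simp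
  also have "card \<dots> = 134" using distinct_card[OF d] terms(1) by simp
  finally show ?thesis .
qed

theorem theorem15:
  shows "(\<forall>t. coble_quartic t \<longleftrightarrow> (\<exists>c. c \<noteq> 0 \<and> t = (\<lambda>\<tau> x. c * coble_formula \<tau> x)))
    \<and> card (Poly_Mapping.keys coble_poly) = 134"
  unfolding coble_formula_CF using coble_quartic_unique coble_quartic_CF card_keys_coble_poly by blast

end
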